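(* Suppose Assumptions A(i),(ii) hold, and let $(g_j)_{j\ge0}$ be univariate filters satisfying (W-1)–(W-3) with $m=1$, $\gamma_j=2^j$ and $M\ge K+\delta(q_0)$. Given observations $Y_1,\dots,Y_N$, let $W_{j,k}=\sum_tg_j(2^jk-t)Y_t$, let $n_j=N2^{-j}+O(1)$ be the number of coefficients at scale $j$ computable from the sample, $\hat\sigma_j^2=\frac1{n_j}\sum_{k=0}^{n_j-1}W_{j,k}^2$, and for fixed $p\ge1$ and weights $w_0,\dots,w_p$ with $\sum_iw_i=0$ and $\sum_i iw_i=1/(2\log2)$ set $\hat d_0=\sum_{i=0}^pw_i\log\hat\sigma_{j+i}^2$. Let $j=j_N$ be such that $j_N\to\infty$ and $N2^{-j_N}\to\infty$ as $N\to\infty$. Then $\hat d_0\to d_0=K+\delta(q_0)$ in probability as $N\to\infty$.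
   Context: Let $0<d<1/2$, $X$ a centered stationary Gaussian process with unit variance and spectral density $f(\lambda)=|1-e^{-i\lambda}|^{-2d}f^*(\lambda)$, $f^*$ a bounded spectral density, continuous and positive at $0$, with $|f^*(\lambda)-f^*(0)|\le Cf^*(0)|\lambda|^\beta$ for some $\beta\in(0,2]$ (Assumption A(i)). $G$ with $E[G(X_0)]=0$, $E[G(X_0)^2]<\infty$, $G=\sum_{q\ge1}\frac{c_q}{q!}H_q$ ($H_q$ Hermite polynomials), Hermite rank $q_0$; Assumption A(ii): $q_0<1/(1-2d)$ and for every $\lambda>0$, $c_q=O((q!)^de^{-\lambda q})$. $\delta(q)=qd-(q-1)/2$. $K\ge0$ integer, $(\Delta^KY)_t=G(X_t)$. Filter conditions, with $\widehat g_j(\lambda)=\sum_\tau g_j(\tau)e^{-i\lambda\tau}$: (W-1) $\mathrm{supp}(g_j)\subset2^j[-A,A]$ for some $A>0$; (W-2) $|\widehat g_j(\lambda)|\le C2^{j/2}|2^j\lambda|^M(1+2^j|\lambda|)^{-\alpha-M}$ on $[-\pi,\pi]$ with integer $M\ge K$, $\alpha>1$; (W-3) $2^{-j/2}\widehat g_j(2^{-j}\lambda)e^{i\Phi_j(\lambda)}\to\widehat g_\infty(\lambda)$ locally uniformly for some phases $\Phi_j$ and a non-identically-zero $\widehat g_\infty$. *)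

theory Defs
  imports "HOL-Probability.Probability"
begin

fun hermite :: "nat \<Rightarrow> real \<Rightarrow> real" where
  "hermite 0 x = 1"
| "hermite (Suc 0) x = x"
| "hermite (Suc (Suc n)) x = x * hermite (Suc n) x - real (Suc n) * hermite n x"

(* Hermite coefficient c_q = E[G(Z) H_q(Z)], Z ~ N(0,1); then G = sum_q c_q/q! H_q in L^2 *)
definition hermite_coeff :: "(real \<Rightarrow> real) \<Rightarrow> nat \<Rightarrow> real" where
  "hermite_coeff G q = (\<integral>x. G x * hermite q x * std_normal_density x \<partial>lborel)"

definition delta_q :: "real \<Rightarrow> nat \<Rightarrow> real" where
  "delta_q d q = real q * d - (real q - 1) / 2"

definition bdiff :: "(int \<Rightarrow> real) \<Rightarrow> int \<Rightarrow> real" where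
  "bdiff y t = y t - y (t - 1)"

definition dtft :: "(int \<Rightarrow> real) \<Rightarrow> real \<Rightarrow> complex" where
  "dtft g lam = (\<Sum>\<tau>\<in>{\<tau>. g \<tau> \<noteq> 0}. complex_of_real (g \<tau>) * cis (- lam * of_int \<tau>))"

definition centered_gaussian_process :: "'a measure \<Rightarrow> (int \<Rightarrow> 'a \<Rightarrow> real) \<Rightarrow> bool" where
  "centered_gaussian_process M X \<longleftrightarrow>
     (\<forall>t. X t \<in> borel_measurable M) \<and>
     (\<forall>I (a :: int \<Rightarrow> real). finite I \<longrightarrow>
        (AE \<omega> in M. (\<Sum>i\<in>I. a i * X i \<omega>) = 0) \<or>
        (\<exists>\<sigma>>0. distributed M lborel (\<lambda>\<omega>. \<Sum>i\<in>I. a i * X i \<omega>) (normal_density 0 \<sigma>)))"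

definition wcoef :: "(nat \<Rightarrow> int \<Rightarrow> real) \<Rightarrow> (int \<Rightarrow> 'a \<Rightarrow> real) \<Rightarrow> nat \<Rightarrow> int \<Rightarrow> 'a \<Rightarrow> real" where
  "wcoef g Y j k \<omega> = (\<Sum>t\<in>{t. g j (2 ^ j * k - t) \<noteq> 0}. g j (2 ^ j * k - t) * Y t \<omega>)"

definition scalogram :: "(nat \<Rightarrow> int \<Rightarrow> real) \<Rightarrow> (int \<Rightarrow> 'a \<Rightarrow> real) \<Rightarrow> nat \<Rightarrow> nat \<Rightarrow> 'a \<Rightarrow> real" where
  "scalogram g Y n j \<omega> = (1 / real n) * (\<Sum>k<n. (wcoef g Y j (int k) \<omega>)\<^sup>2)"

end

theory Submission
  imports Defs "HOL-Real_Asymp.Real_Asymp"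
begin

text \<open>After summing by parts \<open>K\<close> times, the wavelet coefficient is a filtered version
  of \<open>G(X)\<close>, and the scalogram is \<open>2^(2 j (K - 1/2))\<close> times the empirical mean of
  \<open>(\<Sum>\<tau>. u\<^sub>j(\<tau>) G(X(2^j k - \<tau>)))^2\<close> with bounded filters \<open>u\<^sub>j\<close> of length \<open>O(2^j)\<close>. Put
  \<open>b = q0 (1 - 2d) < 1\<close>. Near frequency 0 the spectral density of \<open>X\<close> is asymptotic to a multiple
  of that of the covariance \<open>(1 + |t|)^(-(1 - 2d))\<close>, so that the leading Hermite term has variance \<open>~ L 2^(j (2 - b))\<close> with \<open>L > 0\<close>,
  while the Hermite terms of higher order are \<open>o(2^(j (2 - b)))\<close> in mean square, uniformly in \<open>k\<close>.
  The empirical mean of the squared leading term concentrates: its variance is a sum of fourth order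
  diagrams, and every diagram that connects the two squares is \<open>o(n^2 2^(2 j (2 - b)))\<close>, uniformly
  in \<open>j\<close>. Hence the scalogram divided by \<open>2^(2 j d0)\<close> tends to a positive constant in \<open>L^1\<close>, and the
  weights turn its logarithm into \<open>d0\<close>.

  All comparisons of covariances are made in the order of positive definite functions, where
  products can be estimated factor by factor although the filters change sign.\<close>

section \<open>Covariances with a spectral density\<close>

text \<open>The covariance \<open>r\<close> of X is accessible only through its spectral density,
  and no pointwise decay or sign of \<open>r\<close> is used. Comparing densities yields a second
  covariance \<open>R\<close> such that \<open>R - r\<close> is positive definite while 0 <= R(t) <=
  K (1 + |t|)^(-a). Once \<open>R\<close> has replaced \<open>r\<close> inside a quadratic form,
  absolute values may be taken and the signs of the filters forgotten. Powers of \<open>r\<close>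
  occur because H_q(X_s) and H_q(X_t) have covariance q! r(s - t)^q.

  Fourth moments are computed for the leading Hermite term alone. G is merely square integrable, so
  the remainder is controlled by second moments, through |(x + y)^2 - x^2| <= e x^2 + (1 + 1/e) y^2,
  and the outcome is convergence in L^1. Cutting off the Hermite series costs an error whose
  constant grows with j. This is harmless: the cut-off is sent to infinity at fixed j, and the bound
  for the partial sums does not depend on it.\<close>

definition fcoef :: "(real \<Rightarrow> real) \<Rightarrow> int \<Rightarrow> real" where
  "fcoef \<rho> t = (\<integral>x. \<rho> x * cos (of_int t * x) \<partial>lborel)"

definition psd_on :: "'i set \<Rightarrow> ('i \<Rightarrow> 'i \<Rightarrow> real) \<Rightarrow> bool" where
  "psd_on I Q \<longleftrightarrow> (\<forall>c. 0 \<le> (\<Sum>i\<in>I. \<Sum>j\<in>I. c i * c j * Q i j))"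

text \<open>The closure under products replaces the convolution of spectral densities.\<close>

inductive pd :: "(int \<Rightarrow> real) \<Rightarrow> bool" where
  pd_fcoef: "integrable lborel \<rho> \<Longrightarrow> (\<And>x. 0 \<le> \<rho> x) \<Longrightarrow> pd (fcoef \<rho>)"
| pd_const: "0 \<le> c \<Longrightarrow> pd (\<lambda>_. c)"
| pd_add: "pd r \<Longrightarrow> pd s \<Longrightarrow> pd (\<lambda>t. r t + s t)"
| pd_mult: "pd r \<Longrightarrow> pd s \<Longrightarrow> pd (\<lambda>t. r t * s t)"

lemma integrable_mult_cos:
  fixes \<rho> :: "real \<Rightarrow> real"
  assumes "integrable lborel \<rho>"
  shows "integrable lborel (\<lambda>x. \<rho> x * cos (c * x))"
proof (rule Bochner_Integration.integrable_bound[OF assms])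
  show "(\<lambda>x. \<rho> x * cos (c * x)) \<in> borel_measurable lborel"
    using borel_measurable_integrable[OF assms] by measurable
  show "AE x in lborel. norm (\<rho> x * cos (c * x)) \<le> norm (\<rho> x)"
    by (auto simp: abs_mult intro!: mult_left_le)
qed

text \<open>Since cos (p - q) = cos p cos q + sin p sin q, the integrand at each frequency is the
  density times two values of the form \<open>Q\<close>, with weights multiplied by cosines and by
  sines.\<close>

lemma psd_on_mult_fcoef:
  fixes \<phi> :: "'i \<Rightarrow> int"
  assumes Q: "psd_on I Q" and \<rho>: "integrable lborel \<rho>" "\<And>x. 0 \<le> \<rho> x"
  shows "psd_on I (\<lambda>i j. Q i j * fcoef \<rho> (\<phi> i - \<phi> j))"
  unfolding psd_on_def
proof
  fix c :: "'i \<Rightarrow> real"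
  let ?c = "\<lambda>x i. c i * cos (of_int (\<phi> i) * x)" and ?s = "\<lambda>x i. c i * sin (of_int (\<phi> i) * x)"
  have "(\<Sum>i\<in>I. \<Sum>j\<in>I. c i * c j * (Q i j * fcoef \<rho> (\<phi> i - \<phi> j))) =
    (\<integral>x. (\<Sum>i\<in>I. \<Sum>j\<in>I. (c i * c j * Q i j) * (\<rho> x * cos (of_int (\<phi> i - \<phi> j) * x))) \<partial>lborel)"
    unfolding fcoef_def
    by (subst Bochner_Integration.integral_sum, intro Bochner_Integration.integrable_sum
        integrable_mult_right integrable_mult_cos \<rho>, intro sum.cong refl,
        subst Bochner_Integration.integral_sum, intro integrable_mult_right integrable_mult_cos \<rho>)
       (simp only: integral_mult_right_zero mult.assoc)
  also have "\<dots> = (\<integral>x. \<rho> x * ((\<Sum>i\<in>I. \<Sum>j\<in>I. ?c x i * ?c x j * Q i j)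
      + (\<Sum>i\<in>I. \<Sum>j\<in>I. ?s x i * ?s x j * Q i j)) \<partial>lborel)"
    by (intro Bochner_Integration.integral_cong refl)
       (simp add: sum_distrib_left sum.distrib[symmetric] cos_diff algebra_simps)
  also have "\<dots> \<ge> 0"
    using Q unfolding psd_on_def
    by (intro Bochner_Integration.integral_nonneg mult_nonneg_nonneg \<rho> add_nonneg_nonneg) auto
  finally show "0 \<le> (\<Sum>i\<in>I. \<Sum>j\<in>I. c i * c j * (Q i j * fcoef \<rho> (\<phi> i - \<phi> j)))" .
qed

text \<open>A Schur product theorem. \<open>Q\<close> is kept general because for a product of
  functions the second factor acts on the form already multiplied by the first. The free map
  \<open>\<phi>\<close> allows factors that depend on different time coordinates of one index to be
  multiplied into the same form.\<close>

lemma psd_on_mult_pd: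
  assumes "pd r" "psd_on I Q"
  shows "psd_on I (\<lambda>i j. Q i j * r (\<phi> i - \<phi> j))"
  using assms
proof (induction arbitrary: Q rule: pd.induct)
  case (pd_fcoef \<rho>)
  then show ?case by (intro psd_on_mult_fcoef)
next
  case (pd_const c)
  show ?case unfolding psd_on_def
  proof
    fix u :: "'a \<Rightarrow> real"
    have "0 \<le> c * (\<Sum>i\<in>I. \<Sum>j\<in>I. u i * u j * Q i j)"
      using pd_const by (auto simp: psd_on_def)
    then show "0 \<le> (\<Sum>i\<in>I. \<Sum>j\<in>I. u i * u j * (Q i j * c))"
      by (simp add: sum_distrib_left algebra_simps)
  qed
next
  case (pd_add r s)
  have "psd_on I (\<lambda>i j. Q i j * r (\<phi> i - \<phi> j))" "psd_on I (\<lambda>i j. Q i j * s (\<phi> i - \<phi> j))"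
    using pd_add by auto
  then show ?case unfolding psd_on_def by (simp add: algebra_simps sum.distrib)
next
  case (pd_mult r s)
  have "psd_on I (\<lambda>i j. (Q i j * r (\<phi> i - \<phi> j)) * s (\<phi> i - \<phi> j))"
    using pd_mult by blast
  then show ?case by (simp add: mult.assoc)
qed

lemma psd_on_one: "psd_on I (\<lambda>_ _. 1)"
  unfolding psd_on_def by (simp add: sum_product[symmetric])

lemma pd_power: "pd r \<Longrightarrow> pd (\<lambda>t. r t ^ n)"
  by (induction n) (auto intro: pd_const pd_mult)

lemma pd_scale: "pd r \<Longrightarrow> 0 \<le> c \<Longrightarrow> pd (\<lambda>t. c * r t)"
  using pd_mult[OF pd_const] by simp

lemma pd_quadratic_form:
  assumes "pd r"
  shows "0 \<le> (\<Sum>i\<in>I. \<Sum>j\<in>I. c i * c j * r (\<phi> i - \<phi> j))"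
  using psd_on_mult_pd[OF assms psd_on_one, of I \<phi>] by (simp add: psd_on_def)

text \<open>R^(n+1) - r^(n+1) = R (R^n - r^n) + (R - r) r^n is a sum of products of positive
  definite functions.\<close>

lemma pd_power_diff:
  assumes "pd r" "pd (\<lambda>t. R t - r t)"
  shows "pd (\<lambda>t. R t ^ n - r t ^ n)"
proof (induction n)
  case 0 show ?case using pd_const[of 0] by simp
next
  case (Suc n)
  have R: "pd R" using pd_add[OF assms] by simp
  have "pd (\<lambda>t. R t * (R t ^ n - r t ^ n) + (R t - r t) * r t ^ n)"
    by (intro pd_add pd_mult R Suc assms pd_power)
  then show ?case by (simp add: algebra_simps)
qed

text \<open>If \<open>r\<close> and \<open>r1\<close> are \<open>e\<close>-close in the positive definite order and both are dominated by
  \<open>R\<close>, then their powers are \<open>n R^(n - 1) e\<close>-close. This transfers the asymptotics of the power law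
  covariance to the powers of the covariance of \<open>X\<close>.\<close>

lemma pd_power_perturb:
  assumes "pd r" "pd r1" "pd (\<lambda>t. R t - r t)" "pd (\<lambda>t. R t - r1 t)"
    and "pd (\<lambda>t. e t + (r t - r1 t))" "pd (\<lambda>t. e t - (r t - r1 t))"
  shows "pd (\<lambda>t. real n * R t ^ (n - 1) * e t + (r t ^ n - r1 t ^ n))"
    and "pd (\<lambda>t. real n * R t ^ (n - 1) * e t - (r t ^ n - r1 t ^ n))"
proof -
  have R: "pd R" using pd_add[OF assms(1,3)] by simp
  have e: "pd e" using pd_scale[OF pd_add[OF assms(5,6)], of "1/2"] by simp
  \<comment> \<open>\<open>\<sigma>\<close> stands for either sign, so that a single induction gives
    both bounds.\<close>
  have "pd (\<lambda>t. real n * R t ^ (n - 1) * e t + \<sigma> * (r t ^ n - r1 t ^ n))"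
    if \<sigma>: "pd (\<lambda>t. e t + \<sigma> * (r t - r1 t))" for \<sigma>
  proof (induction n)
    case 0 show ?case using pd_const[of 0] by simp
  next
    case (Suc n)
    \<comment> \<open>The difference of powers splits as (r^n - r1^n) r + (r - r1) r1^n. The
      summands with R - r and R^n - r1^n are slack: they raise the error terms n R^(n-1) e r and e
      r1^n to n R^n e and e R^n.\<close>
    have "pd (\<lambda>t. (real n * R t ^ (n - 1) * e t + \<sigma> * (r t ^ n - r1 t ^ n)) * r t
        + real n * (R t ^ (n - 1) * (e t * (R t - r t)))
        + ((e t + \<sigma> * (r t - r1 t)) * r1 t ^ n + e t * (R t ^ n - r1 t ^ n)))"
      by (intro pd_add pd_mult pd_scale[of _ "real n"] pd_power pd_power_diff Suc assms R e \<sigma>) auto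
    also have "(\<lambda>t. (real n * R t ^ (n - 1) * e t + \<sigma> * (r t ^ n - r1 t ^ n)) * r t
        + real n * (R t ^ (n - 1) * (e t * (R t - r t)))
        + ((e t + \<sigma> * (r t - r1 t)) * r1 t ^ n + e t * (R t ^ n - r1 t ^ n)))
      = (\<lambda>t. real (Suc n) * R t ^ (Suc n - 1) * e t + \<sigma> * (r t ^ Suc n - r1 t ^ Suc n))"
      by (cases n) (auto simp: algebra_simps)
    finally show ?case .
  qed
  from this[of 1] this[of "-1"] assms(5,6)
  show "pd (\<lambda>t. real n * R t ^ (n - 1) * e t + (r t ^ n - r1 t ^ n))"
    and "pd (\<lambda>t. real n * R t ^ (n - 1) * e t - (r t ^ n - r1 t ^ n))"
    by (simp_all add: algebra_simps)
qed

lemma fcoef_add: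
  assumes "integrable lborel \<rho>" "integrable lborel \<rho>'"
  shows "fcoef (\<lambda>x. \<rho> x + \<rho>' x) t = fcoef \<rho> t + fcoef \<rho>' t"
  unfolding fcoef_def using assms
  by (simp add: distrib_right integrable_mult_cos)

lemma fcoef_diff:
  assumes "integrable lborel \<rho>" "integrable lborel \<rho>'"
  shows "fcoef (\<lambda>x. \<rho> x - \<rho>' x) t = fcoef \<rho> t - fcoef \<rho>' t"
  unfolding fcoef_def using assms
  by (simp add: left_diff_distrib integrable_mult_cos)

lemma fcoef_scale: "fcoef (\<lambda>x. c * \<rho> x) t = c * fcoef \<rho> t"
  unfolding fcoef_def by (simp add: mult.assoc)

lemma pd_fcoef_diff:
  assumes "integrable lborel \<rho>" "integrable lborel \<rho>'" "\<And>x. \<rho>' x \<le> \<rho> x"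
  shows "pd (\<lambda>t. fcoef \<rho> t - fcoef \<rho>' t)"
  using pd_fcoef[of "\<lambda>x. \<rho> x - \<rho>' x"] assms
  by (simp add: fcoef_diff[symmetric])

section \<open>Orthogonality of the cosines over one period\<close>

lemma integral_cos_period:
  "(\<integral>x. indicator {-pi<..<pi} x * cos (of_int m * x) \<partial>lborel) = (if m = 0 then 2 * pi else 0)"
proof -
  have "(\<integral>x. indicator {-pi<..<pi} x * cos (of_int m * x) \<partial>lborel)
     = (LBINT x=-pi..pi. cos (of_int m * x))"
    by (subst interval_lebesgue_integral_le_eq) (auto simp: set_lebesgue_integral_def)
  also have "\<dots> = (if m = 0 then 2 * pi else 0)"
  proof (cases "m = 0")
    case True
    then show ?thesis by simp
  next
    case False
    have "(LBINT x=-pi..pi. cos (of_int m * x)) = sin (of_int m * pi) / of_int m - sin (of_int m * (-pi)) / of_int m"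
      using False
      by (intro interval_integral_FTC_finite continuous_intros)
         (auto intro!: derivative_eq_intros simp: has_real_derivative_iff_has_vector_derivative[symmetric])
    then show ?thesis using False by (simp add: mult.commute)
  qed
  finally show ?thesis .
qed

lemma integrable_indicator_pi: "integrable lborel (indicator {-pi<..<pi} :: real \<Rightarrow> real)"
  by simp

lemma fcoef_white: "fcoef (indicator {-pi<..<pi}) t = (if t = 0 then 2 * pi else 0)"
  unfolding fcoef_def by (rule integral_cos_period)

section \<open>Power law covariances\<close>

text \<open>The Poisson kernel (1 - z^2) / (1 - 2 z cos l + z^2) with z = exp (- x). In the
  hyperbolic form its behaviour for small x and l is visible in numerator and denominator
  separately.\<close>

definition poisson :: "real \<Rightarrow> real \<Rightarrow> real" where
  "poisson x l = sinh x / (cosh x - cos l)"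

lemma cosh_minus_cos_pos: "x > 0 \<Longrightarrow> cosh x - cos l > (0::real)"
proof -
  assume "x > 0"
  then have "1 < cosh x" using cosh_real_strict_mono[of 0 x] by simp
  then show ?thesis using cos_le_one[of l] by linarith
qed

lemma poisson_nonneg: "x > 0 \<Longrightarrow> 0 \<le> poisson x l"
  unfolding poisson_def using cosh_minus_cos_pos[of x l] by (auto intro!: divide_nonneg_pos)

text \<open>The real part of the geometric series of z = exp (- x) cis l; the denominator |1 - z|^2
  equals 2 exp (- x) (cosh x - cos l).\<close>

lemma poisson_sums:
  assumes "x > 0"
  shows "(\<lambda>n. exp (- x) ^ n * cos (real n * l)) sums ((poisson x l + 1) / 2)"
proof -
  define z where "z = of_real (exp (- x)) * cis l"
  have "norm z < 1" using assms by (simp add: z_def norm_mult)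
  then have s: "(\<lambda>n. Re (z ^ n)) sums Re (1 / (1 - z))"
    by (intro sums_Re geometric_sums)
  have 1: "Re (z ^ n) = exp (- x) ^ n * cos (real n * l)" for n
  proof -
    have "z ^ n = of_real (exp (- x) ^ n) * cis (real n * l)"
      by (simp only: z_def power_mult_distrib of_real_power Complex.DeMoivre)
    then show ?thesis by simp
  qed
  let ?r = "exp (- x)"
  have alg: "(1 - r * c)\<^sup>2 + (r * s)\<^sup>2 = 1 - 2 * r * c + r\<^sup>2 * (s\<^sup>2 + c\<^sup>2)" for r s c :: real
    by (simp add: power2_eq_square algebra_simps)
  have "(1 - ?r * cos l)\<^sup>2 + (?r * sin l)\<^sup>2 = 1 - 2 * ?r * cos l + ?r\<^sup>2 * ((sin l)\<^sup>2 + (cos l)\<^sup>2)"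
    by (rule alg)
  then have D: "(1 - ?r * cos l)\<^sup>2 + (?r * sin l)\<^sup>2 = 1 - 2 * ?r * cos l + ?r\<^sup>2"
    by simp
  have D2: "1 - 2 * ?r * cos l + ?r\<^sup>2 = 2 * ?r * (cosh x - cos l)"
    by (simp add: cosh_def power2_eq_square algebra_simps exp_minus)
  have D3: "1 - ?r\<^sup>2 = 2 * ?r * sinh x"
    by (simp add: sinh_def power2_eq_square algebra_simps exp_minus)
  have nz: "2 * ?r * (cosh x - cos l) \<noteq> 0"
    using cosh_minus_cos_pos[OF assms, of l] by simp
  have "Re (1 / (1 - z)) = (1 - ?r * cos l) / (2 * ?r * (cosh x - cos l))"
    by (simp add: Re_divide z_def D flip: D2)
  also have "\<dots> = ((1 - ?r\<^sup>2) / (2 * ?r * (cosh x - cos l)) + 1) / 2"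
  proof -
    have "(1 - u) / D = ((1 - v) / D + 1) / 2" if "D \<noteq> 0" "1 - 2 * u + v = D" for u v D :: real
    proof -
      have v: "v = D - 1 + 2 * u" using that(2) by simp
      show ?thesis using that(1) unfolding v by (simp add: field_simps)
    qed
    from this[OF nz, of "?r * cos l"] D2 show ?thesis by simp
  qed
  also have "\<dots> = (poisson x l + 1) / 2"
    unfolding D3 poisson_def by simp
  finally show ?thesis using s unfolding 1 by (simp only:)
qed

lemma integrable_cos_cos_pi:
  "integrable lborel (\<lambda>l. indicator {-pi<..<pi} l * (cos (c * l) * cos (d * l)) :: real)"
  using integrable_mult_cos[OF integrable_mult_cos[OF integrable_indicator_pi, of c], of d]
  by (simp add: mult.assoc)

lemma integral_cos_cos_pi:
  "(\<integral>l. indicator {-pi<..<pi} l * (cos (of_int m * l) * cos (of_int k * l)) \<partial>lborel)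
   = pi * ((if m = - k then 1 else 0) + (if m = k then 1 else 0))"
proof -
  have "(\<integral>l. indicator {-pi<..<pi} l * (cos (of_int m * l) * cos (of_int k * l)) \<partial>lborel)
    = (\<integral>l. 1/2 * (indicator {-pi<..<pi} l * cos (of_int (m + k) * l))
          + 1/2 * (indicator {-pi<..<pi} l * cos (of_int (m - k) * l)) \<partial>lborel)"
    by (intro Bochner_Integration.integral_cong refl)
       (simp add: cos_add cos_diff algebra_simps)
  also have "\<dots> = 1/2 * (\<integral>l. indicator {-pi<..<pi} l * cos (of_int (m + k) * l) \<partial>lborel)
          + 1/2 * (\<integral>l. indicator {-pi<..<pi} l * cos (of_int (m - k) * l) \<partial>lborel)"
    by (subst Bochner_Integration.integral_add)
       (intro integrable_mult_right integrable_mult_cos integrable_indicator_pi,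
        intro integrable_mult_right integrable_mult_cos integrable_indicator_pi,
        simp only: integral_mult_right_zero)
  also have "\<dots> = pi * ((if m = - k then 1 else 0) + (if m = k then 1 else 0))"
    unfolding integral_cos_period by (auto simp: eq_neg_iff_add_eq_0)
  finally show ?thesis .
qed

text \<open>Integrate the series of \<open>poisson_sums\<close> term by term against a cosine: only
  the term n = |t| survives. The one-sided series represents half of kernel plus 1, so the integral
  of the cosine is subtracted from twice the result. At t = 0 this offsets the doubled norm of the
  constant function.\<close>

lemma poisson_fourier:
  assumes x: "x > 0"
  shows "integrable lborel (\<lambda>l. indicator {-pi<..<pi} l * (poisson x l * cos (of_int t * l)))"
    and "(\<integral>l. indicator {-pi<..<pi} l * (poisson x l * cos (of_int t * l)) \<partial>lborel)
        = 2 * pi * exp (- x * \<bar>of_int t\<bar>)"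
proof -
  let ?I = "indicator {-pi<..<pi} :: real \<Rightarrow> real"
  let ?f = "\<lambda>n l. exp (- x) ^ n * (?I l * (cos (of_int (int n) * l) * cos (of_int t * l)))"
  have int: "integrable lborel (?f n)" for n
    by (intro integrable_mult_right integrable_cos_cos_pi)
  have summ: "summable (\<lambda>n. exp (- x) ^ n)"
    using x by (intro summable_geometric) simp
  have bd: "norm (?f n l) \<le> exp (- x) ^ n * ?I l" for n l
    by (auto simp: abs_mult indicator_def mult_le_one intro!: mult_left_le)
  have AE: "AE l in lborel. summable (\<lambda>n. norm (?f n l))"
  proof (rule AE_I2)
    fix l show "summable (\<lambda>n. norm (?f n l))"
      by (rule summable_comparison_test[OF _ summable_mult2[OF summ, of "?I l"]])
         (use bd in auto)
  qed
  have nrm: "summable (\<lambda>n. \<integral>l. norm (?f n l) \<partial>lborel)"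
  proof (rule summable_comparison_test[OF _ summable_mult2[OF summ, of "2 * pi"]], intro exI allI impI)
    fix n
    have "(\<integral>l. norm (?f n l) \<partial>lborel) \<le> (\<integral>l. exp (- x) ^ n * ?I l \<partial>lborel)"
      using bd by (intro integral_mono integrable_norm int integrable_mult_right integrable_indicator_pi)
    then show "norm (\<integral>l. norm (?f n l) \<partial>lborel) \<le> exp (- x) ^ n * (2 * pi)"
      by (simp add: Bochner_Integration.integral_nonneg)
  qed
  have S: "(\<Sum>n. ?f n l) = ?I l * (cos (of_int t * l) * ((poisson x l + 1) / 2))" for l
  proof -
    have "(\<lambda>n. (?I l * cos (of_int t * l)) * (exp (- x) ^ n * cos (real n * l))) sums
       ((?I l * cos (of_int t * l)) * ((poisson x l + 1) / 2))"
      by (intro sums_mult poisson_sums x)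
    then show ?thesis by (simp add: sums_iff algebra_simps)
  qed
  have i1: "integrable lborel (\<lambda>l. \<Sum>n. ?f n l)"
    by (rule integrable_suminf[OF int AE nrm])
  have e1: "(\<integral>l. (\<Sum>n. ?f n l) \<partial>lborel) = (\<Sum>n. \<integral>l. ?f n l \<partial>lborel)"
    by (rule integral_suminf[OF int AE nrm])
  have t1: "(\<integral>l. ?f n l \<partial>lborel) = (if n = nat \<bar>t\<bar> then
      exp (- x) ^ nat \<bar>t\<bar> * pi * (if t = 0 then 2 else 1) else 0)" for n
    unfolding integral_mult_right_zero integral_cos_cos_pi by auto
  have "(\<Sum>n. \<integral>l. ?f n l \<partial>lborel) = exp (- x) ^ nat \<bar>t\<bar> * pi * (if t = 0 then 2 else 1)"
    unfolding t1 by (subst suminf_finite[of "{nat \<bar>t\<bar>}"]) auto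
  also have "exp (- x) ^ nat \<bar>t\<bar> = exp (- x * \<bar>of_int t\<bar>)"
    by (simp add: exp_of_nat_mult[symmetric])
  finally have e2: "(\<integral>l. (\<Sum>n. ?f n l) \<partial>lborel) = exp (- x * \<bar>of_int t\<bar>) * pi * (if t = 0 then 2 else 1)"
    unfolding e1 .
  let ?c = "\<lambda>l. ?I l * cos (of_int t * l)"
  have ic: "integrable lborel ?c" by (intro integrable_mult_cos integrable_indicator_pi)
  have eq: "(\<lambda>l. ?I l * (poisson x l * cos (of_int t * l))) = (\<lambda>l. 2 * (\<Sum>n. ?f n l) - ?c l)"
    unfolding S by (auto simp: field_simps)
  show "integrable lborel (\<lambda>l. ?I l * (poisson x l * cos (of_int t * l)))"
    unfolding eq by (intro Bochner_Integration.integrable_diff integrable_mult_right i1 ic)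
  show "(\<integral>l. ?I l * (poisson x l * cos (of_int t * l)) \<partial>lborel) = 2 * pi * exp (- x * \<bar>of_int t\<bar>)"
    unfolding eq
    by (subst Bochner_Integration.integral_diff, intro integrable_mult_right i1, rule ic,
        unfold integral_mult_right_zero e2 integral_cos_period) auto
qed

text \<open>\<open>(1 + |t|)^(-b)\<close> is the mixture of the geometric sequences \<open>e^(-x |t|)\<close> with weights
  \<open>x^(b - 1) e^(-x) / Gamma b\<close>, and the spectral densities of the latter are Poisson kernels.\<close>

definition powcov :: "real \<Rightarrow> int \<Rightarrow> real" where
  "powcov b t = (1 + \<bar>real_of_int t\<bar>) powr (- b)"

definition powspec :: "real \<Rightarrow> real \<Rightarrow> real" where
  "powspec b l = indicator {-pi<..<pi} l / (2 * pi * Gamma b) *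
     (\<integral>x. indicator {0<..} x * (x powr (b - 1) * exp (- x) * poisson x l) \<partial>lborel)"

lemma powspec_nonneg: "b > 0 \<Longrightarrow> 0 \<le> powspec b l"
proof -
  assume "b > 0"
  have "0 \<le> (\<integral>x. indicator {0<..} x * (x powr (b - 1) * exp (- x) * poisson x l) \<partial>lborel)"
  proof (rule Bochner_Integration.integral_nonneg)
    fix x show "0 \<le> indicator {0<..} x * (x powr (b - 1) * exp (- x) * poisson x l)"
      using poisson_nonneg[of x l] by (cases "x > 0") auto
  qed
  then show ?thesis
    unfolding powspec_def using Gamma_real_pos[OF \<open>b > 0\<close>] by (auto intro!: mult_nonneg_nonneg)
qed

text \<open>Transfers the gauge integrals available for the Gamma function and for powers to the
  Lebesgue integral, which is possible because the integrands are nonnegative.\<close>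

lemma has_bochner_integral_nonneg_HK:
  fixes f :: "real \<Rightarrow> real"
  assumes I: "(f has_integral I) S" and nn: "\<And>x. x \<in> S \<Longrightarrow> 0 \<le> f x"
    and m: "(\<lambda>x. indicator S x * f x) \<in> borel_measurable borel"
  shows "has_bochner_integral lborel (\<lambda>x. indicator S x * f x) I"
proof (rule has_bochner_integral_nn_integral)
  show "0 \<le> I" using has_integral_nonneg[OF I] nn by auto
  show "(\<integral>\<^sup>+ x. ennreal (indicator S x * f x) \<partial>lborel) = ennreal I"
    using nn_integral_has_integral_lebesgue[OF nn I] by simp
qed (use m nn in \<open>auto simp: indicator_def\<close>)

lemma Gamma_lborel:
  fixes b c :: real
  assumes b: "b > 0" and c: "c > 0"
  shows "integrable lborel (\<lambda>x. indicator {0<..} x * (x powr (b - 1) * exp (- c * x)))"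
    and "(\<integral>x. indicator {0<..} x * (x powr (b - 1) * exp (- c * x)) \<partial>lborel) = Gamma b * c powr (- b)"
proof -
  have 1: "((\<lambda>x. x powr (b - 1) / exp x) has_integral Gamma b) {0..}"
    by (rule Gamma_integral_real) (use b in simp)
  have "has_bochner_integral lborel (\<lambda>x. indicator {0..} x * (x powr (b - 1) / exp x)) (Gamma b)"
    by (rule has_bochner_integral_nonneg_HK[OF 1]) auto
  also have "(\<lambda>x::real. indicator {0..} x * (x powr (b - 1) / exp x))
      = (\<lambda>x. indicator {0<..} x * (x powr (b - 1) * exp (- x)))"
    by (auto simp: indicator_def exp_minus divide_inverse fun_eq_iff)
  finally have h: "has_bochner_integral lborel (\<lambda>x. indicator {0<..} x * (x powr (b - 1) * exp (- x))) (Gamma b)" .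
  have "has_bochner_integral lborel (\<lambda>x. indicator {0<..} (0 + c * x) * ((0 + c * x) powr (b - 1) * exp (- (0 + c * x)))) (Gamma b /\<^sub>R \<bar>c\<bar>)"
    using h by (subst lborel_has_bochner_integral_real_affine_iff[symmetric]) (use c in auto)
  from has_bochner_integral_mult_right[OF this, of "c powr (1 - b)"]
  have "has_bochner_integral lborel (\<lambda>x. c powr (1 - b) * (indicator {0<..} (0 + c * x) * ((0 + c * x) powr (b - 1) * exp (- (0 + c * x)))))
     (c powr (1 - b) * (Gamma b /\<^sub>R \<bar>c\<bar>))"
    by simp
  also have "(\<lambda>x. c powr (1 - b) * (indicator {0<..} (0 + c * x) * ((0 + c * x) powr (b - 1) * exp (- (0 + c * x)))))
     = (\<lambda>x. indicator {0<..} x * (x powr (b - 1) * exp (- c * x)))"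
  proof
    fix x
    have "c powr (1 - b) * (c * x) powr (b - 1) = x powr (b - 1)" if "x > 0"
      using c that by (simp add: powr_mult mult.assoc[symmetric] powr_add[symmetric])
    then show "c powr (1 - b) * (indicator {0<..} (0 + c * x) * ((0 + c * x) powr (b - 1) * exp (- (0 + c * x))))
       = indicator {0<..} x * (x powr (b - 1) * exp (- c * x))"
      using c by (auto simp: indicator_def zero_less_mult_iff mult.assoc[symmetric])
  qed
  also have "c powr (1 - b) * (Gamma b /\<^sub>R \<bar>c\<bar>) = Gamma b * c powr (- b)"
    using c by (simp add: powr_diff powr_minus field_simps)
  finally have H: "has_bochner_integral lborel (\<lambda>x. indicator {0<..} x * (x powr (b - 1) * exp (- c * x)))
     (Gamma b * c powr (- b))" .
  show "integrable lborel (\<lambda>x. indicator {0<..} x * (x powr (b - 1) * exp (- c * x)))"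
    and "(\<integral>x. indicator {0<..} x * (x powr (b - 1) * exp (- c * x)) \<partial>lborel) = Gamma b * c powr (- b)"
    using H by (simp_all only: has_bochner_integral_iff)
qed

lemma powspec_fourier:
  assumes b: "b > 0"
  shows "integrable lborel (powspec b)" and "fcoef (powspec b) t = powcov b t"
proof -
  let ?I = "indicator {-pi<..<pi} :: real \<Rightarrow> real"
  let ?g = "\<lambda>x. indicator {0<..} x * (x powr (b - 1) * exp (- x)) :: real"
  let ?F = "\<lambda>t x l. ?g x * (?I l * (poisson x l * cos (of_int t * l)))"
  have [measurable]: "(\<lambda>p. poisson (fst p) (snd p)) \<in> borel_measurable (lborel \<Otimes>\<^sub>M lborel)"
    unfolding poisson_def sinh_def cosh_def by measurable
  have m: "case_prod (?F t) \<in> borel_measurable (lborel \<Otimes>\<^sub>M lborel)" for t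
    unfolding split_beta by measurable
  have g: "integrable lborel ?g" using Gamma_lborel(1)[OF b, of 1] by simp
  have inner: "integrable lborel (\<lambda>l. ?F t x l)" for x t
    using poisson_fourier(1)[of x t] by (cases "x > 0") (auto intro!: integrable_mult_right)
  have inner_val: "(\<integral>l. ?F t x l \<partial>lborel) = ?g x * (2 * pi * exp (- x * \<bar>of_int t\<bar>))" for x t
    using poisson_fourier(2)[of x t] by (cases "x > 0") auto
  \<comment> \<open>For t = 0 the integrand is nonnegative with an explicit inner integral, and it
    dominates the integrand for every other t. This justifies Fubini for all t at once.\<close>
  have "integrable (lborel \<Otimes>\<^sub>M lborel) (case_prod (?F 0))"
  proof (rule lborel_pair.Fubini_integrable[OF m])
    have "(\<lambda>x. \<integral>l. norm (case_prod (?F 0) (x, l)) \<partial>lborel) = (\<lambda>x. 2 * pi * ?g x)"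
    proof
      fix x
      have "(\<integral>l. norm (case_prod (?F 0) (x, l)) \<partial>lborel) = (\<integral>l. ?F 0 x l \<partial>lborel)"
        by (intro Bochner_Integration.integral_cong refl)
           (auto simp: indicator_def abs_mult poisson_nonneg)
      then show "(\<integral>l. norm (case_prod (?F 0) (x, l)) \<partial>lborel) = 2 * pi * ?g x"
        unfolding inner_val by simp
    qed
    then show "integrable lborel (\<lambda>x. \<integral>l. norm (case_prod (?F 0) (x, l)) \<partial>lborel)"
      using g by simp
    show "AE x in lborel. integrable lborel (\<lambda>l. case_prod (?F 0) (x, l))"
      using inner[of _ 0] by (simp only: prod.case AE_I2)
  qed
  then have int: "integrable (lborel \<Otimes>\<^sub>M lborel) (case_prod (?F t))" for t
  proof (rule Bochner_Integration.integrable_bound[OF _ m])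
    show "AE p in lborel \<Otimes>\<^sub>M lborel. norm (case_prod (?F t) p) \<le> norm (case_prod (?F 0) p)"
      by (rule AE_I2) (auto simp: abs_mult split_beta intro!: mult_left_mono mult_left_le)
  qed
  have Fub: "(\<integral>l. \<integral>x. ?F t x l \<partial>lborel \<partial>lborel) = (\<integral>x. \<integral>l. ?F t x l \<partial>lborel \<partial>lborel)" for t
    by (rule lborel_pair.Fubini_integral[OF int])
  have eq: "powspec b l * cos (of_int t * l) = (1 / (2 * pi * Gamma b)) * (\<integral>x. ?F t x l \<partial>lborel)" for t l
  proof -
    have "(\<integral>x. ?F t x l \<partial>lborel) = (\<integral>x. (?I l * cos (of_int t * l)) *
       (indicator {0<..} x * (x powr (b - 1) * exp (- x) * poisson x l)) \<partial>lborel)"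
      by (intro Bochner_Integration.integral_cong refl) (simp add: algebra_simps)
    then show ?thesis unfolding powspec_def by simp
  qed
  have "integrable lborel (\<lambda>l. \<integral>x. ?F 0 x l \<partial>lborel)"
    using lborel_pair.integrable_snd[OF int[of 0]] by simp
  then have "integrable lborel (\<lambda>l. (1 / (2 * pi * Gamma b)) * (\<integral>x. ?F 0 x l \<partial>lborel))"
    by (rule integrable_mult_right)
  then show "integrable lborel (powspec b)"
    unfolding eq[symmetric] by simp
  have "fcoef (powspec b) t = (1 / (2 * pi * Gamma b)) * (\<integral>x. \<integral>l. ?F t x l \<partial>lborel \<partial>lborel)"
    unfolding fcoef_def eq integral_mult_right_zero Fub ..
  also have "(\<integral>x. \<integral>l. ?F t x l \<partial>lborel \<partial>lborel)
     = (\<integral>x. 2 * pi * (indicator {0<..} x * (x powr (b - 1) * exp (- (1 + \<bar>of_int t\<bar>) * x))) \<partial>lborel)"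
  proof (unfold inner_val, intro Bochner_Integration.integral_cong refl)
    fix x :: real
    have e: "exp (- (1 + \<bar>of_int t\<bar>) * x) = exp (- x) * exp (- x * \<bar>real_of_int t\<bar>)"
      by (simp add: exp_add[symmetric] algebra_simps)
    show "?g x * (2 * pi * exp (- x * \<bar>of_int t\<bar>))
      = 2 * pi * (indicator {0<..} x * (x powr (b - 1) * exp (- (1 + \<bar>of_int t\<bar>) * x)))"
      unfolding e by (simp only: ac_simps)
  qed
  also have "\<dots> = 2 * pi * (Gamma b * (1 + \<bar>of_int t\<bar>) powr (- b))"
    unfolding integral_mult_right_zero by (subst Gamma_lborel(2)[OF b]) auto
  finally show "fcoef (powspec b) t = powcov b t"
    using Gamma_real_pos[OF b] by (simp add: powcov_def)
qed

section \<open>The power law spectral density near frequency 0\<close>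

lemma sin_ge_chord:
  assumes "0 \<le> z" "z \<le> pi / 2"
  shows "sin z \<ge> 2 * z / pi"
proof -
  have "convex_on {0..pi/2} (\<lambda>x. - sin x)"
  proof (rule f''_ge0_imp_convex)
    show "((\<lambda>x. - sin x) has_real_derivative - cos x) (at x)" for x :: real
      by (auto intro!: derivative_eq_intros)
    show "((\<lambda>x. - cos x) has_real_derivative sin x) (at x)" for x :: real
      by (auto intro!: derivative_eq_intros)
    show "0 \<le> sin x" if "x \<in> {0..pi/2}" for x :: real
      using that pi_gt_zero by (intro sin_ge_zero) auto
  qed simp
  from convex_onD_Icc'[OF this, of z] assms pi_gt_zero
  show ?thesis by (simp add: field_simps)
qed

lemma one_minus_cos_ge:
  assumes "\<bar>l\<bar> \<le> pi"
  shows "1 - cos l \<ge> 2 * l\<^sup>2 / pi\<^sup>2"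
proof -
  have "2 * (\<bar>l\<bar> / 2) / pi \<le> sin (\<bar>l\<bar> / 2)"
    using assms by (intro sin_ge_chord) auto
  then have "(2 * (\<bar>l\<bar> / 2) / pi)\<^sup>2 \<le> (sin (\<bar>l\<bar> / 2))\<^sup>2"
    by (intro power_mono) auto
  moreover have "(sin (\<bar>l\<bar> / 2))\<^sup>2 = (1 - cos l) / 2"
    using cos_double_sin[of "\<bar>l\<bar> / 2"] by (simp add: abs_if split: if_splits)
  ultimately show ?thesis by (simp add: power_divide mult.commute)
qed

lemma norm_one_minus_cis: "norm (1 - cis l) = 2 * \<bar>sin (l / 2)\<bar>"
proof -
  have "(norm (1 - cis l))\<^sup>2 = (1 - cos l)\<^sup>2 + (sin l)\<^sup>2"
    by (simp add: cmod_power2)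
  also have "\<dots> = 2 * (1 - cos l)"
    using sin_cos_squared_add[of l] by (simp add: power2_eq_square algebra_simps)
  also have "\<dots> = (2 * \<bar>sin (l / 2)\<bar>)\<^sup>2"
    using cos_double_sin[of "l / 2"] by (simp add: power_mult_distrib)
  finally show ?thesis by (rule power2_eq_imp_eq) auto
qed

lemma cosh_minus_one_ge: "cosh x - 1 \<ge> x\<^sup>2 / (2::real)"
proof -
  have s: "z \<le> sinh z" if "0 \<le> z" for z :: real
  proof -
    have "sinh 0 - 0 \<le> sinh z - z"
      proof (rule DERIV_nonneg_imp_nondecreasing[OF that])
      fix x :: real
      have "((\<lambda>z. sinh z - z) has_real_derivative (cosh x - 1)) (at x)"
        by (auto intro!: derivative_eq_intros)
      then show "\<exists>y. ((\<lambda>z. sinh z - z) has_real_derivative y) (at x) \<and> 0 \<le> y"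
        using cosh_real_ge_1[of x] by auto
    qed
    then show ?thesis by simp
  qed
  have "cosh x = 2 * (sinh \<bar>x/2\<bar>)\<^sup>2 + 1"
    using cosh_double[of "x/2"] cosh_square_eq[of "x/2"] by (simp add: abs_if)
  moreover have "\<bar>x/2\<bar>\<^sup>2 \<le> (sinh \<bar>x/2\<bar>)\<^sup>2" using s[of "\<bar>x/2\<bar>"] by (intro power_mono) auto
  ultimately show ?thesis by (simp add: power_divide)
qed

text \<open>With x = l y, sinh x is asymptotic to l y and cosh x - cos l to l^2 (1 + y^2) / 2, which
  leaves a Cauchy type profile.\<close>

lemma poisson_scaled_lim:
  fixes y :: real
  assumes y: "y > 0"
  shows "((\<lambda>l. l * (exp (- l * y) * poisson (l * y) l)) \<longlongrightarrow> 2 * y / (1 + y\<^sup>2)) (at_right 0)"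
proof -
  have 1: "((\<lambda>l. sinh (l * y) / l) \<longlongrightarrow> y) (at_right 0)"
    unfolding sinh_field_def using y by real_asymp
  have 21: "((\<lambda>l. (cosh (l * y) - 1) / l\<^sup>2) \<longlongrightarrow> y\<^sup>2 / 2) (at_right 0)"
    unfolding cosh_field_def power2_eq_square using y by real_asymp
  have 22: "((\<lambda>l::real. (1 - cos l) / l\<^sup>2) \<longlongrightarrow> 1 / 2) (at_right 0)"
    by real_asymp
  have 2: "((\<lambda>l. (cosh (l * y) - cos l) / l\<^sup>2) \<longlongrightarrow> y\<^sup>2 / 2 + 1 / 2) (at_right 0)"
  proof -
    have "(cosh (l * y) - 1) / l\<^sup>2 + (1 - cos l) / l\<^sup>2 = (cosh (l * y) - cos l) / l\<^sup>2" for l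
      unfolding add_divide_distrib[symmetric] by simp
    then show ?thesis
      by (intro Lim_transform_eventually[OF tendsto_add[OF 21 22]] always_eventually allI)
  qed
  have 3: "((\<lambda>l. exp (- l * y)) \<longlongrightarrow> 1) (at_right 0)"
    by (auto intro!: tendsto_eq_intros)
  have p: "y\<^sup>2 / 2 + 1 / 2 > 0" by (simp add: add_nonneg_pos)
  have "((\<lambda>l. exp (- l * y) * ((sinh (l * y) / l) / ((cosh (l * y) - cos l) / l\<^sup>2))) \<longlongrightarrow> 1 * (y / (y\<^sup>2 / 2 + 1 / 2))) (at_right 0)"
    using p by (intro tendsto_intros 1 2 3) simp
  also have "1 * (y / (y\<^sup>2 / 2 + 1 / 2)) = 2 * y / (1 + y\<^sup>2)"
  proof -
    have *: "y\<^sup>2 / 2 + 1 / 2 = (1 + y\<^sup>2) / 2" by simp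
    show ?thesis unfolding * by simp
  qed
  finally show ?thesis
  proof (rule Lim_transform_eventually)
    show "\<forall>\<^sub>F l in at_right 0. exp (- l * y) * ((sinh (l * y) / l) / ((cosh (l * y) - cos l) / l\<^sup>2))
      = l * (exp (- l * y) * poisson (l * y) l)"
      using eventually_at_right_less[of "0::real"]
      by eventually_elim (simp add: poisson_def power2_eq_square)
  qed
qed

text \<open>The substitution x = |l| y extracts the singularity |l|^(b - 1) from the mixture
  integral. The remaining integrand converges as l tends to 0.\<close>

lemma powspec_eq_scaled:
  assumes l: "0 < \<bar>l\<bar>" "\<bar>l\<bar> < pi"
  shows "powspec b l * \<bar>l\<bar> powr (1 - b) = 1 / (2 * pi * Gamma b) *
    (\<integral>y. indicator {0<..} y * (y powr (b - 1) * (\<bar>l\<bar> * (exp (- \<bar>l\<bar> * y) * poisson (\<bar>l\<bar> * y) \<bar>l\<bar>))) \<partial>lborel)"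
proof -
  let ?l = "\<bar>l\<bar>"
  let ?f = "\<lambda>x. indicator {0<..} x * (x powr (b - 1) * exp (- x) * poisson x l)"
  have "(\<integral>x. ?f x \<partial>lborel) = ?l * (\<integral>y. ?f (0 + ?l * y) \<partial>lborel)"
    using lborel_integral_real_affine[of ?l ?f 0] l by simp
  also have "\<dots> = ?l * (\<integral>y. ?l powr (b - 1) * (indicator {0<..} y * (y powr (b - 1) * (exp (- ?l * y) * poisson (?l * y) ?l))) \<partial>lborel)"
    using l by (intro arg_cong[where f = "\<lambda>z. ?l * z"] Bochner_Integration.integral_cong refl)
       (auto simp: indicator_def zero_less_mult_iff powr_mult poisson_def)
  also have "\<dots> = ?l powr (b - 1) * (\<integral>y. ?l * (indicator {0<..} y * (y powr (b - 1) * (exp (- ?l * y) * poisson (?l * y) ?l))) \<partial>lborel)"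
    unfolding integral_mult_right_zero by (simp only: ac_simps)
  also have "(\<lambda>y. ?l * (indicator {0<..} y * (y powr (b - 1) * (exp (- ?l * y) * poisson (?l * y) ?l))))
     = (\<lambda>y. indicator {0<..} y * (y powr (b - 1) * (?l * (exp (- ?l * y) * poisson (?l * y) ?l))))"
    by (simp only: ac_simps)
  finally have *: "(\<integral>x. ?f x \<partial>lborel) = ?l powr (b - 1) *
    (\<integral>y. indicator {0<..} y * (y powr (b - 1) * (?l * (exp (- ?l * y) * poisson (?l * y) ?l))) \<partial>lborel)" .
  have "?l powr (b - 1) * ?l powr (1 - b) = 1"
    using l by (simp add: powr_add[symmetric])
  then have **: "c * (?l powr (b - 1) * I) * ?l powr (1 - b) = c * I" for c I
    by (metis mult.commute mult.left_commute mult.right_neutral)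
  have ***: "indicator {-pi<..<pi} l = (1 :: real)" using l by (auto simp: indicator_def abs_if split: if_splits)
  show ?thesis unfolding powspec_def * *** ** ..
qed

text \<open>A majorant of the rescaled integrand for all |l| < pi. It comes from exp (- x) sinh x <=
  x in the numerator and from cosh x - 1 >= x^2 / 2 and 1 - cos l >= 2 l^2 / pi^2 in the
  denominator, at x = |l| y. It is of order y^b at 0 and y^(b - 2) at infinity.\<close>

definition spec_dom :: "real \<Rightarrow> real \<Rightarrow> real" where
  "spec_dom b y = indicator {0<..} y * (y powr (b - 1) * (y / (y\<^sup>2 / 2 + 2 / pi\<^sup>2)))"

lemma spec_dom_bound:
  assumes l: "0 < \<bar>l\<bar>" "\<bar>l\<bar> < pi"
  shows "0 \<le> indicator {0<..} y * (y powr (b - 1) * (\<bar>l\<bar> * (exp (- \<bar>l\<bar> * y) * poisson (\<bar>l\<bar> * y) \<bar>l\<bar>)))"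
    and "indicator {0<..} y * (y powr (b - 1) * (\<bar>l\<bar> * (exp (- \<bar>l\<bar> * y) * poisson (\<bar>l\<bar> * y) \<bar>l\<bar>)))
       \<le> spec_dom b y"
proof -
  let ?l = "\<bar>l\<bar>"
  show "0 \<le> indicator {0<..} y * (y powr (b - 1) * (?l * (exp (- ?l * y) * poisson (?l * y) ?l)))"
    using l poisson_nonneg[of "?l * y" ?l] by (cases "y > 0") auto
  show "indicator {0<..} y * (y powr (b - 1) * (?l * (exp (- ?l * y) * poisson (?l * y) ?l))) \<le> spec_dom b y"
  proof (cases "y > 0")
    case True
    let ?x = "?l * y" and ?D = "y\<^sup>2 / 2 + 2 / pi\<^sup>2"
    have D: "?D > 0" using True by (intro add_pos_pos) auto
    have x: "?x > 0" using True l by simp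
    have "exp (- ?x) * sinh ?x = (1 - exp (- 2 * ?x)) / 2"
      by (simp add: sinh_field_def field_simps exp_add[symmetric] exp_minus)
    also have "\<dots> \<le> ?x"
      using exp_ge_add_one_self[of "- 2 * ?x"] by simp
    finally have 1: "exp (- ?x) * sinh ?x \<le> ?x" .
    have "?l\<^sup>2 * ?D \<le> cosh ?x - cos ?l"
      using cosh_minus_one_ge[of ?x] one_minus_cos_ge[of ?l] l by (simp add: algebra_simps power_mult_distrib)
    moreover have lD: "?l\<^sup>2 * ?D > 0" using D l by simp
    ultimately have "exp (- ?x) * sinh ?x / (cosh ?x - cos ?l) \<le> ?x / (?l\<^sup>2 * ?D)"
      using 1 x by (intro frac_le) auto
    then have "?l * (exp (- ?x) * sinh ?x / (cosh ?x - cos ?l)) \<le> ?l * (?x / (?l\<^sup>2 * ?D))"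
      using l by (intro mult_left_mono) auto
    also have "\<dots> = y / ?D"
      using l D by (simp only: power2_eq_square) (simp add: divide_simps)
    finally have "?l * (exp (- ?l * y) * poisson ?x ?l) \<le> y / ?D"
      by (simp add: poisson_def)
    from mult_left_mono[OF this, of "y powr (b - 1)"]
    show ?thesis unfolding spec_dom_def using True by simp
  qed (simp add: spec_dom_def)
qed

lemma integrable_powr_unit:
  fixes p :: real
  assumes "p > -1"
  shows "integrable lborel (\<lambda>x. indicator {0..1} x * x powr p)"
  using has_bochner_integral_nonneg_HK[OF has_integral_powr_from_0[OF assms, of 1]]
  by (auto simp: has_bochner_integral_iff)

lemma integrable_powr_tail:
  fixes p :: real
  assumes "p < -1"
  shows "integrable lborel (\<lambda>x. indicator {1..} x * x powr p)"
  using has_bochner_integral_nonneg_HK[OF has_integral_powr_to_inf[OF assms, of 1]]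
  by (auto simp: has_bochner_integral_iff)

lemma integrable_spec_dom:
  assumes b: "0 < b" "b < 1"
  shows "integrable lborel (spec_dom b)"
proof (rule Bochner_Integration.integrable_bound)
  show "integrable lborel (\<lambda>y. pi\<^sup>2 / 2 * (indicator {0..1} y * y powr b) + 2 * (indicator {1..} y * y powr (b - 2)))"
    using b by (intro Bochner_Integration.integrable_add integrable_mult_right integrable_powr_unit integrable_powr_tail) auto
  show "spec_dom b \<in> borel_measurable lborel"
    unfolding spec_dom_def by measurable
  show "AE y in lborel. norm (spec_dom b y) \<le>
     norm (pi\<^sup>2 / 2 * (indicator {0..1} y * y powr b) + 2 * (indicator {1..} y * y powr (b - 2)))"
  proof (rule AE_I2)
    fix y :: real
    let ?D = "y\<^sup>2 / 2 + 2 / pi\<^sup>2"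
    have D: "?D > 0" by (intro add_nonneg_pos) auto
    have nn: "0 \<le> pi\<^sup>2 / 2 * (indicator {0..1} y * y powr b)" "0 \<le> 2 * (indicator {1..} y * y powr (b - 2))"
      by (auto simp: indicator_def)
    have e: "spec_dom b y = y powr b / ?D" if "y > 0"
    proof -
      have "y powr (b - 1) * y = y powr b" using that by (simp add: powr_diff)
      then show ?thesis using that by (simp add: spec_dom_def)
    qed
    have "spec_dom b y \<le> pi\<^sup>2 / 2 * (indicator {0..1} y * y powr b)" if "0 < y" "y \<le> 1"
    proof -
      have "y powr b / ?D \<le> y powr b / (2 / pi\<^sup>2)"
        using D by (intro divide_left_mono) (auto intro!: mult_pos_pos)
      then show ?thesis using that e by (simp add: mult.commute)
    qed
    moreover have "spec_dom b y \<le> 2 * (indicator {1..} y * y powr (b - 2))" if "1 < y"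
    proof -
      have "y powr b / ?D \<le> y powr b / (y\<^sup>2 / 2)"
        using D that by (intro divide_left_mono) (auto intro!: mult_pos_pos)
      also have "\<dots> = 2 * y powr (b - 2)"
        using that by (simp add: powr_diff)
      finally show ?thesis using that e by simp
    qed
    moreover have "spec_dom b y = 0" if "y \<le> 0" using that by (simp add: spec_dom_def)
    moreover have "0 \<le> spec_dom b y" using D unfolding spec_dom_def by (cases "y > 0") auto
    ultimately show "norm (spec_dom b y) \<le>
     norm (pi\<^sup>2 / 2 * (indicator {0..1} y * y powr b) + 2 * (indicator {1..} y * y powr (b - 2)))"
      using nn by (smt (verit) real_norm_def)
  qed
qed

lemma powspec_bound:
  assumes b: "0 < b" "b < 1"
  obtains C where "C > 0" "\<And>l. 0 < \<bar>l\<bar> \<Longrightarrow> \<bar>l\<bar> < pi \<Longrightarrow> powspec b l * \<bar>l\<bar> powr (1 - b) \<le> C"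
proof -
  define C where "C = 1 / (2 * pi * Gamma b) * (\<integral>y. spec_dom b y \<partial>lborel)"
  have G: "Gamma b > 0" using Gamma_real_pos b by simp
  have "powspec b l * \<bar>l\<bar> powr (1 - b) \<le> C" if l: "0 < \<bar>l\<bar>" "\<bar>l\<bar> < pi" for l
    unfolding powspec_eq_scaled[OF l] C_def
    using G integrable_spec_dom[OF b] spec_dom_bound[OF l] order_trans[OF spec_dom_bound[OF l]]
    by (intro mult_left_mono Bochner_Integration.integral_mono') auto
  then show ?thesis using that[of "max C 1"] by fastforce
qed

text \<open>Dominated convergence with majorant \<open>spec_dom\<close>. The limit is a positive
  multiple of the integral of y^(b - 1) 2 y / (1 + y^2), whose integrand is positive on the
  half-line.\<close>

lemma powspec_lim:
  assumes b: "0 < b" "b < 1"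
  obtains C where "C > 0" "((\<lambda>l. powspec b l * \<bar>l\<bar> powr (1 - b)) \<longlongrightarrow> C) (at 0)"
proof -
  let ?k = "\<lambda>l y. indicator {0<..} y * (y powr (b - 1) * (\<bar>l\<bar> * (exp (- \<bar>l\<bar> * y) * poisson (\<bar>l\<bar> * y) \<bar>l\<bar>)))"
  let ?g = "\<lambda>y. indicator {0<..} y * (y powr (b - 1) * (2 * y / (1 + y\<^sup>2)))"
  define C where "C = 1 / (2 * pi * Gamma b) * (\<integral>y. ?g y \<partial>lborel)"
  have G: "Gamma b > 0" using Gamma_real_pos b by simp
  have lim: "(\<lambda>i. ?k (s i) y) \<longlonglongrightarrow> ?g y" if s: "\<And>i. s i \<noteq> 0" "s \<longlonglongrightarrow> 0" for s :: "nat \<Rightarrow> real" and y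
  proof (cases "y > 0")
    case True
    have "filterlim (\<lambda>i. \<bar>s i\<bar>) (at_right 0) sequentially"
      using s tendsto_rabs_zero[OF s(2)] by (auto simp: filterlim_at)
    from filterlim_compose[OF poisson_scaled_lim[OF True] this]
    have "(\<lambda>i. \<bar>s i\<bar> * (exp (- \<bar>s i\<bar> * y) * poisson (\<bar>s i\<bar> * y) \<bar>s i\<bar>)) \<longlonglongrightarrow> 2 * y / (1 + y\<^sup>2)" .
    then show ?thesis by (intro tendsto_mult_left)
  qed simp
  have int: "(\<lambda>i. \<integral>y. ?k (s i) y \<partial>lborel) \<longlonglongrightarrow> (\<integral>y. ?g y \<partial>lborel) \<and> integrable lborel ?g"
    if s: "\<And>i. s i \<noteq> 0" "\<And>i. \<bar>s i\<bar> < pi" "s \<longlonglongrightarrow> 0" for s :: "nat \<Rightarrow> real"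
  proof (intro conjI)
    have m: "?k (s i) \<in> borel_measurable lborel" for i
      unfolding poisson_def sinh_field_def cosh_field_def by measurable
    have bd: "AE y in lborel. norm (?k (s i) y) \<le> spec_dom b y" for i
      using spec_dom_bound[of "s i" _ b] s by (intro AE_I2) (simp del: norm_mult add: abs_of_nonneg)
    have l: "AE y in lborel. (\<lambda>i. ?k (s i) y) \<longlonglongrightarrow> ?g y"
      using lim[of s] s by (intro AE_I2) auto
    have mg: "?g \<in> borel_measurable lborel" by measurable
    show "(\<lambda>i. \<integral>y. ?k (s i) y \<partial>lborel) \<longlonglongrightarrow> (\<integral>y. ?g y \<partial>lborel)"
      by (rule integral_dominated_convergence[OF mg m integrable_spec_dom[OF b] l bd])
    show "integrable lborel ?g"
      by (rule integrable_dominated_convergence[OF mg m integrable_spec_dom[OF b] l bd])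
  qed
  have "integrable lborel ?g"
  proof -
    have "\<bar>1 / real (Suc i)\<bar> < pi" for i
    proof -
      have "1 / real (Suc i) \<le> 1" by simp
      also have "1 < pi" using pi_gt3 by simp
      finally show ?thesis by simp
    qed
    then show ?thesis using int[of "\<lambda>i. 1 / real (Suc i)"] LIMSEQ_Suc[OF lim_1_over_n] by auto
  qed
  moreover have "(\<integral>y. ?g y \<partial>lborel) \<noteq> 0"
  proof
    assume "(\<integral>y. ?g y \<partial>lborel) = 0"
    then have "AE y in lborel. ?g y = 0"
      using \<open>integrable lborel ?g\<close> by (subst (asm) integral_nonneg_eq_0_iff_AE) (auto simp: indicator_def)
    then have "AE y in lborel. y \<notin> {0<..<1::real}"
    proof eventually_elim
      fix y assume "?g y = 0"
      moreover have "1 + y\<^sup>2 > 0" by (simp add: add_pos_nonneg)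
      ultimately show "y \<notin> {0<..<1::real}" by auto
    qed
    then have "{0<..<1::real} \<in> null_sets lborel"
      by (subst AE_iff_null_sets) auto
    then have "emeasure lborel {0<..<1::real} = 0" by (rule null_setsD1)
    moreover have "emeasure lborel {0<..<1::real} = ennreal (1 - 0)"
      by (rule emeasure_lborel_Ioo) simp
    ultimately show False by simp
  qed
  moreover have "(\<integral>y. ?g y \<partial>lborel) \<ge> 0"
    by (intro Bochner_Integration.integral_nonneg) (auto simp: indicator_def)
  ultimately have "C > 0" unfolding C_def using G by simp
  moreover have "((\<lambda>l. powspec b l * \<bar>l\<bar> powr (1 - b)) \<longlongrightarrow> C) (at 0)"
    unfolding tendsto_at_iff_sequentially
  proof (intro allI impI)
    fix s :: "nat \<Rightarrow> real" assume s: "\<forall>i. s i \<in> UNIV - {0}" "s \<longlonglongrightarrow> 0"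
    \<comment> \<open>The domination holds only for |l| < pi, so the finitely many terms of the
      sequence outside this range are replaced by 1.\<close>
    define s' where "s' i = (if \<bar>s i\<bar> < pi then s i else 1)" for i
    have ev: "\<forall>\<^sub>F i in sequentially. s' i = s i"
      using order_tendstoD(2)[OF tendsto_rabs_zero[OF s(2)] pi_gt_zero]
      by eventually_elim (simp add: s'_def)
    have "s' \<longlonglongrightarrow> 0" using s(2) ev by (simp add: tendsto_cong)
    moreover have s': "s' i \<noteq> 0" "\<bar>s' i\<bar> < pi" for i using s(1) pi_gt3 by (auto simp: s'_def)
    ultimately have "(\<lambda>i. 1 / (2 * pi * Gamma b) * (\<integral>y. ?k (s' i) y \<partial>lborel)) \<longlonglongrightarrow> C"
      unfolding C_def using int[of s'] by (intro tendsto_mult_left) auto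
    also have "(\<lambda>i. 1 / (2 * pi * Gamma b) * (\<integral>y. ?k (s' i) y \<partial>lborel))
       = (\<lambda>i. powspec b (s' i) * \<bar>s' i\<bar> powr (1 - b))"
      using s' by (subst powspec_eq_scaled) auto
    finally show "((\<lambda>l. powspec b l * \<bar>l\<bar> powr (1 - b)) \<circ> s) \<longlonglongrightarrow> C"
      by (rule Lim_transform_eventually) (use ev in \<open>auto elim: eventually_mono\<close>)
  qed
  ultimately show ?thesis using that by blast
qed

section \<open>Sums of power law covariances over a window\<close>

lemma powcov_nonneg: "0 \<le> powcov b t" by (simp add: powcov_def)

lemma powcov_power: "powcov b t ^ n = powcov (real n * b) t"
  unfolding powcov_def by (simp add: powr_powr powr_realpow[symmetric] mult.commute add_pos_nonneg)

lemma powcov_antimono: "b \<le> c \<Longrightarrow> powcov c t \<le> powcov b t"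
  unfolding powcov_def by (intro powr_mono) auto

lemma fcoef_powspec: "b > 0 \<Longrightarrow> fcoef (powspec b) = powcov b"
  using powspec_fourier(2) by blast

lemma pd_powcov: "b > 0 \<Longrightarrow> pd (powcov b)"
  using pd_fcoef[of "powspec b"] powspec_fourier(1)[of b] powspec_nonneg[of b]
  by (simp add: fcoef_powspec)

text \<open>Comparison with the integral of z^(- b), one unit step at a time by the mean value
  theorem.\<close>

lemma sum_powr_le:
  assumes b: "0 \<le> b" "b < 1"
  shows "(\<Sum>m<n. (1 + real m) powr (- b)) \<le> real n powr (1 - b) / (1 - b)"
proof (induction n)
  case (Suc n)
  have "(1 + real n) powr (- b) \<le> (real (Suc n) powr (1 - b) - real n powr (1 - b)) / (1 - b)"
  proof (cases "n = 0")
    case True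
    then show ?thesis using b by simp
  next
    case False
    have "\<exists>z. real n < z \<and> z < real (Suc n) \<and>
      real (Suc n) powr (1 - b) - real n powr (1 - b) = (real (Suc n) - real n) * ((1 - b) * z powr (1 - b - 1))"
      using False by (intro MVT2) (auto intro!: derivative_eq_intros)
    then obtain z where z: "real n < z" "z < real (Suc n)"
      "real (Suc n) powr (1 - b) - real n powr (1 - b) = (1 - b) * z powr (- b)" by auto
    have "(1 + real n) powr (- b) \<le> z powr (- b)"
      using z b False by (intro powr_mono2') auto
    then have "(1 - b) * (1 + real n) powr (- b) \<le> (1 - b) * z powr (- b)"
      using b by (intro mult_left_mono) auto
    then show ?thesis using b unfolding z(3)[symmetric] by (subst pos_le_divide_eq) (simp_all add: mult.commute)
  qed
  then show ?case using Suc.IH b by (simp add: field_simps)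
qed simp

text \<open>On either side of s the distances |s - t| are distinct and below 2 N + 1, so each half
  is at most the one-sided sum of \<open>sum_powr_le\<close>.\<close>

lemma sum_powcov_row_inside:
  assumes b: "0 \<le> b" "b < 1" and s: "\<bar>s\<bar> \<le> int N"
  shows "(\<Sum>t\<in>{- int N..int N}. powcov b (s - t)) \<le> 2 / (1 - b) * real (2 * N + 1) powr (1 - b)"
proof -
  let ?J = "{- int N..int N}" and ?h = "\<lambda>m. (1 + real m) powr (- b)"
  have half: "(\<Sum>t\<in>{t\<in>?J. P t}. powcov b (s - t)) \<le> (\<Sum>m<2 * N + 1. ?h m)"
    if inj: "inj_on (\<lambda>t. nat \<bar>s - t\<bar>) {t\<in>?J. P t}" for P
  proof -
    have "(\<Sum>t\<in>{t\<in>?J. P t}. powcov b (s - t)) = (\<Sum>t\<in>{t\<in>?J. P t}. ?h (nat \<bar>s - t\<bar>))"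
      by (simp add: powcov_def)
    also have "\<dots> = sum ?h ((\<lambda>t. nat \<bar>s - t\<bar>) ` {t\<in>?J. P t})"
      by (subst sum.reindex[OF inj]) (simp add: comp_def)
    also have "\<dots> \<le> (\<Sum>m<2 * N + 1. ?h m)"
      using s by (intro sum_mono2) auto
    finally show ?thesis .
  qed
  have "(\<Sum>t\<in>?J. powcov b (s - t)) \<le> (\<Sum>t\<in>{t\<in>?J. t \<le> s}. powcov b (s - t)) + (\<Sum>t\<in>{t\<in>?J. t \<ge> s}. powcov b (s - t))"
  proof -
    have "(\<Sum>t\<in>?J. powcov b (s - t)) = (\<Sum>t\<in>{t\<in>?J. t \<le> s} \<union> {t\<in>?J. t \<ge> s}. powcov b (s - t))"
      by (rule sum.cong[OF _ refl]) auto
    also have "\<dots> \<le> (\<Sum>t\<in>{t\<in>?J. t \<le> s}. powcov b (s - t)) + (\<Sum>t\<in>{t\<in>?J. t \<ge> s}. powcov b (s - t))"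
    proof (subst sum.union_inter[symmetric])
      show "finite {t\<in>?J. t \<le> s}" "finite {t\<in>?J. t \<ge> s}" by (rule finite_subset[of _ ?J]; auto)+
    qed (auto intro!: sum_nonneg powcov_nonneg)
    finally show ?thesis .
  qed
  also have "\<dots> \<le> (\<Sum>m<2 * N + 1. ?h m) + (\<Sum>m<2 * N + 1. ?h m)"
    by (intro add_mono half) (auto simp: inj_on_def)
  also have "\<dots> \<le> 2 / (1 - b) * real (2 * N + 1) powr (1 - b)"
    using sum_powr_le[OF b, of "2 * N + 1"] by simp
  finally show ?thesis .
qed

text \<open>Moving s to the nearest point of the window shortens every distance |s - t| and so only
  increases the sum. Hence the bound is uniform in s, which makes \<open>sum_powcov\<close> uniform
  in the shift h.\<close>

lemma sum_powcov_row:
  assumes b: "0 \<le> b" "b < 1"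
  shows "(\<Sum>t\<in>{- int N..int N}. powcov b (s - t)) \<le> 2 / (1 - b) * real (2 * N + 1) powr (1 - b)"
proof -
  define s' where "s' = max (- int N) (min s (int N))"
  have "powcov b (s - t) \<le> powcov b (s' - t)" if "t \<in> {- int N..int N}" for t
  proof -
    have "\<bar>s' - t\<bar> \<le> \<bar>s - t\<bar>" using that by (auto simp: s'_def)
    then have "\<bar>real_of_int (s' - t)\<bar> \<le> \<bar>real_of_int (s - t)\<bar>"
      by linarith
    then show ?thesis unfolding powcov_def using b by (intro powr_mono2') auto
  qed
  then have "(\<Sum>t\<in>{- int N..int N}. powcov b (s - t)) \<le> (\<Sum>t\<in>{- int N..int N}. powcov b (s' - t))"
    by (intro sum_mono)
  also have "\<dots> \<le> 2 / (1 - b) * real (2 * N + 1) powr (1 - b)"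
    by (rule sum_powcov_row_inside[OF b]) (auto simp: s'_def)
  finally show ?thesis .
qed

lemma sum_powcov:
  assumes b: "0 \<le> b" "b < 1"
  shows "(\<Sum>s\<in>{- int N..int N}. \<Sum>t\<in>{- int N..int N}. powcov b (h + s - t))
     \<le> 2 / (1 - b) * real (2 * N + 1) powr (2 - b)"
proof -
  have "(\<Sum>s\<in>{- int N..int N}. \<Sum>t\<in>{- int N..int N}. powcov b (h + s - t))
     \<le> (\<Sum>s\<in>{- int N..int N}. 2 / (1 - b) * real (2 * N + 1) powr (1 - b))"
    by (intro sum_mono sum_powcov_row b)
  also have "\<dots> = 2 / (1 - b) * (real (2 * N + 1) * real (2 * N + 1) powr (1 - b))"
    by simp
  also have "real (2 * N + 1) * real (2 * N + 1) powr (1 - b) = real (2 * N + 1) powr (1 + (1 - b))"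
    by (subst powr_add) simp
  finally show ?thesis by simp
qed

section \<open>Quadratic forms of the filters\<close>

text \<open>The variance of the output of the filter \<open>u\<close> for a stationary input with
  autocovariance \<open>r\<close>.\<close>

definition bil :: "(int \<Rightarrow> real) \<Rightarrow> nat \<Rightarrow> (int \<Rightarrow> real) \<Rightarrow> real" where
  "bil u N r = (\<Sum>s\<in>{- int N..int N}. \<Sum>t\<in>{- int N..int N}. u s * u t * r (s - t))"

lemma bil_nonneg: "pd r \<Longrightarrow> 0 \<le> bil u N r"
  unfolding bil_def by (rule pd_quadratic_form[where \<phi> = "\<lambda>t. t"])

lemma bil_diff: "bil u N (\<lambda>t. r t - s t) = bil u N r - bil u N s"
  unfolding bil_def by (simp add: algebra_simps sum_subtractf)

lemma bil_add: "bil u N (\<lambda>t. r t + s t) = bil u N r + bil u N s"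
  unfolding bil_def by (simp add: algebra_simps sum.distrib)

lemma bil_scale: "bil u N (\<lambda>t. c * r t) = c * bil u N r"
  unfolding bil_def by (simp add: sum_distrib_left algebra_simps)

lemma bil_abs_le:
  assumes u: "\<And>s. \<bar>u s\<bar> \<le> c" and r: "\<And>t. \<bar>r t\<bar> \<le> R t"
  shows "\<bar>bil u N r\<bar> \<le> c\<^sup>2 * (\<Sum>s\<in>{- int N..int N}. \<Sum>t\<in>{- int N..int N}. R (s - t))"
proof -
  have c: "0 \<le> c" using u[of 0] by linarith
  have "\<bar>bil u N r\<bar> \<le> (\<Sum>s\<in>{- int N..int N}. \<Sum>t\<in>{- int N..int N}. \<bar>u s * u t * r (s - t)\<bar>)"
    unfolding bil_def by (intro order_trans[OF sum_abs] sum_mono sum_abs)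
  also have "\<dots> \<le> (\<Sum>s\<in>{- int N..int N}. \<Sum>t\<in>{- int N..int N}. c * c * R (s - t))"
    unfolding abs_mult using c u r by (intro sum_mono mult_mono) (auto intro: order_trans[OF abs_ge_zero])
  finally show ?thesis by (simp add: sum_distrib_left power2_eq_square)
qed

lemma dtft_eq:
  assumes "\<And>\<tau>. g \<tau> \<noteq> 0 \<Longrightarrow> \<bar>\<tau>\<bar> \<le> int N"
  shows "dtft g x = (\<Sum>\<tau>\<in>{- int N..int N}. complex_of_real (g \<tau>) * cis (- x * of_int \<tau>))"
  unfolding dtft_def using assms by (intro sum.mono_neutral_left) (force simp: abs_le_iff)+

lemma continuous_dtft:
  assumes "\<And>\<tau>. g \<tau> \<noteq> 0 \<Longrightarrow> \<bar>\<tau>\<bar> \<le> int N"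
  shows "continuous_on UNIV (dtft g)"
proof -
  have "dtft g = (\<lambda>x. \<Sum>\<tau>\<in>{- int N..int N}. complex_of_real (g \<tau>) * cis (- x * of_int \<tau>))"
    using dtft_eq[OF assms] by blast
  then show ?thesis unfolding cis_conv_exp by (auto intro!: continuous_intros)
qed

lemma bil_fcoef:
  assumes u: "\<And>\<tau>. u \<tau> \<noteq> 0 \<Longrightarrow> \<bar>\<tau>\<bar> \<le> int N" and \<rho>: "integrable lborel \<rho>"
  shows "bil u N (fcoef \<rho>) = (\<integral>x. \<rho> x * (norm (dtft u x))\<^sup>2 \<partial>lborel)"
proof -
  let ?J = "{- int N..int N}"
  have n2: "(norm (dtft u x))\<^sup>2 = (\<Sum>s\<in>?J. \<Sum>t\<in>?J. u s * u t * cos (of_int (s - t) * x))" for x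
  proof -
    have "(norm (dtft u x))\<^sup>2 = (\<Sum>s\<in>?J. u s * cos (x * of_int s))\<^sup>2 + (\<Sum>s\<in>?J. u s * sin (x * of_int s))\<^sup>2"
      unfolding cmod_power2 by (subst (1 2) dtft_eq[OF u]) (simp_all add: sum_negf)
    also have "\<dots> = (\<Sum>s\<in>?J. \<Sum>t\<in>?J. u s * u t * cos (of_int (s - t) * x))"
      unfolding power2_eq_square sum_product sum.distrib[symmetric]
      by (intro sum.cong refl) (simp add: cos_diff algebra_simps)
    finally show ?thesis .
  qed
  have "bil u N (fcoef \<rho>) = (\<Sum>s\<in>?J. \<Sum>t\<in>?J. \<integral>x. u s * u t * (\<rho> x * cos (of_int (s - t) * x)) \<partial>lborel)"
    unfolding bil_def fcoef_def by simp
  also have "\<dots> = (\<integral>x. (\<Sum>s\<in>?J. \<Sum>t\<in>?J. u s * u t * (\<rho> x * cos (of_int (s - t) * x))) \<partial>lborel)"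
    by (subst Bochner_Integration.integral_sum, intro Bochner_Integration.integrable_sum
        integrable_mult_right integrable_mult_cos \<rho>, intro sum.cong refl,
        subst Bochner_Integration.integral_sum, intro integrable_mult_right integrable_mult_cos \<rho>) simp
  also have "\<dots> = (\<integral>x. \<rho> x * (norm (dtft u x))\<^sup>2 \<partial>lborel)"
    unfolding n2 by (intro Bochner_Integration.integral_cong refl) (simp add: sum_distrib_left algebra_simps)
  finally show ?thesis .
qed

text \<open>Each filter tap is a Fourier coefficient of the transfer function, hence at most its
  mean absolute value.\<close>

lemma fourier_coeff_bound:
  assumes u: "\<And>\<tau>. u \<tau> \<noteq> 0 \<Longrightarrow> \<bar>\<tau>\<bar> \<le> int N"
  shows "2 * pi * \<bar>u \<sigma>\<bar> \<le> (\<integral>x. indicator {-pi<..<pi} x * norm (dtft u x) \<partial>lborel)"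
    and "integrable lborel (\<lambda>x. indicator {-pi<..<pi} x * norm (dtft u x))"
proof -
  let ?J = "{- int N..int N}" and ?I = "indicator {-pi<..<pi} :: real \<Rightarrow> real"
  have dt: "dtft u x = (\<Sum>\<tau>\<in>?J. complex_of_real (u \<tau>) * cis (- x * of_int \<tau>))" for x
    using dtft_eq[OF u] .
  have cont: "continuous_on UNIV (\<lambda>x. norm (dtft u x))"
    by (intro continuous_intros continuous_dtft[OF u])
  have m: "(\<lambda>x. norm (dtft u x)) \<in> borel_measurable borel"
    using cont by (rule borel_measurable_continuous_onI)
  show int: "integrable lborel (\<lambda>x. ?I x * norm (dtft u x))"
  proof (rule Bochner_Integration.integrable_bound)
    show "integrable lborel (\<lambda>x. ?I x * (\<Sum>\<tau>\<in>?J. \<bar>u \<tau>\<bar>))" by (intro integrable_mult_left integrable_indicator_pi)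
    show "(\<lambda>x. ?I x * norm (dtft u x)) \<in> borel_measurable lborel" using m by measurable
    show "AE x in lborel. norm (?I x * norm (dtft u x)) \<le> norm (?I x * (\<Sum>\<tau>\<in>?J. \<bar>u \<tau>\<bar>))"
    proof (rule AE_I2)
      fix x
      have "norm (dtft u x) \<le> (\<Sum>\<tau>\<in>?J. norm (complex_of_real (u \<tau>) * cis (- x * of_int \<tau>)))"
        unfolding dt by (rule norm_sum)
      then have "norm (dtft u x) \<le> (\<Sum>\<tau>\<in>?J. \<bar>u \<tau>\<bar>)" by (simp add: norm_mult)
      then show "norm (?I x * norm (dtft u x)) \<le> norm (?I x * (\<Sum>\<tau>\<in>?J. \<bar>u \<tau>\<bar>))"
        by (simp add: indicator_def sum_nonneg)
    qed
  qed
  have ie: "integrable lborel (\<lambda>x. u \<tau> * (?I x * cos (of_int (\<sigma> - \<tau>) * x)))" for \<tau>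
    by (intro integrable_mult_right integrable_mult_cos integrable_indicator_pi)
  have "(\<integral>x. (\<Sum>\<tau>\<in>?J. u \<tau> * (?I x * cos (of_int (\<sigma> - \<tau>) * x))) \<partial>lborel) = (\<Sum>\<tau>\<in>?J. u \<tau> * (if \<sigma> - \<tau> = 0 then 2 * pi else 0))"
    by (subst Bochner_Integration.integral_sum[OF ie]) (simp only: integral_mult_right_zero integral_cos_period)
  also have "\<dots> = (\<Sum>\<tau>\<in>?J. if \<tau> = \<sigma> then u \<tau> * (2 * pi) else 0)"
    by (intro sum.cong) auto
  also have "\<dots> = 2 * pi * u \<sigma>" using u[of \<sigma>] by (subst sum.delta) (force simp: abs_le_iff)+
  finally have e: "2 * pi * u \<sigma> = (\<integral>x. (\<Sum>\<tau>\<in>?J. u \<tau> * (?I x * cos (of_int (\<sigma> - \<tau>) * x))) \<partial>lborel)" by simp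
  have "\<bar>2 * pi * u \<sigma>\<bar> \<le> (\<integral>x. norm (\<Sum>\<tau>\<in>?J. u \<tau> * (?I x * cos (of_int (\<sigma> - \<tau>) * x))) \<partial>lborel)"
    unfolding e real_norm_def[symmetric] by (rule integral_norm_bound)
  also have "\<dots> \<le> (\<integral>x. ?I x * norm (dtft u x) \<partial>lborel)"
  proof (intro integral_mono int integrable_norm Bochner_Integration.integrable_sum ie)
    fix x
    have "(\<Sum>\<tau>\<in>?J. u \<tau> * (?I x * cos (of_int (\<sigma> - \<tau>) * x))) = ?I x * Re (cis (x * of_int \<sigma>) * dtft u x)"
      unfolding dt sum_distrib_left Re_sum
      by (intro sum.cong refl) (simp add: cos_diff algebra_simps)
    moreover have "\<bar>Re (cis (x * of_int \<sigma>) * dtft u x)\<bar> \<le> norm (dtft u x)"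
      using abs_Re_le_cmod[of "cis (x * of_int \<sigma>) * dtft u x"] by (simp add: norm_mult)
    ultimately show "norm (\<Sum>\<tau>\<in>?J. u \<tau> * (?I x * cos (of_int (\<sigma> - \<tau>) * x))) \<le> ?I x * norm (dtft u x)"
      by (auto simp: indicator_def)
  qed
  finally show "2 * pi * \<bar>u \<sigma>\<bar> \<le> (\<integral>x. ?I x * norm (dtft u x) \<partial>lborel)"
    by (simp add: abs_mult)
qed

lemma integrable_even_real:
  fixes f :: "real \<Rightarrow> real"
  assumes "integrable lborel (\<lambda>x. indicator {0..} x * f x)" "\<And>x. f (- x) = f x"
  shows "integrable lborel f"
  using has_bochner_integral_even_function[of f] assms by (auto simp: has_bochner_integral_iff)

text \<open>The exponents are b - 1 > -1 at the origin and b - 1 - p < -1 at infinity.\<close>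

lemma integrable_japanese_powr:
  fixes p b :: real
  assumes b: "0 < b" and p: "b < p"
  shows "integrable lborel (\<lambda>x. (1 + \<bar>x\<bar>) powr (- p) * \<bar>x\<bar> powr (b - 1))"
proof (rule integrable_even_real)
  show "integrable lborel (\<lambda>x. indicator {0..} x * ((1 + \<bar>x\<bar>) powr (- p) * \<bar>x\<bar> powr (b - 1)))"
  proof (rule Bochner_Integration.integrable_bound)
    show "integrable lborel (\<lambda>x. indicator {0..1} x * x powr (b - 1) + indicator {1..} x * x powr (b - 1 - p))"
      using b p by (intro Bochner_Integration.integrable_add integrable_powr_unit integrable_powr_tail) auto
    show "AE x in lborel. norm (indicator {0..} x * ((1 + \<bar>x\<bar>) powr (- p) * \<bar>x\<bar> powr (b - 1)))
       \<le> norm (indicator {0..1} x * x powr (b - 1) + indicator {1..} x * x powr (b - 1 - p))"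
    proof (rule AE_I2)
      fix x :: real
      have 1: "(1 + x) powr (- p) * x powr (b - 1) \<le> x powr (b - 1)" if "0 \<le> x"
        using that b p powr_mono2'[of "-p" 1 "1 + x"] by (intro mult_left_le_one_le) auto
      have 2: "(1 + x) powr (- p) * x powr (b - 1) \<le> x powr (b - 1 - p)" if "1 \<le> x"
      proof -
        have "(1 + x) powr (- p) \<le> x powr (- p)" using that b p by (intro powr_mono2') auto
        then have "(1 + x) powr (- p) * x powr (b - 1) \<le> x powr (- p) * x powr (b - 1)"
          by (intro mult_right_mono) auto
        then show ?thesis using that by (simp add: powr_add[symmetric])
      qed
      show "norm (indicator {0..} x * ((1 + \<bar>x\<bar>) powr (- p) * \<bar>x\<bar> powr (b - 1)))
       \<le> norm (indicator {0..1} x * x powr (b - 1) + indicator {1..} x * x powr (b - 1 - p))"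
        using 1 2 by (auto simp: indicator_def)
    qed
  qed measurable
qed simp

text \<open>In the application \<open>u j\<close> is \<open>2^(-j (K - 1/2))\<close> times the \<open>K\<close>-fold antidifference of the
  filter \<open>g j\<close>, and \<open>winf x = |ginf x| / |x|^K\<close>.\<close>

locale scaled_filters =
  fixes u :: "nat \<Rightarrow> int \<Rightarrow> real" and A :: nat and C \<alpha> :: real and winf :: "real \<Rightarrow> real"
  assumes supp: "\<And>j \<tau>. u j \<tau> \<noteq> 0 \<Longrightarrow> \<bar>\<tau>\<bar> \<le> int (A * 2 ^ j)"
    and alpha: "1 < \<alpha>"
    and bound: "\<And>j x. \<bar>x\<bar> < pi * 2 ^ j \<Longrightarrow> norm (dtft (u j) (x / 2 ^ j)) / 2 ^ j \<le> C * (1 + \<bar>x\<bar>) powr (- \<alpha>)"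
    and lim: "\<And>x. x \<noteq> 0 \<Longrightarrow> (\<lambda>j. norm (dtft (u j) (x / 2 ^ j)) / 2 ^ j) \<longlonglongrightarrow> winf x"
    and winf: "\<not> (AE x in lborel. winf x = 0)"
begin

lemma C_nonneg: "0 \<le> C"
  using bound[of 0 0] by (simp add: order_trans[OF norm_ge_zero])

text \<open>After the substitution x / 2^j the integral in \<open>fourier_coeff_bound\<close> is at
  most that of C (1 + |x|)^(- \<alpha>), which is finite since \<alpha> > 1 and does not involve
  j.\<close>

lemma filter_bounded: "\<exists>c>0. \<forall>j \<tau>. \<bar>u j \<tau>\<bar> \<le> c"
proof -
  define I where "I = (\<integral>x. C * (1 + \<bar>x\<bar>) powr (- \<alpha>) \<partial>lborel)"
  have int: "integrable lborel (\<lambda>x. C * (1 + \<bar>x\<bar>) powr (- \<alpha>))"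
  proof (intro integrable_mult_right)
    have "integrable lborel (\<lambda>x::real. (1 + \<bar>x\<bar>) powr (- \<alpha>) * \<bar>x\<bar> powr (1 - 1))"
      using alpha by (intro integrable_japanese_powr) auto
    also have "?this \<longleftrightarrow> integrable lborel (\<lambda>x::real. (1 + \<bar>x\<bar>) powr (- \<alpha>))"
      by (intro integrable_cong_AE) (use AE_lborel_singleton[of 0] in auto)
    finally show "integrable lborel (\<lambda>x::real. (1 + \<bar>x\<bar>) powr (- \<alpha>))" .
  qed
  have "2 * pi * \<bar>u j \<tau>\<bar> \<le> I" for j \<tau>
  proof -
    let ?f = "\<lambda>x. indicator {-pi<..<pi} x * norm (dtft (u j) x)"
    have "2 * pi * \<bar>u j \<tau>\<bar> \<le> (\<integral>x. ?f x \<partial>lborel)"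
      by (rule fourier_coeff_bound(1)[OF supp])
    also have "\<dots> = 1 / 2 ^ j * (\<integral>x. ?f (0 + 1 / 2 ^ j * x) \<partial>lborel)"
      using lborel_integral_real_affine[of "1 / 2 ^ j" ?f 0] by simp
    also have "\<dots> = (\<integral>x. 1 / 2 ^ j * ?f (0 + 1 / 2 ^ j * x) \<partial>lborel)" by simp
    also have "\<dots> \<le> I" unfolding I_def
    proof (rule integral_mono'[OF int])
      fix x :: real
      show "0 \<le> C * (1 + \<bar>x\<bar>) powr (- \<alpha>)" using C_nonneg by simp
      show "1 / 2 ^ j * ?f (0 + 1 / 2 ^ j * x) \<le> C * (1 + \<bar>x\<bar>) powr (- \<alpha>)"
      proof (cases "\<bar>x\<bar> < pi * 2 ^ j")
        case True
        then have "- pi < x / 2 ^ j" "x / 2 ^ j < pi" by (auto simp: field_simps)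
        then show ?thesis using bound[OF True] by (simp add: indicator_def)
      next
        case False
        then have "\<not> (- pi < x / 2 ^ j \<and> x / 2 ^ j < pi)" by (auto simp: field_simps)
        then show ?thesis using C_nonneg by (auto simp: indicator_def)
      qed
    qed
    finally show ?thesis .
  qed
  then have "\<bar>u j \<tau>\<bar> \<le> max 1 (I / (2 * pi))" for j \<tau>
    by (simp add: field_simps max.coboundedI2)
  then show ?thesis by (intro exI[of _ "max 1 (I / (2 * pi))"]) auto
qed

text \<open>In the frequency domain the substitution x = y / 2^j turns the singularity |x|^(b - 1)
  of the density into the factor 2^(j (2 - b)). What remains converges to a multiple of the integral
  of \<open>winf\<close>^2 |y|^(b - 1), dominated by (1 + |y|)^(- 2 \<alpha>) |y|^(b - 1). The limit
  is positive because \<open>winf\<close> is not almost everywhere zero.\<close>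

lemma bil_powcov_limit:
  assumes b: "0 < b" "b < 1"
  shows "\<exists>L>0. (\<lambda>j. bil (u j) (A * 2 ^ j) (powcov b) / (2 ^ j) powr (2 - b)) \<longlonglongrightarrow> L"
proof -
  define P where "P x = powspec b x * \<bar>x\<bar> powr (1 - b)" for x
  obtain C1 where C1: "C1 > 0" "\<And>l. 0 < \<bar>l\<bar> \<Longrightarrow> \<bar>l\<bar> < pi \<Longrightarrow> P l \<le> C1"
    using powspec_bound[OF b] unfolding P_def by metis
  obtain Cb where Cb: "Cb > 0" "(P \<longlongrightarrow> Cb) (at 0)"
    using powspec_lim[OF b] unfolding P_def by metis
  have P0: "P x = 0" if "\<bar>x\<bar> \<ge> pi" for x
    using that by (auto simp: P_def powspec_def indicator_def)
  have Pnn: "0 \<le> P x" for x using powspec_nonneg[of b x] b by (simp add: P_def)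
  let ?w = "\<lambda>j y. norm (dtft (u j) (y / 2 ^ j)) / 2 ^ j"
  let ?s = "\<lambda>j y. (?w j y)\<^sup>2 * P (y / 2 ^ j) * \<bar>y\<bar> powr (b - 1)"
  let ?f = "\<lambda>y. (winf y)\<^sup>2 * Cb * \<bar>y\<bar> powr (b - 1)"
  let ?D = "\<lambda>y. C\<^sup>2 * C1 * ((1 + \<bar>y\<bar>) powr (- 2 * \<alpha>) * \<bar>y\<bar> powr (b - 1))"
  have [measurable]: "powspec b \<in> borel_measurable borel" "dtft (u j) \<in> borel_measurable borel" for j
    using borel_measurable_integrable[OF powspec_fourier(1)[OF b(1)]]
      borel_measurable_continuous_onI[OF continuous_dtft[OF supp]] by auto
  have eq: "bil (u j) (A * 2 ^ j) (powcov b) / (2 ^ j) powr (2 - b) = (\<integral>y. ?s j y \<partial>lborel)" for j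
  proof -
    let ?g = "\<lambda>x. powspec b x * (norm (dtft (u j) x))\<^sup>2"
    have "bil (u j) (A * 2 ^ j) (powcov b) = (\<integral>x. ?g x \<partial>lborel)"
      using bil_fcoef[OF supp powspec_fourier(1)[OF b(1)]] fcoef_powspec[OF b(1)] by simp
    also have "\<dots> = 1 / 2 ^ j * (\<integral>x. ?g (0 + 1 / 2 ^ j * x) \<partial>lborel)"
      using lborel_integral_real_affine[of "1 / 2 ^ j" ?g 0] by simp
    finally have "bil (u j) (A * 2 ^ j) (powcov b) / (2 ^ j) powr (2 - b)
        = (\<integral>x. (1 / 2 ^ j / (2 ^ j) powr (2 - b)) * ?g (x / 2 ^ j) \<partial>lborel)" by simp
    also have "\<dots> = (\<integral>y. ?s j y \<partial>lborel)"
    proof (intro integral_cong_AE)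
      show "AE x in lborel. 1 / 2 ^ j / (2 ^ j) powr (2 - b) * ?g (x / 2 ^ j) = ?s j x"
        using AE_lborel_singleton[of 0]
      proof eventually_elim
        fix x :: real assume x: "x \<noteq> 0"
        define B :: real where "B = 2 ^ j"
        have B: "B > 0" by (simp add: B_def)
        have "B powr (2 - b) = B powr 2 * B powr (- b)"
          by (simp add: powr_add[symmetric])
        moreover have "\<bar>x / B\<bar> powr (1 - b) * \<bar>x\<bar> powr (b - 1) = B powr (b - 1)"
        proof -
          have "\<bar>x / B\<bar> powr (1 - b) = \<bar>x\<bar> powr (1 - b) * B powr (b - 1)"
            using B by (simp add: powr_divide powr_minus_divide[symmetric])  (metis minus_diff_eq powr_minus_divide divide_inverse powr_minus)
          moreover have "\<bar>x\<bar> powr (1 - b) * \<bar>x\<bar> powr (b - 1) = 1"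
            using x by (simp add: powr_add[symmetric])
          ultimately show ?thesis by (simp add: mult.assoc mult.left_commute)
        qed
        moreover have "1 / B / B powr (2 - b) = B powr (b - 1) / B\<^sup>2"
          using B by (simp add: powr_diff powr_minus field_simps power2_eq_square)
        ultimately show "1 / 2 ^ j / (2 ^ j) powr (2 - b) * ?g (x / 2 ^ j) = ?s j x"
          unfolding P_def B_def[symmetric] by (simp add: power_divide mult.assoc)
      qed
    qed (unfold P_def, measurable)
    finally show ?thesis .
  qed
  have ms: "?s j \<in> borel_measurable lborel" for j
    unfolding P_def by measurable
  have ptw': "(\<lambda>j. ?s j y) \<longlonglongrightarrow> ?f y" for y
  proof (cases "y = 0")
    case y: False
    have "(\<lambda>j. y / 2 ^ j) \<longlonglongrightarrow> 0"
      by real_asymp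
    then have "filterlim (\<lambda>j. y / 2 ^ j) (at 0) sequentially"
      using y by (auto simp: filterlim_at)
    from filterlim_compose[OF Cb(2) this] have "(\<lambda>j. P (y / 2 ^ j)) \<longlonglongrightarrow> Cb" .
    then show ?thesis
      using lim[OF y] by (intro tendsto_intros)
  qed simp
  have ptw: "AE y in lborel. (\<lambda>j. ?s j y) \<longlonglongrightarrow> ?f y" using ptw' by (rule AE_I2)
  have mf: "?f \<in> borel_measurable lborel"
    using ptw' ms by (rule borel_measurable_LIMSEQ_real)
  have iD: "integrable lborel ?D"
    using integrable_japanese_powr[of b "2 * \<alpha>"] b alpha by (intro integrable_mult_right) auto
  have dom: "AE y in lborel. norm (?s j y) \<le> ?D y" for j
    using AE_lborel_singleton[of 0]
  proof eventually_elim
    fix y :: real assume y: "y \<noteq> 0"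
    show "norm (?s j y) \<le> ?D y"
    proof (cases "\<bar>y\<bar> < pi * 2 ^ j")
      case True
      have "(?w j y)\<^sup>2 \<le> (C * (1 + \<bar>y\<bar>) powr (- \<alpha>))\<^sup>2"
        using bound[OF True] by (intro power_mono) auto
      also have "\<dots> = C\<^sup>2 * (1 + \<bar>y\<bar>) powr (- 2 * \<alpha>)"
        by (simp add: power_mult_distrib powr_power)
      finally have "(?w j y)\<^sup>2 * P (y / 2 ^ j) \<le> (C\<^sup>2 * (1 + \<bar>y\<bar>) powr (- 2 * \<alpha>)) * C1"
        using C1(2)[of "y / 2 ^ j"] True y Pnn
        by (intro mult_mono) (auto simp: field_simps)
      then have "(?w j y)\<^sup>2 * P (y / 2 ^ j) * \<bar>y\<bar> powr (b - 1) \<le> (C\<^sup>2 * (1 + \<bar>y\<bar>) powr (- 2 * \<alpha>)) * C1 * \<bar>y\<bar> powr (b - 1)"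
        by (intro mult_right_mono) auto
      then show ?thesis using Pnn[of "y / 2 ^ j"] by (simp add: abs_mult algebra_simps)
    next
      case False
      then have "P (y / 2 ^ j) = 0" by (intro P0) (simp add: field_simps)
      then show ?thesis using C1(1) by simp
    qed
  qed
  have conv: "(\<lambda>j. \<integral>y. ?s j y \<partial>lborel) \<longlonglongrightarrow> (\<integral>y. ?f y \<partial>lborel)"
    by (rule integral_dominated_convergence[OF mf ms iD ptw dom])
  have fint: "integrable lborel ?f"
    by (rule integrable_dominated_convergence[OF mf ms iD ptw dom])
  have fnn: "0 \<le> ?f y" for y using Cb(1) by simp
  have "(\<integral>y. ?f y \<partial>lborel) \<noteq> 0"
  proof
    assume "(\<integral>y. ?f y \<partial>lborel) = 0"
    then have "AE y in lborel. ?f y = 0"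
      using fint fnn by (subst (asm) integral_nonneg_eq_0_iff_AE) auto
    then have "AE y in lborel. winf y = 0"
      using AE_lborel_singleton[of 0] by eventually_elim (use Cb(1) in auto)
    then show False using winf by simp
  qed
  moreover have "(\<integral>y. ?f y \<partial>lborel) \<ge> 0" using fnn by (intro Bochner_Integration.integral_nonneg)
  ultimately show ?thesis using conv unfolding eq by (intro exI[of _ "\<integral>y. ?f y \<partial>lborel"]) auto
qed

section \<open>Sums over the filter support after the filters have been bounded by a
  constant\<close>

definition window_sum :: "nat \<Rightarrow> (int \<Rightarrow> real) \<Rightarrow> real" where
  "window_sum j r = (\<Sum>s\<in>{- int (A * 2 ^ j)..int (A * 2 ^ j)}. \<Sum>t\<in>{- int (A * 2 ^ j)..int (A * 2 ^ j)}. r (s - t))"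

lemma window_card: "real (2 * (A * 2 ^ j) + 1) \<le> real (2 * A + 1) * 2 ^ j"
  by (simp add: algebra_simps)

lemma window_sum_powcov_shift:
  assumes b: "0 \<le> b" "b < 1"
  shows "\<exists>K\<ge>0. \<forall>j h. window_sum j (\<lambda>t. powcov b (h + t)) \<le> K * (2 ^ j) powr (2 - b)"
proof -
  have "window_sum j (\<lambda>t. powcov b (h + t)) \<le> (2 / (1 - b) * real (2 * A + 1) powr (2 - b)) * (2 ^ j) powr (2 - b)" for j h
  proof -
    have "window_sum j (\<lambda>t. powcov b (h + t)) \<le> 2 / (1 - b) * real (2 * (A * 2 ^ j) + 1) powr (2 - b)"
      unfolding window_sum_def using sum_powcov[OF b, where h = h and N = "A * 2 ^ j"] by (simp only: add_diff_eq)
    also have "\<dots> \<le> 2 / (1 - b) * (real (2 * A + 1) * 2 ^ j) powr (2 - b)"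
      using b window_card[of j] by (intro mult_left_mono powr_mono2) auto
    finally show ?thesis by (simp add: powr_mult)
  qed
  then show ?thesis using b by (intro exI[of _ "2 / (1 - b) * real (2 * A + 1) powr (2 - b)"]) auto
qed

lemma window_sum_powcov:
  assumes b: "0 \<le> b" "b < 1"
  shows "\<exists>K\<ge>0. \<forall>j. window_sum j (powcov b) \<le> K * (2 ^ j) powr (2 - b)"
proof -
  obtain K where "K \<ge> 0" "\<And>j h. window_sum j (\<lambda>t. powcov b (h + t)) \<le> K * (2 ^ j) powr (2 - b)"
    using window_sum_powcov_shift[OF b] by auto
  from this(1) this(2)[of _ 0] show ?thesis by auto
qed

lemma window_sum_diag: "window_sum j (\<lambda>t. if t = 0 then 1 else 0) \<le> real (2 * A + 1) * 2 ^ j"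
proof -
  let ?J = "{- int (A * 2 ^ j)..int (A * 2 ^ j)}"
  have "window_sum j (\<lambda>t. if t = 0 then 1 else 0) = (\<Sum>s\<in>?J. \<Sum>t\<in>?J. if s = t then 1 else 0)"
    unfolding window_sum_def by simp
  also have "\<dots> = real (2 * (A * 2 ^ j) + 1)"
    by simp
  finally show ?thesis using window_card[of j] by simp
qed

lemma window_sum_linear:
  "window_sum j (\<lambda>t. x * r t + y * s t) = x * window_sum j r + y * window_sum j s"
  unfolding window_sum_def by (simp add: sum.distrib sum_distrib_left)

end

section \<open>Long memory spectra\<close>

text \<open>The difference of the two sides is a positive semidefinite form in two copies of the index
  set, with coefficients \<open>c\<close> and \<open>- c\<close> and with \<open>\<phi>\<close> and \<open>\<psi>\<close> exchanged on the second copy.\<close>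

lemma quartic_form_swap_le:
  fixes \<phi> \<psi> :: "'i \<Rightarrow> int"
  assumes r: "pd r"
  shows "(\<Sum>i\<in>I. \<Sum>j\<in>I. c i * c j * (r (\<phi> i - \<phi> j) ^ y * r (\<psi> i - \<psi> j) ^ y * (r (\<phi> i - \<psi> j) ^ z * r (\<psi> i - \<phi> j) ^ z)))
    \<le> (\<Sum>i\<in>I. \<Sum>j\<in>I. c i * c j * (r (\<phi> i - \<phi> j) ^ (y + z) * r (\<psi> i - \<psi> j) ^ (y + z)))"
    (is "?Q1 \<le> ?Q0")
proof (cases "finite I")
  case True
  define c' where "c' p = (if snd p then c (fst p) else - c (fst p))" for p :: "'i \<times> bool"
  define \<phi>' where "\<phi>' p = (if snd p then \<phi> (fst p) else \<psi> (fst p))" for p :: "'i \<times> bool"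
  define \<psi>' where "\<psi>' p = (if snd p then \<psi> (fst p) else \<phi> (fst p))" for p :: "'i \<times> bool"
  have split: "(\<Sum>p\<in>I \<times> UNIV. f p) = (\<Sum>i\<in>I. f (i, True) + f (i, False))" for f :: "'i \<times> bool \<Rightarrow> real"
  proof -
    have "(\<Sum>p\<in>I \<times> UNIV. f p) = (\<Sum>i\<in>I. \<Sum>b\<in>UNIV. f (i, b))"
      by (simp add: sum.cartesian_product)
    then show ?thesis by (simp add: UNIV_bool add.commute)
  qed
  note P = psd_on_mult_pd[OF pd_power[OF r]]
  \<comment> \<open>The exchange affects only the factors with exponent \<open>z\<close>. Between
    equal copies they are the parallel factors in some order; between different copies they are the
    crossed ones, and the weights contribute a minus sign.\<close>
  have "psd_on (I \<times> UNIV) (\<lambda>p p'. 1 * r (\<phi> (fst p) - \<phi> (fst p')) ^ y * r (\<psi> (fst p) - \<psi> (fst p')) ^ y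
      * r (\<phi>' p - \<phi>' p') ^ z * r (\<psi>' p - \<psi>' p') ^ z)"
    by (intro P[where \<phi> = \<phi>'] P[where \<phi> = \<psi>'] P[where \<phi> = "\<lambda>p. \<phi> (fst p)"] P[where \<phi> = "\<lambda>p. \<psi> (fst p)"] psd_on_one)
  then have "0 \<le> (\<Sum>p\<in>I \<times> UNIV. \<Sum>p'\<in>I \<times> UNIV. c' p * c' p' * (1 * r (\<phi> (fst p) - \<phi> (fst p')) ^ y * r (\<psi> (fst p) - \<psi> (fst p')) ^ y
      * r (\<phi>' p - \<phi>' p') ^ z * r (\<psi>' p - \<psi>' p') ^ z))"
    unfolding psd_on_def by blast
  also have "\<dots> = 2 * ?Q0 - 2 * ?Q1"
    unfolding split sum_distrib_left sum_subtractf[symmetric] sum.distrib[symmetric]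
    by (intro sum.cong refl) (simp add: c'_def \<phi>'_def \<psi>'_def power_add algebra_simps)
  finally show ?thesis by simp
qed simp

text \<open>The two factors are replaced one after the other: the difference is (R^p - r^p) in
  \<open>\<phi>\<close> times R^p in \<open>\<psi>\<close>, plus (R^p - r^p) in
  \<open>\<psi>\<close> times r^p in \<open>\<phi>\<close>. Both are positive semidefinite
  forms.\<close>

lemma quartic_form_mono:
  fixes \<phi> \<psi> :: "'i \<Rightarrow> int"
  assumes r: "pd r" and R: "pd (\<lambda>t. R t - r t)"
  shows "(\<Sum>i\<in>I. \<Sum>j\<in>I. c i * c j * (r (\<phi> i - \<phi> j) ^ p * r (\<psi> i - \<psi> j) ^ p))
    \<le> (\<Sum>i\<in>I. \<Sum>j\<in>I. c i * c j * (R (\<phi> i - \<phi> j) ^ p * R (\<psi> i - \<psi> j) ^ p))"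
    (is "?Q1 \<le> ?Q0")
proof -
  have pR: "pd R" using pd_add[OF r R] by simp
  have "psd_on I (\<lambda>i j. 1 * (R (\<phi> i - \<phi> j) ^ p - r (\<phi> i - \<phi> j) ^ p) * R (\<psi> i - \<psi> j) ^ p)"
    by (intro psd_on_mult_pd[OF pd_power[OF pR], where \<phi> = \<psi>] psd_on_mult_pd[OF pd_power_diff[OF r R], where \<phi> = \<phi>] psd_on_one)
  then have 1: "0 \<le> (\<Sum>i\<in>I. \<Sum>j\<in>I. c i * c j * (1 * (R (\<phi> i - \<phi> j) ^ p - r (\<phi> i - \<phi> j) ^ p) * R (\<psi> i - \<psi> j) ^ p))"
    unfolding psd_on_def by blast
  have "psd_on I (\<lambda>i j. 1 * (R (\<psi> i - \<psi> j) ^ p - r (\<psi> i - \<psi> j) ^ p) * r (\<phi> i - \<phi> j) ^ p)"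
    by (intro psd_on_mult_pd[OF pd_power[OF r], where \<phi> = \<phi>] psd_on_mult_pd[OF pd_power_diff[OF r R], where \<phi> = \<psi>] psd_on_one)
  then have 2: "0 \<le> (\<Sum>i\<in>I. \<Sum>j\<in>I. c i * c j * (1 * (R (\<psi> i - \<psi> j) ^ p - r (\<psi> i - \<psi> j) ^ p) * r (\<phi> i - \<phi> j) ^ p))"
    unfolding psd_on_def by blast
  have "?Q0 - ?Q1 = (\<Sum>i\<in>I. \<Sum>j\<in>I. c i * c j * (1 * (R (\<phi> i - \<phi> j) ^ p - r (\<phi> i - \<phi> j) ^ p) * R (\<psi> i - \<psi> j) ^ p))
    + (\<Sum>i\<in>I. \<Sum>j\<in>I. c i * c j * (1 * (R (\<psi> i - \<psi> j) ^ p - r (\<psi> i - \<psi> j) ^ p) * r (\<phi> i - \<phi> j) ^ p))"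
    unfolding sum_subtractf[symmetric] sum.distrib[symmetric]
    by (intro sum.cong refl) (simp add: algebra_simps)
  then show ?thesis using 1 2 by linarith
qed

text \<open>In \<open>\<rho>_approx\<close> the constant \<open>D\<close> takes care of the frequencies away from 0. It amounts to a
  white noise, whose quadratic form is \<open>O(2^j)\<close> and therefore negligible.\<close>

locale lrd_filters = scaled_filters +
  fixes \<rho> :: "real \<Rightarrow> real" and a c :: real
  assumes a: "0 < a" and c: "0 < c"
    and \<rho>: "integrable lborel \<rho>" "\<And>x. 0 \<le> \<rho> x"
    and \<rho>0: "fcoef \<rho> 0 = 1"
    and \<rho>_approx: "\<And>\<epsilon>. \<epsilon> > 0 \<Longrightarrow> \<exists>D\<ge>0. \<forall>x. \<bar>\<rho> x - c * powspec a x\<bar> \<le> \<epsilon> * powspec a x + D * indicator {-pi<..<pi} x"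
begin

abbreviation "r \<equiv> fcoef \<rho>"

lemma pd_r: "pd r" by (intro pd_fcoef \<rho>)

lemma r_even: "r (- t) = r t" by (simp add: fcoef_def)

lemma abs_r_le_1: "\<bar>r t\<bar> \<le> 1"
proof -
  have "\<bar>r t\<bar> \<le> (\<integral>x. norm (\<rho> x * cos (of_int t * x)) \<partial>lborel)"
    unfolding fcoef_def real_norm_def[symmetric] by (rule integral_norm_bound)
  also have "\<dots> \<le> (\<integral>x. \<rho> x * cos (of_int 0 * x) \<partial>lborel)"
    by (intro integral_mono integrable_norm integrable_mult_cos \<rho>)
       (use \<rho> in \<open>auto simp: abs_mult intro!: mult_left_le\<close>)
  finally show ?thesis using \<rho>0 by (simp add: fcoef_def)
qed

lemma white_le_powcov: "fcoef (indicator {-pi<..<pi}) t \<le> 2 * pi * powcov b t"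
  by (auto simp: fcoef_white powcov_nonneg) (simp add: powcov_def)

lemma spectral_comb:
  shows "integrable lborel (\<lambda>x. x1 * powspec a x + x2 * indicator {-pi<..<pi} x)"
    and "fcoef (\<lambda>x. x1 * powspec a x + x2 * indicator {-pi<..<pi} x) t
      = x1 * powcov a t + x2 * (if t = 0 then 2 * pi else 0)"
proof -
  have i: "integrable lborel (\<lambda>x. x1 * powspec a x)" "integrable lborel (\<lambda>x. x2 * indicator {-pi<..<pi} x :: real)"
    using powspec_fourier(1)[OF a] by (auto intro!: integrable_mult_right)
  then show "integrable lborel (\<lambda>x. x1 * powspec a x + x2 * indicator {-pi<..<pi} x)"
    by (rule Bochner_Integration.integrable_add)
  show "fcoef (\<lambda>x. x1 * powspec a x + x2 * indicator {-pi<..<pi} x) t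
      = x1 * powcov a t + x2 * (if t = 0 then 2 * pi else 0)"
    by (subst fcoef_add[OF i]) (simp add: fcoef_scale fcoef_powspec[OF a] fcoef_white)
qed

text \<open>Taking epsilon = 1 in \<open>\<rho>_approx\<close> gives a density above both
  \<open>\<rho>\<close> and c times the power law density. Its covariance is a power law plus a
  white noise, both nonnegative at every lag; the white noise has the value 2 pi at lag 0, where the
  power law equals 1.\<close>

lemma dominating_cov:
  obtains R K where "pd (\<lambda>t. R t - r t)" "pd (\<lambda>t. R t - c * powcov a t)" "0 < K" "\<And>t. 0 \<le> R t" "\<And>t. R t \<le> K * powcov a t"
proof -
  obtain D where D: "D \<ge> 0" "\<And>x. \<bar>\<rho> x - c * powspec a x\<bar> \<le> 1 * powspec a x + D * indicator {-pi<..<pi} x"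
    using \<rho>_approx[of 1] by auto
  let ?\<rho> = "\<lambda>x. (c + 1) * powspec a x + D * indicator {-pi<..<pi} x"
  define R where "R = fcoef ?\<rho>"
  have R: "R t = (c + 1) * powcov a t + D * (if t = 0 then 2 * pi else 0)" for t
    unfolding R_def by (rule spectral_comb(2))
  show ?thesis
  proof (rule that[of R "c + 1 + D * 2 * pi"])
    have "\<rho> x \<le> ?\<rho> x" for x using D(2)[of x] by (auto simp: algebra_simps abs_le_iff)
    then show "pd (\<lambda>t. R t - r t)" unfolding R_def by (intro pd_fcoef_diff spectral_comb \<rho>)
    have "c * powspec a x \<le> ?\<rho> x" for x using D(1) powspec_nonneg[OF a, of x] by (auto simp: algebra_simps)
    then have "pd (\<lambda>t. R t - fcoef (\<lambda>x. c * powspec a x) t)" unfolding R_def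
      by (intro pd_fcoef_diff spectral_comb) (use powspec_fourier(1)[OF a] in auto)
    then show "pd (\<lambda>t. R t - c * powcov a t)" by (simp add: fcoef_scale fcoef_powspec[OF a])
    show "0 < c + 1 + D * 2 * pi" using c D(1) by (simp add: add_pos_nonneg)
    show "0 \<le> R t" for t unfolding R using c D(1) powcov_nonneg[of a t] by (auto intro!: add_nonneg_nonneg mult_nonneg_nonneg)
    show "R t \<le> (c + 1 + D * 2 * pi) * powcov a t" for t
      using mult_left_mono[OF white_le_powcov[of t a] D(1)] unfolding R fcoef_white by (simp add: algebra_simps)
  qed
qed

text \<open>Powers of the power law covariance are again power laws, so
  \<open>bil_powcov_limit\<close> applies with b = q a. The difference of the q-th powers is at most
  q R^(q - 1) e in the positive definite order, where e is an epsilon multiple of the power law plus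
  a white noise. The first part costs epsilon times the target order 2^(j (2 - b)); the second costs
  2^j, which is smaller because b < 1.\<close>

lemma bil_power_limit:
  assumes q: "real q * a < 1" "1 \<le> q"
  shows "\<exists>L>0. (\<lambda>j. bil (u j) (A * 2 ^ j) (\<lambda>t. r t ^ q) / (2 ^ j) powr (2 - real q * a)) \<longlonglongrightarrow> L"
proof -
  let ?b = "real q * a"
  have b: "0 < ?b" "?b < 1" using q a by auto
  obtain L where L: "L > 0" "(\<lambda>j. bil (u j) (A * 2 ^ j) (powcov ?b) / (2 ^ j) powr (2 - ?b)) \<longlonglongrightarrow> L"
    using bil_powcov_limit[OF b] by auto
  obtain R K where R: "pd (\<lambda>t. R t - r t)" "pd (\<lambda>t. R t - c * powcov a t)" and K: "0 < K"
    and R0: "\<And>t. 0 \<le> R t" and RK: "\<And>t. R t \<le> K * powcov a t"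
    using dominating_cov by metis
  obtain M where M: "M > 0" "\<And>j \<tau>. \<bar>u j \<tau>\<bar> \<le> M" using filter_bounded by auto
  obtain W where W: "W \<ge> 0" "\<And>j. window_sum j (powcov ?b) \<le> W * (2 ^ j) powr (2 - ?b)"
    using window_sum_powcov[of ?b] b by force
  let ?d = "\<lambda>j. bil (u j) (A * 2 ^ j) (\<lambda>t. r t ^ q - (c * powcov a t) ^ q)"
  define Z where "Z = M\<^sup>2 * (real q * K ^ (q - 1))"
  have Z: "Z \<ge> 0" using K by (simp add: Z_def)
  have main: "\<exists>D\<ge>0. \<forall>j. \<bar>?d j\<bar> \<le> Z * (\<epsilon> * W * (2 ^ j) powr (2 - ?b) + D * 2 ^ j)" if \<epsilon>: "\<epsilon> > 0" for \<epsilon>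
  proof -
    obtain D where D: "D \<ge> 0" "\<And>x. \<bar>\<rho> x - c * powspec a x\<bar> \<le> \<epsilon> * powspec a x + D * indicator {-pi<..<pi} x"
      using \<rho>_approx[OF \<epsilon>] by auto
    let ?\<rho> = "\<lambda>x. \<epsilon> * powspec a x + D * indicator {-pi<..<pi} x"
    define e where "e = fcoef ?\<rho>"
    have e: "e t = \<epsilon> * powcov a t + D * (if t = 0 then 2 * pi else 0)" for t
      unfolding e_def by (rule spectral_comb(2))
    have pc: "integrable lborel (\<lambda>x. c * powspec a x)" "fcoef (\<lambda>x. c * powspec a x) t = c * powcov a t" for t
      using powspec_fourier(1)[OF a] by (auto simp: fcoef_scale fcoef_powspec[OF a])
    note I = spectral_comb(1)[of \<epsilon> D] pc(1) \<rho>(1)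
    have "pd (\<lambda>t. fcoef (\<lambda>x. ?\<rho> x + (\<rho> x - c * powspec a x)) t)"
      "pd (\<lambda>t. fcoef (\<lambda>x. ?\<rho> x - (\<rho> x - c * powspec a x)) t)"
      using D(2) by (intro pd_fcoef Bochner_Integration.integrable_add Bochner_Integration.integrable_diff I;
          force simp: abs_le_iff algebra_simps)+
    then have pe: "pd (\<lambda>t. e t + (r t - c * powcov a t))" "pd (\<lambda>t. e t - (r t - c * powcov a t))"
      unfolding e_def
      by (simp_all only: fcoef_add[OF I(1) Bochner_Integration.integrable_diff[OF I(3) I(2)]]
          fcoef_diff[OF I(1) Bochner_Integration.integrable_diff[OF I(3) I(2)]] fcoef_diff[OF I(3) I(2)] pc(2))
    have pp: "pd (\<lambda>t. c * powcov a t)" using c a by (intro pd_scale pd_powcov) auto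
    note P = pd_power_perturb[OF pd_r pp R pe, of q]
    let ?E = "\<lambda>t. real q * R t ^ (q - 1) * e t"
    have e0: "0 \<le> e t" for t unfolding e using \<epsilon> D(1) powcov_nonneg[of a t] by (auto intro!: add_nonneg_nonneg)
    have Ebd: "\<bar>?E t\<bar> \<le> (real q * K ^ (q - 1) * \<epsilon>) * powcov ?b t + (real q * K ^ (q - 1) * (D * 2 * pi)) * (if t = 0 then 1 else 0)" for t
    proof -
      have "\<bar>?E t\<bar> = ?E t" using R0 e0 by simp
      also have "\<dots> \<le> real q * (K * powcov a t) ^ (q - 1) * e t"
        using R0 RK e0 by (intro mult_right_mono mult_left_mono power_mono) auto
      also have "\<dots> = (real q * K ^ (q - 1)) * (powcov a t ^ (q - 1) * e t)"
        by (simp add: power_mult_distrib)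
      also have "powcov a t ^ (q - 1) * e t = \<epsilon> * powcov ?b t + D * 2 * pi * (if t = 0 then 1 else 0)"
      proof -
        have "powcov a t ^ (q - 1) * powcov a t = powcov ?b t"
          using q(2) power_minus_mult[of q "powcov a t"] by (simp add: powcov_power[symmetric])
        then show ?thesis unfolding e by (auto simp: algebra_simps) (simp add: powcov_def)
      qed
      finally show ?thesis by (simp add: algebra_simps)
    qed
    have "\<bar>?d j\<bar> \<le> bil (u j) (A * 2 ^ j) ?E" for j
      using bil_nonneg[OF P(1), of "u j" "A * 2 ^ j"] bil_nonneg[OF P(2), of "u j" "A * 2 ^ j"]
      unfolding bil_add bil_diff by linarith
    also have "bil (u j) (A * 2 ^ j) ?E \<le> Z * (\<epsilon> * W * (2 ^ j) powr (2 - ?b) + (D * 2 * pi * real (2 * A + 1)) * 2 ^ j)" for j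
    proof -
      have "bil (u j) (A * 2 ^ j) ?E \<le> M\<^sup>2 * window_sum j (\<lambda>t. (real q * K ^ (q - 1) * \<epsilon>) * powcov ?b t + (real q * K ^ (q - 1) * (D * 2 * pi)) * (if t = 0 then 1 else 0))"
        unfolding window_sum_def by (rule order_trans[OF abs_ge_self bil_abs_le[OF M(2) Ebd]])
      also have "\<dots> \<le> M\<^sup>2 * ((real q * K ^ (q - 1) * \<epsilon>) * (W * (2 ^ j) powr (2 - ?b)) + (real q * K ^ (q - 1) * (D * 2 * pi)) * (real (2 * A + 1) * 2 ^ j))"
        unfolding window_sum_linear using K \<epsilon> D(1)
        by (intro mult_left_mono add_mono W(2) window_sum_diag) auto
      also have "\<dots> = Z * (\<epsilon> * W * (2 ^ j) powr (2 - ?b) + (D * 2 * pi * real (2 * A + 1)) * 2 ^ j)"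
        by (simp add: Z_def algebra_simps)
      finally show ?thesis .
    qed
    finally show ?thesis using D(1) by (intro exI[of _ "D * 2 * pi * real (2 * A + 1)"]) auto
  qed
  have "(\<lambda>j. ?d j / (2 ^ j) powr (2 - ?b)) \<longlonglongrightarrow> 0"
  proof (rule tendstoI)
    fix \<eta> :: real assume \<eta>: "\<eta> > 0"
    \<comment> \<open>Makes the power law part of the error at most \<open>\<eta> / 2\<close> and
      leaves the other half to the white noise; the summand 1 avoids a zero denominator.\<close>
    define \<epsilon> where "\<epsilon> = \<eta> / (2 * (Z * W + 1))"
    have ZW: "Z * W \<ge> 0" using Z W by simp
    have \<epsilon>: "\<epsilon> > 0" using \<eta> ZW by (simp add: \<epsilon>_def add_nonneg_pos)
    have ZWe: "Z * \<epsilon> * W \<le> \<eta> / 2"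
    proof -
      have "Z * \<epsilon> * W = (\<eta> / 2) * (Z * W / (Z * W + 1))"
        using ZW by (simp add: \<epsilon>_def field_simps)
      also have "\<dots> \<le> (\<eta> / 2) * 1" using ZW \<eta> by (intro mult_left_mono) auto
      finally show ?thesis by simp
    qed
    obtain D where D: "D \<ge> 0" "\<And>j. \<bar>?d j\<bar> \<le> Z * (\<epsilon> * W * (2 ^ j) powr (2 - ?b) + D * 2 ^ j)"
      using main[OF \<epsilon>] by auto
    have "(\<lambda>j. Z * D * (2 ^ j) powr (?b - 1)) \<longlonglongrightarrow> Z * D * 0"
    proof (intro tendsto_mult_left)
      have "(\<lambda>j. (2 powr (?b - 1)) ^ j) \<longlonglongrightarrow> 0"
        using b powr_less_mono[of "?b - 1" 0 2] by (intro LIMSEQ_power_zero) auto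
      then show "(\<lambda>j::nat. (2 ^ j :: real) powr (?b - 1)) \<longlonglongrightarrow> 0"
        by (simp add: powr_realpow[symmetric] powr_powr powr_power mult.commute)
    qed
    then have "\<forall>\<^sub>F j in sequentially. Z * D * (2 ^ j) powr (?b - 1) < \<eta> / 2"
      using \<eta> by (intro order_tendstoD(2)[of _ "Z * D * 0"]) auto
    then show "\<forall>\<^sub>F j in sequentially. dist (?d j / (2 ^ j) powr (2 - ?b)) 0 < \<eta>"
    proof eventually_elim
      fix j assume j: "Z * D * (2 ^ j) powr (?b - 1) < \<eta> / 2"
      have "\<bar>?d j\<bar> / (2 ^ j) powr (2 - ?b) \<le> Z * (\<epsilon> * W * (2 ^ j) powr (2 - ?b) + D * 2 ^ j) / (2 ^ j) powr (2 - ?b)"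
        using D(2)[of j] by (intro divide_right_mono) auto
      also have "\<dots> = Z * \<epsilon> * W + Z * D * (2 ^ j / (2 ^ j) powr (2 - ?b))"
        by (simp add: field_simps)
      also have "2 ^ j / (2 ^ j) powr (2 - ?b) = (2 ^ j :: real) powr (?b - 1)"
      proof -
        have "(2 ^ j :: real) powr (?b - 1) * (2 ^ j) powr (2 - ?b) = (2 ^ j) powr 1"
          unfolding powr_add[symmetric] by simp
        then show ?thesis by (simp add: field_simps)
      qed
      finally show "dist (?d j / (2 ^ j) powr (2 - ?b)) 0 < \<eta>"
        using ZWe j by (simp add: dist_real_def)
    qed
  qed
  moreover have "(\<lambda>j. c ^ q * (bil (u j) (A * 2 ^ j) (powcov ?b) / (2 ^ j) powr (2 - ?b))) \<longlonglongrightarrow> c ^ q * L"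
    by (intro tendsto_intros L)
  ultimately have "(\<lambda>j. ?d j / (2 ^ j) powr (2 - ?b) + c ^ q * (bil (u j) (A * 2 ^ j) (powcov ?b) / (2 ^ j) powr (2 - ?b))) \<longlonglongrightarrow> 0 + c ^ q * L"
    by (rule tendsto_add)
  also have "(\<lambda>j. ?d j / (2 ^ j) powr (2 - ?b) + c ^ q * (bil (u j) (A * 2 ^ j) (powcov ?b) / (2 ^ j) powr (2 - ?b)))
     = (\<lambda>j. bil (u j) (A * 2 ^ j) (\<lambda>t. r t ^ q) / (2 ^ j) powr (2 - ?b))"
    unfolding bil_diff power_mult_distrib bil_scale powcov_power by (auto simp: field_simps)
  finally show ?thesis using L(1) c by (intro exI[of _ "c ^ q * L"]) auto
qed

text \<open>Only q + 1 of the m factors are exchanged for \<open>R\<close>. The others are bounded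
  by 1 in absolute value afterwards, so the estimate is the same for all m > q.\<close>

lemma bil_power_remainder:
  assumes q: "real q * a < 1"
  shows "\<exists>E. E \<longlonglongrightarrow> 0 \<and> (\<forall>j m. m > q \<longrightarrow> bil (u j) (A * 2 ^ j) (\<lambda>t. r t ^ m) \<le> E j * (2 ^ j) powr (2 - real q * a))"
proof -
  \<comment> \<open>The exponent has to exceed q a in order to gain a power of 2^j, stay below 1 for
    the window sums, and not exceed (q + 1) a, the decay available. The midpoint of q a and 1 takes
    over when (q + 1) a is too large.\<close>
  define b where "b = min (real (Suc q) * a) ((1 + real q * a) / 2)"
  have b: "real q * a < b" "b < 1" "b \<le> real (Suc q) * a" "0 \<le> b" using q a by (auto simp: b_def min_def algebra_simps)
  obtain R K where R: "pd (\<lambda>t. R t - r t)" and K: "0 < K"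
    and R0: "\<And>t. 0 \<le> R t" and RK: "\<And>t. R t \<le> K * powcov a t"
    using dominating_cov by metis
  obtain M where M: "M > 0" "\<And>j \<tau>. \<bar>u j \<tau>\<bar> \<le> M" using filter_bounded by auto
  obtain W where W: "W \<ge> 0" "\<And>j. window_sum j (powcov b) \<le> W * (2 ^ j) powr (2 - b)"
    using window_sum_powcov[of b] b by force
  define E where "E j = (M\<^sup>2 * K ^ Suc q * W) * (2 powr (real q * a - b)) ^ j" for j :: nat
  have "E \<longlonglongrightarrow> (M\<^sup>2 * K ^ Suc q * W) * 0"
    unfolding E_def using b powr_less_mono[of "real q * a - b" 0 2]
    by (intro tendsto_mult_left LIMSEQ_power_zero) auto
  moreover have "bil (u j) (A * 2 ^ j) (\<lambda>t. r t ^ m) \<le> E j * (2 ^ j) powr (2 - real q * a)" if m: "m > q" for j m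
  proof -
    have "pd (\<lambda>t. r t ^ (m - Suc q) * (R t ^ Suc q - r t ^ Suc q))"
      by (intro pd_mult pd_power pd_r pd_power_diff R)
    from bil_nonneg[OF this, of "u j" "A * 2 ^ j"]
    have "bil (u j) (A * 2 ^ j) (\<lambda>t. r t ^ (m - Suc q) * r t ^ Suc q) \<le> bil (u j) (A * 2 ^ j) (\<lambda>t. r t ^ (m - Suc q) * R t ^ Suc q)"
      unfolding right_diff_distrib bil_diff by simp
    also have "(\<lambda>t. r t ^ (m - Suc q) * r t ^ Suc q) = (\<lambda>t. r t ^ m)"
      unfolding power_add[symmetric] using m by simp
    also have "bil (u j) (A * 2 ^ j) (\<lambda>t. r t ^ (m - Suc q) * R t ^ Suc q) \<le> M\<^sup>2 * window_sum j (\<lambda>t. K ^ Suc q * powcov b t + 0 * powcov b t)"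
      unfolding window_sum_def
    proof (rule order_trans[OF abs_ge_self bil_abs_le[OF M(2)]])
      fix t
      have "\<bar>r t ^ (m - Suc q) * R t ^ Suc q\<bar> = \<bar>r t\<bar> ^ (m - Suc q) * R t ^ Suc q"
        using R0[of t] by (simp add: abs_mult power_abs)
      also have "\<dots> \<le> 1 * (K * powcov a t) ^ Suc q"
        using R0[of t] RK[of t] abs_r_le_1[of t] by (intro mult_mono power_mono power_le_one) auto
      also have "\<dots> = K ^ Suc q * powcov (real (Suc q) * a) t"
        by (simp only: power_mult_distrib powcov_power mult_1)
      also have "\<dots> \<le> K ^ Suc q * powcov b t"
        using K b by (intro mult_left_mono powcov_antimono) auto
      finally show "\<bar>r t ^ (m - Suc q) * R t ^ Suc q\<bar> \<le> K ^ Suc q * powcov b t + 0 * powcov b t" by simp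
    qed
    also have "\<dots> \<le> M\<^sup>2 * (K ^ Suc q * (W * (2 ^ j) powr (2 - b)))"
      unfolding window_sum_linear using W(2)[of j] K by (auto intro!: mult_left_mono)
    also have "\<dots> = E j * (2 ^ j) powr (2 - real q * a)"
    proof -
      have "(2 powr (real q * a - b)) ^ j = (2 ^ j) powr (real q * a - b)"
        by (simp add: powr_realpow[symmetric] powr_powr powr_power mult.commute)
      moreover have "(2 ^ j :: real) powr (real q * a - b) * (2 ^ j) powr (2 - real q * a) = (2 ^ j) powr (2 - b)"
        unfolding powr_add[symmetric] by simp
      ultimately show ?thesis unfolding E_def by (simp only: mult.assoc)
    qed
    finally show ?thesis .
  qed
  ultimately show ?thesis by auto
qed

end

section \<open>Fourth order diagrams\<close>

lemma sum4_product:
  fixes f g :: "'i \<Rightarrow> 'i \<Rightarrow> real"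
  shows "(\<Sum>a\<in>J. \<Sum>b\<in>J. \<Sum>c\<in>J. \<Sum>d\<in>J. f a c * g b d) = (\<Sum>a\<in>J. \<Sum>c\<in>J. f a c) * (\<Sum>b\<in>J. \<Sum>d\<in>J. g b d)"
    and "(\<Sum>a\<in>J. \<Sum>b\<in>J. \<Sum>c\<in>J. \<Sum>d\<in>J. f a b * g c d) = (\<Sum>a\<in>J. \<Sum>b\<in>J. f a b) * (\<Sum>c\<in>J. \<Sum>d\<in>J. g c d)"
proof -
  have "(\<Sum>c\<in>J. \<Sum>d\<in>J. f a c * g b d) = (\<Sum>c\<in>J. f a c) * (\<Sum>d\<in>J. g b d)" for a b
    by (rule sum_product[symmetric])
  then show "(\<Sum>a\<in>J. \<Sum>b\<in>J. \<Sum>c\<in>J. \<Sum>d\<in>J. f a c * g b d) = (\<Sum>a\<in>J. \<Sum>c\<in>J. f a c) * (\<Sum>b\<in>J. \<Sum>d\<in>J. g b d)"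
    by (simp add: sum_product)
  show "(\<Sum>a\<in>J. \<Sum>b\<in>J. \<Sum>c\<in>J. \<Sum>d\<in>J. f a b * g c d) = (\<Sum>a\<in>J. \<Sum>b\<in>J. f a b) * (\<Sum>c\<in>J. \<Sum>d\<in>J. g c d)"
    by (simp only: sum_distrib_left[symmetric] sum_distrib_right[symmetric])
qed

lemma sum_pair: "(\<Sum>p\<in>I \<times> J. F p) = (\<Sum>s\<in>I. \<Sum>t\<in>J. F (s, t))"
  by (simp add: sum.cartesian_product)

lemma sum_triple:
  "(\<Sum>i\<in>L \<times> J \<times> J'. F i) = (\<Sum>k\<in>L. \<Sum>s\<in>J. \<Sum>t\<in>J'. F (k, s, t))"
  by (simp add: sum.cartesian_product split_beta)

lemma sum5_reorder:
  fixes F :: "'i \<Rightarrow> 'i \<Rightarrow> 'l \<Rightarrow> 'i \<Rightarrow> 'i \<Rightarrow> real"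
  shows "(\<Sum>s\<in>J. \<Sum>t\<in>J. \<Sum>l\<in>L. \<Sum>s'\<in>J. \<Sum>t'\<in>J. F s t l s' t')
    = (\<Sum>l\<in>L. \<Sum>s\<in>J. \<Sum>s'\<in>J. \<Sum>t\<in>J. \<Sum>t'\<in>J. F s t l s' t')"
proof -
  have "(\<Sum>s\<in>J. \<Sum>t\<in>J. \<Sum>l\<in>L. \<Sum>s'\<in>J. \<Sum>t'\<in>J. F s t l s' t')
    = (\<Sum>s\<in>J. \<Sum>l\<in>L. \<Sum>t\<in>J. \<Sum>s'\<in>J. \<Sum>t'\<in>J. F s t l s' t')"
    by (rule sum.cong[OF refl], rule sum.swap)
  also have "\<dots> = (\<Sum>l\<in>L. \<Sum>s\<in>J. \<Sum>t\<in>J. \<Sum>s'\<in>J. \<Sum>t'\<in>J. F s t l s' t')"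
    by (rule sum.swap)
  also have "\<dots> = (\<Sum>l\<in>L. \<Sum>s\<in>J. \<Sum>s'\<in>J. \<Sum>t\<in>J. \<Sum>t'\<in>J. F s t l s' t')"
    by (rule sum.cong[OF refl], rule sum.cong[OF refl], rule sum.swap)
  finally show ?thesis .
qed

text \<open>The near pairs number O(n) only. Their bound C1 may therefore be large, and smallness is
  required of the far pairs alone.\<close>

lemma sum_near_far:
  fixes T :: "nat \<Rightarrow> nat \<Rightarrow> real"
  assumes near: "\<And>k l. T k l \<le> C1" and far: "\<And>k l. \<bar>int k - int l\<bar> \<ge> int m \<Longrightarrow> T k l \<le> C2"
    and C: "0 \<le> C1" "0 \<le> C2"
  shows "(\<Sum>k<n. \<Sum>l<n. T k l) \<le> real n * real (2 * m + 1) * C1 + (real n)\<^sup>2 * C2"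
proof -
  have "(\<Sum>l<n. T k l) \<le> real (2 * m + 1) * C1 + real n * C2" for k
  proof -
    have "(\<Sum>l<n. T k l) \<le> (\<Sum>l<n. (if l \<in> {k - m..k + m} then C1 else 0) + C2)"
    proof (intro sum_mono)
      fix l assume "l \<in> {..<n}"
      \<comment> \<open>Truncation of k - m at 0 loses nothing, since l is a natural number.\<close>
      have "l \<in> {k - m..k + m} \<or> \<bar>int k - int l\<bar> \<ge> int m" by auto
      then show "T k l \<le> (if l \<in> {k - m..k + m} then C1 else 0) + C2"
        using near[of k l] far[of k l] C by auto
    qed
    also have "\<dots> = (\<Sum>l\<in>{..<n} \<inter> {k - m..k + m}. C1) + real n * C2"
      by (simp only: sum.distrib sum.If_cases[OF finite_lessThan] Collect_mem_eq) simp
    also have "(\<Sum>l\<in>{..<n} \<inter> {k - m..k + m}. C1) \<le> (\<Sum>l\<in>{k - m..k + m}. C1)"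
      using C by (intro sum_mono2) auto
    also have "\<dots> = real (card {k - m..k + m}) * C1" by simp
    also have "\<dots> \<le> real (2 * m + 1) * C1"
      using C by (intro mult_right_mono) auto
    finally show ?thesis by simp
  qed
  then have "(\<Sum>k<n. \<Sum>l<n. T k l) \<le> (\<Sum>k<n. real (2 * m + 1) * C1 + real n * C2)"
    by (intro sum_mono) auto
  then show ?thesis by (simp add: algebra_simps power2_eq_square)
qed

context lrd_filters
begin

text \<open>The contribution to the second moment of the sum of \<open>n\<close> squares of the diagrams with \<open>x\<close>
  edges inside each square and \<open>y\<close> parallel and \<open>z\<close> crossed pairs of edges between the two squares.\<close>

definition quartic :: "nat \<Rightarrow> nat \<Rightarrow> nat \<Rightarrow> nat \<Rightarrow> nat \<Rightarrow> real" where
  "quartic n j x y z = (let J = {- int (A * 2 ^ j)..int (A * 2 ^ j)};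
      cf = (\<lambda>(k, s, t). u j s * u j t * r (s - t) ^ x);
      \<phi> = (\<lambda>(k, s, t). 2 ^ j * int k - s); \<psi> = (\<lambda>(k, s, t). 2 ^ j * int k - t)
    in \<Sum>i\<in>{..<n} \<times> J \<times> J. \<Sum>i'\<in>{..<n} \<times> J \<times> J. cf i * cf i' *
      (r (\<phi> i - \<phi> i') ^ y * r (\<psi> i - \<psi> i') ^ y * (r (\<phi> i - \<psi> i') ^ z * r (\<psi> i - \<phi> i') ^ z)))"

text \<open>The crossed pairs are made parallel, then \<open>r\<close> is exchanged for
  \<open>R\<close>, first in the factors joining the two squares and then in the inner ones; after
  that, absolute values are allowed. Since x < q, at least one pair of factors joins the squares,
  and it decays with the distance of k and l. Near pairs are merely bounded by the right power of
  2^j and are outnumbered as n grows.\<close>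

lemma quartic_small:
  assumes xyz: "x + y + z = q" "x < q" and qa: "real q * a < 1" and \<epsilon>: "\<epsilon> > 0"
  shows "\<exists>n0. \<forall>n\<ge>n0. \<forall>j. quartic n j x y z \<le> \<epsilon> * (real n)\<^sup>2 * (2 ^ j) powr (4 - 2 * (real q * a))"
proof -
  define p where "p = y + z"
  have p: "x + p = q" "1 \<le> p" using xyz by (auto simp: p_def)
  obtain R K where R: "pd (\<lambda>t. R t - r t)" and K: "0 < K"
    and R0: "\<And>t. 0 \<le> R t" and RK: "\<And>t. R t \<le> K * powcov a t"
    using dominating_cov by metis
  obtain M where M: "M > 0" "\<And>j \<tau>. \<bar>u j \<tau>\<bar> \<le> M" using filter_bounded by auto
  have xq: "real x * a \<le> real q * a" using a p by (intro mult_right_mono) auto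
  have xa: "0 \<le> real x * a" "real x * a < 1" "0 \<le> real q * a"
    using a le_less_trans[OF xq qa] by auto
  obtain Wx where Wx: "Wx \<ge> 0" "\<And>j. window_sum j (powcov (real x * a)) \<le> Wx * (2 ^ j) powr (2 - real x * a)"
    using window_sum_powcov[of "real x * a"] xa by force
  obtain Wq where Wq: "Wq \<ge> 0" "\<And>j h. window_sum j (\<lambda>t. powcov (real q * a) (h + t)) \<le> Wq * (2 ^ j) powr (2 - real q * a)"
    using window_sum_powcov_shift[of "real q * a"] xa qa by force
  define J where "J j = {- int (A * 2 ^ j)..int (A * 2 ^ j)}" for j :: nat
  define T where "T j k l = (\<Sum>s\<in>J j. \<Sum>s'\<in>J j. \<Sum>t\<in>J j. \<Sum>t'\<in>J j.
     (u j s * u j s' * R (2 ^ j * (int k - int l) + (s' - s)) ^ p) * (u j t * u j t' * R (2 ^ j * (int k - int l) + (t' - t)) ^ p)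
       * (R (s - t) ^ x * R (s' - t') ^ x))" for j k l
  have le_T: "quartic n j x y z \<le> (\<Sum>k<n. \<Sum>l<n. T j k l)" for n j
  proof -
    let ?I = "{..<n} \<times> J j \<times> J j"
    let ?cf = "(\<lambda>(k, s, t). u j s * u j t * r (s - t) ^ x) :: nat \<times> int \<times> int \<Rightarrow> real"
    let ?\<phi> = "(\<lambda>(k, s, t). 2 ^ j * int k - s) :: nat \<times> int \<times> int \<Rightarrow> int"
    let ?\<psi> = "(\<lambda>(k, s, t). 2 ^ j * int k - t) :: nat \<times> int \<times> int \<Rightarrow> int"
    have "quartic n j x y z \<le> (\<Sum>i\<in>?I. \<Sum>i'\<in>?I. ?cf i * ?cf i' * (r (?\<phi> i - ?\<phi> i') ^ p * r (?\<psi> i - ?\<psi> i') ^ p))"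
      unfolding quartic_def Let_def p_def J_def by (rule quartic_form_swap_le[OF pd_r])
    also have "\<dots> \<le> (\<Sum>i\<in>?I. \<Sum>i'\<in>?I. ?cf i * ?cf i' * (R (?\<phi> i - ?\<phi> i') ^ p * R (?\<psi> i - ?\<psi> i') ^ p))"
      by (rule quartic_form_mono[OF pd_r R])
    also have "\<dots> = (\<Sum>k<n. \<Sum>s\<in>J j. \<Sum>t\<in>J j. \<Sum>l<n. \<Sum>s'\<in>J j. \<Sum>t'\<in>J j.
       (u j s * u j t * r (s - t) ^ x) * (u j s' * u j t' * r (s' - t') ^ x) *
         (R (2 ^ j * (int k - int l) + (s' - s)) ^ p * R (2 ^ j * (int k - int l) + (t' - t)) ^ p))"
      unfolding sum_triple prod.case by (simp add: algebra_simps)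
    also have "\<dots> = (\<Sum>k<n. \<Sum>l<n. \<Sum>s\<in>J j. \<Sum>s'\<in>J j. \<Sum>t\<in>J j. \<Sum>t'\<in>J j.
       (u j s * u j s' * R (2 ^ j * (int k - int l) + (s' - s)) ^ p) * (u j t * u j t' * R (2 ^ j * (int k - int l) + (t' - t)) ^ p)
       * (r (s - t) ^ x * r (s' - t') ^ x))"
      by (rule sum.cong[OF refl], subst sum5_reorder) (simp only: ac_simps)
    also have "\<dots> \<le> (\<Sum>k<n. \<Sum>l<n. T j k l)"
    proof (intro sum_mono)
      fix k l
      \<comment> \<open>Read with (s, s') as one index and (t, t') as the other, the sum is again a
        quadratic form: the joining factors become weights, and the inner factors r(s - t) and r(s'
        - t') are the entries. Hence \<open>quartic_form_mono\<close> applies a second time.\<close>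
      let ?d = "\<lambda>(s, s'). u j s * u j s' * R (2 ^ j * (int k - int l) + (s' - s)) ^ p"
      show "(\<Sum>s\<in>J j. \<Sum>s'\<in>J j. \<Sum>t\<in>J j. \<Sum>t'\<in>J j.
       (u j s * u j s' * R (2 ^ j * (int k - int l) + (s' - s)) ^ p) * (u j t * u j t' * R (2 ^ j * (int k - int l) + (t' - t)) ^ p)
       * (r (s - t) ^ x * r (s' - t') ^ x)) \<le> T j k l"
        using quartic_form_mono[OF pd_r R, where I = "J j \<times> J j" and c = ?d and \<phi> = fst and p = x and \<psi> = snd]
        unfolding T_def sum_pair by simp
    qed
    finally show ?thesis .
  qed
  let ?px = "powcov (real x * a)" and ?pp = "powcov (real p * a)" and ?pq = "powcov (real q * a)"
  define G where "G j h = (\<Sum>s\<in>J j. \<Sum>s'\<in>J j. \<Sum>t\<in>J j. \<Sum>t'\<in>J j.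
     (?pp (h + (s' - s)) * ?pp (h + (t' - t))) * (?px (s - t) * ?px (s' - t')))" for j h
  define Z where "Z = M ^ 4 * K ^ (2 * q)"
  have Z: "Z > 0" using M K by (simp add: Z_def)
  have pc: "R t ^ i \<le> K ^ i * powcov (real i * a) t" for t i
    unfolding powcov_power[symmetric] power_mult_distrib[symmetric] by (intro power_mono RK R0)
  have T_le: "T j k l \<le> Z * G j (2 ^ j * (int k - int l))" for j k l
  proof -
    let ?h = "2 ^ j * (int k - int l)"
    have 1: "\<bar>u j s * u j s' * R t ^ i\<bar> \<le> (M * M * K ^ i) * powcov (real i * a) t" for s s' t i
    proof -
      have "\<bar>u j s * u j s' * R t ^ i\<bar> = \<bar>u j s\<bar> * \<bar>u j s'\<bar> * R t ^ i" using R0 by (simp add: abs_mult)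
      also have "\<dots> \<le> M * M * (K ^ i * powcov (real i * a) t)"
        using M(1) by (intro mult_mono M pc) (auto simp: R0)
      finally show ?thesis by (simp add: mult.assoc)
    qed
    have "T j k l \<le> (\<Sum>s\<in>J j. \<Sum>s'\<in>J j. \<Sum>t\<in>J j. \<Sum>t'\<in>J j.
       (((M * M * K ^ p) * ?pp (?h + (s' - s))) * ((M * M * K ^ p) * ?pp (?h + (t' - t)))) * ((K ^ x * ?px (s - t)) * (K ^ x * ?px (s' - t'))))"
      unfolding T_def
    proof (intro sum_mono)
      fix s s' t t'
      let ?t1 = "u j s * u j s' * R (?h + (s' - s)) ^ p" and ?t2 = "u j t * u j t' * R (?h + (t' - t)) ^ p"
      have "?t1 * ?t2 * (R (s - t) ^ x * R (s' - t') ^ x) \<le> \<bar>?t1\<bar> * \<bar>?t2\<bar> * (R (s - t) ^ x * R (s' - t') ^ x)"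
        unfolding abs_mult[symmetric] using R0 by (intro mult_right_mono abs_ge_self) auto
      also have "\<dots> \<le> (((M * M * K ^ p) * ?pp (?h + (s' - s))) * ((M * M * K ^ p) * ?pp (?h + (t' - t)))) * ((K ^ x * ?px (s - t)) * (K ^ x * ?px (s' - t')))"
        using M(1) K by (intro mult_mono 1 pc) (auto simp: R0 powcov_nonneg)
      finally show "?t1 * ?t2 * (R (s - t) ^ x * R (s' - t') ^ x) \<le> \<dots>" .
    qed
    also have "\<dots> = Z * G j ?h"
    proof -
      have "Z = (M * M * K ^ p) * (M * M * K ^ p) * (K ^ x * K ^ x)"
        unfolding Z_def p(1)[symmetric] by (simp add: power_add power_mult power2_eq_square power4_eq_xxxx algebra_simps)
      then show ?thesis unfolding G_def sum_distrib_left by (simp only: ac_simps)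
    qed
    finally show ?thesis .
  qed
  let ?B = "\<lambda>j::nat. (2 ^ j :: real) powr (4 - 2 * (real q * a))"
  have near: "G j h \<le> 2 * Wq\<^sup>2 * ?B j" for j h
  proof -
    have "G j h \<le> (\<Sum>s\<in>J j. \<Sum>s'\<in>J j. \<Sum>t\<in>J j. \<Sum>t'\<in>J j.
       ?pq (h + (s' - s)) * ?pq (h + (t' - t)) + ?pq (s - t) * ?pq (s' - t'))"
      unfolding G_def
    proof (intro sum_mono)
      fix s s' t t'
      let ?\<beta> = "powcov a (h + (s' - s)) * powcov a (h + (t' - t))" and ?\<alpha> = "powcov a (s - t) * powcov a (s' - t')"
      \<comment> \<open>Both products are at most the q-th power of the larger base. This decouples
        joining from inner factors, and each fourfold sum becomes a product of two double sums with
        the exponent q a < 1.\<close>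
      have gen: "\<beta> ^ p * \<gamma> ^ x \<le> \<beta> ^ q + \<gamma> ^ q" if "0 \<le> \<beta>" "0 \<le> \<gamma>" for \<beta> \<gamma> :: real
      proof (cases "\<beta> \<le> \<gamma>")
        case True
        then have "\<beta> ^ p * \<gamma> ^ x \<le> \<gamma> ^ p * \<gamma> ^ x" using that by (intro mult_right_mono power_mono) auto
        also have "\<dots> = \<gamma> ^ q" using p by (simp add: power_add[symmetric] add.commute)
        finally show ?thesis using that by (simp add: add_increasing)
      next
        case False
        then have "\<beta> ^ p * \<gamma> ^ x \<le> \<beta> ^ p * \<beta> ^ x" using that by (intro mult_left_mono power_mono) auto
        also have "\<dots> = \<beta> ^ q" using p by (simp add: power_add[symmetric] add.commute)
        finally show ?thesis using that by (simp add: add_increasing2)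
      qed
      have "?\<beta> ^ p * ?\<alpha> ^ x \<le> ?\<beta> ^ q + ?\<alpha> ^ q"
        by (intro gen mult_nonneg_nonneg powcov_nonneg)
      then show "?pp (h + (s' - s)) * ?pp (h + (t' - t)) * (?px (s - t) * ?px (s' - t'))
        \<le> ?pq (h + (s' - s)) * ?pq (h + (t' - t)) + ?pq (s - t) * ?pq (s' - t')"
        by (simp only: power_mult_distrib powcov_power)
    qed
    also have "\<dots> = (\<Sum>s\<in>J j. \<Sum>s'\<in>J j. ?pq (h + (s' - s)))\<^sup>2 + (window_sum j ?pq)\<^sup>2"
      unfolding sum.distrib sum4_product window_sum_def J_def power2_eq_square ..
    also have "(\<Sum>s\<in>J j. \<Sum>s'\<in>J j. ?pq (h + (s' - s))) = window_sum j (\<lambda>t. ?pq (h + t))"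
      unfolding window_sum_def J_def by (rule sum.swap)
    also have "(window_sum j (\<lambda>t. ?pq (h + t)))\<^sup>2 + (window_sum j ?pq)\<^sup>2 \<le> (Wq * (2 ^ j) powr (2 - real q * a))\<^sup>2 + (Wq * (2 ^ j) powr (2 - real q * a))\<^sup>2"
      using Wq(2)[of j h] Wq(2)[of j 0]
      by (intro add_mono power_mono) (auto simp: window_sum_def intro!: sum_nonneg powcov_nonneg)
    also have "\<dots> = 2 * Wq\<^sup>2 * ?B j"
      by (simp add: power_mult_distrib powr_power algebra_simps)
    finally show ?thesis .
  qed
  \<comment> \<open>The taps move a time by at most 2 A 2^j in total, and m >= 4 A makes this at
    most half of the distance 2^j |d|. So every joining factor is at most (2^j m / 2)^(- p a), and
    the two of them give the gain in m.\<close>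
  have far: "G j (2 ^ j * d) \<le> Wx\<^sup>2 * (real m / 2) powr (- 2 * (real p * a)) * ?B j"
    if m: "4 * int A \<le> int m" "m \<ge> 1" "\<bar>d\<bar> \<ge> int m" for j d m
  proof -
    define Y where "Y = (2 ^ j * (real m / 2)) powr (- (real p * a))"
    have pY: "?pp (2 ^ j * d + (s' - s)) \<le> Y" if "s \<in> J j" "s' \<in> J j" for s s'
    proof -
      have "\<bar>s' - s\<bar> \<le> 2 * (int A * 2 ^ j)" using that by (auto simp: J_def abs_le_iff)
      also have "\<dots> * 2 \<le> 2 ^ j * int m" using m(1) by (simp add: algebra_simps)
      finally have 1: "2 * \<bar>s' - s\<bar> \<le> 2 ^ j * int m" by simp
      have 2: "2 ^ j * int m \<le> \<bar>2 ^ j * d\<bar>" using m(3) by (simp add: abs_mult)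
      have gen: "b \<le> 2 * \<bar>e + f\<bar>" if "2 * \<bar>f\<bar> \<le> b" "b \<le> \<bar>e\<bar>" for b e f :: int
        using that abs_triangle_ineq4[of "e + f" f] by simp
      have "2 ^ j * int m \<le> 2 * \<bar>2 ^ j * d + (s' - s)\<bar>" by (rule gen[OF 1 2])
      then have "real_of_int (2 ^ j * int m) \<le> real_of_int (2 * \<bar>2 ^ j * d + (s' - s)\<bar>)" by (simp only: of_int_le_iff)
      then have "2 ^ j * (real m / 2) \<le> 1 + \<bar>real_of_int (2 ^ j * d + (s' - s))\<bar>" by simp
      then show ?thesis unfolding powcov_def Y_def using m(2) a by (intro powr_mono2') auto
    qed
    have "G j (2 ^ j * d) \<le> (\<Sum>s\<in>J j. \<Sum>s'\<in>J j. \<Sum>t\<in>J j. \<Sum>t'\<in>J j. (Y * Y) * (?px (s - t) * ?px (s' - t')))"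
      unfolding G_def by (intro sum_mono mult_right_mono mult_mono pY mult_nonneg_nonneg powcov_nonneg) (auto simp: Y_def)
    also have "\<dots> = (Y * Y) * (\<Sum>s\<in>J j. \<Sum>s'\<in>J j. \<Sum>t\<in>J j. \<Sum>t'\<in>J j. ?px (s - t) * ?px (s' - t'))"
      by (simp only: sum_distrib_left)
    also have "\<dots> = (Y * Y) * (window_sum j ?px)\<^sup>2"
      unfolding sum4_product window_sum_def J_def power2_eq_square ..
    also have "\<dots> \<le> (Y * Y) * (Wx * (2 ^ j) powr (2 - real x * a))\<^sup>2"
      using Wx(2)[of j]
      by (intro mult_left_mono power_mono) (auto simp: window_sum_def intro!: sum_nonneg powcov_nonneg)
    also have "\<dots> = Wx\<^sup>2 * (real m / 2) powr (- 2 * (real p * a)) * ?B j"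
    proof -
      have e1: "Y * Y = (2 ^ j) powr (- 2 * (real p * a)) * (real m / 2) powr (- 2 * (real p * a))"
      proof -
        have e: "- (real p * a) + - (real p * a) = - 2 * (real p * a)" by simp
        show ?thesis unfolding Y_def powr_add[symmetric] e by (subst powr_mult) auto
      qed
      have e2: "(Wx * (2 ^ j) powr (2 - real x * a))\<^sup>2 = Wx\<^sup>2 * (2 ^ j) powr (2 * (2 - real x * a))"
        by (simp add: power_mult_distrib powr_power mult.commute)
      have e3: "(2 ^ j :: real) powr (- 2 * (real p * a)) * (2 ^ j) powr (2 * (2 - real x * a)) = ?B j"
        unfolding powr_add[symmetric] p(1)[symmetric] by (simp add: algebra_simps)
      show ?thesis unfolding e1 e2 e3[symmetric] by (simp only: ac_simps)
    qed
    finally show ?thesis .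
  qed
  have "((\<lambda>m. Z * Wx\<^sup>2 * (real m / 2) powr (- 2 * (real p * a))) \<longlongrightarrow> Z * Wx\<^sup>2 * 0) sequentially"
  proof (intro tendsto_mult_left tendsto_neg_powr)
    show "- 2 * (real p * a) < 0" using p a by simp
    show "filterlim (\<lambda>m. real m / 2) at_top sequentially" by real_asymp
  qed
  then have "eventually (\<lambda>m. Z * Wx\<^sup>2 * (real m / 2) powr (- 2 * (real p * a)) < \<epsilon> / 2 \<and> m \<ge> 4 * A + 1) sequentially"
    using \<epsilon> by (intro eventually_conj eventually_ge_at_top order_tendstoD(2)[of _ "Z * Wx\<^sup>2 * 0"]) auto
  then obtain m where m: "Z * Wx\<^sup>2 * (real m / 2) powr (- 2 * (real p * a)) < \<epsilon> / 2" "m \<ge> 4 * A + 1"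
    by (auto simp: eventually_sequentially)
  \<comment> \<open>From this n on, the near pairs contribute at most half of the allowed n^2
    \<open>\<epsilon>\<close>.\<close>
  define n0 where "n0 = nat \<lceil>real (2 * m + 1) * (Z * (2 * Wq\<^sup>2)) / (\<epsilon> / 2)\<rceil>"
  show ?thesis
  proof (intro exI[of _ n0] allI impI)
    fix n j assume n: "n0 \<le> n"
    have "quartic n j x y z \<le> (\<Sum>k<n. \<Sum>l<n. T j k l)" by (rule le_T)
    also have "\<dots> \<le> real n * real (2 * m + 1) * (Z * (2 * Wq\<^sup>2 * ?B j)) + (real n)\<^sup>2 * (\<epsilon> / 2 * ?B j)"
    proof (rule sum_near_far)
      show "T j k l \<le> Z * (2 * Wq\<^sup>2 * ?B j)" for k l
        using Z by (intro order_trans[OF T_le mult_left_mono[OF near]]) auto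
      show "T j k l \<le> \<epsilon> / 2 * ?B j" if "\<bar>int k - int l\<bar> \<ge> int m" for k l
      proof -
        have "T j k l \<le> Z * (Wx\<^sup>2 * (real m / 2) powr (- 2 * (real p * a)) * ?B j)"
          using Z m(2) that by (intro order_trans[OF T_le mult_left_mono[OF far]]) auto
        also have "\<dots> = (Z * Wx\<^sup>2 * (real m / 2) powr (- 2 * (real p * a))) * ?B j" by simp
        also have "\<dots> \<le> \<epsilon> / 2 * ?B j" using m(1) by (intro mult_right_mono) auto
        finally show ?thesis .
      qed
    qed (use Z \<epsilon> in auto)
    also have "real n * real (2 * m + 1) * (Z * (2 * Wq\<^sup>2 * ?B j)) \<le> (real n)\<^sup>2 * (\<epsilon> / 2 * ?B j)"
    proof -
      have "real (2 * m + 1) * (Z * (2 * Wq\<^sup>2)) / (\<epsilon> / 2) \<le> real n"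
        using n unfolding n0_def by linarith
      then have "real (2 * m + 1) * (Z * (2 * Wq\<^sup>2)) \<le> real n * (\<epsilon> / 2)"
        using \<epsilon> by (subst (asm) pos_divide_le_eq) auto
      then have "real n * ?B j * (real (2 * m + 1) * (Z * (2 * Wq\<^sup>2))) \<le> real n * ?B j * (real n * (\<epsilon> / 2))"
        by (intro mult_left_mono) auto
      then show ?thesis by (simp only: power2_eq_square ac_simps)
    qed
    finally show "quartic n j x y z \<le> \<epsilon> * (real n)\<^sup>2 * ?B j" by (simp add: algebra_simps)
  qed
qed

end

section \<open>Gaussian moments and Hermite polynomials\<close>

lemma hermite_Suc: "hermite (Suc n) x = x * hermite n x - real n * hermite (n - 1) x"
  by (cases n) auto

text \<open>This class is closed under sums and products, so integrability of any polynomial in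
  Gaussian variables follows from closure rules.\<close>

definition all_moments :: "'a measure \<Rightarrow> ('a \<Rightarrow> real) \<Rightarrow> bool" where
  "all_moments M f \<longleftrightarrow> f \<in> borel_measurable M \<and> (\<forall>n. integrable M (\<lambda>x. \<bar>f x\<bar> ^ n))"

lemma all_moments_integrable: "all_moments M f \<Longrightarrow> integrable M f"
proof -
  assume f: "all_moments M f"
  then have "integrable M (\<lambda>x. \<bar>f x\<bar> ^ 1)" unfolding all_moments_def by blast
  then show "integrable M f" using f integrable_abs_cancel by (auto simp: all_moments_def)
qed

lemma power_abs_sum_le: "\<bar>x + y :: real\<bar> ^ n \<le> 2 ^ n * (\<bar>x\<bar> ^ n + \<bar>y\<bar> ^ n)"
proof -
  have "\<bar>x + y\<bar> ^ n \<le> (2 * max \<bar>x\<bar> \<bar>y\<bar>) ^ n" by (intro power_mono) auto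
  also have "\<dots> = 2 ^ n * max \<bar>x\<bar> \<bar>y\<bar> ^ n" by (simp add: power_mult_distrib)
  also have "max \<bar>x\<bar> \<bar>y\<bar> ^ n \<le> \<bar>x\<bar> ^ n + \<bar>y\<bar> ^ n" by (auto simp: max_def)
  finally show ?thesis by simp
qed

lemma power_abs_mult_le: "\<bar>x * y :: real\<bar> ^ n \<le> \<bar>x\<bar> ^ (2 * n) + \<bar>y\<bar> ^ (2 * n)"
proof -
  have "\<bar>x * y\<bar> \<le> max \<bar>x\<bar> \<bar>y\<bar> ^ 2"
    unfolding abs_mult power2_eq_square by (intro mult_mono) auto
  then have "\<bar>x * y\<bar> ^ n \<le> (max \<bar>x\<bar> \<bar>y\<bar> ^ 2) ^ n" by (intro power_mono) auto
  also have "\<dots> \<le> \<bar>x\<bar> ^ (2 * n) + \<bar>y\<bar> ^ (2 * n)" by (auto simp: max_def power_mult)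
  finally show ?thesis .
qed

context prob_space
begin

lemma all_moments_const: "all_moments M (\<lambda>_. c)"
  by (simp add: all_moments_def)

lemma all_moments_add:
  assumes "all_moments M f" "all_moments M g"
  shows "all_moments M (\<lambda>x. f x + g x)"
  unfolding all_moments_def
proof (intro conjI allI)
  have [measurable]: "f \<in> borel_measurable M" "g \<in> borel_measurable M"
    using assms by (auto simp: all_moments_def)
  show "(\<lambda>x. f x + g x) \<in> borel_measurable M" by measurable
  show "integrable M (\<lambda>x. \<bar>f x + g x\<bar> ^ n)" for n
  proof (rule Bochner_Integration.integrable_bound)
    show "integrable M (\<lambda>x. 2 ^ n * (\<bar>f x\<bar> ^ n + \<bar>g x\<bar> ^ n))"
      using assms by (auto simp: all_moments_def)
    show "AE x in M. norm (\<bar>f x + g x\<bar> ^ n) \<le> norm (2 ^ n * (\<bar>f x\<bar> ^ n + \<bar>g x\<bar> ^ n))"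
      using power_abs_sum_le by (intro AE_I2) (simp add: abs_mult)
  qed measurable
qed

lemma all_moments_mult:
  assumes "all_moments M f" "all_moments M g"
  shows "all_moments M (\<lambda>x. f x * g x)"
  unfolding all_moments_def
proof (intro conjI allI)
  have [measurable]: "f \<in> borel_measurable M" "g \<in> borel_measurable M"
    using assms by (auto simp: all_moments_def)
  show "(\<lambda>x. f x * g x) \<in> borel_measurable M" by measurable
  show "integrable M (\<lambda>x. \<bar>f x * g x\<bar> ^ n)" for n
  proof (rule Bochner_Integration.integrable_bound)
    show "integrable M (\<lambda>x. \<bar>f x\<bar> ^ (2 * n) + \<bar>g x\<bar> ^ (2 * n))"
      using assms by (auto simp: all_moments_def)
    show "AE x in M. norm (\<bar>f x * g x\<bar> ^ n) \<le> norm (\<bar>f x\<bar> ^ (2 * n) + \<bar>g x\<bar> ^ (2 * n))"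
      using power_abs_mult_le by (intro AE_I2) simp
  qed measurable
qed

lemma all_moments_power: "all_moments M f \<Longrightarrow> all_moments M (\<lambda>x. f x ^ n)"
  by (induction n) (auto intro: all_moments_const all_moments_mult)

lemma all_moments_sum: "(\<And>i. i \<in> I \<Longrightarrow> all_moments M (f i)) \<Longrightarrow> all_moments M (\<lambda>x. \<Sum>i\<in>I. f i x)"
  by (induction I rule: infinite_finite_induct) (auto intro: all_moments_const all_moments_add)

lemmas all_moments_intros = all_moments_const all_moments_add all_moments_mult all_moments_power all_moments_sum

text \<open>By the binomial theorem the expectation is a polynomial in t, so the derivative is its
  linear coefficient and no limit has to be exchanged with the integral.\<close>

lemma expectation_power_deriv:
  assumes F: "all_moments M F" and L: "all_moments M L" and Z: "all_moments M Z"
  shows "((\<lambda>t. expectation (\<lambda>\<omega>. F \<omega> * (L \<omega> + t * Z \<omega>) ^ n)) has_real_derivative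
     real n * expectation (\<lambda>\<omega>. F \<omega> * (Z \<omega> * L \<omega> ^ (n - 1)))) (at 0)"
proof -
  define e where "e k = expectation (\<lambda>\<omega>. F \<omega> * (Z \<omega> ^ k * L \<omega> ^ (n - k)))" for k
  have eq: "expectation (\<lambda>\<omega>. F \<omega> * (L \<omega> + t * Z \<omega>) ^ n) = (\<Sum>k\<le>n. (real (n choose k) * e k) * t ^ k)" for t
  proof -
    have "F \<omega> * (L \<omega> + t * Z \<omega>) ^ n = (\<Sum>k\<le>n. (real (n choose k) * t ^ k) * (F \<omega> * (Z \<omega> ^ k * L \<omega> ^ (n - k))))" for \<omega>
      unfolding add.commute[of "L \<omega>"] binomial_ring sum_distrib_left
      by (intro sum.cong refl) (simp add: power_mult_distrib algebra_simps)
    then have "expectation (\<lambda>\<omega>. F \<omega> * (L \<omega> + t * Z \<omega>) ^ n) =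
      (\<Sum>k\<le>n. expectation (\<lambda>\<omega>. (real (n choose k) * t ^ k) * (F \<omega> * (Z \<omega> ^ k * L \<omega> ^ (n - k)))))"
      by (simp only:) (intro Bochner_Integration.integral_sum all_moments_integrable all_moments_intros F L Z)
    also have "\<dots> = (\<Sum>k\<le>n. (real (n choose k) * e k) * t ^ k)"
      unfolding integral_mult_right_zero e_def by (simp only: ac_simps)
    finally show ?thesis .
  qed
  have "((\<lambda>t. \<Sum>k\<le>n. (real (n choose k) * e k) * t ^ k) has_real_derivative
      (\<Sum>k\<le>n. (real (n choose k) * e k) * (real k * 0 ^ (k - 1)))) (at 0)"
    by (intro DERIV_sum DERIV_cmult) (auto intro!: derivative_eq_intros)
  moreover have "(\<Sum>k\<le>n. (real (n choose k) * e k) * (real k * 0 ^ (k - 1))) = real n * e 1"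
  proof (cases n)
    case (Suc m)
    have "(\<Sum>k\<le>n. (real (n choose k) * e k) * (real k * 0 ^ (k - 1))) = (\<Sum>k\<le>n. if k = 1 then real n * e 1 else 0)"
    proof (intro sum.cong refl)
      fix k assume "k \<in> {..n}"
      show "(real (n choose k) * e k) * (real k * 0 ^ (k - 1)) = (if k = 1 then real n * e 1 else 0)"
        by (cases k rule: nat.exhaust; cases "k - 1") auto
    qed
    then show ?thesis using Suc by simp
  qed simp
  ultimately show ?thesis unfolding eq e_def by simp
qed

end

locale gaussian_family = prob_space M for M :: "'a measure" +
  fixes J :: "'j set" and Z :: "'j \<Rightarrow> 'a \<Rightarrow> real"
  assumes finite_J: "finite J"
    and Z_meas: "\<And>j. j \<in> J \<Longrightarrow> Z j \<in> borel_measurable M"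
    and lin_gauss: "\<And>a. (AE \<omega> in M. (\<Sum>j\<in>J. a j * Z j \<omega>) = 0) \<or>
        (\<exists>\<sigma>>0. distributed M lborel (\<lambda>\<omega>. \<Sum>j\<in>J. a j * Z j \<omega>) (normal_density 0 \<sigma>))"
begin

definition lin :: "('j \<Rightarrow> real) \<Rightarrow> 'a \<Rightarrow> real" where
  "lin a \<omega> = (\<Sum>j\<in>J. a j * Z j \<omega>)"

text \<open>The moments of the standard normal law, (n - 1)!! for even n.\<close>

definition gmoment :: "nat \<Rightarrow> real" where
  "gmoment n = (if even n then fact n / (2 ^ (n div 2) * fact (n div 2)) else 0)"

lemma lin_meas[measurable]: "lin a \<in> borel_measurable M"
  unfolding lin_def using Z_meas by measurable

lemma lin_moments_aux:
  "\<exists>\<sigma>\<ge>0. all_moments M (lin a) \<and> (\<forall>n. expectation (\<lambda>\<omega>. lin a \<omega> ^ n) = gmoment n * \<sigma> ^ n)"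
  using lin_gauss[of a]
proof
  assume "AE \<omega> in M. (\<Sum>j\<in>J. a j * Z j \<omega>) = 0"
  then have z: "AE \<omega> in M. lin a \<omega> = 0" by (simp add: lin_def)
  have "expectation (\<lambda>\<omega>. lin a \<omega> ^ n) = expectation (\<lambda>_. 0 ^ n)" for n
    by (intro integral_cong_AE) (use z in auto)
  moreover have "integrable M (\<lambda>\<omega>. \<bar>lin a \<omega>\<bar> ^ n)" for n
  proof -
    have "integrable M (\<lambda>\<omega>. \<bar>lin a \<omega>\<bar> ^ n) \<longleftrightarrow> integrable M (\<lambda>_. (0::real) ^ n)"
      by (intro integrable_cong_AE) (use z in auto)
    then show ?thesis by simp
  qed
  ultimately show ?thesis
    \<comment> \<open>The degenerate case is the deviation 0, where 0 ^ 0 = 1 accounts for the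
      moment of order 0.\<close>
    by (intro exI[of _ 0]) (auto simp: all_moments_def gmoment_def power_0_left prob_space)
next
  assume "\<exists>\<sigma>>0. distributed M lborel (\<lambda>\<omega>. \<Sum>j\<in>J. a j * Z j \<omega>) (normal_density 0 \<sigma>)"
  then obtain \<sigma> where \<sigma>: "\<sigma> > 0" and D: "distributed M lborel (lin a) (normal_density 0 \<sigma>)"
    unfolding lin_def by auto
  have "expectation (\<lambda>\<omega>. lin a \<omega> ^ n) = gmoment n * \<sigma> ^ n" for n
  proof -
    have e: "expectation (\<lambda>\<omega>. lin a \<omega> ^ n) = (\<integral>x. normal_density 0 \<sigma> x * x ^ n \<partial>lborel)"
      by (subst distributed_integral[OF D]) auto
    show ?thesis
    proof (cases "even n")
      case True
      then obtain k where k: "n = 2 * k" by auto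
      have "(\<integral>x. normal_density 0 \<sigma> x * x ^ n \<partial>lborel) = fact (2 * k) / ((2 / \<sigma>\<^sup>2) ^ k * fact k)"
        using has_bochner_integral_integral_eq[OF normal_moment_even[OF \<sigma>, of 0 k]] unfolding k by simp
      then show ?thesis unfolding e using \<sigma> by (simp add: gmoment_def k power_divide power_mult)
    next
      case False
      then obtain k where k: "n = 2 * k + 1" using oddE by blast
      have "(\<integral>x. normal_density 0 \<sigma> x * x ^ n \<partial>lborel) = 0"
        using has_bochner_integral_integral_eq[OF normal_moment_odd[OF \<sigma>, of 0 k]] unfolding k by simp
      then show ?thesis unfolding e by (simp add: gmoment_def k)
    qed
  qed
  moreover have "integrable M (\<lambda>\<omega>. \<bar>lin a \<omega>\<bar> ^ n)" for n
  proof -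
    have ev: "integrable M (\<lambda>\<omega>. \<bar>lin a \<omega>\<bar> ^ (2 * k))" for k
    proof -
      have "integrable lborel (\<lambda>x. normal_density 0 \<sigma> x * \<bar>x\<bar> ^ (2 * k))"
        using normal_moment_even[OF \<sigma>, of 0 k] by (auto simp: has_bochner_integral_iff power_mult)
      then show ?thesis by (subst distributed_integrable[OF D, symmetric]) auto
    qed
    show ?thesis
    proof (rule Bochner_Integration.integrable_bound)
      show "integrable M (\<lambda>\<omega>. 1 + \<bar>lin a \<omega>\<bar> ^ (2 * n))" using ev by simp
      show "AE \<omega> in M. norm (\<bar>lin a \<omega>\<bar> ^ n) \<le> norm (1 + \<bar>lin a \<omega>\<bar> ^ (2 * n))"
        using power_abs_mult_le[of 1 "lin a _" n] by (intro AE_I2) simp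
    qed measurable
  qed
  ultimately show ?thesis using \<sigma> by (intro exI[of _ \<sigma>]) (auto simp: all_moments_def)
qed

lemma all_moments_lin: "all_moments M (lin a)"
  using lin_moments_aux by blast

lemma lin_add: "lin (\<lambda>j. a j + t * b j) \<omega> = lin a \<omega> + t * lin b \<omega>"
  by (simp add: lin_def sum.distrib sum_distrib_left algebra_simps)

lemma lin_single: "i \<in> J \<Longrightarrow> lin (\<lambda>j. if j = i then 1 else 0) \<omega> = Z i \<omega>"
  unfolding lin_def using finite_J by (subst sum.cong[OF refl, of _ _ "\<lambda>j. if j = i then Z j \<omega> else 0"]) auto

lemma all_moments_Z: "i \<in> J \<Longrightarrow> all_moments M (Z i)"
  using all_moments_lin[of "\<lambda>j. if j = i then 1 else 0"] by (simp add: lin_single ext[of "lin _" "Z i"])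

lemma lin_moment_even: "expectation (\<lambda>\<omega>. lin a \<omega> ^ (2 * k)) = fact (2 * k) / (2 ^ k * fact k) * expectation (\<lambda>\<omega>. (lin a \<omega>)\<^sup>2) ^ k"
  and lin_moment_odd: "odd n \<Longrightarrow> expectation (\<lambda>\<omega>. lin a \<omega> ^ n) = 0"
proof -
  obtain \<sigma> where s: "\<And>n. expectation (\<lambda>\<omega>. lin a \<omega> ^ n) = gmoment n * \<sigma> ^ n"
    using lin_moments_aux[of a] by auto
  show "expectation (\<lambda>\<omega>. lin a \<omega> ^ (2 * k)) = fact (2 * k) / (2 ^ k * fact k) * expectation (\<lambda>\<omega>. (lin a \<omega>)\<^sup>2) ^ k"
    unfolding s by (simp add: gmoment_def power_mult)
  show "odd n \<Longrightarrow> expectation (\<lambda>\<omega>. lin a \<omega> ^ n) = 0"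
    unfolding s by (simp add: gmoment_def)
qed

definition cov :: "'j \<Rightarrow> 'j \<Rightarrow> real" where
  "cov i j = expectation (\<lambda>\<omega>. Z i \<omega> * Z j \<omega>)"

text \<open>Differentiate the even moments of \<open>lin a + t Z\<^sub>i\<close>, which are powers of a quadratic
  polynomial in \<open>t\<close>.\<close>

lemma lin_power_stein:
  assumes i: "i \<in> J"
  shows "expectation (\<lambda>\<omega>. Z i \<omega> * lin a \<omega> ^ n) = real n * (\<Sum>j\<in>J. a j * cov i j) * expectation (\<lambda>\<omega>. lin a \<omega> ^ (n - 1))"
proof -
  let ?e = "\<lambda>j. if j = i then 1 else (0::real)"
  have D: "((\<lambda>t. expectation (\<lambda>\<omega>. lin (\<lambda>j. a j + t * ?e j) \<omega> ^ Suc n)) has_real_derivative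
     real (Suc n) * expectation (\<lambda>\<omega>. Z i \<omega> * lin a \<omega> ^ n)) (at 0)"
    using expectation_power_deriv[OF all_moments_const[of 1] all_moments_lin[of a] all_moments_Z[OF i], of "Suc n"]
    unfolding lin_add lin_single[OF i] by simp
  show ?thesis
  proof (cases "even n")
    case True
    have "((\<lambda>t. expectation (\<lambda>\<omega>. lin (\<lambda>j. a j + t * ?e j) \<omega> ^ Suc n)) has_real_derivative 0) (at 0)"
      using True by (subst lin_moment_odd) auto
    from DERIV_unique[OF D this] True show ?thesis by (cases "n = 0") (auto simp: lin_moment_odd)
  next
    case False
    then obtain k where k: "n = 2 * k + 1" using oddE by blast
    define c where "c = (\<Sum>j\<in>J. a j * cov i j)"
    have c: "c = expectation (\<lambda>\<omega>. Z i \<omega> * lin a \<omega>)"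
    proof -
      have "expectation (\<lambda>\<omega>. \<Sum>j\<in>J. a j * (Z i \<omega> * Z j \<omega>)) = (\<Sum>j\<in>J. a j * cov i j)"
        unfolding cov_def using i
        by (subst Bochner_Integration.integral_sum) (auto intro!: all_moments_integrable all_moments_intros all_moments_Z)
      then show ?thesis unfolding c_def lin_def by (simp add: sum_distrib_left algebra_simps)
    qed
    let ?V = "\<lambda>t. expectation (\<lambda>\<omega>. (lin (\<lambda>j. a j + t * ?e j) \<omega>)\<^sup>2)"
    have DV: "(?V has_real_derivative 2 * c) (at 0)"
      using expectation_power_deriv[OF all_moments_const[of 1] all_moments_lin[of a] all_moments_Z[OF i], of 2]
      unfolding lin_add lin_single[OF i] c by simp
    have V0: "?V 0 = expectation (\<lambda>\<omega>. (lin a \<omega>)\<^sup>2)" by simp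
    have DVp: "((\<lambda>t. K * ?V t ^ (k + 1)) has_real_derivative K * (real (k + 1) * (2 * c * ?V 0 ^ k))) (at 0)" for K
      using DERIV_cmult[OF DERIV_power[OF DV, of "k + 1"], of K] by simp
    have "((\<lambda>t. expectation (\<lambda>\<omega>. lin (\<lambda>j. a j + t * ?e j) \<omega> ^ Suc n)) has_real_derivative
      fact (2 * (k + 1)) / (2 ^ (k + 1) * fact (k + 1)) * (real (k + 1) * (2 * c * ?V 0 ^ k))) (at 0)"
    proof -
      have "Suc n = 2 * (k + 1)" using k by simp
      then show ?thesis unfolding lin_moment_even using DVp by (simp only: lin_moment_even)
    qed
    from DERIV_unique[OF D this]
    have "real (2 * k + 2) * expectation (\<lambda>\<omega>. Z i \<omega> * lin a \<omega> ^ n) =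
       fact (2 * (k + 1)) / (2 ^ (k + 1) * fact (k + 1)) * (real (k + 1) * (2 * c * expectation (\<lambda>\<omega>. (lin a \<omega>)\<^sup>2) ^ k))"
      unfolding V0 k by simp
    also have "\<dots> = real (2 * k + 2) * (real n * c * (fact (2 * k) / (2 ^ k * fact k) * expectation (\<lambda>\<omega>. (lin a \<omega>)\<^sup>2) ^ k))"
    proof -
      have al: "(2 * q * n' * f) / ((2 * p) * (q * g)) * (q * (2 * c * x)) = 2 * q * (n' * c * (f / (p * g) * x))"
        if "q \<noteq> 0" "p \<noteq> 0" "g \<noteq> 0" for q n' f p g x :: real
        using that by (simp add: field_simps)
      have 2: "2 ^ (k + 1) * fact (k + 1) = ((2 * 2 ^ k) * (real (k + 1) * fact k) :: real)" by simp
      have 3: "fact (2 * (k + 1)) = (2 * real (k + 1) * real (2 * k + 1) * fact (2 * k) :: real)"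
        by (simp add: algebra_simps)
      have 4: "real (2 * k + 2) = 2 * real (k + 1)" by simp
      show ?thesis unfolding k 2 3 4 by (rule al) simp_all
    qed
    finally show ?thesis unfolding c_def[symmetric] lin_moment_even[symmetric] k by simp
  qed
qed

text \<open>\<open>poly_grad F D\<close>: \<open>F\<close> is a polynomial in the variables \<open>Z j\<close>, and \<open>D\<close> is its gradient.\<close>

inductive poly_grad :: "('a \<Rightarrow> real) \<Rightarrow> ('j \<Rightarrow> 'a \<Rightarrow> real) \<Rightarrow> bool" where
  pg_const: "poly_grad (\<lambda>_. c) (\<lambda>_ _. 0)"
| pg_add: "poly_grad F D \<Longrightarrow> poly_grad F' D' \<Longrightarrow> poly_grad (\<lambda>\<omega>. F \<omega> + F' \<omega>) (\<lambda>j \<omega>. D j \<omega> + D' j \<omega>)"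
| pg_mult: "poly_grad F D \<Longrightarrow> m \<in> J \<Longrightarrow> poly_grad (\<lambda>\<omega>. Z m \<omega> * F \<omega>) (\<lambda>j \<omega>. Z m \<omega> * D j \<omega> + (if j = m then F \<omega> else 0))"

lemma poly_grad_moments:
  assumes "poly_grad F D" shows "all_moments M F \<and> (\<forall>j. all_moments M (D j))"
  using assms
proof (induction rule: poly_grad.induct)
  case (pg_mult F D m)
  have "all_moments M (\<lambda>\<omega>. Z m \<omega> * D j \<omega> + (if j = m then F \<omega> else 0))" for j
    using pg_mult by (cases "j = m") (auto intro!: all_moments_intros all_moments_Z)
  then show ?case using pg_mult by (auto intro!: all_moments_intros all_moments_Z)
qed (auto intro!: all_moments_intros)

lemma poly_grad_cong: "poly_grad F D \<Longrightarrow> (\<And>\<omega>. F \<omega> = F' \<omega>) \<Longrightarrow> (\<And>j \<omega>. D j \<omega> = D' j \<omega>) \<Longrightarrow> poly_grad F' D'"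
  by (metis ext)

text \<open>Stein's identity with an additional power of a linear combination. The power drives the
  induction: a new factor \<open>Z m\<close> is produced by differentiating the statement for F,
  with exponent n + 1, in the direction of \<open>Z m\<close>.\<close>

lemma stein_aux:
  assumes "poly_grad F D" and i: "i \<in> J"
  shows "expectation (\<lambda>\<omega>. Z i \<omega> * F \<omega> * lin a \<omega> ^ n) =
     (\<Sum>j\<in>J. cov i j * expectation (\<lambda>\<omega>. D j \<omega> * lin a \<omega> ^ n))
     + real n * (\<Sum>j\<in>J. a j * cov i j) * expectation (\<lambda>\<omega>. F \<omega> * lin a \<omega> ^ (n - 1))"
  using assms(1)
proof (induction arbitrary: a n rule: poly_grad.induct)
  case (pg_const c)
  then show ?case using lin_power_stein[OF i, of a n]
    by (simp add: algebra_simps)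
next
  case (pg_add F D F' D')
  note m = poly_grad_moments[OF pg_add.hyps(1)] poly_grad_moments[OF pg_add.hyps(2)]
  have I: "integrable M (\<lambda>\<omega>. Z i \<omega> * F \<omega> * lin a \<omega> ^ n)" "integrable M (\<lambda>\<omega>. Z i \<omega> * F' \<omega> * lin a \<omega> ^ n)"
    "integrable M (\<lambda>\<omega>. F \<omega> * lin a \<omega> ^ k)" "integrable M (\<lambda>\<omega>. F' \<omega> * lin a \<omega> ^ k)"
    "integrable M (\<lambda>\<omega>. D j \<omega> * lin a \<omega> ^ n)" "integrable M (\<lambda>\<omega>. D' j \<omega> * lin a \<omega> ^ n)" for k j
    using m i by (auto intro!: all_moments_integrable all_moments_intros all_moments_Z all_moments_lin)
  have "expectation (\<lambda>\<omega>. Z i \<omega> * (F \<omega> + F' \<omega>) * lin a \<omega> ^ n)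
     = expectation (\<lambda>\<omega>. Z i \<omega> * F \<omega> * lin a \<omega> ^ n) + expectation (\<lambda>\<omega>. Z i \<omega> * F' \<omega> * lin a \<omega> ^ n)"
    by (subst Bochner_Integration.integral_add[OF I(1,2), symmetric]) (simp add: algebra_simps)
  then show ?case unfolding pg_add.IH distrib_right
    by (simp add: I sum.distrib distrib_left algebra_simps)
next
  case (pg_mult F D m)
  note mom = poly_grad_moments[OF pg_mult.hyps(1)]
  note AM = all_moments_intros all_moments_Z all_moments_lin i pg_mult.hyps(2) mom[THEN conjunct1] mom[THEN conjunct2, rule_format]
  let ?e = "\<lambda>j. if j = m then 1 else (0::real)"
  have lt: "lin (\<lambda>j. a j + t * ?e j) \<omega> = lin a \<omega> + t * Z m \<omega>" for t \<omega>
    unfolding lin_add lin_single[OF pg_mult.hyps(2)] ..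
  have ct: "(\<Sum>j\<in>J. (a j + t * ?e j) * cov i j) = (\<Sum>j\<in>J. a j * cov i j) + t * cov i m" for t
  proof -
    have "(\<Sum>j\<in>J. (a j + t * ?e j) * cov i j) = (\<Sum>j\<in>J. a j * cov i j) + (\<Sum>j\<in>J. if j = m then t * cov i m else 0)"
      unfolding sum.distrib[symmetric] by (intro sum.cong refl) (auto simp: algebra_simps)
    then show ?thesis using finite_J pg_mult.hyps(2) by simp
  qed
  obtain S where S: "(\<Sum>j\<in>J. a j * cov i j) = S" by simp
  \<comment> \<open>The induction hypothesis along the line from \<open>a\<close> in direction
    \<open>m\<close>, at exponent \<open>Suc n\<close>. Its derivative at t = 0 is
    \<open>Suc n\<close> times the claim.\<close>
  have eq: "expectation (\<lambda>\<omega>. (Z i \<omega> * F \<omega>) * (lin a \<omega> + t * Z m \<omega>) ^ Suc n)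
     = (\<Sum>j\<in>J. cov i j * expectation (\<lambda>\<omega>. D j \<omega> * (lin a \<omega> + t * Z m \<omega>) ^ Suc n))
     + real (Suc n) * (S + t * cov i m) * expectation (\<lambda>\<omega>. F \<omega> * (lin a \<omega> + t * Z m \<omega>) ^ n)" for t
    using pg_mult.IH[of "\<lambda>j. a j + t * ?e j" "Suc n"] unfolding lt ct S by simp
  have D1: "((\<lambda>t. expectation (\<lambda>\<omega>. (Z i \<omega> * F \<omega>) * (lin a \<omega> + t * Z m \<omega>) ^ Suc n)) has_real_derivative
    real (Suc n) * expectation (\<lambda>\<omega>. (Z i \<omega> * F \<omega>) * (Z m \<omega> * lin a \<omega> ^ n))) (at 0)"
    using expectation_power_deriv[of "\<lambda>\<omega>. Z i \<omega> * F \<omega>" "lin a" "Z m" "Suc n"] by (simp add: AM)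
  have D2: "((\<lambda>t. expectation (\<lambda>\<omega>. D j \<omega> * (lin a \<omega> + t * Z m \<omega>) ^ Suc n)) has_real_derivative
    real (Suc n) * expectation (\<lambda>\<omega>. D j \<omega> * (Z m \<omega> * lin a \<omega> ^ n))) (at 0)" for j
    using expectation_power_deriv[of "D j" "lin a" "Z m" "Suc n"] by (simp add: AM)
  have D3: "((\<lambda>t. expectation (\<lambda>\<omega>. F \<omega> * (lin a \<omega> + t * Z m \<omega>) ^ n)) has_real_derivative
    real n * expectation (\<lambda>\<omega>. F \<omega> * (Z m \<omega> * lin a \<omega> ^ (n - 1)))) (at 0)"
    using expectation_power_deriv[of F "lin a" "Z m" n] by (simp add: AM)
  have "((\<lambda>t. (\<Sum>j\<in>J. cov i j * expectation (\<lambda>\<omega>. D j \<omega> * (lin a \<omega> + t * Z m \<omega>) ^ Suc n))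
     + real (Suc n) * (S + t * cov i m) * expectation (\<lambda>\<omega>. F \<omega> * (lin a \<omega> + t * Z m \<omega>) ^ n)) has_real_derivative
     ((\<Sum>j\<in>J. cov i j * (real (Suc n) * expectation (\<lambda>\<omega>. D j \<omega> * (Z m \<omega> * lin a \<omega> ^ n))))
     + ((real (Suc n) * cov i m) * expectation (\<lambda>\<omega>. F \<omega> * (lin a \<omega> + 0 * Z m \<omega>) ^ n)
       + real n * expectation (\<lambda>\<omega>. F \<omega> * (Z m \<omega> * lin a \<omega> ^ (n - 1))) * (real (Suc n) * (S + 0 * cov i m))))) (at 0)"
    by (intro DERIV_add DERIV_sum DERIV_cmult D2 DERIV_mult D3) (auto intro!: derivative_eq_intros)
  then have "((\<lambda>t. expectation (\<lambda>\<omega>. (Z i \<omega> * F \<omega>) * (lin a \<omega> + t * Z m \<omega>) ^ Suc n)) has_real_derivative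
     ((\<Sum>j\<in>J. cov i j * (real (Suc n) * expectation (\<lambda>\<omega>. D j \<omega> * (Z m \<omega> * lin a \<omega> ^ n))))
     + ((real (Suc n) * cov i m) * expectation (\<lambda>\<omega>. F \<omega> * (lin a \<omega> + 0 * Z m \<omega>) ^ n)
       + real n * expectation (\<lambda>\<omega>. F \<omega> * (Z m \<omega> * lin a \<omega> ^ (n - 1))) * (real (Suc n) * (S + 0 * cov i m))))) (at 0)"
    unfolding eq[symmetric] .
  from DERIV_unique[OF D1 this]
  have "real (Suc n) * expectation (\<lambda>\<omega>. (Z i \<omega> * F \<omega>) * (Z m \<omega> * lin a \<omega> ^ n))
    = real (Suc n) * ((\<Sum>j\<in>J. cov i j * expectation (\<lambda>\<omega>. D j \<omega> * (Z m \<omega> * lin a \<omega> ^ n)))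
       + cov i m * expectation (\<lambda>\<omega>. F \<omega> * lin a \<omega> ^ n)
       + real n * S * expectation (\<lambda>\<omega>. F \<omega> * (Z m \<omega> * lin a \<omega> ^ (n - 1))))"
    by (simp add: sum_distrib_left algebra_simps)
  then have main: "expectation (\<lambda>\<omega>. (Z i \<omega> * F \<omega>) * (Z m \<omega> * lin a \<omega> ^ n))
    = (\<Sum>j\<in>J. cov i j * expectation (\<lambda>\<omega>. D j \<omega> * (Z m \<omega> * lin a \<omega> ^ n)))
       + cov i m * expectation (\<lambda>\<omega>. F \<omega> * lin a \<omega> ^ n)
       + real n * S * expectation (\<lambda>\<omega>. F \<omega> * (Z m \<omega> * lin a \<omega> ^ (n - 1)))"
    by (subst (asm) mult_cancel_left) simp
  have "(\<Sum>j\<in>J. cov i j * expectation (\<lambda>\<omega>. (Z m \<omega> * D j \<omega> + (if j = m then F \<omega> else 0)) * lin a \<omega> ^ n))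
     = (\<Sum>j\<in>J. cov i j * expectation (\<lambda>\<omega>. D j \<omega> * (Z m \<omega> * lin a \<omega> ^ n)) + (if j = m then cov i m * expectation (\<lambda>\<omega>. F \<omega> * lin a \<omega> ^ n) else 0))"
  proof (intro sum.cong refl)
    fix j
    have "integrable M (\<lambda>\<omega>. D j \<omega> * (Z m \<omega> * lin a \<omega> ^ n))" "integrable M (\<lambda>\<omega>. F \<omega> * lin a \<omega> ^ n)"
      by (intro all_moments_integrable AM)+
    then show "cov i j * expectation (\<lambda>\<omega>. (Z m \<omega> * D j \<omega> + (if j = m then F \<omega> else 0)) * lin a \<omega> ^ n)
      = cov i j * expectation (\<lambda>\<omega>. D j \<omega> * (Z m \<omega> * lin a \<omega> ^ n)) + (if j = m then cov i m * expectation (\<lambda>\<omega>. F \<omega> * lin a \<omega> ^ n) else 0)"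
      by (cases "j = m") (simp_all add: distrib_right distrib_left ac_simps)
  qed
  also have "\<dots> = (\<Sum>j\<in>J. cov i j * expectation (\<lambda>\<omega>. D j \<omega> * (Z m \<omega> * lin a \<omega> ^ n))) + cov i m * expectation (\<lambda>\<omega>. F \<omega> * lin a \<omega> ^ n)"
    using finite_J pg_mult.hyps(2) by (simp add: sum.distrib)
  finally show ?case using main unfolding S by (simp add: ac_simps)
qed

lemma stein:
  assumes "poly_grad F D" "i \<in> J"
  shows "expectation (\<lambda>\<omega>. Z i \<omega> * F \<omega>) = (\<Sum>j\<in>J. cov i j * expectation (D j))"
  using stein_aux[OF assms, of "\<lambda>_. 0" 0] by simp

lemma poly_grad_scale: "poly_grad F D \<Longrightarrow> poly_grad (\<lambda>\<omega>. c * F \<omega>) (\<lambda>j \<omega>. c * D j \<omega>)"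
proof (induction rule: poly_grad.induct)
  case (pg_const d) show ?case using poly_grad.pg_const[of "c * d"] by simp
next
  case (pg_add F D F' D') then show ?case using poly_grad.pg_add by (simp add: distrib_left)
next
  case (pg_mult F D m)
  from poly_grad.pg_mult[OF pg_mult.IH pg_mult.hyps(2)] show ?case
    by (rule poly_grad_cong) (auto simp: algebra_simps)
qed

lemma poly_grad_mult:
  assumes "poly_grad F D" "poly_grad F' D'"
  shows "poly_grad (\<lambda>\<omega>. F \<omega> * F' \<omega>) (\<lambda>j \<omega>. D j \<omega> * F' \<omega> + F \<omega> * D' j \<omega>)"
  using assms(1)
proof (induction rule: poly_grad.induct)
  case (pg_const c) from poly_grad_scale[OF assms(2), of c] show ?case by simp
next
  case (pg_add F D G E) from poly_grad.pg_add[OF pg_add.IH] show ?case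
    by (rule poly_grad_cong) (auto simp: algebra_simps)
next
  case (pg_mult F D m)
  from poly_grad.pg_mult[OF pg_mult.IH pg_mult.hyps(2)] show ?case
    by (rule poly_grad_cong) (auto simp: algebra_simps)
qed

lemma poly_grad_hermite:
  assumes m: "m \<in> J"
  shows "poly_grad (\<lambda>\<omega>. hermite n (Z m \<omega>)) (\<lambda>j \<omega>. if j = m then real n * hermite (n - 1) (Z m \<omega>) else 0)"
proof (induction n rule: less_induct)
  case (less n)
  show ?case
  proof (cases n)
    case 0
    from pg_const[of 1] show ?thesis unfolding 0 by (rule poly_grad_cong) auto
  next
    case (Suc k)
    show ?thesis
    proof (cases k)
      case 0
      from pg_mult[OF pg_const[of 1] m] show ?thesis unfolding Suc 0 by (rule poly_grad_cong) auto
    next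
      case (Suc l)
      have "poly_grad (\<lambda>\<omega>. hermite k (Z m \<omega>)) (\<lambda>j \<omega>. if j = m then real k * hermite (k - 1) (Z m \<omega>) else 0)"
        "poly_grad (\<lambda>\<omega>. hermite l (Z m \<omega>)) (\<lambda>j \<omega>. if j = m then real l * hermite (l - 1) (Z m \<omega>) else 0)"
        using less Suc \<open>n = Suc k\<close> by auto
      from pg_add[OF pg_mult[OF this(1) m] poly_grad_scale[OF this(2), of "- real k"]]
      show ?thesis unfolding \<open>n = Suc k\<close> Suc
        by (rule poly_grad_cong) (auto simp: hermite_Suc[of l] algebra_simps)
    qed
  qed
qed

end

text \<open>The multigraphs on four vertices with degrees \<open>k, l, m, n\<close>, given by their numbers of edges
  12, 13, 14, 23, 24, 34.\<close>

definition wick_edges :: "nat \<Rightarrow> nat \<Rightarrow> nat \<Rightarrow> nat \<Rightarrow> (nat \<times> nat \<times> nat \<times> nat \<times> nat \<times> nat) set" where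
  "wick_edges k l m n = {(a, b, c, d, e, f). a + b + c = k \<and> a + d + e = l \<and> b + d + f = m \<and> c + e + f = n}"

lemma finite_wick_edges: "finite (wick_edges k l m n)"
proof (rule finite_subset)
  show "wick_edges k l m n \<subseteq> {..k} \<times> {..k} \<times> {..k} \<times> {..l} \<times> {..l} \<times> {..m}"
    by (auto simp: wick_edges_def)
qed simp

text \<open>The weight of \<open>a\<close> parallel edges; the factorial accounts for their
  permutations.\<close>

definition exp_term :: "real \<Rightarrow> nat \<Rightarrow> real" where
  "exp_term r a = r ^ a / fact a"

lemma exp_term_Suc: "(1 + real a) * exp_term r (Suc a) = r * exp_term r a"
proof -
  have "fact (Suc a) = (1 + real a) * (fact a :: real)" "1 + real a \<noteq> 0" by simp_all
  then show ?thesis unfolding exp_term_def by simp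
qed

lemma exp_term_0[simp]: "exp_term r 0 = 1"
  by (simp add: exp_term_def)

text \<open>Removal of one edge. Graphs without such an edge carry the factor 0, the others arise
  from a smaller graph by adding one, and the multiplicity lowers the divided power.\<close>

lemma sum_shift_edge:
  fixes w :: "'t \<Rightarrow> real"
  assumes "finite E" "inj_on inc E'" "\<And>t. t \<in> E' \<Longrightarrow> inc t \<in> E"
    and "\<And>t. t \<in> E \<Longrightarrow> cnt t \<noteq> 0 \<Longrightarrow> t \<in> inc ` E'"
    and "\<And>t. t \<in> E' \<Longrightarrow> real (cnt (inc t)) * w (inc t) = r * w t"
  shows "(\<Sum>t\<in>E. real (cnt t) * w t) = r * (\<Sum>t\<in>E'. w t)"
proof -
  have "(\<Sum>t\<in>E. real (cnt t) * w t) = (\<Sum>t\<in>inc ` E'. real (cnt t) * w t)"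
    using assms by (intro sum.mono_neutral_right) auto
  also have "\<dots> = (\<Sum>t\<in>E'. real (cnt (inc t)) * w (inc t))"
    by (simp add: sum.reindex[OF assms(2)])
  also have "\<dots> = r * (\<Sum>t\<in>E'. w t)"
    unfolding sum_distrib_left using assms(5) by (rule sum.cong[OF refl])
  finally show ?thesis .
qed

locale wick_weights =
  fixes r1 r2 r3 r4 r5 r6 :: real
begin

definition wt :: "nat \<times> nat \<times> nat \<times> nat \<times> nat \<times> nat \<Rightarrow> real" where
  "wt = (\<lambda>(a, b, c, d, e, f). exp_term r1 a * exp_term r2 b * exp_term r3 c * exp_term r4 d * exp_term r5 e * exp_term r6 f)"

text \<open>The coefficient of x1^k x2^l x3^m x4^n in exp (r1 x1 x2 + r2 x1 x3 + r3 x1 x4 + r4 x2 x3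
  + r5 x2 x4 + r6 x3 x4).\<close>

definition W :: "nat \<Rightarrow> nat \<Rightarrow> nat \<Rightarrow> nat \<Rightarrow> real" where
  "W k l m n = (\<Sum>t\<in>wick_edges k l m n. wt t)"

lemma W_0: "W 0 0 0 n = (if n = 0 then 1 else 0)"
proof -
  have "wick_edges 0 0 0 n = (if n = 0 then {(0,0,0,0,0,0)} else {})"
    by (auto simp: wick_edges_def)
  then show ?thesis by (simp add: W_def wt_def)
qed



lemma shift_a:
  "(\<Sum>t\<in>wick_edges (Suc k) (Suc l) m n. real (case t of (a,b,c,d,e,f) \<Rightarrow> a) * wt t) = r1 * W k l m n"
  unfolding W_def
proof (rule sum_shift_edge[OF finite_wick_edges, where inc = "\<lambda>(a,b,c,d,e,f). (Suc a,b,c,d,e,f)"])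
  fix t assume "t \<in> wick_edges (Suc k) (Suc l) m n" "(case t of (a,b,c,d,e,f) \<Rightarrow> a) \<noteq> 0"
  then show "t \<in> (\<lambda>(a,b,c,d,e,f). (Suc a,b,c,d,e,f)) ` wick_edges k l m n"
    by (intro image_eqI[of _ _ "case t of (a,b,c,d,e,f) \<Rightarrow> (a - 1,b,c,d,e,f)"]) (auto simp: wick_edges_def)
qed (auto simp: wick_edges_def wt_def inj_on_def exp_term_Suc ac_simps)

lemma shift_a_0: "(\<Sum>t\<in>wick_edges (Suc k) 0 m n. real (case t of (a,b,c,d,e,f) \<Rightarrow> a) * wt t) = 0"
  by (rule sum.neutral) (auto simp: wick_edges_def)

lemma shift_b:
  "(\<Sum>t\<in>wick_edges (Suc k) l (Suc m) n. real (case t of (a,b,c,d,e,f) \<Rightarrow> b) * wt t) = r2 * W k l m n"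
  unfolding W_def
proof (rule sum_shift_edge[OF finite_wick_edges, where inc = "\<lambda>(a,b,c,d,e,f). (a,Suc b,c,d,e,f)"])
  fix t assume "t \<in> wick_edges (Suc k) l (Suc m) n" "(case t of (a,b,c,d,e,f) \<Rightarrow> b) \<noteq> 0"
  then show "t \<in> (\<lambda>(a,b,c,d,e,f). (a,Suc b,c,d,e,f)) ` wick_edges k l m n"
    by (intro image_eqI[of _ _ "case t of (a,b,c,d,e,f) \<Rightarrow> (a,b - 1,c,d,e,f)"]) (auto simp: wick_edges_def)
qed (auto simp: wick_edges_def wt_def inj_on_def exp_term_Suc ac_simps)

lemma shift_b_0: "(\<Sum>t\<in>wick_edges (Suc k) l 0 n. real (case t of (a,b,c,d,e,f) \<Rightarrow> b) * wt t) = 0"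
  by (rule sum.neutral) (auto simp: wick_edges_def)

lemma shift_c:
  "(\<Sum>t\<in>wick_edges (Suc k) l m (Suc n). real (case t of (a,b,c,d,e,f) \<Rightarrow> c) * wt t) = r3 * W k l m n"
  unfolding W_def
proof (rule sum_shift_edge[OF finite_wick_edges, where inc = "\<lambda>(a,b,c,d,e,f). (a,b,Suc c,d,e,f)"])
  fix t assume "t \<in> wick_edges (Suc k) l m (Suc n)" "(case t of (a,b,c,d,e,f) \<Rightarrow> c) \<noteq> 0"
  then show "t \<in> (\<lambda>(a,b,c,d,e,f). (a,b,Suc c,d,e,f)) ` wick_edges k l m n"
    by (intro image_eqI[of _ _ "case t of (a,b,c,d,e,f) \<Rightarrow> (a,b,c - 1,d,e,f)"]) (auto simp: wick_edges_def)
qed (auto simp: wick_edges_def wt_def inj_on_def exp_term_Suc ac_simps)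

lemma shift_c_0: "(\<Sum>t\<in>wick_edges (Suc k) l m 0. real (case t of (a,b,c,d,e,f) \<Rightarrow> c) * wt t) = 0"
  by (rule sum.neutral) (auto simp: wick_edges_def)

lemma shift_d:
  "(\<Sum>t\<in>wick_edges 0 (Suc l) (Suc m) n. real (case t of (a,b,c,d,e,f) \<Rightarrow> d) * wt t) = r4 * W 0 l m n"
  unfolding W_def
proof (rule sum_shift_edge[OF finite_wick_edges, where inc = "\<lambda>(a,b,c,d,e,f). (a,b,c,Suc d,e,f)"])
  fix t assume "t \<in> wick_edges 0 (Suc l) (Suc m) n" "(case t of (a,b,c,d,e,f) \<Rightarrow> d) \<noteq> 0"
  then show "t \<in> (\<lambda>(a,b,c,d,e,f). (a,b,c,Suc d,e,f)) ` wick_edges 0 l m n"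
    by (intro image_eqI[of _ _ "case t of (a,b,c,d,e,f) \<Rightarrow> (a,b,c,d - 1,e,f)"]) (auto simp: wick_edges_def)
qed (auto simp: wick_edges_def wt_def inj_on_def exp_term_Suc ac_simps)

lemma shift_d_0: "(\<Sum>t\<in>wick_edges 0 (Suc l) 0 n. real (case t of (a,b,c,d,e,f) \<Rightarrow> d) * wt t) = 0"
  by (rule sum.neutral) (auto simp: wick_edges_def)

lemma shift_e:
  "(\<Sum>t\<in>wick_edges 0 (Suc l) m (Suc n). real (case t of (a,b,c,d,e,f) \<Rightarrow> e) * wt t) = r5 * W 0 l m n"
  unfolding W_def
proof (rule sum_shift_edge[OF finite_wick_edges, where inc = "\<lambda>(a,b,c,d,e,f). (a,b,c,d,Suc e,f)"])
  fix t assume "t \<in> wick_edges 0 (Suc l) m (Suc n)" "(case t of (a,b,c,d,e,f) \<Rightarrow> e) \<noteq> 0"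
  then show "t \<in> (\<lambda>(a,b,c,d,e,f). (a,b,c,d,Suc e,f)) ` wick_edges 0 l m n"
    by (intro image_eqI[of _ _ "case t of (a,b,c,d,e,f) \<Rightarrow> (a,b,c,d,e - 1,f)"]) (auto simp: wick_edges_def)
qed (auto simp: wick_edges_def wt_def inj_on_def exp_term_Suc ac_simps)

lemma shift_e_0: "(\<Sum>t\<in>wick_edges 0 (Suc l) m 0. real (case t of (a,b,c,d,e,f) \<Rightarrow> e) * wt t) = 0"
  by (rule sum.neutral) (auto simp: wick_edges_def)

lemma shift_f:
  "(\<Sum>t\<in>wick_edges 0 0 (Suc m) (Suc n). real (case t of (a,b,c,d,e,f) \<Rightarrow> f) * wt t) = r6 * W 0 0 m n"
  unfolding W_def
proof (rule sum_shift_edge[OF finite_wick_edges, where inc = "\<lambda>(a,b,c,d,e,f). (a,b,c,d,e,Suc f)"])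
  fix t assume "t \<in> wick_edges 0 0 (Suc m) (Suc n)" "(case t of (a,b,c,d,e,f) \<Rightarrow> f) \<noteq> 0"
  then show "t \<in> (\<lambda>(a,b,c,d,e,f). (a,b,c,d,e,Suc f)) ` wick_edges 0 0 m n"
    by (intro image_eqI[of _ _ "case t of (a,b,c,d,e,f) \<Rightarrow> (a,b,c,d,e,f - 1)"]) (auto simp: wick_edges_def)
qed (auto simp: wick_edges_def wt_def inj_on_def exp_term_Suc ac_simps)

lemma shift_f_0: "(\<Sum>t\<in>wick_edges 0 0 (Suc m) 0. real (case t of (a,b,c,d,e,f) \<Rightarrow> f) * wt t) = 0"
  by (rule sum.neutral) (auto simp: wick_edges_def)

text \<open>The multiplicities of the edges at the first vertex add up to \<open>Suc k\<close>, and
  weighting by one of them removes an edge of that kind. A neighbour of degree 0 is treated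
  separately because truncated subtraction would leave a spurious term.\<close>

lemma W_vertex_1:
  "real (Suc k) * W (Suc k) l m n = (if l = 0 then 0 else r1 * W k (l - 1) m n)
     + (if m = 0 then 0 else r2 * W k l (m - 1) n) + (if n = 0 then 0 else r3 * W k l m (n - 1))"
proof -
  have "real (Suc k) * W (Suc k) l m n =
     (\<Sum>t\<in>wick_edges (Suc k) l m n. real (case t of (a,b,c,d,e,f) \<Rightarrow> a) * wt t)
   + (\<Sum>t\<in>wick_edges (Suc k) l m n. real (case t of (a,b,c,d,e,f) \<Rightarrow> b) * wt t)
   + (\<Sum>t\<in>wick_edges (Suc k) l m n. real (case t of (a,b,c,d,e,f) \<Rightarrow> c) * wt t)"
    unfolding W_def sum_distrib_left sum.distrib[symmetric]
    by (intro sum.cong refl) (auto simp: wick_edges_def distrib_right[symmetric] simp flip: of_nat_add)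
  also have "(\<Sum>t\<in>wick_edges (Suc k) l m n. real (case t of (a,b,c,d,e,f) \<Rightarrow> a) * wt t)
     = (if l = 0 then 0 else r1 * W k (l - 1) m n)"
    by (cases l, simp only: shift_a_0 if_True simp_thms, simp only: shift_a nat.distinct if_False diff_Suc_1)
  also have "(\<Sum>t\<in>wick_edges (Suc k) l m n. real (case t of (a,b,c,d,e,f) \<Rightarrow> b) * wt t)
     = (if m = 0 then 0 else r2 * W k l (m - 1) n)"
    by (cases m, simp only: shift_b_0 if_True simp_thms, simp only: shift_b nat.distinct if_False diff_Suc_1)
  also have "(\<Sum>t\<in>wick_edges (Suc k) l m n. real (case t of (a,b,c,d,e,f) \<Rightarrow> c) * wt t)
     = (if n = 0 then 0 else r3 * W k l m (n - 1))"
    by (cases n, simp only: shift_c_0 if_True simp_thms, simp only: shift_c nat.distinct if_False diff_Suc_1)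
  finally show ?thesis .
qed

lemma W_vertex_2:
  "real (Suc l) * W 0 (Suc l) m n = (if m = 0 then 0 else r4 * W 0 l (m - 1) n) + (if n = 0 then 0 else r5 * W 0 l m (n - 1))"
proof -
  have "real (Suc l) * W 0 (Suc l) m n =
     (\<Sum>t\<in>wick_edges 0 (Suc l) m n. real (case t of (a,b,c,d,e,f) \<Rightarrow> d) * wt t)
   + (\<Sum>t\<in>wick_edges 0 (Suc l) m n. real (case t of (a,b,c,d,e,f) \<Rightarrow> e) * wt t)"
    unfolding W_def sum_distrib_left sum.distrib[symmetric]
    by (intro sum.cong refl) (auto simp: wick_edges_def distrib_right[symmetric] simp flip: of_nat_add)
  also have "(\<Sum>t\<in>wick_edges 0 (Suc l) m n. real (case t of (a,b,c,d,e,f) \<Rightarrow> d) * wt t)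
     = (if m = 0 then 0 else r4 * W 0 l (m - 1) n)"
    by (cases m, simp only: shift_d_0 if_True simp_thms, simp only: shift_d nat.distinct if_False diff_Suc_1)
  also have "(\<Sum>t\<in>wick_edges 0 (Suc l) m n. real (case t of (a,b,c,d,e,f) \<Rightarrow> e) * wt t)
     = (if n = 0 then 0 else r5 * W 0 l m (n - 1))"
    by (cases n, simp only: shift_e_0 if_True simp_thms, simp only: shift_e nat.distinct if_False diff_Suc_1)
  finally show ?thesis .
qed

lemma W_vertex_3:
  "real (Suc m) * W 0 0 (Suc m) n = (if n = 0 then 0 else r6 * W 0 0 m (n - 1))"
proof -
  have "real (Suc m) * W 0 0 (Suc m) n =
     (\<Sum>t\<in>wick_edges 0 0 (Suc m) n. real (case t of (a,b,c,d,e,f) \<Rightarrow> f) * wt t)"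
    unfolding W_def sum_distrib_left
    by (intro sum.cong refl) (auto simp: wick_edges_def)
  also have "\<dots> = (if n = 0 then 0 else r6 * W 0 0 m (n - 1))"
    by (cases n, simp only: shift_f_0 if_True simp_thms, simp only: shift_f nat.distinct if_False diff_Suc_1)
  finally show ?thesis .
qed

text \<open>Adding the degree conditions of two vertices and subtracting those of the other two
  shows that opposite edges have the same multiplicity, so two parameters remain.\<close>

lemma wick_edges_diag:
  "(a, b, c, d, e, f) \<in> wick_edges q q q q \<Longrightarrow> c = q - a - b \<and> d = q - a - b \<and> e = b \<and> f = a \<and> a + b \<le> q"
  by (auto simp: wick_edges_def)

lemma W_diag:
  "W q q q q = (\<Sum>(a, b)\<in>{(a, b). a + b \<le> q}. (exp_term r1 a * exp_term r6 a) *
     (exp_term r2 b * exp_term r5 b) * (exp_term r3 (q - a - b) * exp_term r4 (q - a - b)))"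
proof -
  let ?i = "\<lambda>(a, b). (a, b, q - a - b, q - a - b, b, a)"
  have "wick_edges q q q q = ?i ` {(a, b). a + b \<le> q}"
  proof (intro equalityI subsetI)
    fix t assume "t \<in> wick_edges q q q q"
    then show "t \<in> ?i ` {(a, b). a + b \<le> q}"
      by (cases t) (auto dest!: wick_edges_diag simp: image_iff)
  qed (auto simp: wick_edges_def)
  moreover have "inj_on ?i {(a, b). a + b \<le> q}" by (auto simp: inj_on_def)
  ultimately show ?thesis
    unfolding W_def by (simp add: sum.reindex) (intro sum.cong refl, auto simp: wt_def)
qed

lemma W_two: "W k l 0 0 = (if k = l then exp_term r1 k else 0)"
proof -
  have "wick_edges k l 0 0 = (if k = l then {(k,0,0,0,0,0)} else {})"
    by (auto simp: wick_edges_def)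
  then show ?thesis by (simp add: W_def wt_def)
qed

end

locale gaussian_four = gaussian_family M "{..<4::nat}" Z for M :: "'a measure" and Z +
  assumes unit: "\<And>i. i < 4 \<Longrightarrow> cov i i = 1"
begin

sublocale wick_weights "cov 0 1" "cov 0 2" "cov 0 3" "cov 1 2" "cov 1 3" "cov 2 3" .

definition h4 :: "nat \<Rightarrow> nat \<Rightarrow> nat \<Rightarrow> nat \<Rightarrow> 'a \<Rightarrow> real" where
  "h4 k l m n \<omega> = hermite k (Z 0 \<omega>) * (hermite l (Z 1 \<omega>) * (hermite m (Z 2 \<omega>) * hermite n (Z 3 \<omega>)))"

definition H4 :: "nat \<Rightarrow> nat \<Rightarrow> nat \<Rightarrow> nat \<Rightarrow> real" where
  "H4 k l m n = expectation (h4 k l m n)"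

lemma poly_grad_h4:
  "poly_grad (h4 k l m n) (\<lambda>j \<omega>. (if j = 0 then real k * h4 (k - 1) l m n \<omega> else 0) + (if j = 1 then real l * h4 k (l - 1) m n \<omega> else 0)
     + (if j = 2 then real m * h4 k l (m - 1) n \<omega> else 0) + (if j = 3 then real n * h4 k l m (n - 1) \<omega> else 0))"
  using poly_grad_mult[OF poly_grad_hermite[of 0 k] poly_grad_mult[OF poly_grad_hermite[of 1 l] poly_grad_mult[OF poly_grad_hermite[of 2 m] poly_grad_hermite[of 3 n]]]]
  by (rule poly_grad_cong) (auto simp: h4_def algebra_simps)

lemma integrable_h4: "integrable M (h4 k l m n)"
  using poly_grad_moments[OF poly_grad_h4] all_moments_integrable by blast

lemma stein_h4:
  assumes "i < 4"
  shows "expectation (\<lambda>\<omega>. Z i \<omega> * h4 k l m n \<omega>) = cov i 0 * (real k * H4 (k - 1) l m n) + cov i 1 * (real l * H4 k (l - 1) m n)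
    + cov i 2 * (real m * H4 k l (m - 1) n) + cov i 3 * (real n * H4 k l m (n - 1))"
proof -
  have J: "{..<4::nat} = {0, 1, 2, 3}" by auto
  have i: "i \<in> {..<4}" using assms by simp
  show ?thesis
    unfolding stein[OF poly_grad_h4 i] by (simp add: J H4_def)
qed

lemma integrable_Z_h4: "i < 4 \<Longrightarrow> integrable M (\<lambda>\<omega>. Z i \<omega> * h4 k l m n \<omega>)"
  using poly_grad_moments[OF poly_grad_h4[of k l m n]]
  by (intro all_moments_integrable all_moments_mult all_moments_Z) auto

text \<open>In the Stein identity the contraction of \<open>Z 0\<close> with itself has coefficient
  1, the variance, and cancels the second term of the Hermite recursion. This is why the graphs have
  no loops.\<close>

lemma H4_vertex_1:
  "H4 (Suc k) l m n = cov 0 1 * (real l * H4 k (l - 1) m n) + cov 0 2 * (real m * H4 k l (m - 1) n) + cov 0 3 * (real n * H4 k l m (n - 1))"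
proof -
  have "H4 (Suc k) l m n = expectation (\<lambda>\<omega>. Z 0 \<omega> * h4 k l m n \<omega> - real k * h4 (k - 1) l m n \<omega>)"
    unfolding H4_def by (intro Bochner_Integration.integral_cong refl) (simp add: h4_def hermite_Suc algebra_simps)
  also have "\<dots> = expectation (\<lambda>\<omega>. Z 0 \<omega> * h4 k l m n \<omega>) - real k * H4 (k - 1) l m n"
    unfolding H4_def by (subst Bochner_Integration.integral_diff) (auto simp: integrable_Z_h4 integrable_h4)
  finally show ?thesis by (simp add: stein_h4 unit)
qed

lemma H4_vertex_2:
  "H4 0 (Suc l) m n = cov 1 2 * (real m * H4 0 l (m - 1) n) + cov 1 3 * (real n * H4 0 l m (n - 1))"
proof -
  have "H4 0 (Suc l) m n = expectation (\<lambda>\<omega>. Z 1 \<omega> * h4 0 l m n \<omega> - real l * h4 0 (l - 1) m n \<omega>)"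
    unfolding H4_def by (intro Bochner_Integration.integral_cong refl) (simp add: h4_def hermite_Suc algebra_simps)
  also have "\<dots> = expectation (\<lambda>\<omega>. Z 1 \<omega> * h4 0 l m n \<omega>) - real l * H4 0 (l - 1) m n"
    unfolding H4_def by (subst Bochner_Integration.integral_diff) (auto simp: integrable_Z_h4 integrable_h4)
  finally show ?thesis using unit[of 1] by (simp add: stein_h4)
qed

lemma H4_vertex_3: "H4 0 0 (Suc m) n = cov 2 3 * (real n * H4 0 0 m (n - 1))"
proof -
  have "H4 0 0 (Suc m) n = expectation (\<lambda>\<omega>. Z 2 \<omega> * h4 0 0 m n \<omega> - real m * h4 0 0 (m - 1) n \<omega>)"
    unfolding H4_def by (intro Bochner_Integration.integral_cong refl) (simp add: h4_def hermite_Suc algebra_simps)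
  also have "\<dots> = expectation (\<lambda>\<omega>. Z 2 \<omega> * h4 0 0 m n \<omega>) - real m * H4 0 0 (m - 1) n"
    unfolding H4_def by (subst Bochner_Integration.integral_diff) (auto simp: integrable_Z_h4 integrable_h4)
  finally show ?thesis by (simp add: stein_h4 unit)
qed

lemma H4_0: "H4 0 0 0 n = (if n = 0 then 1 else 0)"
proof (cases n)
  case 0 then show ?thesis by (simp add: H4_def h4_def[abs_def] prob_space)
next
  case (Suc n')
  have "H4 0 0 0 (Suc n') = expectation (\<lambda>\<omega>. Z 3 \<omega> * h4 0 0 0 n' \<omega> - real n' * h4 0 0 0 (n' - 1) \<omega>)"
    unfolding H4_def by (intro Bochner_Integration.integral_cong refl) (simp add: h4_def hermite_Suc algebra_simps)
  also have "\<dots> = expectation (\<lambda>\<omega>. Z 3 \<omega> * h4 0 0 0 n' \<omega>) - real n' * H4 0 0 0 (n' - 1)"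
    unfolding H4_def by (subst Bochner_Integration.integral_diff) (auto simp: integrable_Z_h4 integrable_h4)
  finally show ?thesis by (simp add: stein_h4 unit Suc)
qed

text \<open>The diagram formula: both sides satisfy the recursion that empties the vertices one
  after the other, hence the nested inductions.\<close>

lemma H4_eq_W: "H4 k l m n = fact k * fact l * fact m * fact n * W k l m n"
proof (induction k arbitrary: l m n)
  case 0
  show ?case
  proof (induction l arbitrary: m n)
    case 0
    show ?case
    proof (induction m arbitrary: n)
      case 0
      then show ?case unfolding H4_0 W_0 by simp
    next
      case (Suc m)
      have "fact 0 * fact 0 * fact (Suc m) * fact n * W 0 0 (Suc m) n = fact m * fact n * (real (Suc m) * W 0 0 (Suc m) n)"
        by (simp only: fact_Suc fact_0 ac_simps)
      also have "\<dots> = H4 0 0 (Suc m) n" unfolding H4_vertex_3 Suc.IH W_vertex_3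
        by (cases n) (auto simp: algebra_simps)
      finally show ?case ..
    qed
  next
    case (Suc l)
    have "fact 0 * fact (Suc l) * fact m * fact n * W 0 (Suc l) m n = fact l * fact m * fact n * (real (Suc l) * W 0 (Suc l) m n)"
      by (simp only: fact_Suc fact_0 ac_simps)
    also have "\<dots> = H4 0 (Suc l) m n" unfolding H4_vertex_2 Suc.IH W_vertex_2
      by (cases n; cases m) (auto simp: algebra_simps)
    finally show ?case ..
  qed
next
  case (Suc k)
  have "fact (Suc k) * fact l * fact m * fact n * W (Suc k) l m n = fact k * fact l * fact m * fact n * (real (Suc k) * W (Suc k) l m n)"
    by (simp only: fact_Suc ac_simps)
  also have "\<dots> = H4 (Suc k) l m n" unfolding H4_vertex_1 Suc.IH W_vertex_1
    by (cases n; cases m; cases l) (auto simp: algebra_simps)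
  finally show ?case ..
qed

end

text \<open>Several indices may carry the same time, so their coefficients are added up before the
  definition applies.\<close>

lemma gaussian_process_comb:
  assumes "centered_gaussian_process M X" and "finite J"
  shows "(AE \<omega> in M. (\<Sum>j\<in>J. a j * X (\<tau> j) \<omega>) = 0) \<or>
    (\<exists>\<sigma>>0. distributed M lborel (\<lambda>\<omega>. \<Sum>j\<in>J. a j * X (\<tau> j) \<omega>) (normal_density 0 \<sigma>))"
proof -
  define b where "b s = (\<Sum>j\<in>{j\<in>J. \<tau> j = s}. a j)" for s
  have "(\<Sum>j\<in>J. a j * X (\<tau> j) \<omega>) = (\<Sum>s\<in>\<tau> ` J. b s * X s \<omega>)" for \<omega>
  proof -
    have "(\<Sum>j\<in>J. a j * X (\<tau> j) \<omega>) = (\<Sum>s\<in>\<tau> ` J. \<Sum>j\<in>{j\<in>J. \<tau> j = s}. a j * X (\<tau> j) \<omega>)"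
      by (rule sum.image_gen[OF assms(2)])
    also have "\<dots> = (\<Sum>s\<in>\<tau> ` J. b s * X s \<omega>)"
      unfolding b_def sum_distrib_right by (intro sum.cong refl) auto
    finally show ?thesis .
  qed
  moreover have "finite (\<tau> ` J)" using assms(2) by simp
  ultimately show ?thesis
    using assms(1) unfolding centered_gaussian_process_def by simp
qed

locale gaussian_process = prob_space M for M :: "'a measure" +
  fixes X :: "int \<Rightarrow> 'a \<Rightarrow> real" and r :: "int \<Rightarrow> real"
  assumes gauss: "centered_gaussian_process M X"
    and acov: "\<And>s t. expectation (\<lambda>\<omega>. X s \<omega> * X t \<omega>) = r (s - t)"
    and r0: "r 0 = 1"
begin

lemma X_meas: "X t \<in> borel_measurable M"
  using gauss by (simp add: centered_gaussian_process_def)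

lemma gaussian_four: "gaussian_four M (\<lambda>i. X (\<tau> i))"
proof -
  interpret gaussian_family M "{..<4::nat}" "\<lambda>i. X (\<tau> i)"
    by unfold_locales (simp, rule X_meas, rule gaussian_process_comb[OF gauss], simp)
  show ?thesis
    by unfold_locales (simp add: cov_def acov r0)
qed

text \<open>The four-vertex formula with two vertices of degree 0.\<close>

lemma hermite_two:
  shows "integrable M (\<lambda>\<omega>. hermite k (X s \<omega>) * hermite l (X t \<omega>))"
    and "expectation (\<lambda>\<omega>. hermite k (X s \<omega>) * hermite l (X t \<omega>)) = (if k = l then fact k * r (s - t) ^ k else 0)"
proof -
  define \<tau> :: "nat \<Rightarrow> int" where "\<tau> i = (if i = 0 then s else t)" for i
  interpret G: gaussian_four M "\<lambda>i. X (\<tau> i)" by (rule gaussian_four)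
  have c: "G.cov i j = r (\<tau> i - \<tau> j)" for i j unfolding G.cov_def acov ..
  have h: "G.h4 k l 0 0 = (\<lambda>\<omega>. hermite k (X s \<omega>) * hermite l (X t \<omega>))"
    by (intro ext, unfold G.h4_def, simp add: \<tau>_def)
  show "integrable M (\<lambda>\<omega>. hermite k (X s \<omega>) * hermite l (X t \<omega>))"
    using G.integrable_h4[of k l 0 0] unfolding h .
  have "expectation (\<lambda>\<omega>. hermite k (X s \<omega>) * hermite l (X t \<omega>)) = fact k * fact l * fact 0 * fact 0 * G.W k l 0 0"
    unfolding h[symmetric] G.H4_eq_W[symmetric] G.H4_def ..
  also have "\<dots> = (if k = l then fact k * r (s - t) ^ k else 0)"
    by (simp only: G.W_two) (simp only: c, simp add: exp_term_def \<tau>_def)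
  finally show "expectation (\<lambda>\<omega>. hermite k (X s \<omega>) * hermite l (X t \<omega>)) = (if k = l then fact k * r (s - t) ^ k else 0)" .
qed

lemma hermite_four:
  shows "integrable M (\<lambda>\<omega>. (hermite q (X t0 \<omega>) * hermite q (X t1 \<omega>)) * (hermite q (X t2 \<omega>) * hermite q (X t3 \<omega>)))"
    and "expectation (\<lambda>\<omega>. (hermite q (X t0 \<omega>) * hermite q (X t1 \<omega>)) * (hermite q (X t2 \<omega>) * hermite q (X t3 \<omega>)))
    = (\<Sum>(x, y)\<in>{(x, y). x + y \<le> q}. fact q ^ 4 / (fact x * fact y * fact (q - x - y))\<^sup>2 *
       ((r (t0 - t1) * r (t2 - t3)) ^ x * (r (t0 - t2) * r (t1 - t3)) ^ y * (r (t0 - t3) * r (t1 - t2)) ^ (q - x - y)))"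
proof -
  define \<tau> :: "nat \<Rightarrow> int" where "\<tau> i = [t0, t1, t2, t3] ! i" for i
  interpret G: gaussian_four M "\<lambda>i. X (\<tau> i)" by (rule gaussian_four)
  have c: "G.cov i j = r (\<tau> i - \<tau> j)" for i j unfolding G.cov_def acov ..
  have h: "G.h4 q q q q = (\<lambda>\<omega>. (hermite q (X t0 \<omega>) * hermite q (X t1 \<omega>)) * (hermite q (X t2 \<omega>) * hermite q (X t3 \<omega>)))"
    by (intro ext, unfold G.h4_def, simp add: \<tau>_def mult.assoc)
  show "integrable M (\<lambda>\<omega>. (hermite q (X t0 \<omega>) * hermite q (X t1 \<omega>)) * (hermite q (X t2 \<omega>) * hermite q (X t3 \<omega>)))"
    using G.integrable_h4[of q q q q] unfolding h .
  have "expectation (\<lambda>\<omega>. (hermite q (X t0 \<omega>) * hermite q (X t1 \<omega>)) * (hermite q (X t2 \<omega>) * hermite q (X t3 \<omega>)))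
     = fact q * fact q * fact q * fact q * G.W q q q q"
    unfolding h[symmetric] G.H4_eq_W[symmetric] G.H4_def ..
  also have "\<dots> = (\<Sum>(x, y)\<in>{(x, y). x + y \<le> q}. fact q ^ 4 / (fact x * fact y * fact (q - x - y))\<^sup>2 *
       ((r (t0 - t1) * r (t2 - t3)) ^ x * (r (t0 - t2) * r (t1 - t3)) ^ y * (r (t0 - t3) * r (t1 - t2)) ^ (q - x - y)))"
    by (simp only: G.W_diag sum_distrib_left, intro sum.cong refl)
       (simp only: c, auto simp: exp_term_def \<tau>_def power_mult_distrib power2_eq_square power4_eq_xxxx)
  finally show "expectation (\<lambda>\<omega>. (hermite q (X t0 \<omega>) * hermite q (X t1 \<omega>)) * (hermite q (X t2 \<omega>) * hermite q (X t3 \<omega>)))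
    = (\<Sum>(x, y)\<in>{(x, y). x + y \<le> q}. fact q ^ 4 / (fact x * fact y * fact (q - x - y))\<^sup>2 *
       ((r (t0 - t1) * r (t2 - t3)) ^ x * (r (t0 - t2) * r (t1 - t3)) ^ y * (r (t0 - t3) * r (t1 - t2)) ^ (q - x - y)))" .
qed

lemma X_std_normal: "distributed M lborel (X t) std_normal_density"
proof -
  note [measurable] = X_meas
  have E: "expectation (\<lambda>\<omega>. (X t \<omega>)\<^sup>2) = 1" using acov[of t t] r0 by (simp add: power2_eq_square)
  have "(AE \<omega> in M. X t \<omega> = 0) \<or> (\<exists>\<sigma>>0. distributed M lborel (X t) (normal_density 0 \<sigma>))"
    using gaussian_process_comb[OF gauss, of "{()}" "\<lambda>_. 1" "\<lambda>_. t"] by simp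
  then show ?thesis
  proof
    assume "AE \<omega> in M. X t \<omega> = 0"
    then have "expectation (\<lambda>\<omega>. (X t \<omega>)\<^sup>2) = expectation (\<lambda>_. 0)"
      by (intro integral_cong_AE) auto
    then show ?thesis using E by simp
  next
    assume "\<exists>\<sigma>>0. distributed M lborel (X t) (normal_density 0 \<sigma>)"
    then obtain \<sigma> where \<sigma>: "\<sigma> > 0" "distributed M lborel (X t) (normal_density 0 \<sigma>)" by auto
    have "expectation (\<lambda>\<omega>. (X t \<omega>)\<^sup>2) = (\<integral>x. normal_density 0 \<sigma> x * x\<^sup>2 \<partial>lborel)"
      by (subst distributed_integral[OF \<sigma>(2)]) auto
    also have "\<dots> = \<sigma>\<^sup>2"
      using has_bochner_integral_integral_eq[OF normal_moment_even[OF \<sigma>(1), of 0 1]] by (simp add: numeral_2_eq_2)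
    finally have "\<sigma> = 1" using E \<sigma>(1) by (simp add: power2_eq_1_iff)
    then show ?thesis using \<sigma>(2) by simp
  qed
qed

end

section \<open>Completeness of the Hermite polynomials\<close>

definition std_gauss :: "real measure" where
  "std_gauss = density lborel std_normal_density"

lemma std_gauss_sets[measurable_cong, simp]: "sets std_gauss = sets borel"
  by (simp add: std_gauss_def)

lemma std_gauss_space[simp]: "space std_gauss = UNIV"
  by (simp add: std_gauss_def)

lemma prob_space_std_gauss: "prob_space std_gauss"
  unfolding std_gauss_def by (rule prob_space_normal_density) simp

lemma std_gauss_integral:
  fixes F :: "real \<Rightarrow> real"
  assumes "F \<in> borel_measurable borel"
  shows "integrable std_gauss F \<longleftrightarrow> integrable lborel (\<lambda>x. F x * std_normal_density x)"
    and "integral\<^sup>L std_gauss F = (\<integral>x. F x * std_normal_density x \<partial>lborel)"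
  unfolding std_gauss_def using assms
  by (auto simp: integrable_density integral_density mult.commute)

lemma (in gaussian_process) X_std_gauss:
  fixes F :: "real \<Rightarrow> real"
  assumes "F \<in> borel_measurable borel"
  shows "integrable M (\<lambda>\<omega>. F (X t \<omega>)) \<longleftrightarrow> integrable std_gauss F"
    and "expectation (\<lambda>\<omega>. F (X t \<omega>)) = integral\<^sup>L std_gauss F"
proof -
  show "integrable M (\<lambda>\<omega>. F (X t \<omega>)) \<longleftrightarrow> integrable std_gauss F"
    unfolding std_gauss_integral(1)[OF assms] using distributed_integrable[OF X_std_normal[of t], of F] assms
    by (simp add: mult.commute)
  show "expectation (\<lambda>\<omega>. F (X t \<omega>)) = integral\<^sup>L std_gauss F"
    unfolding std_gauss_integral(2)[OF assms] using distributed_integral[OF X_std_normal[of t], of F] assms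
    by (simp add: mult.commute)
qed

text \<open>A standard normal variable is the Gaussian process that is constant in time.\<close>

interpretation std_gauss: gaussian_process std_gauss "\<lambda>_ x. x" "\<lambda>_. 1"
proof -
  interpret prob_space std_gauss by (rule prob_space_std_gauss)
  have D: "distributed std_gauss lborel (\<lambda>x. x) std_normal_density"
    unfolding distributed_def std_gauss_def by (auto simp: distr_id2 measurable_lborel1)
  show "gaussian_process std_gauss (\<lambda>_ x. x) (\<lambda>_. 1)"
  proof
    show "centered_gaussian_process std_gauss (\<lambda>_ x. x)"
      unfolding centered_gaussian_process_def
    proof (intro conjI allI impI)
      fix I :: "int set" and a :: "int \<Rightarrow> real"
      have e: "(\<Sum>i\<in>I. a i * x) = 0 + (\<Sum>i\<in>I. a i) * x" for x by (simp add: sum_distrib_right)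
      show "(AE x in std_gauss. (\<Sum>i\<in>I. a i * x) = 0) \<or> (\<exists>\<sigma>>0. distributed std_gauss lborel (\<lambda>x. \<Sum>i\<in>I. a i * x) (normal_density 0 \<sigma>))"
      proof (cases "(\<Sum>i\<in>I. a i) = 0")
        case True then show ?thesis unfolding e by simp
      next
        case False
        from normal_density_affine[OF D _ False, of 0]
        show ?thesis unfolding e using False by (intro disjI2 exI[of _ "\<bar>\<Sum>i\<in>I. a i\<bar>"]) simp
      qed
    qed auto
    show "expectation (\<lambda>x. x * x) = 1"
      using has_bochner_integral_integral_eq[OF normal_moment_even[of 1 0 1]]
      by (subst std_gauss_integral(2)) (auto simp: power2_eq_square mult.commute numeral_2_eq_2)
  qed auto
qed

lemma hermite_0_fun: "hermite 0 = (\<lambda>_. 1)" and hermite_1_fun: "hermite (Suc 0) = (\<lambda>x. x)"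
  by (auto intro: ext)

lemma hermite_measurable[measurable]: "hermite n \<in> borel_measurable borel"
proof (induction n rule: less_induct)
  case (less n)
  show ?case
  proof (cases n)
    case 0 then show ?thesis by (simp add: hermite_0_fun)
  next
    case (Suc k)
    have [measurable]: "hermite k \<in> borel_measurable borel" "hermite (k - 1) \<in> borel_measurable borel"
      by (rule less; simp add: Suc)+
    have "hermite n = (\<lambda>x. x * hermite k x - real k * hermite (k - 1) x)"
      unfolding Suc by (rule ext) (rule hermite_Suc)
    then show ?thesis by (simp only:) measurable
  qed
qed

abbreviation gauss_int :: "(real \<Rightarrow> real) \<Rightarrow> real" where
  "gauss_int F \<equiv> integral\<^sup>L std_gauss F"

lemma all_moments_hermite: "all_moments std_gauss (hermite n)"
proof -
  have id: "all_moments std_gauss (\<lambda>x. x)"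
  proof -
    interpret G: gaussian_four std_gauss "\<lambda>_ x. x"
      by (rule std_gauss.gaussian_four)
    show ?thesis using G.all_moments_Z[of 0] by simp
  qed
  show ?thesis
  proof (induction n rule: less_induct)
    case (less n)
    show ?case
    proof (cases n)
      case 0 then show ?thesis using std_gauss.all_moments_const[of 1] by (simp add: hermite_0_fun)
    next
      case (Suc k)
      have "hermite n = (\<lambda>x. x * hermite k x + (- real k) * hermite (k - 1) x)"
        unfolding Suc by (rule ext) (simp add: hermite_Suc)
      then show ?thesis
        by (simp only:) (intro std_gauss.all_moments_intros id less; simp add: Suc)
    qed
  qed
qed

lemma integrable_power2_all_moments: "all_moments M F \<Longrightarrow> integrable M (\<lambda>x. (F x)\<^sup>2)"
proof -
  assume "all_moments M F"
  then have "integrable M (\<lambda>x. \<bar>F x\<bar> ^ 2)" unfolding all_moments_def by blast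
  then show ?thesis by simp
qed

lemma integrable_mult_L2:
  fixes F G :: "'a \<Rightarrow> real"
  assumes [measurable]: "F \<in> borel_measurable M" "G \<in> borel_measurable M"
    and "integrable M (\<lambda>x. (F x)\<^sup>2)" "integrable M (\<lambda>x. (G x)\<^sup>2)"
  shows "integrable M (\<lambda>x. F x * G x)"
proof (rule Bochner_Integration.integrable_bound)
  show "integrable M (\<lambda>x. (F x)\<^sup>2 + (G x)\<^sup>2)" by (intro Bochner_Integration.integrable_add assms)
  show "AE x in M. norm (F x * G x) \<le> norm ((F x)\<^sup>2 + (G x)\<^sup>2)"
  proof (rule AE_I2)
    fix x
    have "2 * (\<bar>F x\<bar> * \<bar>G x\<bar>) \<le> (F x)\<^sup>2 + (G x)\<^sup>2"
      using zero_le_power2[of "\<bar>F x\<bar> - \<bar>G x\<bar>"] by (simp add: power2_diff)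
    moreover have "0 \<le> \<bar>F x\<bar> * \<bar>G x\<bar>" by simp
    ultimately have "\<bar>F x\<bar> * \<bar>G x\<bar> \<le> (F x)\<^sup>2 + (G x)\<^sup>2" by linarith
    then show "norm (F x * G x) \<le> norm ((F x)\<^sup>2 + (G x)\<^sup>2)" by (simp add: abs_mult)
  qed
qed measurable

lemma integrable_diff_L2:
  fixes F G :: "'a \<Rightarrow> real"
  assumes [measurable]: "F \<in> borel_measurable M" "G \<in> borel_measurable M"
    and "integrable M (\<lambda>x. (F x)\<^sup>2)" "integrable M (\<lambda>x. (G x)\<^sup>2)"
  shows "integrable M (\<lambda>x. (F x - G x)\<^sup>2)"
proof -
  have "(\<lambda>x. (F x - G x)\<^sup>2) = (\<lambda>x. (F x)\<^sup>2 + (G x)\<^sup>2 - 2 * (F x * G x))"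
    by (auto simp: power2_diff mult.assoc)
  then show ?thesis
    by (simp only:) (intro Bochner_Integration.integrable_add Bochner_Integration.integrable_diff integrable_mult_right integrable_mult_L2 assms)
qed

text \<open>Completing the square turns exp (s x) times the density into a multiple of a shifted
  density. The bound serves as majorant when the power series of a character is integrated term by
  term.\<close>

lemma gauss_exp_integrable: "integrable std_gauss (\<lambda>x. exp (c * \<bar>x\<bar>))"
proof -
  have e: "integrable std_gauss (\<lambda>x. exp (s * x))" for s :: real
  proof -
    have "std_normal_density (0 + 1 * x - s) = exp (s * x) * std_normal_density x * exp (- s\<^sup>2 / 2)" for x
    proof -
      have "- (x - s)\<^sup>2 / 2 = s * x + (- x\<^sup>2 / 2) + (- s\<^sup>2 / 2)" by (simp add: power2_eq_square field_simps)
      then show ?thesis by (simp add: std_normal_density_def exp_add[symmetric] del: exp_add)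
    qed
    moreover have "integrable lborel (\<lambda>x. std_normal_density (- s + 1 * x))"
      by (rule lborel_integrable_real_affine) (auto intro: integrable_normal_density)
    ultimately have "integrable lborel (\<lambda>x. exp (s * x) * std_normal_density x * exp (- s\<^sup>2 / 2))"
      by (simp add: algebra_simps)
    then show ?thesis by (subst std_gauss_integral(1)) (auto simp: integrable_mult_left_iff)
  qed
  show ?thesis
  proof (rule Bochner_Integration.integrable_bound[OF Bochner_Integration.integrable_add[OF e[of c] e[of "- c"]]])
    show "AE x in std_gauss. norm (exp (c * \<bar>x\<bar>)) \<le> norm (exp (c * x) + exp (- c * x))"
    proof (rule AE_I2)
      fix x :: real
      have "0 < exp (c * x)" "0 < exp (- c * x)" by simp_all
      then have "exp (c * \<bar>x\<bar>) \<le> exp (c * x) + exp (- c * x)" by (simp add: abs_if)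
      then show "norm (exp (c * \<bar>x\<bar>)) \<le> norm (exp (c * x) + exp (- c * x))" by simp
    qed
  qed measurable
qed

text \<open>The identity x H_q = H_(q+1) + q H_(q-1) absorbs one power of x at a time, so the
  induction is over all q simultaneously.\<close>

lemma hermite_orthogonal_moments:
  assumes m: "F \<in> borel_measurable borel" and L2: "integrable std_gauss (\<lambda>x. (F x)\<^sup>2)"
    and orth: "\<And>q. gauss_int (\<lambda>x. F x * hermite q x) = 0"
  shows "gauss_int (\<lambda>x. F x * x ^ n) = 0"
proof -
  note [measurable] = m
  have pm: "all_moments std_gauss (\<lambda>x. x ^ n * hermite q x)" for n q
  proof -
      have "all_moments std_gauss (\<lambda>x. x)" using all_moments_hermite[of "Suc 0"] unfolding hermite_1_fun .
    then show ?thesis by (intro std_gauss.all_moments_intros all_moments_hermite)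
  qed
  have int: "integrable std_gauss (\<lambda>x. F x * (x ^ n * hermite q x))" for n q
    by (rule integrable_mult_L2[OF _ _ L2 integrable_power2_all_moments[OF pm]]) measurable
  have "gauss_int (\<lambda>x. F x * (x ^ n * hermite q x)) = 0" for q
  proof (induction n arbitrary: q)
    case 0 then show ?case using orth by simp
  next
    case (Suc n)
    have "gauss_int (\<lambda>x. F x * (x ^ Suc n * hermite q x)) =
       gauss_int (\<lambda>x. F x * (x ^ n * hermite (Suc q) x) + real q * (F x * (x ^ n * hermite (q - 1) x)))"
      by (intro Bochner_Integration.integral_cong refl) (simp add: hermite_Suc algebra_simps)
    also have "\<dots> = 0" using Suc.IH by (subst Bochner_Integration.integral_add) (auto intro: int)
    finally show ?case .
  qed
  from this[of 0] show ?thesis by simp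
qed

text \<open>The partial sums of the exponential series are dominated by |F(x)| exp (|t x|), a
  product of two square integrable functions, and each of them integrates to 0 because all moments
  of F vanish.\<close>

lemma hermite_orthogonal_fourier:
  assumes m: "F \<in> borel_measurable borel" and L2: "integrable std_gauss (\<lambda>x. (F x)\<^sup>2)"
    and orth: "\<And>q. gauss_int (\<lambda>x. F x * hermite q x) = 0"
  shows "integrable std_gauss (\<lambda>x. complex_of_real (F x) * iexp (t * x))"
    and "(CLINT x|std_gauss. complex_of_real (F x) * iexp (t * x)) = 0"
proof -
  note [measurable] = m
  let ?f = "\<lambda>x. complex_of_real (F x) * iexp (t * x)"
  let ?p = "\<lambda>N x. \<Sum>n<N. ((\<i> * of_real t) ^ n /\<^sub>R fact n) * complex_of_real (F x * x ^ n)"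
  let ?w = "\<lambda>x. \<bar>F x\<bar> * exp (\<bar>t\<bar> * \<bar>x\<bar>)"
  have id: "all_moments std_gauss (\<lambda>x. x)" using all_moments_hermite[of "Suc 0"] unfolding hermite_1_fun .
  have intm: "integrable std_gauss (\<lambda>x. F x * x ^ n)" for n
    by (rule integrable_mult_L2[OF _ _ L2 integrable_power2_all_moments[OF std_gauss.all_moments_power[OF id]]]) measurable
  have w: "integrable std_gauss ?w"
  proof (rule integrable_mult_L2)
    show "integrable std_gauss (\<lambda>x. \<bar>F x\<bar>\<^sup>2)" using L2 by simp
    show "integrable std_gauss (\<lambda>x. (exp (\<bar>t\<bar> * \<bar>x\<bar>))\<^sup>2)"
      using gauss_exp_integrable[of "2 * \<bar>t\<bar>"] by (simp add: power2_eq_square exp_add[symmetric] algebra_simps)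
  qed measurable
  have sums: "(\<lambda>N. ?p N x) \<longlonglongrightarrow> ?f x" for x
  proof -
    have "(\<lambda>n. ((\<i> * of_real (t * x)) ^ n /\<^sub>R fact n)) sums iexp (t * x)"
      by (rule exp_converges)
    then have "(\<lambda>n. complex_of_real (F x) * ((\<i> * of_real (t * x)) ^ n /\<^sub>R fact n)) sums ?f x"
      by (rule sums_mult)
    then show ?thesis unfolding sums_def by (simp add: power_mult_distrib algebra_simps)
  qed
  have bd: "norm (?p N x) \<le> ?w x" for N x
  proof -
    have "norm (?p N x) \<le> (\<Sum>n<N. \<bar>F x\<bar> * ((\<bar>t\<bar> * \<bar>x\<bar>) ^ n /\<^sub>R fact n))"
      by (rule order_trans[OF norm_sum])
         (intro sum_mono, simp add: norm_mult norm_power abs_mult power_abs power_mult_distrib algebra_simps)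
    also have "\<dots> = \<bar>F x\<bar> * (\<Sum>n<N. (\<bar>t\<bar> * \<bar>x\<bar>) ^ n /\<^sub>R fact n)" by (simp add: sum_distrib_left)
    also have "(\<Sum>n<N. (\<bar>t\<bar> * \<bar>x\<bar>) ^ n /\<^sub>R fact n) \<le> exp (\<bar>t\<bar> * \<bar>x\<bar>)"
      unfolding exp_def by (rule sum_le_suminf[OF summable_exp_generic]) auto
    finally show ?thesis by (simp add: mult_left_mono)
  qed
  have mf: "?f \<in> borel_measurable std_gauss" by measurable
  have mp: "?p N \<in> borel_measurable std_gauss" for N by measurable
  show "integrable std_gauss ?f"
    by (rule integrable_dominated_convergence[OF mf mp w AE_I2 AE_I2]) (use sums bd in auto)
  have lim: "(\<lambda>N. integral\<^sup>L std_gauss (?p N)) \<longlonglongrightarrow> integral\<^sup>L std_gauss ?f"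
    by (rule integral_dominated_convergence[OF mf mp w AE_I2 AE_I2]) (use sums bd in auto)
  have "integral\<^sup>L std_gauss (?p N) = 0" for N
  proof -
    have "integral\<^sup>L std_gauss (?p N) = (\<Sum>n<N. integral\<^sup>L std_gauss (\<lambda>x. ((\<i> * of_real t) ^ n /\<^sub>R fact n) * complex_of_real (F x * x ^ n)))"
      by (intro Bochner_Integration.integral_sum integrable_mult_right integrable_of_real intm)
    also have "\<dots> = (\<Sum>n<N. ((\<i> * of_real t) ^ n /\<^sub>R fact n) * complex_of_real (gauss_int (\<lambda>x. F x * x ^ n)))"
      by (simp only: integral_mult_right_zero integral_complex_of_real)
    also have "\<dots> = 0" unfolding hermite_orthogonal_moments[OF m L2 orth] by simp
    finally show ?thesis .
  qed
  then show "integral\<^sup>L std_gauss ?f = 0"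
    using lim by (simp add: LIMSEQ_const_iff)
qed

text \<open>The positive and the negative part of \<open>F\<close> have the same integral against every character,
  so they are the densities of the same measure by Levy's uniqueness theorem.\<close>

lemma hermite_complete:
  assumes m: "F \<in> borel_measurable borel" and L2: "integrable std_gauss (\<lambda>x. (F x)\<^sup>2)"
    and orth: "\<And>q. gauss_int (\<lambda>x. F x * hermite q x) = 0"
  shows "AE x in std_gauss. F x = 0"
proof -
  note [measurable] = m
  define pos where "pos x = max 0 (F x)" for x
  define neg where "neg x = max 0 (- F x)" for x
  have [measurable]: "pos \<in> borel_measurable borel" "neg \<in> borel_measurable borel"
    unfolding pos_def[abs_def] neg_def[abs_def] by measurable
  have F: "F x = pos x - neg x" for x by (auto simp: pos_def neg_def)
  have nn: "0 \<le> pos x" "0 \<le> neg x" for x by (auto simp: pos_def neg_def)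
  have iF: "integrable std_gauss F"
    using integrable_mult_L2[OF _ _ L2, of "\<lambda>_. 1"] by simp
  have ip: "integrable std_gauss pos" "integrable std_gauss neg"
    by (rule Bochner_Integration.integrable_bound[OF iF]; auto simp: pos_def neg_def)+
  \<comment> \<open>The common mass of both parts, equal because F is orthogonal to
    \<open>hermite 0\<close>. Dividing by it produces probability measures; if it is 0, both parts
    vanish almost everywhere.\<close>
  define c where "c = gauss_int pos"
  have "gauss_int F = 0" using orth[of 0] by simp
  then have c': "c = gauss_int neg"
    using Bochner_Integration.integral_diff[OF ip] by (simp add: F[abs_def] c_def)
  show ?thesis
  proof (cases "c = 0")
    case True
    have "AE x in std_gauss. pos x = 0" "AE x in std_gauss. neg x = 0"
      using True c' integral_nonneg_eq_0_iff_AE[OF ip(1)] integral_nonneg_eq_0_iff_AE[OF ip(2)] nn by (auto simp: c_def)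
    then show ?thesis by eventually_elim (simp add: F)
  next
    case False
    have cp: "c > 0" using False nn by (simp add: c_def less_le Bochner_Integration.integral_nonneg)
    define P where "P f = density std_gauss (\<lambda>x. ennreal (f x / c))" for f :: "real \<Rightarrow> real"
    have prob: "real_distribution (P f)" if f: "integrable std_gauss f" "\<And>x. 0 \<le> f x" "gauss_int f = c" for f
    proof -
      note [measurable] = borel_measurable_integrable[OF f(1)]
      have "(\<integral>\<^sup>+ x. ennreal (f x / c) \<partial>std_gauss) = ennreal (gauss_int (\<lambda>x. f x / c))"
        using f cp by (intro nn_integral_eq_integral) auto
      also have "\<dots> = 1" using f(3) cp by simp
      finally have "emeasure (P f) (space (P f)) = 1"
        unfolding P_def by (subst emeasure_density) auto
      then show ?thesis
        by (intro real_distribution.intro real_distribution_axioms.intro prob_spaceI) (simp_all add: P_def)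
    qed
    have ch: "char (P f) t = (CLINT x|std_gauss. (f x / c) *\<^sub>R iexp (t * x))"
      if f: "integrable std_gauss f" "\<And>x. 0 \<le> f x" for f t
      unfolding char_def P_def using borel_measurable_integrable[OF f(1)] f(2) cp
      by (subst integral_density) auto
    have ii: "integrable std_gauss (\<lambda>x. (f x / c) *\<^sub>R iexp (t * x))" if f: "integrable std_gauss f" for f t
    proof (rule Bochner_Integration.integrable_bound)
      show "integrable std_gauss (\<lambda>x. f x / c)" using f by simp
      show "(\<lambda>x. (f x / c) *\<^sub>R iexp (t * x)) \<in> borel_measurable std_gauss"
        using borel_measurable_integrable[OF f] by measurable
    qed auto
    have "char (P pos) = char (P neg)"
    proof
      fix t
      have "char (P pos) t - char (P neg) t = (CLINT x|std_gauss. (pos x / c) *\<^sub>R iexp (t * x) - (neg x / c) *\<^sub>R iexp (t * x))"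
        unfolding ch[OF ip(1) nn(1)] ch[OF ip(2) nn(2)] by (rule Bochner_Integration.integral_diff[symmetric]) (intro ii ip)+
      also have "\<dots> = (CLINT x|std_gauss. complex_of_real (1 / c) * (complex_of_real (F x) * iexp (t * x)))"
        by (intro Bochner_Integration.integral_cong refl) (simp add: F scaleR_conv_of_real diff_divide_distrib algebra_simps)
      also have "\<dots> = 0"
        unfolding integral_mult_right_zero hermite_orthogonal_fourier(2)[OF m L2 orth] by simp
      finally show "char (P pos) t = char (P neg) t" by simp
    qed
    then have "P pos = P neg"
      by (intro Levy_uniqueness prob ip nn) (simp_all add: c_def c'[symmetric])
    then have "AE x in std_gauss. ennreal (pos x / c) = ennreal (neg x / c)"
      unfolding P_def by (subst (asm) std_gauss.density_unique_iff) auto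
    then show ?thesis
      by eventually_elim (use nn cp in \<open>auto simp: F\<close>)
  qed
qed

lemma power2_hermite_integrable: "integrable std_gauss (\<lambda>x. (hermite q x)\<^sup>2)"
  by (rule integrable_power2_all_moments[OF all_moments_hermite])

lemma hermite_sum_L2:
  shows "integrable std_gauss (\<lambda>x. (\<Sum>q\<in>Q. d q * hermite q x)\<^sup>2)"
    and "gauss_int (\<lambda>x. (\<Sum>q\<in>Q. d q * hermite q x)\<^sup>2) = (\<Sum>q\<in>Q. (d q)\<^sup>2 * fact q)"
proof -
  have "all_moments std_gauss (\<lambda>x. \<Sum>q\<in>Q. d q * hermite q x)"
    by (intro std_gauss.all_moments_intros all_moments_hermite)
  then show "integrable std_gauss (\<lambda>x. (\<Sum>q\<in>Q. d q * hermite q x)\<^sup>2)"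
    by (rule integrable_power2_all_moments)
  have "gauss_int (\<lambda>x. (\<Sum>q\<in>Q. d q * hermite q x)\<^sup>2) = gauss_int (\<lambda>x. \<Sum>q\<in>Q. \<Sum>p\<in>Q. (d q * d p) * (hermite q x * hermite p x))"
    unfolding power2_eq_square sum_product by (simp add: ac_simps)
  also have "\<dots> = (\<Sum>q\<in>Q. \<Sum>p\<in>Q. (d q * d p) * (if q = p then fact q * 1 ^ q else 0))"
    by (subst Bochner_Integration.integral_sum, intro Bochner_Integration.integrable_sum integrable_mult_right std_gauss.hermite_two(1),
        intro sum.cong refl, subst Bochner_Integration.integral_sum, intro integrable_mult_right std_gauss.hermite_two(1))
       (simp only: integral_mult_right_zero std_gauss.hermite_two(2))
  also have "\<dots> = (\<Sum>q\<in>Q. (d q)\<^sup>2 * fact q)"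
  proof (cases "finite Q")
    case True
    then show ?thesis
      by (intro sum.cong refl) (simp add: power2_eq_square if_distrib[of "\<lambda>x. _ * x"] cong: if_cong)
  qed simp
  finally show "gauss_int (\<lambda>x. (\<Sum>q\<in>Q. d q * hermite q x)\<^sup>2) = (\<Sum>q\<in>Q. (d q)\<^sup>2 * fact q)" .
qed

lemma abs_mult_le_weighted:
  fixes a b e :: real
  assumes "e > 0"
  shows "\<bar>a * b\<bar> \<le> a\<^sup>2 / e + e * b\<^sup>2"
proof -
  have "0 \<le> (\<bar>a\<bar> / sqrt e - sqrt e * \<bar>b\<bar>)\<^sup>2" by simp
  also have "\<dots> = a\<^sup>2 / e + e * b\<^sup>2 - 2 * \<bar>a * b\<bar>"
    using assms by (simp add: power2_diff power_divide power_mult_distrib abs_mult)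
  finally show ?thesis using abs_ge_zero[of "a * b"] by linarith
qed

section \<open>The Hermite expansion in mean square\<close>

context
  fixes F :: "real \<Rightarrow> real"
  assumes m[measurable]: "F \<in> borel_measurable borel" and L2: "integrable std_gauss (\<lambda>x. (F x)\<^sup>2)"
begin

definition hcoef :: "nat \<Rightarrow> real" where
  "hcoef q = gauss_int (\<lambda>x. F x * hermite q x)"

definition hpart :: "nat \<Rightarrow> real \<Rightarrow> real" where
  "hpart N x = (\<Sum>q<N. hcoef q / fact q * hermite q x)"

lemma hpart_measurable[measurable]: "hpart N \<in> borel_measurable borel"
  unfolding hpart_def by measurable

lemma hpart_L2: "integrable std_gauss (\<lambda>x. (hpart N x)\<^sup>2)"
  unfolding hpart_def by (rule hermite_sum_L2)

lemma integrable_F_hermite: "integrable std_gauss (\<lambda>x. F x * hermite q x)"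
  by (intro integrable_mult_L2 m L2 power2_hermite_integrable) simp_all

lemma hpart_dist_F: "gauss_int (\<lambda>x. (F x - hpart N x)\<^sup>2) = gauss_int (\<lambda>x. (F x)\<^sup>2) - (\<Sum>q<N. (hcoef q)\<^sup>2 / fact q)"
proof -
  have Fh: "integrable std_gauss (\<lambda>x. F x * hpart N x)"
    by (rule integrable_mult_L2[OF _ _ L2 hpart_L2]) simp_all
  have "gauss_int (\<lambda>x. F x * hpart N x) = gauss_int (\<lambda>x. \<Sum>q<N. hcoef q / fact q * (F x * hermite q x))"
    unfolding hpart_def by (simp add: sum_distrib_left ac_simps)
  also have "\<dots> = (\<Sum>q<N. hcoef q / fact q * hcoef q)"
    by (subst Bochner_Integration.integral_sum, intro integrable_mult_right integrable_F_hermite)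
       (simp only: integral_mult_right_zero hcoef_def)
  finally have 1: "gauss_int (\<lambda>x. F x * hpart N x) = (\<Sum>q<N. (hcoef q)\<^sup>2 / fact q)"
    by (simp add: power2_eq_square)
  have 2: "gauss_int (\<lambda>x. (hpart N x)\<^sup>2) = (\<Sum>q<N. (hcoef q)\<^sup>2 / fact q)"
    unfolding hpart_def hermite_sum_L2(2) by (intro sum.cong refl) (simp add: power2_eq_square)
  have "gauss_int (\<lambda>x. (F x - hpart N x)\<^sup>2) = gauss_int (\<lambda>x. (F x)\<^sup>2 + (hpart N x)\<^sup>2 - 2 * (F x * hpart N x))"
    by (intro Bochner_Integration.integral_cong refl) (simp add: power2_diff)
  also have "\<dots> = gauss_int (\<lambda>x. (F x)\<^sup>2) + gauss_int (\<lambda>x. (hpart N x)\<^sup>2) - 2 * gauss_int (\<lambda>x. F x * hpart N x)"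
    using L2 hpart_L2 Fh by simp
  finally show ?thesis unfolding 1 2 by simp
qed

lemma hcoef_bessel: "(\<Sum>q<N. (hcoef q)\<^sup>2 / fact q) \<le> gauss_int (\<lambda>x. (F x)\<^sup>2)"
proof -
  have "0 \<le> gauss_int (\<lambda>x. (F x - hpart N x)\<^sup>2)" by (intro Bochner_Integration.integral_nonneg) simp
  then show ?thesis unfolding hpart_dist_F by simp
qed

lemma hcoef_summable: "summable (\<lambda>q. (hcoef q)\<^sup>2 / fact q)"
  using hcoef_bessel by (intro summableI_nonneg_bounded) auto

definition htail :: "nat \<Rightarrow> real" where
  "htail M = (\<Sum>q. (hcoef (q + M))\<^sup>2 / fact (q + M))"

lemma htail_lim: "htail \<longlonglongrightarrow> 0"
  unfolding htail_def[abs_def] using suminf_exist_split2[OF hcoef_summable] by simp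

lemma htail_nonneg: "0 \<le> htail M"
  unfolding htail_def by (intro suminf_nonneg summable_ignore_initial_segment[OF hcoef_summable]) auto

lemma hpart_dist:
  assumes "M \<le> N"
  shows "integrable std_gauss (\<lambda>x. (hpart N x - hpart M x)\<^sup>2)"
    and "gauss_int (\<lambda>x. (hpart N x - hpart M x)\<^sup>2) \<le> htail M"
proof -
  have e: "hpart N x - hpart M x = (\<Sum>q\<in>{M..<N}. hcoef q / fact q * hermite q x)" for x
    unfolding hpart_def using assms by (simp add: sum_diff_nat_ivl[of 0 M N, symmetric] atLeast0LessThan)
  show "integrable std_gauss (\<lambda>x. (hpart N x - hpart M x)\<^sup>2)" unfolding e by (rule hermite_sum_L2)
  have "gauss_int (\<lambda>x. (hpart N x - hpart M x)\<^sup>2) = (\<Sum>q\<in>{M..<N}. (hcoef q)\<^sup>2 / fact q)"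
    unfolding e hermite_sum_L2(2) by (intro sum.cong refl) (simp add: power2_eq_square)
  also have "\<dots> = (\<Sum>q<N - M. (hcoef (q + M))\<^sup>2 / fact (q + M))"
    using assms sum.shift_bounds_nat_ivl[of "\<lambda>q. (hcoef q)\<^sup>2 / fact q" 0 M "N - M"] by (simp add: atLeast0LessThan)
  also have "\<dots> \<le> htail M"
    unfolding htail_def by (intro sum_le_suminf summable_ignore_initial_segment[OF hcoef_summable]) auto
  finally show "gauss_int (\<lambda>x. (hpart N x - hpart M x)\<^sup>2) \<le> htail M" .
qed

text \<open>The partial sums form a Cauchy sequence in mean square by Bessel's inequality. A fast
  subsequence converges almost everywhere, and by Fatou's lemma its limit L is at squared distance
  at most \<open>htail M\<close> from every partial sum. Then F - L is orthogonal to all Hermite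
  polynomials, and completeness gives F = L almost everywhere.\<close>

lemma hermite_expansion: "(\<lambda>N. gauss_int (\<lambda>x. (F x - hpart N x)\<^sup>2)) \<longlonglongrightarrow> 0"
proof -
  have "\<forall>i. \<exists>n. \<forall>k\<ge>n. htail k \<le> (1/4) ^ i"
  proof
    fix i
    have "\<forall>\<^sub>F k in sequentially. htail k < (1/4) ^ i" using htail_lim by (rule order_tendstoD) simp
    then show "\<exists>n. \<forall>k\<ge>n. htail k \<le> (1/4) ^ i"
      by (meson eventually_sequentially less_imp_le)
  qed
  then obtain \<nu> where \<nu>: "\<And>i k. k \<ge> \<nu> i \<Longrightarrow> htail k \<le> (1/4) ^ i" by metis
  \<comment> \<open>Summing the \<open>Suc (\<nu> k)\<close> makes the indices increasing and at
    least i, while keeping the tail below (1/4)^i.\<close>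
  define n where "n i = (\<Sum>k\<le>i. Suc (\<nu> k))" for i
  have n_Suc: "n i \<le> n (Suc i)" for i by (simp add: n_def)
  have n_ge: "n i \<ge> i" for i by (induction i) (auto simp: n_def)
  have n_tail: "htail (n i) \<le> (1/4) ^ i" for i
  proof (rule \<nu>)
    have "Suc (\<nu> i) \<le> n i" unfolding n_def by (rule member_le_sum) auto
    then show "\<nu> i \<le> n i" by simp
  qed
  let ?D = "\<lambda>i x. hpart (n (Suc i)) x - hpart (n i) x"
  have Dint: "integrable std_gauss (\<lambda>x. \<bar>?D i x\<bar>)" for i
    using integrable_mult_L2[OF _ _ hpart_dist(1)[OF n_Suc[of i]], of "\<lambda>_. 1"] by simp
  have D1: "gauss_int (\<lambda>x. \<bar>?D i x\<bar>) \<le> 2 * (1/2) ^ i" for i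
  proof -
    have "gauss_int (\<lambda>x. \<bar>?D i x\<bar>) \<le> gauss_int (\<lambda>x. (?D i x)\<^sup>2 / (1/2) ^ i + (1/2) ^ i)"
    proof (intro integral_mono Dint Bochner_Integration.integrable_add integrable_divide hpart_dist n_Suc)
      fix x show "\<bar>?D i x\<bar> \<le> (?D i x)\<^sup>2 / (1/2) ^ i + (1/2) ^ i"
        using abs_mult_le_weighted[of "(1/2) ^ i" "?D i x" 1] by simp
    qed simp
    also have "\<dots> = gauss_int (\<lambda>x. (?D i x)\<^sup>2) / (1/2) ^ i + (1/2) ^ i"
      using hpart_dist(1)[OF n_Suc[of i]] by (subst Bochner_Integration.integral_add) (simp_all add: std_gauss.prob_space[simplified])
    also have "\<dots> \<le> (1/4) ^ i / (1/2) ^ i + (1/2) ^ i"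
      using hpart_dist(2)[OF n_Suc[of i]] n_tail[of i] by (intro add_right_mono divide_right_mono) auto
    also have "(1/4) ^ i / (1/2) ^ i = ((1/2) ^ i :: real)"
      by (simp add: power_divide[symmetric])
    finally show ?thesis by simp
  qed
  have "(\<integral>\<^sup>+ x. (\<Sum>i. ennreal \<bar>?D i x\<bar>) \<partial>std_gauss) = (\<Sum>i. \<integral>\<^sup>+ x. ennreal \<bar>?D i x\<bar> \<partial>std_gauss)"
    by (rule nn_integral_suminf) simp
  also have "\<dots> = (\<Sum>i. ennreal (gauss_int (\<lambda>x. \<bar>?D i x\<bar>)))"
    by (intro suminf_cong nn_integral_eq_integral Dint) auto
  also have "\<dots> \<le> (\<Sum>i. ennreal (2 * (1/2) ^ i))"
    using D1 by (intro suminf_le ennreal_leI) auto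
  also have "\<dots> = ennreal (\<Sum>i. 2 * (1/2) ^ i)"
    by (rule suminf_ennreal2) (auto intro: summable_mult summable_geometric)
  finally have fin: "(\<integral>\<^sup>+ x. (\<Sum>i. ennreal \<bar>?D i x\<bar>) \<partial>std_gauss) \<noteq> \<infinity>"
    using ennreal_less_top le_less_trans by (metis infinity_ennreal_def less_irrefl)
  have "AE x in std_gauss. (\<Sum>i. ennreal \<bar>?D i x\<bar>) \<noteq> \<infinity>"
    by (rule nn_integral_PInf_AE[OF _ fin]) measurable
  then have conv: "AE x in std_gauss. convergent (\<lambda>i. hpart (n i) x)"
  proof eventually_elim
    fix x assume "(\<Sum>i. ennreal \<bar>?D i x\<bar>) \<noteq> \<infinity>"
    then have "summable (\<lambda>i. \<bar>?D i x\<bar>)" by (intro summable_suminf_not_top) auto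
    then have "summable (\<lambda>i. ?D i x)" by (rule summable_rabs_cancel)
    then have "convergent (\<lambda>k. \<Sum>i<k. ?D i x)" by (simp add: summable_iff_convergent)
    then have "convergent (\<lambda>k. hpart (n k) x - hpart (n 0) x)" unfolding sum_lessThan_telescope[of "\<lambda>i. hpart (n i) x"] .
    then have "convergent (\<lambda>k. (hpart (n k) x - hpart (n 0) x) + hpart (n 0) x)"
      by (intro convergent_add convergent_const)
    then show "convergent (\<lambda>k. hpart (n k) x)" by simp
  qed
  define L where "L x = lim (\<lambda>i. hpart (n i) x)" for x
  have [measurable]: "L \<in> borel_measurable borel" unfolding L_def by measurable
  have L: "AE x in std_gauss. (\<lambda>i. hpart (n i) x) \<longlonglongrightarrow> L x"
    using conv by eventually_elim (simp add: L_def convergent_LIMSEQ_iff)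
  have nnL: "(\<integral>\<^sup>+ x. ennreal ((L x - hpart M x)\<^sup>2) \<partial>std_gauss) \<le> ennreal (htail M)" for M
  proof -
    have "(\<integral>\<^sup>+ x. ennreal ((L x - hpart M x)\<^sup>2) \<partial>std_gauss) = (\<integral>\<^sup>+ x. liminf (\<lambda>i. ennreal ((hpart (n i) x - hpart M x)\<^sup>2)) \<partial>std_gauss)"
    proof (rule nn_integral_cong_AE)
      show "AE x in std_gauss. ennreal ((L x - hpart M x)\<^sup>2) = liminf (\<lambda>i. ennreal ((hpart (n i) x - hpart M x)\<^sup>2))"
        using L
      proof eventually_elim
        fix x assume "(\<lambda>i. hpart (n i) x) \<longlonglongrightarrow> L x"
        then have "(\<lambda>i. ennreal ((hpart (n i) x - hpart M x)\<^sup>2)) \<longlonglongrightarrow> ennreal ((L x - hpart M x)\<^sup>2)"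
          by (intro tendsto_ennrealI tendsto_intros)
        then show "ennreal ((L x - hpart M x)\<^sup>2) = liminf (\<lambda>i. ennreal ((hpart (n i) x - hpart M x)\<^sup>2))"
          by (intro lim_imp_Liminf[symmetric]) auto
      qed
    qed
    also have "\<dots> \<le> liminf (\<lambda>i. \<integral>\<^sup>+ x. ennreal ((hpart (n i) x - hpart M x)\<^sup>2) \<partial>std_gauss)"
      by (rule nn_integral_liminf) measurable
    also have "\<dots> \<le> liminf (\<lambda>_::nat. ennreal (htail M))"
    proof (rule Liminf_mono)
      show "\<forall>\<^sub>F i in sequentially. (\<integral>\<^sup>+ x. ennreal ((hpart (n i) x - hpart M x)\<^sup>2) \<partial>std_gauss) \<le> ennreal (htail M)"
        using eventually_ge_at_top[of M]
      proof eventually_elim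
        fix i assume "M \<le> i"
        then have Mn: "M \<le> n i" using n_ge[of i] by simp
        show "(\<integral>\<^sup>+ x. ennreal ((hpart (n i) x - hpart M x)\<^sup>2) \<partial>std_gauss) \<le> ennreal (htail M)"
          by (subst nn_integral_eq_integral[OF hpart_dist(1)[OF Mn]]) (auto intro!: ennreal_leI hpart_dist(2) Mn)
      qed
    qed
    also have "\<dots> = ennreal (htail M)" by (simp add: Liminf_const)
    finally show ?thesis .
  qed
  have Li: "integrable std_gauss (\<lambda>x. (L x - hpart M x)\<^sup>2)" for M
    by (rule integrableI_bounded) (use nnL[of M] in \<open>auto intro: le_less_trans\<close>)
  have Ld: "gauss_int (\<lambda>x. (L x - hpart M x)\<^sup>2) \<le> htail M" for M
    using nnL[of M] by (subst (asm) nn_integral_eq_integral[OF Li]) (auto simp: htail_nonneg)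
  have L2L: "integrable std_gauss (\<lambda>x. (F x - L x)\<^sup>2)"
  proof -
    have "integrable std_gauss (\<lambda>x. (L x)\<^sup>2)" using Li[of 0] by (simp add: hpart_def)
    then show ?thesis by (intro integrable_diff_L2 L2) simp_all
  qed
  have "gauss_int (\<lambda>x. (F x - L x) * hermite q x) = 0" for q
  proof -
    have I1: "integrable std_gauss (\<lambda>x. (F x - L x) * hermite q x)"
      by (rule integrable_mult_L2[OF _ _ L2L power2_hermite_integrable]) simp_all
    \<comment> \<open>For M > q the partial sum has the same q-th coefficient as F, so only L minus
      the partial sum contributes, and it is small in mean square.\<close>
    have "\<bar>gauss_int (\<lambda>x. (F x - L x) * hermite q x)\<bar> \<le> e * (1 + fact q)" if e: "e > 0" for e
    proof -
      have "\<forall>\<^sub>F M in sequentially. htail M < e\<^sup>2" using htail_lim by (rule order_tendstoD) (use e in simp)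
      then have "\<forall>\<^sub>F M in sequentially. htail M < e\<^sup>2 \<and> q < M"
        by (intro eventually_conj eventually_gt_at_top)
      then obtain M where M: "M > q" "htail M < e\<^sup>2"
        using eventually_happens'[OF sequentially_bot] by blast
      have I2: "integrable std_gauss (\<lambda>x. (L x - hpart M x) * hermite q x)"
        by (rule integrable_mult_L2[OF _ _ Li power2_hermite_integrable]) simp_all
      have I3: "integrable std_gauss (\<lambda>x. (hcoef p / fact p) * (hermite p x * hermite q x))" for p
        by (intro integrable_mult_right std_gauss.hermite_two(1))
      have "gauss_int (\<lambda>x. hpart M x * hermite q x) = gauss_int (\<lambda>x. \<Sum>p<M. (hcoef p / fact p) * (hermite p x * hermite q x))"
        unfolding hpart_def sum_distrib_right by (simp add: ac_simps)
      also have "\<dots> = (\<Sum>p<M. hcoef p / fact p * (if p = q then fact p * 1 ^ p else 0))"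
        by (subst Bochner_Integration.integral_sum[OF I3]) (simp only: integral_mult_right_zero std_gauss.hermite_two(2))
      also have "\<dots> = (\<Sum>p<M. if p = q then hcoef p else 0)" by (intro sum.cong refl) simp
      also have "\<dots> = hcoef q" using M(1) by simp
      finally have hq: "gauss_int (\<lambda>x. hpart M x * hermite q x) = hcoef q" .
      have I4: "integrable std_gauss (\<lambda>x. hpart M x * hermite q x)"
        by (rule integrable_mult_L2[OF _ _ hpart_L2 power2_hermite_integrable]) simp_all
      have "gauss_int (\<lambda>x. (F x - L x) * hermite q x) = gauss_int (\<lambda>x. F x * hermite q x - hpart M x * hermite q x - (L x - hpart M x) * hermite q x)"
        by (intro Bochner_Integration.integral_cong refl) (simp add: algebra_simps)
      also have "\<dots> = - gauss_int (\<lambda>x. (L x - hpart M x) * hermite q x)"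
        by (simp only: Bochner_Integration.integral_diff I2 I4 integrable_F_hermite Bochner_Integration.integrable_diff hq)
           (simp add: hcoef_def)
      finally have "\<bar>gauss_int (\<lambda>x. (F x - L x) * hermite q x)\<bar> \<le> gauss_int (\<lambda>x. norm ((L x - hpart M x) * hermite q x))"
        using integral_norm_bound[of std_gauss "\<lambda>x. (L x - hpart M x) * hermite q x"] by simp
      also have "\<dots> \<le> gauss_int (\<lambda>x. (L x - hpart M x)\<^sup>2 / e + e * (hermite q x)\<^sup>2)"
        unfolding real_norm_def using abs_mult_le_weighted[OF e]
        by (intro integral_mono integrable_abs I2 Bochner_Integration.integrable_add integrable_divide integrable_mult_right Li power2_hermite_integrable)
      also have "\<dots> = gauss_int (\<lambda>x. (L x - hpart M x)\<^sup>2) / e + e * fact q"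
        using Li[of M] power2_hermite_integrable[of q] std_gauss.hermite_two(2)[of q q]
        by (simp add: power2_eq_square)
      also have "\<dots> \<le> e\<^sup>2 / e + e * fact q"
        using Ld[of M] M(2) e by (intro add_right_mono divide_right_mono) auto
      also have "\<dots> = e * (1 + fact q)" using e by (simp add: power2_eq_square algebra_simps)
      finally show ?thesis .
    qed
    note b = this
    have "\<bar>gauss_int (\<lambda>x. (F x - L x) * hermite q x)\<bar> \<le> 0 + e" if "e > 0" for e
    proof -
      have p: "0 < 1 + (fact q :: real)" by (simp add: add_pos_pos)
      then have "e / (1 + fact q) * (1 + fact q) = e" by simp
      then show ?thesis using b[of "e / (1 + fact q)"] that p by simp
    qed
    then have "\<bar>gauss_int (\<lambda>x. (F x - L x) * hermite q x)\<bar> \<le> 0" by (rule field_le_epsilon)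
    then show ?thesis by simp
  qed
  then have "AE x in std_gauss. F x - L x = 0"
    by (intro hermite_complete L2L) measurable
  then have "gauss_int (\<lambda>x. (F x - hpart M x)\<^sup>2) = gauss_int (\<lambda>x. (L x - hpart M x)\<^sup>2)" for M
    by (intro integral_cong_AE) auto
  then have "gauss_int (\<lambda>x. (F x - hpart M x)\<^sup>2) \<le> htail M" for M using Ld by simp
  then show ?thesis
    by (intro tendsto_sandwich[OF _ _ tendsto_const htail_lim] always_eventually allI Bochner_Integration.integral_nonneg) auto
qed

end

section \<open>Reduction of the wavelet filters\<close>

lemma dtft_bdiff:
  assumes h: "\<And>\<tau>. h \<tau> \<noteq> 0 \<Longrightarrow> \<bar>\<tau>\<bar> \<le> int N"
  shows "dtft (bdiff h) x = (1 - cis (- x)) * dtft h x"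
proof -
  let ?e = "\<lambda>\<tau>. cis (- x * of_int \<tau>)"
  have d: "dtft h x = (\<Sum>\<tau>\<in>{- int N..int N}. complex_of_real (h \<tau>) * ?e \<tau>)"
    by (rule dtft_eq[of h N, OF h])
  have b: "bdiff h \<tau> \<noteq> 0 \<Longrightarrow> \<bar>\<tau>\<bar> \<le> int (Suc N)" for \<tau>
    using h[of \<tau>] h[of "\<tau> - 1"] by (cases "h \<tau> = 0") (auto simp: bdiff_def)
  have z: "h \<tau> = 0" if "\<bar>\<tau>\<bar> > int N" for \<tau> using h[of \<tau>] that by force
  have "dtft (bdiff h) x = (\<Sum>\<tau>\<in>{- int (Suc N)..int (Suc N)}. complex_of_real (h \<tau>) * ?e \<tau>)
     - (\<Sum>\<tau>\<in>{- int (Suc N)..int (Suc N)}. complex_of_real (h (\<tau> - 1)) * ?e \<tau>)"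
    by (subst dtft_eq[of "bdiff h" "Suc N", OF b]) (simp_all add: bdiff_def algebra_simps sum_subtractf)
  also have "(\<Sum>\<tau>\<in>{- int (Suc N)..int (Suc N)}. complex_of_real (h \<tau>) * ?e \<tau>) = dtft h x"
    unfolding d by (intro sum.mono_neutral_right) (auto simp: z)
  also have "(\<Sum>\<tau>\<in>{- int (Suc N)..int (Suc N)}. complex_of_real (h (\<tau> - 1)) * ?e \<tau>)
     = (\<Sum>\<tau>\<in>{- int (Suc N) - 1..int (Suc N) - 1}. complex_of_real (h \<tau>) * ?e (\<tau> + 1))"
    by (rule sum.reindex_bij_witness[where i = "\<lambda>\<tau>. \<tau> + 1" and j = "\<lambda>\<tau>. \<tau> - 1"]) auto
  also have "\<dots> = (\<Sum>\<tau>\<in>{- int N..int N}. complex_of_real (h \<tau>) * ?e (\<tau> + 1))"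
    by (intro sum.mono_neutral_right) (auto simp: z)
  also have "\<dots> = cis (- x) * dtft h x"
    unfolding d sum_distrib_left
    by (intro sum.cong refl) (simp add: cis_mult algebra_simps)
  finally show ?thesis by (simp add: algebra_simps)
qed

text \<open>The cumulative sum of g. It vanishes beyond the support exactly because g sums to 0, so
  the support does not grow.\<close>

lemma antidifference:
  assumes g: "\<And>\<tau>. g \<tau> \<noteq> 0 \<Longrightarrow> \<bar>\<tau>\<bar> \<le> int N" and s: "(\<Sum>\<tau>\<in>{- int N..int N}. g \<tau>) = 0"
  obtains h where "\<And>\<tau>. h \<tau> \<noteq> 0 \<Longrightarrow> \<bar>\<tau>\<bar> \<le> int N" "bdiff h = g"
proof
  have z: "g \<tau> = 0" if "\<bar>\<tau>\<bar> > int N" for \<tau> using g[of \<tau>] that by force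
  define h where "h \<tau> = (\<Sum>\<sigma>\<in>{- int N..\<tau>}. g \<sigma>)" for \<tau>
  show "\<bar>\<tau>\<bar> \<le> int N" if "h \<tau> \<noteq> 0" for \<tau>
  proof (rule ccontr)
    assume "\<not> \<bar>\<tau>\<bar> \<le> int N"
    then consider "\<tau> < - int N" | "\<tau> > int N" by linarith
    then have "h \<tau> = 0"
    proof cases
      case 2
      have "h \<tau> = (\<Sum>\<sigma>\<in>{- int N..int N}. g \<sigma>)" unfolding h_def
        using 2 by (intro sum.mono_neutral_right) (auto simp: z)
      then show ?thesis using s by simp
    qed (simp add: h_def)
    then show False using that by simp
  qed
  show "bdiff h = g"
  proof
    fix \<tau>
    show "bdiff h \<tau> = g \<tau>"
    proof (cases "\<tau> < - int N")
      case True then show ?thesis by (simp add: bdiff_def h_def z)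
    next
      case False
      then have "{- int N..\<tau>} = insert \<tau> {- int N..\<tau> - 1}" by auto
      then show ?thesis by (simp add: bdiff_def h_def)
    qed
  qed
qed

lemma norm_one_minus_cis_ge:
  assumes "\<bar>x\<bar> \<le> pi"
  shows "norm (1 - cis (- x)) \<ge> 2 / pi * \<bar>x\<bar>"
proof -
  have "2 * (\<bar>x\<bar> / 2) / pi \<le> sin (\<bar>x\<bar> / 2)"
    using assms by (intro sin_ge_chord) auto
  also have "\<dots> \<le> \<bar>sin (- x / 2)\<bar>" by (simp add: abs_if)
  finally show ?thesis unfolding norm_one_minus_cis by simp
qed

text \<open>The zero at frequency 0 is divided out one factor 1 - cis (- x) at a time. The bound
  forces the transform to vanish at 0, so g sums to 0 and has an antidifference; |1 - cis (- x)| >=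
  2 x / pi then lowers the order of the bound by one.\<close>

lemma iterated_antidifference:
  assumes "\<And>\<tau>. g \<tau> \<noteq> 0 \<Longrightarrow> \<bar>\<tau>\<bar> \<le> int N"
    and "\<And>x. 0 < x \<Longrightarrow> x \<le> pi \<Longrightarrow> norm (dtft g x) \<le> C * x ^ K"
  shows "\<exists>h. (\<forall>\<tau>. h \<tau> \<noteq> 0 \<longrightarrow> \<bar>\<tau>\<bar> \<le> int N) \<and> (bdiff ^^ K) h = g"
  using assms
proof (induction K arbitrary: g C)
  case 0 then show ?case by auto
next
  case (Suc K)
  have "((\<lambda>x. norm (dtft g x)) \<longlongrightarrow> norm (dtft g 0)) (at_right 0)"
    using continuous_dtft[OF Suc.prems(1)]
    by (intro tendsto_norm) (auto simp: continuous_on_eq_continuous_at isCont_def intro: filterlim_mono[OF _ order_refl at_le])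
  moreover have "((\<lambda>x. C * x ^ Suc K) \<longlongrightarrow> 0) (at_right 0)"
    by (auto intro!: tendsto_eq_intros)
  moreover have "\<forall>\<^sub>F x in at_right 0. norm (dtft g x) \<le> C * x ^ Suc K"
    using eventually_at_right_less[of "0::real"] eventually_at_right_real[OF pi_gt_zero]
    by eventually_elim (intro Suc.prems(2), auto)
  ultimately have "norm (dtft g 0) \<le> 0"
    by (intro tendsto_le[OF trivial_limit_at_right_real])
  then have "complex_of_real (\<Sum>\<tau>\<in>{- int N..int N}. g \<tau>) = 0"
    using dtft_eq[of g N 0, OF Suc.prems(1)] by simp
  then have "(\<Sum>\<tau>\<in>{- int N..int N}. g \<tau>) = 0" by (simp only: of_real_eq_0_iff)
  from antidifference[OF Suc.prems(1) this] obtain h1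
    where h1: "\<And>\<tau>. h1 \<tau> \<noteq> 0 \<Longrightarrow> \<bar>\<tau>\<bar> \<le> int N" "bdiff h1 = g" by blast
  have "norm (dtft h1 x) \<le> (C * pi / 2) * x ^ K" if x: "0 < x" "x \<le> pi" for x
  proof -
    have "2 / pi * x * norm (dtft h1 x) \<le> norm (1 - cis (- x)) * norm (dtft h1 x)"
      using norm_one_minus_cis_ge[of x] x by (intro mult_right_mono) auto
    also have "\<dots> = norm (dtft g x)" using dtft_bdiff[of h1 N x, OF h1(1)] h1(2) by (simp add: norm_mult)
    also have "\<dots> \<le> C * x ^ Suc K" by (rule Suc.prems(2)[OF x])
    finally have "x * (2 * norm (dtft h1 x)) \<le> x * (C * pi * x ^ K)" by (simp add: field_simps)
    then show ?thesis using x by (simp add: mult_le_cancel_left)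
  qed
  from Suc.IH[OF h1(1) this] obtain h where h: "\<forall>\<tau>. h \<tau> \<noteq> 0 \<longrightarrow> \<bar>\<tau>\<bar> \<le> int N" "(bdiff ^^ K) h = h1" by blast
  then show ?case using h1(2) by (intro exI[of _ h]) simp
qed

lemma bdiff_support:
  assumes "\<And>\<tau>. h \<tau> \<noteq> 0 \<Longrightarrow> \<bar>\<tau>\<bar> \<le> int N" "bdiff h \<tau> \<noteq> 0"
  shows "\<bar>\<tau>\<bar> \<le> int (Suc N)"
  using assms(1)[of \<tau>] assms(1)[of "\<tau> - 1"] assms(2) by (cases "h \<tau> = 0") (auto simp: bdiff_def)

lemma dtft_bdiff_funpow:
  assumes "\<And>\<tau>. h \<tau> \<noteq> 0 \<Longrightarrow> \<bar>\<tau>\<bar> \<le> int N"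
  shows "dtft ((bdiff ^^ K) h) x = (1 - cis (- x)) ^ K * dtft h x"
  using assms
proof (induction K arbitrary: h N)
  case (Suc K)
  have "dtft ((bdiff ^^ Suc K) h) x = dtft ((bdiff ^^ K) (bdiff h)) x" by (simp add: funpow_swap1)
  also have "\<dots> = (1 - cis (- x)) ^ K * dtft (bdiff h) x"
    by (rule Suc.IH[OF bdiff_support[OF Suc.prems]])
  also have "\<dots> = (1 - cis (- x)) ^ Suc K * dtft h x"
    by (subst dtft_bdiff[OF Suc.prems]) simp_all
  finally show ?case .
qed simp

text \<open>Summation by parts, without boundary terms since the support is finite.\<close>

lemma sum_bdiff:
  assumes h: "\<And>\<tau>. h \<tau> \<noteq> 0 \<Longrightarrow> \<bar>\<tau>\<bar> \<le> int N"
  shows "(\<Sum>\<tau>\<in>{- int (Suc N)..int (Suc N)}. bdiff h \<tau> * y (c - \<tau>)) = (\<Sum>\<tau>\<in>{- int N..int N}. h \<tau> * bdiff y (c - \<tau>))"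
proof -
  have z: "h \<tau> = 0" if "\<bar>\<tau>\<bar> > int N" for \<tau> using h[of \<tau>] that by force
  have "(\<Sum>\<tau>\<in>{- int (Suc N)..int (Suc N)}. bdiff h \<tau> * y (c - \<tau>))
    = (\<Sum>\<tau>\<in>{- int (Suc N)..int (Suc N)}. h \<tau> * y (c - \<tau>)) - (\<Sum>\<tau>\<in>{- int (Suc N)..int (Suc N)}. h (\<tau> - 1) * y (c - \<tau>))"
    unfolding bdiff_def by (simp add: algebra_simps sum_subtractf)
  also have "(\<Sum>\<tau>\<in>{- int (Suc N)..int (Suc N)}. h \<tau> * y (c - \<tau>)) = (\<Sum>\<tau>\<in>{- int N..int N}. h \<tau> * y (c - \<tau>))"
    by (intro sum.mono_neutral_right) (auto simp: z)
  also have "(\<Sum>\<tau>\<in>{- int (Suc N)..int (Suc N)}. h (\<tau> - 1) * y (c - \<tau>))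
     = (\<Sum>\<tau>\<in>{- int (Suc N) - 1..int (Suc N) - 1}. h \<tau> * y (c - \<tau> - 1))"
    by (rule sum.reindex_bij_witness[where i = "\<lambda>\<tau>. \<tau> + 1" and j = "\<lambda>\<tau>. \<tau> - 1"]) (auto simp: algebra_simps)
  also have "\<dots> = (\<Sum>\<tau>\<in>{- int N..int N}. h \<tau> * y (c - \<tau> - 1))"
    by (intro sum.mono_neutral_right) (auto simp: z)
  finally show ?thesis by (simp add: bdiff_def algebra_simps sum_subtractf)
qed

lemma sum_bdiff_funpow:
  assumes "\<And>\<tau>. h \<tau> \<noteq> 0 \<Longrightarrow> \<bar>\<tau>\<bar> \<le> int N"
  shows "(\<Sum>\<tau>\<in>{\<tau>. (bdiff ^^ K) h \<tau> \<noteq> 0}. (bdiff ^^ K) h \<tau> * y (c - \<tau>)) = (\<Sum>\<tau>\<in>{- int N..int N}. h \<tau> * (bdiff ^^ K) y (c - \<tau>))"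
  using assms
proof (induction K arbitrary: h N)
  case 0
  then show ?case by (auto intro!: sum.mono_neutral_left simp: abs_le_iff) (metis minus_le_iff)
next
  case (Suc K)
  have "(\<Sum>\<tau>\<in>{\<tau>. (bdiff ^^ Suc K) h \<tau> \<noteq> 0}. (bdiff ^^ Suc K) h \<tau> * y (c - \<tau>))
     = (\<Sum>\<tau>\<in>{- int (Suc N)..int (Suc N)}. bdiff h \<tau> * (bdiff ^^ K) y (c - \<tau>))"
    using Suc.IH[OF bdiff_support[OF Suc.prems]] by (simp add: funpow_swap1)
  also have "\<dots> = (\<Sum>\<tau>\<in>{- int N..int N}. h \<tau> * bdiff ((bdiff ^^ K) y) (c - \<tau>))"
    by (rule sum_bdiff[OF Suc.prems])
  finally show ?case by simp
qed

lemma wcoef_reduce: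
  assumes h: "\<And>\<tau>. h \<tau> \<noteq> 0 \<Longrightarrow> \<bar>\<tau>\<bar> \<le> int N" and g: "(bdiff ^^ K) h = g j"
  shows "wcoef g Y j k \<omega> = (\<Sum>\<tau>\<in>{- int N..int N}. h \<tau> * (bdiff ^^ K) (\<lambda>s. Y s \<omega>) (2 ^ j * k - \<tau>))"
proof -
  have "wcoef g Y j k \<omega> = (\<Sum>\<tau>\<in>{\<tau>. g j \<tau> \<noteq> 0}. g j \<tau> * Y (2 ^ j * k - \<tau>) \<omega>)"
    unfolding wcoef_def
    by (rule sum.reindex_bij_witness[where i = "\<lambda>\<tau>. 2 ^ j * k - \<tau>" and j = "\<lambda>t. 2 ^ j * k - t"]) auto
  then show ?thesis
    using sum_bdiff_funpow[where h = h, OF h, where K = K and y = "\<lambda>s. Y s \<omega>" and c = "2 ^ j * k"] unfolding g by simp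
qed

lemma dtft_scale: "c \<noteq> 0 \<Longrightarrow> dtft (\<lambda>\<tau>. c * h \<tau>) x = complex_of_real c * dtft h x"
  unfolding dtft_def by (simp add: sum_distrib_left mult.assoc)

text \<open>The decay of order \<open>Mv\<close> >= K at frequency 0 allows K differences to be
  split off each filter. They are then applied to Y instead, where they produce G(X).\<close>

lemma scaled_filters_of_wavelet:
  fixes g :: "nat \<Rightarrow> int \<Rightarrow> real" and K Mv :: nat
  assumes W1: "\<exists>A>0. \<forall>j \<tau>. g j \<tau> \<noteq> 0 \<longrightarrow> \<bar>real_of_int \<tau>\<bar> \<le> 2 ^ j * A"
    and Mv: "Mv \<ge> K"
    and W2: "\<exists>C \<alpha>. \<alpha> > 1 \<and> (\<forall>j. \<forall>x\<in>{-pi..pi}.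
         norm (dtft (g j) x) \<le> C * 2 powr (real j / 2) * \<bar>2 ^ j * x\<bar> ^ Mv
             * (1 + 2 ^ j * \<bar>x\<bar>) powr (- \<alpha> - real Mv))"
    and W3: "\<exists>(\<Phi> :: nat \<Rightarrow> real \<Rightarrow> real) (ginf :: real \<Rightarrow> complex). (\<exists>x. ginf x \<noteq> 0) \<and>
         (\<forall>S. compact S \<longrightarrow> uniform_limit S
            (\<lambda>j x. complex_of_real (2 powr (- real j / 2)) * dtft (g j) (x / 2 ^ j) * cis (\<Phi> j x))
            ginf sequentially)"
  obtains u A C \<alpha> winf where "scaled_filters u A C \<alpha> winf"
    and "\<And>(Y :: int \<Rightarrow> 'a \<Rightarrow> real) j k \<omega>. wcoef g Y j k \<omega> = (2 ^ j) powr (real K - 1 / 2) *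
       (\<Sum>\<tau>\<in>{- int (A * 2 ^ j)..int (A * 2 ^ j)}. u j \<tau> * (bdiff ^^ K) (\<lambda>s. Y s \<omega>) (2 ^ j * k - \<tau>))"
proof -
  obtain A0 where A0: "A0 > 0" "\<And>j \<tau>. g j \<tau> \<noteq> 0 \<Longrightarrow> \<bar>real_of_int \<tau>\<bar> \<le> 2 ^ j * A0" using W1 by auto
  define A where "A = nat \<lceil>A0\<rceil>"
  have gs: "\<bar>\<tau>\<bar> \<le> int (A * 2 ^ j)" if "g j \<tau> \<noteq> 0" for j \<tau>
  proof -
    have "real_of_int \<bar>\<tau>\<bar> \<le> 2 ^ j * A0" using A0(2)[OF that] by simp
    also have "\<dots> \<le> 2 ^ j * real A" unfolding A_def by (intro mult_left_mono real_nat_ceiling_ge) simp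
    also have "\<dots> = real_of_int (int (A * 2 ^ j))" by simp
    finally show ?thesis by (simp only: of_int_le_iff)
  qed
  obtain C0 \<alpha> where \<alpha>: "\<alpha> > 1" and C1: "\<forall>j. \<forall>x\<in>{-pi..pi}.
         norm (dtft (g j) x) \<le> C0 * 2 powr (real j / 2) * \<bar>2 ^ j * x\<bar> ^ Mv * (1 + 2 ^ j * \<bar>x\<bar>) powr (- \<alpha> - real Mv)"
    using W2 by blast
  have C0: "norm (dtft (g j) x) \<le> C0 * 2 powr (real j / 2) * \<bar>2 ^ j * x\<bar> ^ Mv * (1 + 2 ^ j * \<bar>x\<bar>) powr (- \<alpha> - real Mv)"
    if "\<bar>x\<bar> \<le> pi" for j x
    using C1[rule_format, of x j] that by (simp add: abs_le_iff minus_le_iff)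
  have gb: "norm (dtft (g j) x) \<le> \<bar>C0\<bar> * 2 powr (real j / 2) * (2 ^ j * \<bar>x\<bar>) ^ Mv * (1 + 2 ^ j * \<bar>x\<bar>) powr (- \<alpha> - real Mv)"
    if "\<bar>x\<bar> \<le> pi" for j x
    by (rule order_trans[OF C0[OF that]]) (auto simp: abs_mult intro!: mult_right_mono)
  have "\<exists>h. (\<forall>\<tau>. h \<tau> \<noteq> 0 \<longrightarrow> \<bar>\<tau>\<bar> \<le> int (A * 2 ^ j)) \<and> (bdiff ^^ K) h = g j" for j
  proof (rule iterated_antidifference)
    fix x :: real assume x: "0 < x" "x \<le> pi"
    have "norm (dtft (g j) x) \<le> \<bar>C0\<bar> * 2 powr (real j / 2) * (2 ^ j * x) ^ Mv * (1 + 2 ^ j * x) powr (- \<alpha> - real Mv)"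
      using gb[of x j] x by simp
    also have "\<dots> \<le> \<bar>C0\<bar> * 2 powr (real j / 2) * ((2 ^ j) ^ Mv * pi ^ (Mv - K) * x ^ K) * 1"
    proof (intro mult_mono)
      have "x ^ Mv = x ^ (Mv - K) * x ^ K" using Mv by (simp add: power_add[symmetric])
      also have "\<dots> \<le> pi ^ (Mv - K) * x ^ K" using x by (intro mult_right_mono power_mono) auto
      finally show "(2 ^ j * x) ^ Mv \<le> (2 ^ j) ^ Mv * pi ^ (Mv - K) * x ^ K"
        by (simp add: power_mult_distrib mult.assoc)
      show "(1 + 2 ^ j * x) powr (- \<alpha> - real Mv) \<le> 1"
        using x \<alpha> powr_mono[of "- \<alpha> - real Mv" 0 "1 + 2 ^ j * x"] by (simp split: if_splits)
    qed (use x in auto)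
    finally show "norm (dtft (g j) x) \<le> (\<bar>C0\<bar> * 2 powr (real j / 2) * ((2 ^ j) ^ Mv * pi ^ (Mv - K))) * x ^ K"
      by (simp add: ac_simps)
  qed (rule gs)
  then obtain h where hs: "\<And>j \<tau>. h j \<tau> \<noteq> 0 \<Longrightarrow> \<bar>\<tau>\<bar> \<le> int (A * 2 ^ j)" and hg: "\<And>j. (bdiff ^^ K) (h j) = g j"
    by metis
  \<comment> \<open>\<open>g j\<close> is of size 2^(j/2) at frequency x / 2^j, and dividing by (1 -
    cis (- x / 2^j))^K multiplies this by 2^(j K). The exponent is chosen so that the transform of
    \<open>u j\<close> has size 2^j.\<close>
  define u where "u j \<tau> = (2 ^ j) powr (1 / 2 - real K) * h j \<tau>" for j \<tau>
  have us: "\<bar>\<tau>\<bar> \<le> int (A * 2 ^ j)" if "u j \<tau> \<noteq> 0" for j \<tau>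
    using hs that by (auto simp: u_def)
  have du: "norm (dtft (u j) x) = (2 ^ j) powr (1 / 2 - real K) * norm (dtft (h j) x)" for j x
    unfolding u_def[abs_def] by (subst dtft_scale) (simp_all add: norm_mult)
  have dg: "norm (dtft (g j) x) = norm (1 - cis (- x)) ^ K * norm (dtft (h j) x)" for j x
    using dtft_bdiff_funpow[of "h j" "A * 2 ^ j" K x, OF hs] by (simp add: hg norm_mult norm_power)
  have p12: "(2 ^ j :: real) powr (1 / 2) = 2 powr (real j / 2)" for j :: nat
    by (simp add: powr_realpow[symmetric] powr_powr)
  define C where "C = \<bar>C0\<bar> * (pi / 2) ^ K"
  have bound': "norm (dtft (u j) (x / 2 ^ j)) / 2 ^ j \<le> C * (1 + \<bar>x\<bar>) powr (- \<alpha>)" if x: "\<bar>x\<bar> < pi * 2 ^ j" "x \<noteq> 0" for j x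
  proof -
    define B :: real where "B = 2 ^ j"
    have B: "B > 0" by (simp add: B_def)
    have y: "\<bar>x / B\<bar> \<le> pi" using x B by (simp add: B_def field_simps)
    have "(2 / pi * \<bar>x / B\<bar>) ^ K * norm (dtft (h j) (x / B)) \<le> norm (1 - cis (- (x / B))) ^ K * norm (dtft (h j) (x / B))"
      using norm_one_minus_cis_ge[OF y] by (intro mult_right_mono power_mono) auto
    also have "\<dots> \<le> \<bar>C0\<bar> * 2 powr (real j / 2) * \<bar>x\<bar> ^ Mv * (1 + \<bar>x\<bar>) powr (- \<alpha> - real Mv)"
      using gb[OF y, of j] B unfolding dg[symmetric] B_def[symmetric] by simp
    also have "\<dots> \<le> \<bar>C0\<bar> * 2 powr (real j / 2) * (\<bar>x\<bar> ^ K * (1 + \<bar>x\<bar>) powr (- \<alpha>))"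
    proof -
      have "\<bar>x\<bar> ^ Mv * (1 + \<bar>x\<bar>) powr (- \<alpha> - real Mv) = \<bar>x\<bar> ^ K * (\<bar>x\<bar> ^ (Mv - K) * (1 + \<bar>x\<bar>) powr (- \<alpha> - real Mv))"
        using Mv by (simp add: power_add[symmetric] mult.assoc[symmetric])
      also have "\<dots> \<le> \<bar>x\<bar> ^ K * ((1 + \<bar>x\<bar>) ^ Mv * (1 + \<bar>x\<bar>) powr (- \<alpha> - real Mv))"
      proof (intro mult_left_mono mult_right_mono)
        have "\<bar>x\<bar> ^ (Mv - K) \<le> (1 + \<bar>x\<bar>) ^ (Mv - K)" by (intro power_mono) auto
        also have "\<dots> \<le> (1 + \<bar>x\<bar>) ^ Mv" by (intro power_increasing) auto
        finally show "\<bar>x\<bar> ^ (Mv - K) \<le> (1 + \<bar>x\<bar>) ^ Mv" .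
      qed auto
      also have "(1 + \<bar>x\<bar>) ^ Mv * (1 + \<bar>x\<bar>) powr (- \<alpha> - real Mv) = (1 + \<bar>x\<bar>) powr (- \<alpha>)"
        by (simp add: powr_realpow[symmetric] powr_add[symmetric] add_pos_nonneg)
      finally have "\<bar>x\<bar> ^ Mv * (1 + \<bar>x\<bar>) powr (- \<alpha> - real Mv) \<le> \<bar>x\<bar> ^ K * (1 + \<bar>x\<bar>) powr (- \<alpha>)" .
      then show ?thesis unfolding mult.assoc by (intro mult_left_mono) auto
    qed
    finally have "(2 / pi) ^ K * \<bar>x\<bar> ^ K / B ^ K * norm (dtft (h j) (x / B)) \<le> \<bar>C0\<bar> * 2 powr (real j / 2) * (\<bar>x\<bar> ^ K * (1 + \<bar>x\<bar>) powr (- \<alpha>))"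
      using B by (simp add: power_mult_distrib power_divide abs_divide)
    moreover have "(2 / pi) ^ K * \<bar>x\<bar> ^ K / B ^ K > 0" using B x(2) by simp
    ultimately have "norm (dtft (h j) (x / B)) \<le> \<bar>C0\<bar> * 2 powr (real j / 2) * (\<bar>x\<bar> ^ K * (1 + \<bar>x\<bar>) powr (- \<alpha>)) / ((2 / pi) ^ K * \<bar>x\<bar> ^ K / B ^ K)"
      by (subst pos_le_divide_eq) (simp_all add: mult.commute)
    also have "\<dots> = C * (1 + \<bar>x\<bar>) powr (- \<alpha>) * (2 powr (real j / 2) * B ^ K)"
      using B x(2) by (simp add: C_def power_divide field_simps)
    finally have "norm (dtft (u j) (x / B)) / B \<le> (B powr (1 / 2 - real K) * (C * (1 + \<bar>x\<bar>) powr (- \<alpha>) * (2 powr (real j / 2) * B ^ K))) / B"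
      unfolding du B_def[symmetric] using B by (intro divide_right_mono mult_left_mono) auto
    also have "\<dots> = C * (1 + \<bar>x\<bar>) powr (- \<alpha>) * (B powr (1 / 2 - real K) * (B powr (1 / 2) * B ^ K) / B)"
      unfolding p12[symmetric] B_def[symmetric] by simp
    also have "B powr (1 / 2 - real K) * (B powr (1 / 2) * B ^ K) / B = 1"
      using B by (simp add: powr_realpow[symmetric] powr_add[symmetric])
    finally show ?thesis unfolding B_def by simp
  qed
  have bound: "norm (dtft (u j) (x / 2 ^ j)) / 2 ^ j \<le> C * (1 + \<bar>x\<bar>) powr (- \<alpha>)" if x: "\<bar>x\<bar> < pi * 2 ^ j" for j x
  proof (cases "x = 0")
    case True
    \<comment> \<open>The argument above divides by |x|^K, so the bound at frequency 0 is obtained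
      by continuity.\<close>
    have "((\<lambda>x. norm (dtft (u j) (x / 2 ^ j)) / 2 ^ j) \<longlongrightarrow> norm (dtft (u j) (0 / 2 ^ j)) / 2 ^ j) (at 0)"
    proof -
      have "continuous_on UNIV (\<lambda>x. norm (dtft (u j) (x / 2 ^ j)) / 2 ^ j)"
        by (intro continuous_intros continuous_on_compose2[OF continuous_dtft[of "u j" "A * 2 ^ j", OF us]]) auto
      then show ?thesis unfolding continuous_on_eq_continuous_at[OF open_UNIV] isCont_def by blast
    qed
    moreover have "((\<lambda>x. C * (1 + \<bar>x\<bar>) powr (- \<alpha>)) \<longlongrightarrow> C * (1 + \<bar>0\<bar>) powr (- \<alpha>)) (at (0::real))"
      by (intro tendsto_intros) auto
    moreover have "\<forall>\<^sub>F x in at 0. norm (dtft (u j) (x / 2 ^ j)) / 2 ^ j \<le> C * (1 + \<bar>x\<bar>) powr (- \<alpha>)"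
      unfolding eventually_at using bound'[of _ j] by (intro exI[of _ "pi * 2 ^ j"]) (auto simp: dist_real_def)
    ultimately show ?thesis unfolding True by (intro tendsto_le[of "at (0::real)"]) auto
  qed (rule bound'[OF x])
  from W3 obtain \<Phi> ginf where H: "(\<exists>x. ginf x \<noteq> 0) \<and> (\<forall>S. compact S \<longrightarrow> uniform_limit S
            (\<lambda>j x. complex_of_real (2 powr (- real j / 2)) * dtft (g j) (x / 2 ^ j) * cis (\<Phi> j x))
            ginf sequentially)" by (elim exE)
  from conjunct1[OF H] obtain x0 where x0: "ginf x0 \<noteq> 0" by (elim exE)
  note lim = conjunct2[OF H, rule_format]
  \<comment> \<open>Taking norms removes the phases, and the variance depends on norms
    alone.\<close>
  have nlim: "uniform_limit S (\<lambda>j x. 2 powr (- real j / 2) * norm (dtft (g j) (x / 2 ^ j))) (\<lambda>x. norm (ginf x)) sequentially"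
    if "compact S" for S
  proof -
    have "uniform_limit S (\<lambda>j x. norm (complex_of_real (2 powr (- real j / 2)) * dtft (g j) (x / 2 ^ j) * cis (\<Phi> j x)))
       (\<lambda>x. norm (ginf x)) sequentially"
      using lim[OF that] by (rule uniform_limit_norm)
    then show ?thesis by (simp add: norm_mult)
  qed
  define winf where "winf x = norm (ginf x) / \<bar>x\<bar> ^ K" for x
  have wl: "(\<lambda>j. norm (dtft (u j) (x / 2 ^ j)) / 2 ^ j) \<longlonglongrightarrow> winf x" if x: "x \<noteq> 0" for x
  proof -
    have 1: "(\<lambda>j. 2 powr (- real j / 2) * norm (dtft (g j) (x / 2 ^ j))) \<longlonglongrightarrow> norm (ginf x)"
      using nlim[of "{x}"] by (rule tendsto_uniform_limitI) auto
    have 2: "(\<lambda>j. 2 ^ j * norm (1 - cis (- (x / 2 ^ j)))) \<longlonglongrightarrow> \<bar>x\<bar>"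
    proof -
      have "(\<lambda>j. 2 ^ j * (2 * sin (\<bar>x\<bar> / 2 ^ j / 2))) \<longlonglongrightarrow> \<bar>x\<bar>" by real_asymp
      moreover have "\<forall>\<^sub>F j in sequentially. 2 ^ j * (2 * sin (\<bar>x\<bar> / 2 ^ j / 2)) = 2 ^ j * norm (1 - cis (- (x / 2 ^ j)))"
      proof -
        have "\<forall>\<^sub>F j in sequentially. \<bar>x\<bar> / 2 ^ j < pi"
          using pi_gt_zero by real_asymp
        then show ?thesis
        proof eventually_elim
          fix j :: nat assume *: "\<bar>x\<bar> / 2 ^ j < pi"
          have "0 \<le> sin (z / 2)" if "0 \<le> z" "z < pi" for z :: real
            using that by (intro sin_ge_zero) auto
          from this[OF _ *] have "0 \<le> sin (\<bar>x\<bar> / 2 ^ j / 2)" by simp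
          moreover have "\<bar>sin (\<bar>x\<bar> / 2 ^ j / 2)\<bar> = \<bar>sin (- (x / 2 ^ j) / 2)\<bar>" by (simp add: abs_if)
          ultimately show "2 ^ j * (2 * sin (\<bar>x\<bar> / 2 ^ j / 2)) = 2 ^ j * norm (1 - cis (- (x / 2 ^ j)))"
            unfolding norm_one_minus_cis by simp
        qed
      qed
      ultimately show ?thesis by (rule Lim_transform_eventually)
    qed
    have "(\<lambda>j. 2 powr (- real j / 2) * norm (dtft (g j) (x / 2 ^ j)) / (2 ^ j * norm (1 - cis (- (x / 2 ^ j)))) ^ K) \<longlonglongrightarrow> norm (ginf x) / \<bar>x\<bar> ^ K"
      using x by (intro tendsto_intros 1 2) auto
    moreover have "\<forall>\<^sub>F j in sequentially. 2 powr (- real j / 2) * norm (dtft (g j) (x / 2 ^ j)) / (2 ^ j * norm (1 - cis (- (x / 2 ^ j)))) ^ K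
        = norm (dtft (u j) (x / 2 ^ j)) / 2 ^ j"
    proof -
      have "\<forall>\<^sub>F j in sequentially. 0 < 2 ^ j * norm (1 - cis (- (x / 2 ^ j)))"
        using x by (intro order_tendstoD(1)[OF 2]) auto
      then show ?thesis
      proof eventually_elim
        fix j :: nat assume "0 < 2 ^ j * norm (1 - cis (- (x / 2 ^ j)))"
        then have c: "norm (1 - cis (- (x / 2 ^ j))) > 0" by (simp add: zero_less_mult_iff)
        define B :: real where "B = 2 ^ j"
        have B: "B > 0" by (simp add: B_def)
        have e1: "2 powr (- real j / 2) = B powr (- 1 / 2)"
          unfolding B_def by (simp add: powr_realpow[symmetric] powr_powr)
        have e2: "B powr (- 1 / 2) / B ^ K = B powr (1 / 2 - real K) / B"
        proof -
          have e: "- 1 / 2 - real K = (1 / 2 - real K) - 1" by simp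
          have "B powr (- 1 / 2) / B ^ K = B powr (- 1 / 2 - real K)"
            by (simp only: powr_diff powr_realpow[OF B])
          also have "\<dots> = B powr (1 / 2 - real K) / B powr 1"
            unfolding e powr_diff[of B "1 / 2 - real K" 1] ..
          finally show ?thesis using B by simp
        qed
        have "p * (m * y) / (b * m) = p / b * y" if "m \<noteq> 0" for p m y b :: real
          using that by simp
        from this[of "norm (1 - cis (- (x / 2 ^ j))) ^ K"] c
        have "B powr (- 1 / 2) * (norm (1 - cis (- (x / 2 ^ j))) ^ K * norm (dtft (h j) (x / 2 ^ j))) / (B ^ K * norm (1 - cis (- (x / 2 ^ j))) ^ K)
          = B powr (- 1 / 2) / B ^ K * norm (dtft (h j) (x / 2 ^ j))" by simp
        also have "\<dots> = B powr (1 / 2 - real K) * norm (dtft (h j) (x / 2 ^ j)) / B" unfolding e2 by simp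
        finally show "2 powr (- real j / 2) * norm (dtft (g j) (x / 2 ^ j)) / (2 ^ j * norm (1 - cis (- (x / 2 ^ j)))) ^ K
          = norm (dtft (u j) (x / 2 ^ j)) / 2 ^ j"
          unfolding dg du power_mult_distrib e1 by (simp only: B_def)
      qed
    qed
    ultimately show ?thesis unfolding winf_def by (rule Lim_transform_eventually)
  qed
  have wnz: "\<not> (AE x in lborel. winf x = 0)"
  proof
    assume ae: "AE x in lborel. winf x = 0"
    \<comment> \<open>A locally uniform limit of continuous functions is continuous, so
      |\<open>ginf\<close>| is positive on an interval next to x0 and not merely on a possible null
      set.\<close>
    have "continuous_on (cball x0 1) (\<lambda>x. norm (ginf x))"
    proof (rule uniform_limit_theorem[OF _ nlim])
      show "\<forall>\<^sub>F j in sequentially. continuous_on (cball x0 1) (\<lambda>x. 2 powr (- real j / 2) * norm (dtft (g j) (x / 2 ^ j)))"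
        by (intro always_eventually allI continuous_intros continuous_on_compose2[OF continuous_dtft[OF gs]]) auto
    qed auto
    then have "continuous (at x0) (\<lambda>x. norm (ginf x))"
      by (rule continuous_on_interior) simp
    then have "((\<lambda>x. norm (ginf x)) \<longlongrightarrow> norm (ginf x0)) (at x0)" by (simp add: isCont_def)
    then have "\<forall>\<^sub>F x in at x0. 0 < norm (ginf x)"
      using x0 by (intro order_tendstoD(1)) auto
    then obtain d where d: "d > 0" "\<And>x. x \<noteq> x0 \<Longrightarrow> dist x x0 < d \<Longrightarrow> 0 < norm (ginf x)"
      unfolding eventually_at by auto
    have "AE x in lborel. x \<notin> {x0<..<x0 + d}"
      using ae AE_lborel_singleton[of 0]
    proof eventually_elim
      fix x assume x: "winf x = 0" "x \<noteq> 0"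
      then have "ginf x = 0" by (auto simp: winf_def)
      then show "x \<notin> {x0<..<x0 + d}" using d(2)[of x] by (auto simp: dist_real_def)
    qed
    then have "{x0<..<x0 + d} \<in> null_sets lborel" by (subst AE_iff_null_sets) auto
    then have "emeasure lborel {x0<..<x0 + d} = 0" by (rule null_setsD1)
    moreover have "emeasure lborel {x0<..<x0 + d} = ennreal (x0 + d - x0)" using d by (intro emeasure_lborel_Ioo) auto
    ultimately show False using d by simp
  qed
  show ?thesis
  proof (rule that)
    show "scaled_filters u A C \<alpha> winf"
      by unfold_locales (fact us \<alpha> bound wl wnz)+
    show "wcoef g Y j k \<omega> = (2 ^ j) powr (real K - 1 / 2) *
       (\<Sum>\<tau>\<in>{- int (A * 2 ^ j)..int (A * 2 ^ j)}. u j \<tau> * (bdiff ^^ K) (\<lambda>s. Y s \<omega>) (2 ^ j * k - \<tau>))"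
      for Y :: "int \<Rightarrow> 'a \<Rightarrow> real" and j k \<omega>
    proof -
      have "(2 ^ j :: real) powr (real K - 1 / 2) * (2 ^ j) powr (1 / 2 - real K) = 1"
        unfolding powr_add[symmetric] by simp
      then have "(2 ^ j :: real) powr (real K - 1 / 2) * (u j \<tau> * z) = h j \<tau> * z" for \<tau> z
        by (simp add: u_def mult.assoc[symmetric])
      moreover have "wcoef g Y j k \<omega> = (\<Sum>\<tau>\<in>{- int (A * 2 ^ j)..int (A * 2 ^ j)}. h j \<tau> * (bdiff ^^ K) (\<lambda>s. Y s \<omega>) (2 ^ j * k - \<tau>))"
        by (rule wcoef_reduce[where h = "h j"]) (rule hs, assumption, rule hg)
      ultimately show ?thesis unfolding sum_distrib_left by (simp only:)
    qed
  qed
qed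

section \<open>Convergence of the normalised scalogram\<close>

locale subordinated = lrd_filters u A C \<alpha> winf \<rho> a c + gaussian_process M X "fcoef \<rho>"
  for u A C \<alpha> winf \<rho> a c and M :: "'a measure" and X
begin

abbreviation J :: "nat \<Rightarrow> int set" where
  "J j \<equiv> {- int (A * 2 ^ j)..int (A * 2 ^ j)}"

definition wsum :: "(real \<Rightarrow> real) \<Rightarrow> nat \<Rightarrow> nat \<Rightarrow> 'a \<Rightarrow> real" where
  "wsum F j k \<omega> = (\<Sum>\<tau>\<in>J j. u j \<tau> * F (X (2 ^ j * int k - \<tau>) \<omega>))"

lemma wsum_measurable:
  assumes [measurable]: "F \<in> borel_measurable borel"
  shows "wsum F j k \<in> borel_measurable M"
  unfolding wsum_def using X_meas by measurable

lemma wsum_add: "wsum (\<lambda>x. a1 * F x + a2 * G x) j k \<omega> = a1 * wsum F j k \<omega> + a2 * wsum G j k \<omega>"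
  unfolding wsum_def by (simp add: sum.distrib sum_distrib_left algebra_simps)

text \<open>A crude Cauchy-Schwarz bound. Its constant depends on j, so apart from integrability it
  serves to remove a truncation at fixed j.\<close>

lemma wsum_L2_bound:
  assumes F: "F \<in> borel_measurable borel" "integrable std_gauss (\<lambda>x. (F x)\<^sup>2)"
  shows "integrable M (\<lambda>\<omega>. (wsum F j k \<omega>)\<^sup>2)"
    and "expectation (\<lambda>\<omega>. (wsum F j k \<omega>)\<^sup>2) \<le> (\<Sum>\<tau>\<in>J j. (u j \<tau>)\<^sup>2) * (real (card (J j)) * gauss_int (\<lambda>x. (F x)\<^sup>2))"
proof -
  have m: "(\<lambda>x. (F x)\<^sup>2) \<in> borel_measurable borel" using F(1) by measurable
  have i: "integrable M (\<lambda>\<omega>. (F (X t \<omega>))\<^sup>2)" for t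
    using X_std_gauss(1)[OF m] F(2) by simp
  let ?b = "\<lambda>\<omega>. (\<Sum>\<tau>\<in>J j. (u j \<tau>)\<^sup>2) * (\<Sum>\<tau>\<in>J j. (F (X (2 ^ j * int k - \<tau>) \<omega>))\<^sup>2)"
  have ib: "integrable M ?b" by (intro integrable_mult_right Bochner_Integration.integrable_sum i)
  have le: "(wsum F j k \<omega>)\<^sup>2 \<le> ?b \<omega>" for \<omega>
    unfolding wsum_def by (rule Cauchy_Schwarz_ineq_sum)
  show I: "integrable M (\<lambda>\<omega>. (wsum F j k \<omega>)\<^sup>2)"
  proof (rule Bochner_Integration.integrable_bound[OF ib])
    show "(\<lambda>\<omega>. (wsum F j k \<omega>)\<^sup>2) \<in> borel_measurable M" using wsum_measurable[OF F(1)] by measurable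
    show "AE \<omega> in M. norm ((wsum F j k \<omega>)\<^sup>2) \<le> norm (?b \<omega>)"
      by (intro AE_I2) (simp only: real_norm_def abs_power2 order_trans[OF le abs_ge_self])
  qed
  have "expectation (\<lambda>\<omega>. (wsum F j k \<omega>)\<^sup>2) \<le> expectation ?b" by (intro integral_mono I ib le)
  also have "\<dots> = (\<Sum>\<tau>\<in>J j. (u j \<tau>)\<^sup>2) * (\<Sum>\<tau>\<in>J j. expectation (\<lambda>\<omega>. (F (X (2 ^ j * int k - \<tau>) \<omega>))\<^sup>2))"
    by (simp add: Bochner_Integration.integral_sum i)
  also have "\<dots> = (\<Sum>\<tau>\<in>J j. (u j \<tau>)\<^sup>2) * (real (card (J j)) * gauss_int (\<lambda>x. (F x)\<^sup>2))"
    unfolding X_std_gauss(2)[OF m] by simp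
  finally show "expectation (\<lambda>\<omega>. (wsum F j k \<omega>)\<^sup>2) \<le> (\<Sum>\<tau>\<in>J j. (u j \<tau>)\<^sup>2) * (real (card (J j)) * gauss_int (\<lambda>x. (F x)\<^sup>2))" .
qed

lemma wsum_hermite_mult:
  "integrable M (\<lambda>\<omega>. wsum (hermite p) j k \<omega> * wsum (hermite q) j k \<omega>)"
  "expectation (\<lambda>\<omega>. wsum (hermite p) j k \<omega> * wsum (hermite q) j k \<omega>) = (if p = q then fact p * bil (u j) (A * 2 ^ j) (\<lambda>t. r t ^ p) else 0)"
proof -
  let ?h = "\<lambda>s t \<omega>. hermite p (X (2 ^ j * int k - s) \<omega>) * hermite q (X (2 ^ j * int k - t) \<omega>)"
  have e: "wsum (hermite p) j k \<omega> * wsum (hermite q) j k \<omega> = (\<Sum>s\<in>J j. \<Sum>t\<in>J j. (u j s * u j t) * ?h s t \<omega>)" for \<omega>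
    unfolding wsum_def sum_product by (simp add: ac_simps)
  show "integrable M (\<lambda>\<omega>. wsum (hermite p) j k \<omega> * wsum (hermite q) j k \<omega>)"
    unfolding e by (intro Bochner_Integration.integrable_sum integrable_mult_right hermite_two(1))
  have "expectation (\<lambda>\<omega>. wsum (hermite p) j k \<omega> * wsum (hermite q) j k \<omega>)
     = (\<Sum>s\<in>J j. \<Sum>t\<in>J j. (u j s * u j t) * (if p = q then fact p * r (2 ^ j * int k - s - (2 ^ j * int k - t)) ^ p else 0))"
    unfolding e
    by (subst Bochner_Integration.integral_sum, intro Bochner_Integration.integrable_sum integrable_mult_right hermite_two(1),
        intro sum.cong refl, subst Bochner_Integration.integral_sum, intro integrable_mult_right hermite_two(1))
       (simp only: integral_mult_right_zero hermite_two(2))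
  also have "\<dots> = (if p = q then fact p * bil (u j) (A * 2 ^ j) (\<lambda>t. r t ^ p) else 0)"
  proof -
    have "r (2 ^ j * int k - s - (2 ^ j * int k - t)) = r (s - t)" for s t
      using r_even[of "s - t"] by (simp add: algebra_simps)
    then show ?thesis by (simp add: bil_def sum_distrib_left ac_simps)
  qed
  finally show "expectation (\<lambda>\<omega>. wsum (hermite p) j k \<omega> * wsum (hermite q) j k \<omega>) = (if p = q then fact p * bil (u j) (A * 2 ^ j) (\<lambda>t. r t ^ p) else 0)" .
qed

text \<open>By orthogonality the second moment of a partial Hermite sum is a combination of the
  forms of r^p with p > q. \<open>bil_power_remainder\<close> bounds them uniformly in p, and
  Bessel's inequality bounds the weights, so the truncation index can go to infinity at fixed
  j.\<close>

lemma wsum_remainder: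
  assumes F: "F \<in> borel_measurable borel" "integrable std_gauss (\<lambda>x. (F x)\<^sup>2)"
    and rank: "\<And>p. p \<le> q \<Longrightarrow> hcoef F p = 0" and qa: "real q * a < 1"
  shows "\<exists>E. E \<longlonglongrightarrow> 0 \<and> (\<forall>j k. expectation (\<lambda>\<omega>. (wsum F j k \<omega>)\<^sup>2) \<le> E j * (2 ^ j) powr (2 - real q * a))"
proof -
  obtain E where E: "E \<longlonglongrightarrow> 0" and Eb: "\<And>j m. m > q \<Longrightarrow> bil (u j) (A * 2 ^ j) (\<lambda>t. r t ^ m) \<le> E j * (2 ^ j) powr (2 - real q * a)"
    using bil_power_remainder[OF qa] by blast
  let ?V = "gauss_int (\<lambda>x. (F x)\<^sup>2)" and ?B = "\<lambda>j::nat. (2 ^ j :: real) powr (2 - real q * a)"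
  have V: "0 \<le> ?V" by (intro Bochner_Integration.integral_nonneg) simp
  \<comment> \<open>\<open>E j\<close> may be negative, whereas Bessel's inequality is multiplied by
    a nonnegative number.\<close>
  have part: "expectation (\<lambda>\<omega>. (wsum (hpart F N) j k \<omega>)\<^sup>2) \<le> ?V * (max (E j) 0 * ?B j)" for N j k
  proof -
    have w: "wsum (hpart F N) j k \<omega> = (\<Sum>p<N. hcoef F p / fact p * wsum (hermite p) j k \<omega>)" for \<omega>
      unfolding wsum_def hpart_def[OF F] sum_distrib_left by (subst sum.swap) (simp add: ac_simps)
    have "expectation (\<lambda>\<omega>. (wsum (hpart F N) j k \<omega>)\<^sup>2)
      = expectation (\<lambda>\<omega>. \<Sum>p<N. \<Sum>p'<N. (hcoef F p / fact p * (hcoef F p' / fact p')) * (wsum (hermite p) j k \<omega> * wsum (hermite p') j k \<omega>))"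
      unfolding w power2_eq_square sum_product by (simp add: ac_simps)
    also have "\<dots> = (\<Sum>p<N. \<Sum>p'<N. (hcoef F p / fact p * (hcoef F p' / fact p')) * (if p = p' then fact p * bil (u j) (A * 2 ^ j) (\<lambda>t. r t ^ p) else 0))"
      by (subst Bochner_Integration.integral_sum, intro Bochner_Integration.integrable_sum integrable_mult_right wsum_hermite_mult(1),
          intro sum.cong refl, subst Bochner_Integration.integral_sum, intro integrable_mult_right wsum_hermite_mult(1))
         (simp only: integral_mult_right_zero wsum_hermite_mult(2))
    also have "\<dots> = (\<Sum>p<N. (hcoef F p)\<^sup>2 / fact p * bil (u j) (A * 2 ^ j) (\<lambda>t. r t ^ p))"
      by (intro sum.cong refl) (simp add: power2_eq_square if_distrib[of "\<lambda>x. _ * x"] cong: if_cong)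
    also have "\<dots> \<le> (\<Sum>p<N. (hcoef F p)\<^sup>2 / fact p * (max (E j) 0 * ?B j))"
    proof (intro sum_mono)
      fix p
      show "(hcoef F p)\<^sup>2 / fact p * bil (u j) (A * 2 ^ j) (\<lambda>t. r t ^ p) \<le> (hcoef F p)\<^sup>2 / fact p * (max (E j) 0 * ?B j)"
      proof (cases "p \<le> q")
        case True then show ?thesis by (simp add: rank)
      next
        case False
        then have "bil (u j) (A * 2 ^ j) (\<lambda>t. r t ^ p) \<le> E j * ?B j" by (intro Eb) simp
        also have "\<dots> \<le> max (E j) 0 * ?B j" by (intro mult_right_mono) auto
        finally show ?thesis by (intro mult_left_mono) auto
      qed
    qed
    also have "\<dots> = (\<Sum>p<N. (hcoef F p)\<^sup>2 / fact p) * (max (E j) 0 * ?B j)" by (simp add: sum_distrib_right)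
    also have "\<dots> \<le> ?V * (max (E j) 0 * ?B j)"
      using hcoef_bessel[OF F] by (intro mult_right_mono) auto
    finally show ?thesis .
  qed
  have "expectation (\<lambda>\<omega>. (wsum F j k \<omega>)\<^sup>2) \<le> (2 * ?V * max (E j) 0) * ?B j" for j k
  proof -
    \<comment> \<open>Depends on j but not on N, so the second summand below disappears as N tends
      to infinity.\<close>
    define Q where "Q = (\<Sum>\<tau>\<in>J j. (u j \<tau>)\<^sup>2) * real (card (J j))"
    have mp: "hpart F N \<in> borel_measurable borel" for N using hpart_measurable[OF F] .
    have D: "(\<lambda>x. F x - hpart F N x) \<in> borel_measurable borel" "integrable std_gauss (\<lambda>x. (F x - hpart F N x)\<^sup>2)" for N
      using F(1) mp[of N] hpart_L2[OF F, of N] by (auto intro!: integrable_diff_L2 F(2))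
    have "expectation (\<lambda>\<omega>. (wsum F j k \<omega>)\<^sup>2) \<le> 2 * (?V * (max (E j) 0 * ?B j)) + 2 * (Q * gauss_int (\<lambda>x. (F x - hpart F N x)\<^sup>2))" for N
    proof -
      note I1 = wsum_L2_bound(1)[OF mp[of N] hpart_L2[OF F], of j k]
      note I2 = wsum_L2_bound(1)[OF D, of N j k]
      have "expectation (\<lambda>\<omega>. (wsum F j k \<omega>)\<^sup>2) \<le> expectation (\<lambda>\<omega>. 2 * (wsum (hpart F N) j k \<omega>)\<^sup>2 + 2 * (wsum (\<lambda>x. F x - hpart F N x) j k \<omega>)\<^sup>2)"
      proof (intro integral_mono wsum_L2_bound(1)[OF F] Bochner_Integration.integrable_add integrable_mult_right I1 I2)
        fix \<omega>
        have "wsum F j k \<omega> = wsum (hpart F N) j k \<omega> + wsum (\<lambda>x. F x - hpart F N x) j k \<omega>"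
          unfolding wsum_def sum.distrib[symmetric] by (simp add: algebra_simps)
        moreover have "(x + y)\<^sup>2 \<le> 2 * x\<^sup>2 + 2 * y\<^sup>2" for x y :: real
          using zero_le_power2[of "x - y"] by (simp add: power2_sum power2_diff)
        ultimately show "(wsum F j k \<omega>)\<^sup>2 \<le> 2 * (wsum (hpart F N) j k \<omega>)\<^sup>2 + 2 * (wsum (\<lambda>x. F x - hpart F N x) j k \<omega>)\<^sup>2"
          by simp
      qed
      also have "\<dots> = 2 * expectation (\<lambda>\<omega>. (wsum (hpart F N) j k \<omega>)\<^sup>2) + 2 * expectation (\<lambda>\<omega>. (wsum (\<lambda>x. F x - hpart F N x) j k \<omega>)\<^sup>2)"
        using I1 I2 by simp
      also have "\<dots> \<le> 2 * (?V * (max (E j) 0 * ?B j)) + 2 * (Q * gauss_int (\<lambda>x. (F x - hpart F N x)\<^sup>2))"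
        using part[of N j k] wsum_L2_bound(2)[OF D, of N j k] unfolding Q_def mult.assoc by (intro add_mono mult_left_mono) auto
      finally show ?thesis .
    qed
    moreover have "(\<lambda>N. 2 * (?V * (max (E j) 0 * ?B j)) + 2 * (Q * gauss_int (\<lambda>x. (F x - hpart F N x)\<^sup>2))) \<longlonglongrightarrow> 2 * (?V * (max (E j) 0 * ?B j)) + 2 * (Q * 0)"
      by (intro tendsto_intros hermite_expansion F)
    ultimately have "expectation (\<lambda>\<omega>. (wsum F j k \<omega>)\<^sup>2) \<le> 2 * (?V * (max (E j) 0 * ?B j)) + 2 * (Q * 0)"
      by (intro LIMSEQ_le_const) auto
    then show ?thesis by simp
  qed
  moreover have "(\<lambda>j. 2 * ?V * max (E j) 0) \<longlonglongrightarrow> 2 * ?V * max 0 0"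
    by (intro tendsto_intros E)
  ultimately show ?thesis by (intro exI[of _ "\<lambda>j. 2 * ?V * max (E j) 0"]) auto
qed

end

lemma sum_swap_inner: "(\<Sum>i\<in>I. \<Sum>k\<in>K. \<Sum>p\<in>P. f i k p) = (\<Sum>p\<in>P. \<Sum>i\<in>I. \<Sum>k\<in>K. f i k p)"
proof -
  have "(\<Sum>i\<in>I. \<Sum>k\<in>K. \<Sum>p\<in>P. f i k p) = (\<Sum>i\<in>I. \<Sum>p\<in>P. \<Sum>k\<in>K. f i k p)"
    by (rule sum.cong[OF refl], rule sum.swap)
  also have "\<dots> = (\<Sum>p\<in>P. \<Sum>i\<in>I. \<Sum>k\<in>K. f i k p)" by (rule sum.swap)
  finally show ?thesis .
qed

context subordinated
begin

lemma square_sum_moments: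
  fixes q n j
  defines "S \<equiv> \<lambda>\<omega>. \<Sum>k<n. (wsum (hermite q) j k \<omega>)\<^sup>2"
  shows "integrable M (\<lambda>\<omega>. (S \<omega>)\<^sup>2)"
    and "expectation (\<lambda>\<omega>. (S \<omega>)\<^sup>2) = (\<Sum>(x, y)\<in>{(x, y). x + y \<le> q}. fact q ^ 4 / (fact x * fact y * fact (q - x - y))\<^sup>2 * quartic n j x y (q - x - y))"
proof -
  let ?I = "{..<n} \<times> J j \<times> J j"
  let ?c = "(\<lambda>(k, s, t). u j s * u j t) :: nat \<times> int \<times> int \<Rightarrow> real"
  let ?\<phi> = "(\<lambda>(k, s, t). 2 ^ j * int k - s) :: nat \<times> int \<times> int \<Rightarrow> int"
  let ?\<psi> = "(\<lambda>(k, s, t). 2 ^ j * int k - t) :: nat \<times> int \<times> int \<Rightarrow> int"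
  let ?h = "\<lambda>i \<omega>. hermite q (X (?\<phi> i) \<omega>) * hermite q (X (?\<psi> i) \<omega>)"
  let ?P = "{(x, y). x + y \<le> q}"
  let ?co = "\<lambda>x y. fact q ^ 4 / (fact x * fact y * fact (q - x - y))\<^sup>2 :: real"
  let ?m = "\<lambda>x y i i'. (r (?\<phi> i - ?\<psi> i) * r (?\<phi> i' - ?\<psi> i')) ^ x * (r (?\<phi> i - ?\<phi> i') * r (?\<psi> i - ?\<psi> i')) ^ y
     * (r (?\<phi> i - ?\<psi> i') * r (?\<psi> i - ?\<phi> i')) ^ (q - x - y)"
  have S: "S \<omega> = (\<Sum>i\<in>?I. ?c i * ?h i \<omega>)" for \<omega>
    unfolding S_def sum_triple prod.case wsum_def power2_eq_square sum_product by (simp add: ac_simps)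
  have S2: "(S \<omega>)\<^sup>2 = (\<Sum>i\<in>?I. \<Sum>i'\<in>?I. (?c i * ?c i') * (?h i \<omega> * ?h i' \<omega>))" for \<omega>
    unfolding S power2_eq_square sum_product by (simp add: ac_simps)
  show "integrable M (\<lambda>\<omega>. (S \<omega>)\<^sup>2)"
    unfolding S2 by (intro Bochner_Integration.integrable_sum integrable_mult_right hermite_four(1))
  have "expectation (\<lambda>\<omega>. (S \<omega>)\<^sup>2) = (\<Sum>i\<in>?I. \<Sum>i'\<in>?I. (?c i * ?c i') * (\<Sum>(x, y)\<in>?P. ?co x y * ?m x y i i'))"
    unfolding S2
    by (subst Bochner_Integration.integral_sum, intro Bochner_Integration.integrable_sum integrable_mult_right hermite_four(1),
        intro sum.cong refl, subst Bochner_Integration.integral_sum, intro integrable_mult_right hermite_four(1))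
       (simp only: integral_mult_right_zero hermite_four(2))
  also have "\<dots> = (\<Sum>i\<in>?I. \<Sum>i'\<in>?I. \<Sum>p\<in>?P. ?co (fst p) (snd p) * ((?c i * ?c i') * ?m (fst p) (snd p) i i'))"
    unfolding sum_distrib_left by (intro sum.cong refl) (simp add: split_beta ac_simps)
  also have "\<dots> = (\<Sum>p\<in>?P. \<Sum>i\<in>?I. \<Sum>i'\<in>?I. ?co (fst p) (snd p) * ((?c i * ?c i') * ?m (fst p) (snd p) i i'))"
    by (rule sum_swap_inner)
  also have "\<dots> = (\<Sum>(x, y)\<in>?P. ?co x y * quartic n j x y (q - x - y))"
  proof (intro sum.cong refl)
    fix p
    have e: "r (t - s) = r (s - t)" for s t
      using r_even[of "s - t"] by simp
    have "(\<Sum>i\<in>?I. \<Sum>i'\<in>?I. (?c i * ?c i') * ?m (fst p) (snd p) i i') = quartic n j (fst p) (snd p) (q - fst p - snd p)"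
      unfolding quartic_def Let_def
      by (intro sum.cong refl) (simp add: split_beta e power_mult_distrib ac_simps)
    then have "(\<Sum>i\<in>?I. \<Sum>i'\<in>?I. ?co (fst p) (snd p) * ((?c i * ?c i') * ?m (fst p) (snd p) i i'))
      = ?co (fst p) (snd p) * quartic n j (fst p) (snd p) (q - fst p - snd p)"
      by (simp only: sum_distrib_left[symmetric])
    then show "(\<Sum>i\<in>?I. \<Sum>i'\<in>?I. ?co (fst p) (snd p) * ((?c i * ?c i') * ?m (fst p) (snd p) i i'))
      = (case p of (x, y) \<Rightarrow> ?co x y * quartic n j x y (q - x - y))"
      by (simp only: prod.case_eq_if)
  qed
  finally show "expectation (\<lambda>\<omega>. (S \<omega>)\<^sup>2) = (\<Sum>(x, y)\<in>?P. ?co x y * quartic n j x y (q - x - y))" .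
qed

text \<open>By \<open>wsum_hermite_mult\<close>, the second moment of
  \<open>wsum (hermite q) j k\<close>, the same for all k.\<close>

definition hvar :: "nat \<Rightarrow> nat \<Rightarrow> real" where
  "hvar q j = fact q * bil (u j) (A * 2 ^ j) (\<lambda>t. r t ^ q)"

text \<open>This is the square of the mean, which the variance cancels.\<close>

lemma quartic_disconnected: "quartic n j q 0 0 = (real n * bil (u j) (A * 2 ^ j) (\<lambda>t. r t ^ q))\<^sup>2"
proof -
  let ?cf = "(\<lambda>(k, s, t). u j s * u j t * r (s - t) ^ q) :: nat \<times> int \<times> int \<Rightarrow> real"
  have "(\<Sum>i\<in>{..<n} \<times> J j \<times> J j. ?cf i) = real n * bil (u j) (A * 2 ^ j) (\<lambda>t. r t ^ q)"
    unfolding sum_triple bil_def by simp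
  then show ?thesis unfolding quartic_def Let_def power2_eq_square by (simp only: sum_product[symmetric] power_0 mult_1_right)
qed

text \<open>After the disconnected diagram has cancelled, finitely many diagrams remain, each
  covered by \<open>quartic_small\<close>. Uniformity in j is essential, because the scale grows
  together with the sample size in no prescribed relation to n.\<close>

lemma square_mean_variance:
  assumes qa: "real q * a < 1" and \<epsilon>: "\<epsilon> > 0"
  shows "\<forall>\<^sub>F n in sequentially. \<forall>j. expectation (\<lambda>\<omega>. ((1 / real n) * (\<Sum>k<n. (wsum (hermite q) j k \<omega>)\<^sup>2) - hvar q j)\<^sup>2)
     \<le> \<epsilon> * (2 ^ j) powr (4 - 2 * (real q * a))"
proof -
  let ?P = "{(x, y). x + y \<le> q}" and ?Q = "{(x, y). x + y \<le> q \<and> x < q}"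
  let ?co = "\<lambda>x y. fact q ^ 4 / (fact x * fact y * fact (q - x - y))\<^sup>2 :: real"
  have finP: "finite ?P" by (rule finite_subset[of _ "{..q} \<times> {..q}"]) auto
  have finQ: "finite ?Q" by (rule finite_subset[OF _ finP]) auto
  define Cf where "Cf = (\<Sum>(x, y)\<in>?Q. ?co x y)"
  have Cf: "Cf \<ge> 0" unfolding Cf_def by (intro sum_nonneg) auto
  \<comment> \<open>Divides the allowance by the total weight of the connected diagrams, plus 1 to
    keep the denominator positive.\<close>
  define \<epsilon>' where "\<epsilon>' = \<epsilon> / (Cf + 1)"
  have \<epsilon>': "\<epsilon>' > 0" using \<epsilon> Cf by (simp add: \<epsilon>'_def)
  have "\<forall>\<^sub>F n in sequentially. \<forall>p\<in>?Q. \<forall>j. quartic n j (fst p) (snd p) (q - fst p - snd p) \<le> \<epsilon>' * (real n)\<^sup>2 * (2 ^ j) powr (4 - 2 * (real q * a))"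
  proof (rule eventually_ball_finite[OF finQ], intro ballI)
    fix p assume "p \<in> ?Q"
    then show "\<forall>\<^sub>F n in sequentially. \<forall>j. quartic n j (fst p) (snd p) (q - fst p - snd p) \<le> \<epsilon>' * (real n)\<^sup>2 * (2 ^ j) powr (4 - 2 * (real q * a))"
      using quartic_small[of "fst p" "snd p" "q - fst p - snd p" q, OF _ _ qa \<epsilon>']
      unfolding eventually_sequentially by force
  qed
  then show ?thesis
    using eventually_gt_at_top[of 0]
  proof eventually_elim
    fix n :: nat assume H: "\<forall>p\<in>?Q. \<forall>j. quartic n j (fst p) (snd p) (q - fst p - snd p) \<le> \<epsilon>' * (real n)\<^sup>2 * (2 ^ j) powr (4 - 2 * (real q * a))"
      and n: "n > 0"
    show "\<forall>j. expectation (\<lambda>\<omega>. ((1 / real n) * (\<Sum>k<n. (wsum (hermite q) j k \<omega>)\<^sup>2) - hvar q j)\<^sup>2) \<le> \<epsilon> * (2 ^ j) powr (4 - 2 * (real q * a))"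
    proof
      fix j
      let ?B = "(2 ^ j :: real) powr (4 - 2 * (real q * a))"
      let ?S = "\<lambda>\<omega>. \<Sum>k<n. (wsum (hermite q) j k \<omega>)\<^sup>2"
      note S2 = square_sum_moments[where n = n and q = q and j = j]
      have i1: "integrable M (\<lambda>\<omega>. (wsum (hermite q) j k \<omega>)\<^sup>2)" for k
        using wsum_hermite_mult(1)[of q j k q] by (simp add: power2_eq_square)
      have e1: "expectation (\<lambda>\<omega>. (wsum (hermite q) j k \<omega>)\<^sup>2) = hvar q j" for k
        using wsum_hermite_mult(2)[of q j k q] by (simp add: power2_eq_square hvar_def)
      have iS: "integrable M ?S" by (intro Bochner_Integration.integrable_sum i1)
      have eS: "expectation ?S = real n * hvar q j"
        by (simp add: Bochner_Integration.integral_sum i1 e1)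
      have "expectation (\<lambda>\<omega>. ((1 / real n) * ?S \<omega> - hvar q j)\<^sup>2)
        = expectation (\<lambda>\<omega>. (1 / (real n)\<^sup>2) * (?S \<omega>)\<^sup>2 + (- 2 * hvar q j / real n) * ?S \<omega> + (hvar q j)\<^sup>2)"
        by (intro Bochner_Integration.integral_cong refl) (simp add: power2_diff power_divide power_mult_distrib)
      also have "\<dots> = (1 / (real n)\<^sup>2) * expectation (\<lambda>\<omega>. (?S \<omega>)\<^sup>2) + (- 2 * hvar q j / real n) * expectation ?S + (hvar q j)\<^sup>2"
        using S2(1) iS by (subst Bochner_Integration.integral_add, (simp; fail), (simp; fail), subst Bochner_Integration.integral_add) (simp_all add: prob_space)
      also have "\<dots> = (1 / (real n)\<^sup>2) * expectation (\<lambda>\<omega>. (?S \<omega>)\<^sup>2) - (hvar q j)\<^sup>2"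
        unfolding eS using n by (simp add: power2_eq_square)
      finally have V: "expectation (\<lambda>\<omega>. ((1 / real n) * ?S \<omega> - hvar q j)\<^sup>2) = (1 / (real n)\<^sup>2) * expectation (\<lambda>\<omega>. (?S \<omega>)\<^sup>2) - (hvar q j)\<^sup>2" .
      have V2: "expectation (\<lambda>\<omega>. (?S \<omega>)\<^sup>2) = (\<Sum>(x, y)\<in>?Q. ?co x y * quartic n j x y (q - x - y)) + (real n * hvar q j)\<^sup>2"
      proof -
        have "?P = insert (q, 0) ?Q" by auto
        moreover have "(q, 0) \<notin> ?Q" by simp
        ultimately have "expectation (\<lambda>\<omega>. (?S \<omega>)\<^sup>2) = ?co q 0 * quartic n j q 0 (q - q - 0) + (\<Sum>(x, y)\<in>?Q. ?co x y * quartic n j x y (q - x - y))"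
          unfolding S2(2) using finQ by simp
        also have "?co q 0 * quartic n j q 0 (q - q - 0) = (real n * hvar q j)\<^sup>2"
          by (simp add: quartic_disconnected hvar_def power_mult_distrib power2_eq_square power4_eq_xxxx)
        finally show ?thesis by simp
      qed
      have "(\<Sum>(x, y)\<in>?Q. ?co x y * quartic n j x y (q - x - y)) \<le> (\<Sum>(x, y)\<in>?Q. ?co x y * (\<epsilon>' * (real n)\<^sup>2 * ?B))"
      proof (intro sum_mono)
        fix p assume p: "p \<in> ?Q"
        show "(case p of (x, y) \<Rightarrow> ?co x y * quartic n j x y (q - x - y)) \<le> (case p of (x, y) \<Rightarrow> ?co x y * (\<epsilon>' * (real n)\<^sup>2 * ?B))"
          unfolding split_beta by (rule mult_left_mono[OF H[rule_format, OF p]]) simp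
      qed
      also have "\<dots> = Cf * (\<epsilon>' * (real n)\<^sup>2 * ?B)" unfolding Cf_def sum_distrib_right split_beta ..
      finally have V3: "(\<Sum>(x, y)\<in>?Q. ?co x y * quartic n j x y (q - x - y)) \<le> Cf * (\<epsilon>' * (real n)\<^sup>2 * ?B)" .
      have "expectation (\<lambda>\<omega>. ((1 / real n) * ?S \<omega> - hvar q j)\<^sup>2) = (1 / (real n)\<^sup>2) * (\<Sum>(x, y)\<in>?Q. ?co x y * quartic n j x y (q - x - y))"
        unfolding V V2 using n by (simp add: distrib_left power_mult_distrib)
      also have "\<dots> \<le> (1 / (real n)\<^sup>2) * (Cf * (\<epsilon>' * (real n)\<^sup>2 * ?B))"
        by (rule mult_left_mono[OF V3]) simp
      also have "\<dots> = Cf * \<epsilon>' * ?B"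
        using n by simp
      also have "\<dots> \<le> \<epsilon> * ?B"
      proof (intro mult_right_mono)
        have "Cf * \<epsilon>' = \<epsilon> * (Cf / (Cf + 1))" by (simp add: \<epsilon>'_def)
        also have "\<dots> \<le> \<epsilon> * 1" using Cf \<epsilon> by (intro mult_left_mono) auto
        finally show "Cf * \<epsilon>' \<le> \<epsilon>" by simp
      qed simp
      finally show "expectation (\<lambda>\<omega>. ((1 / real n) * ?S \<omega> - hvar q j)\<^sup>2) \<le> \<epsilon> * ?B" .
    qed
  qed
qed

lemma normalized_scalogram_L1:
  assumes G: "G \<in> borel_measurable borel" "integrable std_gauss (\<lambda>x. (G x)\<^sup>2)"
    and q: "1 \<le> q" "real q * a < 1"
    and rank: "hcoef G q \<noteq> 0" "\<And>p. p < q \<Longrightarrow> hcoef G p = 0"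
  shows "\<exists>L>0. \<forall>\<epsilon>>0. \<exists>n0 j0. \<forall>n\<ge>n0. \<forall>j\<ge>j0.
    expectation (\<lambda>\<omega>. \<bar>(1 / real n) * (\<Sum>k<n. (wsum G j k \<omega>)\<^sup>2) / (2 ^ j) powr (2 - real q * a) - L\<bar>) \<le> \<epsilon>"
proof -
  define \<beta> where "\<beta> = hcoef G q / fact q"
  have \<beta>: "\<beta> \<noteq> 0" using rank(1) by (simp add: \<beta>_def)
  define R where "R x = G x - \<beta> * hermite q x" for x
  have mR: "R \<in> borel_measurable borel" unfolding R_def[abs_def] using G(1) by measurable
  have bh: "integrable std_gauss (\<lambda>x. (\<beta> * hermite q x)\<^sup>2)"
    using power2_hermite_integrable[of q] by (simp add: power_mult_distrib)
  have L2R: "integrable std_gauss (\<lambda>x. (R x)\<^sup>2)"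
    unfolding R_def by (rule integrable_diff_L2[OF _ _ G(2) bh]) (use G(1) in simp_all)
  have rR: "hcoef R p = 0" if "p \<le> q" for p
  proof -
    have "hcoef R p = gauss_int (\<lambda>x. G x * hermite p x - \<beta> * (hermite q x * hermite p x))"
      unfolding hcoef_def[OF mR L2R] R_def by (simp add: algebra_simps)
    also have "\<dots> = hcoef G p - \<beta> * (if q = p then fact q * 1 ^ q else 0)"
      unfolding hcoef_def[OF G]
      by (subst Bochner_Integration.integral_diff[OF integrable_F_hermite[OF G] integrable_mult_right[OF std_gauss.hermite_two(1)]])
         (simp only: integral_mult_right_zero std_gauss.hermite_two(2))
    also have "\<dots> = 0" using that rank(2)[of p] by (cases "p = q") (auto simp: \<beta>_def)
    finally show ?thesis .
  qed
  let ?B = "\<lambda>j::nat. (2 ^ j :: real) powr (2 - real q * a)"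
  have B: "?B j > 0" for j by simp
  obtain E where E: "E \<longlonglongrightarrow> 0" and Eb: "\<And>j k. expectation (\<lambda>\<omega>. (wsum R j k \<omega>)\<^sup>2) \<le> E j * ?B j"
    using wsum_remainder[OF mR L2R rR q(2)] by blast
  obtain L0 where L0: "L0 > 0" "(\<lambda>j. bil (u j) (A * 2 ^ j) (\<lambda>t. r t ^ q) / ?B j) \<longlonglongrightarrow> L0"
    using bil_power_limit[OF q(2) q(1)] by blast
  define L where "L = \<beta>\<^sup>2 * (fact q * L0)"
  have L: "L > 0" using \<beta> L0(1) by (simp add: L_def)
  have vL: "(\<lambda>j. \<beta>\<^sup>2 * hvar q j / ?B j) \<longlonglongrightarrow> L"
  proof -
    have "(\<lambda>j. \<beta>\<^sup>2 * (fact q * (bil (u j) (A * 2 ^ j) (\<lambda>t. r t ^ q) / ?B j))) \<longlonglongrightarrow> L"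
      unfolding L_def by (intro tendsto_intros L0)
    then show ?thesis by (simp add: hvar_def)
  qed
  have "\<exists>n0 j0. \<forall>n\<ge>n0. \<forall>j\<ge>j0. expectation (\<lambda>\<omega>. \<bar>(1 / real n) * (\<Sum>k<n. (wsum G j k \<omega>)\<^sup>2) / ?B j - L\<bar>) \<le> \<epsilon>"
    if \<epsilon>: "\<epsilon> > 0" for \<epsilon>
  proof -
    \<comment> \<open>Each of four errors receives \<open>\<epsilon> / 4\<close>: e (L + 1) from the
      cross term on the leading part, (1 + 1/e) E(j) from the remainder, 2 \<beta>^2 e2 from the
      fluctuation of the leading squares, and the distance of the leading variance from L.\<close>
    define e where "e = \<epsilon> / (4 * (L + 1))"
    define e2 where "e2 = \<epsilon> / (8 * \<beta>\<^sup>2)"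
    have e: "e > 0" "e2 > 0" using \<epsilon> L \<beta> by (auto simp: e_def e2_def)
    have "(\<lambda>j. (1 + 1 / e) * E j) \<longlonglongrightarrow> (1 + 1 / e) * 0" by (intro tendsto_intros E)
    then have "\<forall>\<^sub>F j in sequentially. (1 + 1 / e) * E j < \<epsilon> / 4"
      using \<epsilon> by (intro order_tendstoD(2)) auto
    moreover have "\<forall>\<^sub>F j in sequentially. \<beta>\<^sup>2 * hvar q j / ?B j < L + 1"
      using vL by (rule order_tendstoD) simp
    moreover have "\<forall>\<^sub>F j in sequentially. \<bar>\<beta>\<^sup>2 * hvar q j / ?B j - L\<bar> < \<epsilon> / 4"
      using tendstoD[OF vL, of "\<epsilon> / 4"] \<epsilon> by (simp add: dist_real_def)
    ultimately have "\<forall>\<^sub>F j in sequentially. (1 + 1 / e) * E j < \<epsilon> / 4 \<and> \<beta>\<^sup>2 * hvar q j / ?B j < L + 1 \<and> \<bar>\<beta>\<^sup>2 * hvar q j / ?B j - L\<bar> < \<epsilon> / 4"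
      by eventually_elim simp
    then obtain j0 where j0: "\<And>j. j \<ge> j0 \<Longrightarrow> (1 + 1 / e) * E j < \<epsilon> / 4 \<and> \<beta>\<^sup>2 * hvar q j / ?B j < L + 1 \<and> \<bar>\<beta>\<^sup>2 * hvar q j / ?B j - L\<bar> < \<epsilon> / 4"
      by (auto simp: eventually_sequentially)
    obtain n1 where n1: "\<And>n j. n \<ge> n1 \<Longrightarrow> expectation (\<lambda>\<omega>. ((1 / real n) * (\<Sum>k<n. (wsum (hermite q) j k \<omega>)\<^sup>2) - hvar q j)\<^sup>2)
       \<le> e2\<^sup>2 * (2 ^ j) powr (4 - 2 * (real q * a))"
      using square_mean_variance[OF q(2), of "e2\<^sup>2"] e(2) by (auto simp: eventually_sequentially)
    show ?thesis
    proof (rule exI[of _ "max n1 1"], rule exI[of _ j0], intro allI impI)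
      fix n j assume nn: "max n1 1 \<le> n" and jj: "j0 \<le> j"
      then have n: "n \<ge> n1" "n > 0" by auto
      note jj' = j0[OF jj]
      let ?S = "\<lambda>\<omega>. (1 / real n) * (\<Sum>k<n. (wsum (hermite q) j k \<omega>)\<^sup>2)"
      have iH: "integrable M (\<lambda>\<omega>. (wsum (hermite q) j k \<omega>)\<^sup>2)" for k
        by (rule wsum_L2_bound(1)[OF hermite_measurable power2_hermite_integrable])
      have eH: "expectation (\<lambda>\<omega>. (wsum (hermite q) j k \<omega>)\<^sup>2) = hvar q j" for k
        using wsum_hermite_mult(2)[of q j k q] by (simp add: power2_eq_square hvar_def)
      have iR: "integrable M (\<lambda>\<omega>. (wsum R j k \<omega>)\<^sup>2)" for k by (rule wsum_L2_bound(1)[OF mR L2R])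
      have iG: "integrable M (\<lambda>\<omega>. (wsum G j k \<omega>)\<^sup>2)" for k by (rule wsum_L2_bound(1)[OF G])
      have iS2: "integrable M (\<lambda>\<omega>. (?S \<omega>)\<^sup>2)"
        using square_sum_moments(1)[where n = n and q = q and j = j] by (simp add: power_mult_distrib power_divide)
      have iS: "integrable M ?S" by (intro integrable_mult_right Bochner_Integration.integrable_sum iH)
      have iV: "integrable M (\<lambda>\<omega>. (?S \<omega> - hvar q j)\<^sup>2)"
        using iS iS2 by (intro integrable_diff_L2) auto
      let ?b1 = "\<lambda>\<omega>. (1 / real n) * (\<Sum>k<n. e * \<beta>\<^sup>2 * (wsum (hermite q) j k \<omega>)\<^sup>2 + (1 + 1 / e) * (wsum R j k \<omega>)\<^sup>2)"
      \<comment> \<open>The weight \<open>e2 * ?B j\<close> is the bound for the standard deviation,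
        so after taking expectations the two summands balance.\<close>
      let ?b2 = "\<lambda>\<omega>. \<beta>\<^sup>2 * ((?S \<omega> - hvar q j)\<^sup>2 / (e2 * ?B j) + e2 * ?B j)"
      have wG: "wsum G j k \<omega> = \<beta> * wsum (hermite q) j k \<omega> + wsum R j k \<omega>" for k \<omega>
        using wsum_add[of \<beta> "hermite q" 1 R j k \<omega>] by (simp add: R_def)
      have sq: "\<bar>(x + y)\<^sup>2 - x\<^sup>2\<bar> \<le> e * x\<^sup>2 + (1 + 1 / e) * y\<^sup>2" for x y :: real
      proof -
        have "(x + y)\<^sup>2 - x\<^sup>2 = 2 * (x * y) + y\<^sup>2" by (simp add: power2_sum)
        moreover have "2 * \<bar>x * y\<bar> \<le> e * x\<^sup>2 + y\<^sup>2 / e"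
        proof -
          have "0 \<le> (sqrt e * \<bar>x\<bar> - \<bar>y\<bar> / sqrt e)\<^sup>2" by simp
          also have "\<dots> = e * x\<^sup>2 + y\<^sup>2 / e - 2 * \<bar>x * y\<bar>"
            using e(1) by (simp add: power2_diff power_divide power_mult_distrib abs_mult)
          finally show ?thesis by simp
        qed
        moreover have "\<bar>2 * (x * y) + y\<^sup>2\<bar> \<le> 2 * \<bar>x * y\<bar> + y\<^sup>2"
          using abs_triangle_ineq[of "2 * (x * y)" "y\<^sup>2"] by (simp add: abs_mult)
        moreover have "(1 + 1 / e) * y\<^sup>2 = y\<^sup>2 + y\<^sup>2 / e" by (simp add: distrib_right)
        ultimately show ?thesis by linarith
      qed
      have b1: "\<bar>(1 / real n) * (\<Sum>k<n. (wsum G j k \<omega>)\<^sup>2) - \<beta>\<^sup>2 * ?S \<omega>\<bar> \<le> ?b1 \<omega>" for \<omega>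
      proof -
        have "(1 / real n) * (\<Sum>k<n. (wsum G j k \<omega>)\<^sup>2) - \<beta>\<^sup>2 * ?S \<omega> = (1 / real n) * (\<Sum>k<n. (wsum G j k \<omega>)\<^sup>2 - (\<beta> * wsum (hermite q) j k \<omega>)\<^sup>2)"
          by (simp add: sum_subtractf sum_distrib_left power_mult_distrib right_diff_distrib ac_simps)
        then have "\<bar>(1 / real n) * (\<Sum>k<n. (wsum G j k \<omega>)\<^sup>2) - \<beta>\<^sup>2 * ?S \<omega>\<bar> = (1 / real n) * \<bar>\<Sum>k<n. (wsum G j k \<omega>)\<^sup>2 - (\<beta> * wsum (hermite q) j k \<omega>)\<^sup>2\<bar>"
          by (simp add: abs_mult)
        also have "\<dots> \<le> (1 / real n) * (\<Sum>k<n. \<bar>(wsum G j k \<omega>)\<^sup>2 - (\<beta> * wsum (hermite q) j k \<omega>)\<^sup>2\<bar>)"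
          by (intro mult_left_mono sum_abs) simp
        also have "\<dots> \<le> (1 / real n) * (\<Sum>k<n. e * (\<beta> * wsum (hermite q) j k \<omega>)\<^sup>2 + (1 + 1 / e) * (wsum R j k \<omega>)\<^sup>2)"
          unfolding wG by (intro mult_left_mono sum_mono sq) simp
        finally show ?thesis by (simp add: power_mult_distrib mult.assoc)
      qed
      have b2: "\<beta>\<^sup>2 * \<bar>?S \<omega> - hvar q j\<bar> \<le> ?b2 \<omega>" for \<omega>
        using abs_mult_le_weighted[of "e2 * ?B j" "?S \<omega> - hvar q j" 1] e(2) B[of j]
        by (intro mult_left_mono) auto
      let ?Z = "\<lambda>\<omega>. (1 / real n) * (\<Sum>k<n. (wsum G j k \<omega>)\<^sup>2)"
      have pw: "\<bar>?Z \<omega> / ?B j - L\<bar> \<le> (?b1 \<omega> + ?b2 \<omega>) / ?B j + \<epsilon> / 4" for \<omega>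
      proof -
        define z1 where "z1 = (?Z \<omega> - \<beta>\<^sup>2 * ?S \<omega>) / ?B j"
        define z2 where "z2 = \<beta>\<^sup>2 * (?S \<omega> - hvar q j) / ?B j"
        define z3 where "z3 = \<beta>\<^sup>2 * hvar q j / ?B j - L"
        have "?Z \<omega> / ?B j - L = z1 + z2 + z3"
          unfolding z1_def z2_def z3_def by (simp only: diff_divide_distrib right_diff_distrib)
        moreover have "\<bar>z1\<bar> \<le> ?b1 \<omega> / ?B j"
          using divide_right_mono[OF b1[of \<omega>], of "?B j"] unfolding z1_def by (simp add: abs_divide)
        moreover have "\<bar>z2\<bar> \<le> ?b2 \<omega> / ?B j"
          using divide_right_mono[OF b2[of \<omega>], of "?B j"] unfolding z2_def by (simp add: abs_divide abs_mult)
        moreover have "\<bar>z3\<bar> \<le> \<epsilon> / 4" using jj' by (simp add: z3_def)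
        ultimately have "\<bar>?Z \<omega> / ?B j - L\<bar> \<le> ?b1 \<omega> / ?B j + ?b2 \<omega> / ?B j + \<epsilon> / 4"
          by linarith
        then show ?thesis by (simp only: add_divide_distrib)
      qed
      have i1: "integrable M ?b1"
        by (intro integrable_mult_right Bochner_Integration.integrable_sum Bochner_Integration.integrable_add iH iR)
      have i2: "integrable M ?b2"
        by (intro integrable_mult_right Bochner_Integration.integrable_add integrable_divide iV) simp
      have iZ: "integrable M (\<lambda>\<omega>. \<bar>?Z \<omega> / ?B j - L\<bar>)"
        by (intro integrable_abs Bochner_Integration.integrable_diff integrable_divide integrable_mult_right Bochner_Integration.integrable_sum iG) simp
      have "expectation ?b1 = (1 / real n) * (\<Sum>k<n. e * \<beta>\<^sup>2 * expectation (\<lambda>\<omega>. (wsum (hermite q) j k \<omega>)\<^sup>2) + (1 + 1 / e) * expectation (\<lambda>\<omega>. (wsum R j k \<omega>)\<^sup>2))"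
        unfolding integral_mult_right_zero
        by (subst Bochner_Integration.integral_sum, intro Bochner_Integration.integrable_add integrable_mult_right iH iR,
            intro arg_cong[where f = "\<lambda>z. 1 / real n * z"] sum.cong refl,
            subst Bochner_Integration.integral_add, intro integrable_mult_right iH, intro integrable_mult_right iR)
           (simp only: integral_mult_right_zero)
      also have "\<dots> \<le> (1 / real n) * (\<Sum>k<n. e * \<beta>\<^sup>2 * hvar q j + (1 + 1 / e) * (E j * ?B j))"
        unfolding eH using e(1) by (intro mult_left_mono sum_mono add_left_mono Eb) auto
      also have "\<dots> = e * \<beta>\<^sup>2 * hvar q j + (1 + 1 / e) * (E j * ?B j)" using n(2) by simp
      finally have E1: "expectation ?b1 \<le> e * \<beta>\<^sup>2 * hvar q j + (1 + 1 / e) * (E j * ?B j)" .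
      have "expectation ?b2 = \<beta>\<^sup>2 * (expectation (\<lambda>\<omega>. (?S \<omega> - hvar q j)\<^sup>2) / (e2 * ?B j) + e2 * ?B j)"
        unfolding integral_mult_right_zero using iV
        by (subst Bochner_Integration.integral_add) (simp_all add: prob_space)
      also have "\<dots> \<le> \<beta>\<^sup>2 * (e2\<^sup>2 * (2 ^ j) powr (4 - 2 * (real q * a)) / (e2 * ?B j) + e2 * ?B j)"
        using e(2) B[of j] by (intro mult_left_mono add_right_mono divide_right_mono n1[OF n(1)]) auto
      also have e2e: "e2\<^sup>2 * (2 ^ j) powr (4 - 2 * (real q * a)) / (e2 * ?B j) = e2 * ?B j"
      proof -
        have "(2 ^ j :: real) powr (4 - 2 * (real q * a)) = ?B j * ?B j" unfolding powr_add[symmetric] by (simp add: ac_simps)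
        then show ?thesis using e(2) B[of j] by (simp add: power2_eq_square)
      qed
      finally have E2: "expectation ?b2 \<le> \<beta>\<^sup>2 * (e2 * ?B j + e2 * ?B j)" .
      have "expectation (\<lambda>\<omega>. \<bar>?Z \<omega> / ?B j - L\<bar>) \<le> expectation (\<lambda>\<omega>. (?b1 \<omega> + ?b2 \<omega>) / ?B j + \<epsilon> / 4)"
        by (intro integral_mono iZ Bochner_Integration.integrable_add integrable_divide i1 i2 pw) simp
      also have "\<dots> = (expectation ?b1 + expectation ?b2) / ?B j + \<epsilon> / 4"
        using i1 i2 by (subst Bochner_Integration.integral_add) (simp_all add: prob_space del: sum_divide_distrib)
      also have "\<dots> \<le> (e * \<beta>\<^sup>2 * hvar q j + (1 + 1 / e) * (E j * ?B j) + \<beta>\<^sup>2 * (e2 * ?B j + e2 * ?B j)) / ?B j + \<epsilon> / 4"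
        by (intro add_right_mono divide_right_mono add_mono E1 E2) simp
      also have "(e * \<beta>\<^sup>2 * hvar q j + (1 + 1 / e) * (E j * ?B j) + \<beta>\<^sup>2 * (e2 * ?B j + e2 * ?B j)) / ?B j + \<epsilon> / 4
          = e * (\<beta>\<^sup>2 * hvar q j / ?B j) + (1 + 1 / e) * E j + 2 * (\<beta>\<^sup>2 * e2) + \<epsilon> / 4"
        by (simp add: add_divide_distrib)
      also have "\<dots> \<le> \<epsilon> / 4 + \<epsilon> / 4 + \<epsilon> / 4 + \<epsilon> / 4"
      proof (intro add_mono)
        have "e * (\<beta>\<^sup>2 * hvar q j / ?B j) \<le> e * (L + 1)" using jj' e(1) by (intro mult_left_mono) auto
        also have "\<dots> = \<epsilon> / 4" using L by (simp add: e_def field_simps)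
        finally show "e * (\<beta>\<^sup>2 * hvar q j / ?B j) \<le> \<epsilon> / 4" .
        show "(1 + 1 / e) * E j \<le> \<epsilon> / 4" using jj' by simp
        show "2 * (\<beta>\<^sup>2 * e2) \<le> \<epsilon> / 4" using \<beta> by (simp add: e2_def)
      qed simp
      finally show "expectation (\<lambda>\<omega>. \<bar>?Z \<omega> / ?B j - L\<bar>) \<le> \<epsilon>" by simp
    qed
  qed
  then show ?thesis using L by blast
qed

end

section \<open>Consistency\<close>

lemma lrd_density_ratio:
  fixes d :: real
  shows "((\<lambda>x. norm (1 - cis (- x)) powr (- 2 * d) * \<bar>x\<bar> powr (2 * d)) \<longlongrightarrow> 1) (at 0)"
proof -
  have s: "((\<lambda>x::real. 2 * \<bar>sin (x / 2)\<bar> / \<bar>x\<bar>) \<longlongrightarrow> 1) (at 0)"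
  proof -
    have "((\<lambda>x::real. 2 * sin (x / 2) / x) \<longlongrightarrow> 1) (at 0)" by real_asymp
    then have "((\<lambda>x::real. \<bar>2 * sin (x / 2) / x\<bar>) \<longlongrightarrow> \<bar>1\<bar>) (at 0)" by (rule tendsto_rabs)
    then show ?thesis by (simp add: abs_mult)
  qed
  have "((\<lambda>x::real. (2 * \<bar>sin (x / 2)\<bar> / \<bar>x\<bar>) powr (- 2 * d)) \<longlongrightarrow> 1 powr (- 2 * d)) (at 0)"
    by (intro tendsto_powr s tendsto_const) simp
  then have "((\<lambda>x::real. (2 * \<bar>sin (x / 2)\<bar> / \<bar>x\<bar>) powr (- 2 * d)) \<longlongrightarrow> 1) (at 0)" by simp
  then show ?thesis
  proof (rule Lim_transform_eventually)
    show "\<forall>\<^sub>F x in at 0. (2 * \<bar>sin (x / 2)\<bar> / \<bar>x\<bar>) powr (- 2 * d) = norm (1 - cis (- x)) powr (- 2 * d) * \<bar>x\<bar> powr (2 * d)"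
      unfolding eventually_at_filter
      by (rule always_eventually) (simp add: norm_one_minus_cis powr_divide powr_minus_divide powr_mult)
  qed
qed

text \<open>Multiplied by |x|^(2 d), both densities converge at 0, and c is the ratio of the limits,
  so near 0 their difference is an arbitrarily small multiple of the power law density. Away from 0
  both are bounded, which is what D absorbs.\<close>

lemma lrd_density_approx:
  fixes d :: real and fstar :: "real \<Rightarrow> real"
  assumes d: "0 < d" "d < 1 / 2"
    and meas: "fstar \<in> borel_measurable borel" and nonneg: "\<And>x. 0 \<le> fstar x"
    and bdd: "\<exists>B. \<forall>x\<in>{-pi..pi}. fstar x \<le> B"
    and cont: "isCont fstar 0" and pos: "fstar 0 > 0"
  defines "\<rho> \<equiv> \<lambda>x. indicator {-pi<..<pi} x * (norm (1 - cis (- x)) powr (- 2 * d) * fstar x)"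
  obtains c where "c > 0" "integrable lborel \<rho>"
    "\<And>\<epsilon>. \<epsilon> > 0 \<Longrightarrow> \<exists>D\<ge>0. \<forall>x. \<bar>\<rho> x - c * powspec (1 - 2 * d) x\<bar> \<le> \<epsilon> * powspec (1 - 2 * d) x + D * indicator {-pi<..<pi} x"
proof -
  define P where "P = powspec (1 - 2 * d)"
  define h where "h x = \<bar>x\<bar> powr (2 * d)" for x :: real
  have a: "0 < 1 - 2 * d" "1 - 2 * d < 1" using d by auto
  have P0: "P x \<ge> 0" for x unfolding P_def by (rule powspec_nonneg[OF a(1)])
  have P1: "P x = 0" if "x \<notin> {-pi<..<pi}" for x using that by (simp add: P_def powspec_def)
  obtain C where C: "C > 0" "((\<lambda>l. P l * h l) \<longlongrightarrow> C) (at 0)"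
    using powspec_lim[OF a] unfolding P_def h_def by (auto simp: algebra_simps)
  obtain B where B: "B > 0" "\<And>x. 0 < \<bar>x\<bar> \<Longrightarrow> \<bar>x\<bar> < pi \<Longrightarrow> P x * h x \<le> B"
    using powspec_bound[OF a] unfolding P_def h_def by (auto simp: algebra_simps)
  obtain F where F: "\<And>x. x \<in> {-pi..pi} \<Longrightarrow> fstar x \<le> F" using bdd by blast
  define c where "c = fstar 0 / C"
  have c: "c > 0" using pos C(1) by (simp add: c_def)
  have F0: "F \<ge> 0" using F[of 0] pos by simp
  have \<rho>0: "\<rho> x \<ge> 0" for x using nonneg by (simp add: \<rho>_def)
  have m: "\<rho> \<in> borel_measurable borel"
  proof -
    have [measurable]: "(\<lambda>x. norm (1 - cis (- x))) \<in> borel_measurable borel"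
      by (intro borel_measurable_continuous_onI continuous_intros)
    show ?thesis unfolding \<rho>_def using meas by measurable
  qed
  have approx: "\<exists>D\<ge>0. \<forall>x. \<bar>\<rho> x - c * P x\<bar> \<le> \<epsilon> * P x + D * indicator {-pi<..<pi} x" if \<epsilon>: "\<epsilon> > 0" for \<epsilon>
  proof -
    have "((\<lambda>x. fstar x * (norm (1 - cis (- x)) powr (- 2 * d) * h x) - c * (P x * h x)) \<longlongrightarrow> fstar 0 * 1 - c * C) (at 0)"
      using cont unfolding h_def isCont_def
      by (intro tendsto_intros lrd_density_ratio C(2)[unfolded h_def])
    then have "((\<lambda>x. fstar x * (norm (1 - cis (- x)) powr (- 2 * d) * h x) - c * (P x * h x)) \<longlongrightarrow> 0) (at 0)"
      using C(1) by (simp add: c_def)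
    then have "\<forall>\<^sub>F x in at 0. \<bar>fstar x * (norm (1 - cis (- x)) powr (- 2 * d) * h x) - c * (P x * h x)\<bar> < \<epsilon> * (C / 2)"
      using \<epsilon> C(1) by (auto dest!: tendstoD[of _ _ _ "\<epsilon> * (C / 2)"] simp: dist_real_def mult.assoc)
    moreover have "\<forall>\<^sub>F x in at 0. C / 2 < P x * h x"
      using C by (intro order_tendstoD(1)[OF C(2)]) simp
    ultimately have "\<forall>\<^sub>F x in at 0. \<bar>fstar x * (norm (1 - cis (- x)) powr (- 2 * d) * h x) - c * (P x * h x)\<bar> \<le> \<epsilon> * (P x * h x)"
    proof eventually_elim
      case (elim x)
      have "\<epsilon> * (C / 2) \<le> \<epsilon> * (P x * h x)" using elim(2) \<epsilon> by (intro mult_left_mono) auto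
      then show ?case using elim(1) by linarith
    qed
    then obtain \<delta> where \<delta>: "\<delta> > 0" "\<And>x. x \<noteq> 0 \<Longrightarrow> \<bar>x\<bar> < \<delta> \<Longrightarrow>
        \<bar>fstar x * (norm (1 - cis (- x)) powr (- 2 * d) * h x) - c * (P x * h x)\<bar> \<le> \<epsilon> * (P x * h x)"
      unfolding eventually_at by (auto simp: dist_real_def)
    \<comment> \<open>The first two summands bound both densities outside the neighbourhood. The
      third handles the point x = 0, where \<open>0 powr (- 2 * d) = 0\<close> makes
      \<open>\<rho>\<close> vanish, whatever the value \<open>P 0\<close> is.\<close>
    define D where "D = (2 / pi * \<delta>) powr (- 2 * d) * F + c * (B * \<delta> powr (- 2 * d)) + c * P 0"
    have D0: "D \<ge> 0" unfolding D_def using F0 c B(1) P0 by simp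
    have "\<bar>\<rho> x - c * P x\<bar> \<le> \<epsilon> * P x + D * indicator {-pi<..<pi} x" for x
    proof (cases "x \<in> {-pi<..<pi}")
      case False
      then show ?thesis using P1[OF False] by (simp add: \<rho>_def)
    next
      case True
      then have xpi: "\<bar>x\<bar> < pi" by auto
      show ?thesis
      proof (cases "x = 0")
        case x: True
        have "0 \<le> (2 / pi * \<delta>) powr (- 2 * d) * F" "0 \<le> c * (B * \<delta> powr (- 2 * d))" "0 \<le> \<epsilon> * P 0" "0 \<le> c * P 0"
          using F0 c B(1) P0 \<epsilon> by auto
        then show ?thesis using True by (simp add: x \<rho>_def D_def)
      next
        case x: False
        then have h: "h x > 0" by (simp add: h_def)
        show ?thesis
        proof (cases "\<bar>x\<bar> < \<delta>")
          case near: True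
          have e: "fstar x * (norm (1 - cis (- x)) powr (- 2 * d) * h x) - c * (P x * h x) = (\<rho> x - c * P x) * h x"
            using True by (simp add: \<rho>_def algebra_simps)
          have "\<bar>\<rho> x - c * P x\<bar> * h x \<le> (\<epsilon> * P x) * h x"
            using \<delta>(2)[OF x near] h unfolding e by (simp add: abs_mult mult.assoc)
          then have "\<bar>\<rho> x - c * P x\<bar> \<le> \<epsilon> * P x" using h by simp
          then show ?thesis using D0 True by simp
        next
          case far: False
          have "2 / pi * \<delta> \<le> 2 / pi * \<bar>x\<bar>" using far by (intro mult_left_mono) auto
          also have "\<dots> \<le> norm (1 - cis (- x))" using xpi by (intro norm_one_minus_cis_ge) simp
          finally have "2 / pi * \<delta> \<le> norm (1 - cis (- x))" .
          then have "norm (1 - cis (- x)) powr (- 2 * d) \<le> (2 / pi * \<delta>) powr (- 2 * d)"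
            using \<delta>(1) d by (intro powr_mono2') auto
          then have 1: "\<rho> x \<le> (2 / pi * \<delta>) powr (- 2 * d) * F"
            unfolding \<rho>_def using True F[of x] nonneg[of x] F0 by (simp add: mult_mono)
          have "\<delta> powr (2 * d) \<le> h x" unfolding h_def using far \<delta>(1) d by (intro powr_mono2) auto
          then have "P x * \<delta> powr (2 * d) \<le> P x * h x" using P0 by (intro mult_left_mono)
          also have "\<dots> \<le> B" using B(2) x xpi by simp
          finally have "P x \<le> B * \<delta> powr (- 2 * d)"
            using \<delta>(1) by (simp add: powr_minus field_simps)
          then have "c * P x \<le> c * (B * \<delta> powr (- 2 * d))" using c by (intro mult_left_mono) auto
          moreover have "0 \<le> c * P x" "0 \<le> c * P 0" "0 \<le> \<epsilon> * P x" using P0 c \<epsilon> by auto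
          ultimately show ?thesis using 1 \<rho>0[of x] True F0 unfolding D_def by simp
        qed
      qed
    qed
    then show ?thesis using D0 by blast
  qed
  have int: "integrable lborel \<rho>"
  proof -
    obtain D where D: "D \<ge> 0" "\<And>x. \<bar>\<rho> x - c * P x\<bar> \<le> 1 * P x + D * indicator {-pi<..<pi} x"
      using approx[of 1] by auto
    show ?thesis
    proof (rule Bochner_Integration.integrable_bound)
      show "integrable lborel (\<lambda>x. (c + 1) * P x + D * indicator {-pi<..<pi} x)"
        unfolding P_def by (intro Bochner_Integration.integrable_add integrable_mult_right powspec_fourier(1)[OF a(1)] integrable_indicator_pi)
      show "AE x in lborel. norm (\<rho> x) \<le> norm ((c + 1) * P x + D * indicator {-pi<..<pi} x)"
      proof (rule AE_I2)
        fix x show "norm (\<rho> x) \<le> norm ((c + 1) * P x + D * indicator {-pi<..<pi} x)"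
          using D(2)[of x] \<rho>0[of x] by (simp add: distrib_right)
      qed
    qed (use m in simp)
  qed
  show thesis by (rule that[OF c int]) (use approx in \<open>simp add: P_def\<close>)
qed

lemma fcoef_interval_integral:
  "fcoef (\<lambda>x. indicator {-pi<..<pi} x * f x) t = (LBINT x=-pi..pi. cos (of_int t * x) * f x)"
  unfolding fcoef_def
  by (subst interval_lebesgue_integral_le_eq) (auto simp: set_lebesgue_integral_def ac_simps)

text \<open>The logarithm is 2 D (s + i) ln 2 + ln L plus a small error. The weights sum to 0, which
  removes 2 D s ln 2 and ln L, and their first moment 1 / (2 ln 2) turns 2 D i ln 2 into D.\<close>

lemma (in prob_space) log_regression_tendsto:
  fixes Z :: "nat \<Rightarrow> nat \<Rightarrow> 'a \<Rightarrow> real" and s :: "nat \<Rightarrow> nat"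
  assumes Z: "\<And>N i. Z N i \<in> borel_measurable M"
    and lim: "\<And>i \<eta>. i \<le> p \<Longrightarrow> \<eta> > 0 \<Longrightarrow> (\<lambda>N. prob {\<omega>\<in>space M. \<bar>Z N i \<omega> - L\<bar> > \<eta>}) \<longlonglongrightarrow> 0"
    and L: "L > 0" and w: "(\<Sum>i\<le>p. w i) = 0" "(\<Sum>i\<le>p. real i * w i) = 1 / (2 * ln 2)"
    and \<epsilon>: "\<epsilon> > 0"
  shows "(\<lambda>N. prob {\<omega>\<in>space M. \<bar>(\<Sum>i\<le>p. w i * ln ((2 ^ (s N + i)) powr (2 * D) * Z N i \<omega>)) - D\<bar> > \<epsilon>}) \<longlonglongrightarrow> 0"
proof -
  define W where "W = (\<Sum>i\<le>p. \<bar>w i\<bar>)"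
  have W: "W \<ge> 0" unfolding W_def by (rule sum_nonneg) simp
  have "isCont ln L" by (rule isCont_ln) (use L in simp)
  then obtain \<eta> where \<eta>: "\<eta> > 0" "\<And>z. \<bar>z - L\<bar> < \<eta> \<Longrightarrow> \<bar>ln z - ln L\<bar> < \<epsilon> / (W + 1)"
    unfolding continuous_at_eps_delta dist_real_def using \<epsilon> W by (metis add_nonneg_pos divide_pos_pos zero_less_one)
  \<comment> \<open>Below \<open>\<eta>\<close> for the continuity of the logarithm at L, and below
    L so that Z stays positive and the logarithm splits.\<close>
  define \<kappa> where "\<kappa> = min \<eta> L / 2"
  have \<kappa>: "\<kappa> > 0" "\<kappa> < \<eta>" "\<kappa> < L" using \<eta>(1) L by (auto simp: \<kappa>_def)
  define bad where "bad N i = {\<omega>\<in>space M. \<bar>Z N i \<omega> - L\<bar> > \<kappa>}" for N i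
  have bad: "bad N i \<in> sets M" for N i unfolding bad_def using Z[of N i] by measurable
  have incl: "{\<omega>\<in>space M. \<bar>(\<Sum>i\<le>p. w i * ln ((2 ^ (s N + i)) powr (2 * D) * Z N i \<omega>)) - D\<bar> > \<epsilon>} \<subseteq> (\<Union>i\<in>{..p}. bad N i)" for N
  proof (rule subsetI, rule ccontr)
    fix \<omega> assume \<omega>: "\<omega> \<in> {\<omega>\<in>space M. \<bar>(\<Sum>i\<le>p. w i * ln ((2 ^ (s N + i)) powr (2 * D) * Z N i \<omega>)) - D\<bar> > \<epsilon>}"
      and "\<omega> \<notin> (\<Union>i\<in>{..p}. bad N i)"
    then have Zi: "\<bar>Z N i \<omega> - L\<bar> \<le> \<kappa>" if "i \<le> p" for i using that by (force simp: bad_def not_less)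
    have "(\<Sum>i\<le>p. w i * ln ((2 ^ (s N + i)) powr (2 * D) * Z N i \<omega>))
      = (\<Sum>i\<le>p. 2 * D * ln 2 * real (s N) * w i + 2 * D * ln 2 * (real i * w i) + (w i * (ln (Z N i \<omega>) - ln L) + ln L * w i))"
    proof (rule sum.cong[OF refl])
      fix i assume "i \<in> {..p}"
      then have "Z N i \<omega> > 0" using Zi[of i] \<kappa>(3) by auto
      then have "ln ((2 ^ (s N + i)) powr (2 * D) * Z N i \<omega>) = 2 * D * (real (s N + i) * ln 2) + ln (Z N i \<omega>)"
        by (subst ln_mult) (simp_all add: ln_powr ln_realpow)
      then show "w i * ln ((2 ^ (s N + i)) powr (2 * D) * Z N i \<omega>)
         = 2 * D * ln 2 * real (s N) * w i + 2 * D * ln 2 * (real i * w i) + (w i * (ln (Z N i \<omega>) - ln L) + ln L * w i)"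
        by (simp add: algebra_simps)
    qed
    also have "\<dots> = D + (\<Sum>i\<le>p. w i * (ln (Z N i \<omega>) - ln L))"
      by (simp only: sum.distrib sum_distrib_left[symmetric] w) simp
    finally have "\<bar>(\<Sum>i\<le>p. w i * ln ((2 ^ (s N + i)) powr (2 * D) * Z N i \<omega>)) - D\<bar> = \<bar>\<Sum>i\<le>p. w i * (ln (Z N i \<omega>) - ln L)\<bar>"
      by simp
    also have "\<dots> \<le> (\<Sum>i\<le>p. \<bar>w i\<bar> * (\<epsilon> / (W + 1)))"
    proof (rule order_trans[OF sum_abs sum_mono])
      fix i assume "i \<in> {..p}"
      then have "\<bar>Z N i \<omega> - L\<bar> < \<eta>" using Zi[of i] \<kappa>(2) by auto
      then show "\<bar>w i * (ln (Z N i \<omega>) - ln L)\<bar> \<le> \<bar>w i\<bar> * (\<epsilon> / (W + 1))"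
        unfolding abs_mult by (intro mult_left_mono less_imp_le[OF \<eta>(2)]) auto
    qed
    also have "\<dots> = W * (\<epsilon> / (W + 1))" unfolding W_def sum_distrib_right ..
    also have "\<dots> \<le> \<epsilon>" using W \<epsilon> by (simp add: field_simps)
    finally show False using \<omega> by simp
  qed
  have "(\<lambda>N. \<Sum>i\<le>p. prob (bad N i)) \<longlonglongrightarrow> (\<Sum>i\<le>p. 0)"
    unfolding bad_def by (intro tendsto_sum lim \<kappa>) simp
  then have 0: "(\<lambda>N. \<Sum>i\<le>p. prob (bad N i)) \<longlonglongrightarrow> 0" by simp
  show ?thesis
  proof (rule tendsto_sandwich[OF _ _ tendsto_const 0]; rule always_eventually; rule allI)
    fix N
    have "prob {\<omega>\<in>space M. \<bar>(\<Sum>i\<le>p. w i * ln ((2 ^ (s N + i)) powr (2 * D) * Z N i \<omega>)) - D\<bar> > \<epsilon>} \<le> prob (\<Union>i\<in>{..p}. bad N i)"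
      using bad by (intro finite_measure_mono[OF incl]) auto
    also have "\<dots> \<le> (\<Sum>i\<le>p. prob (bad N i))"
      using bad by (intro finite_measure_subadditive_finite) auto
    finally show "prob {\<omega>\<in>space M. \<bar>(\<Sum>i\<le>p. w i * ln ((2 ^ (s N + i)) powr (2 * D) * Z N i \<omega>)) - D\<bar> > \<epsilon>} \<le> (\<Sum>i\<le>p. prob (bad N i))" .
  qed (rule measure_nonneg)
qed

lemma coefficient_count_at_top:
  fixes n :: "nat \<Rightarrow> nat \<Rightarrow> nat"
  assumes n: "\<exists>C. \<forall>N j. \<bar>real (n N j) - real N / 2 ^ j\<bar> \<le> C"
    and s: "filterlim (\<lambda>N. real N / 2 ^ s N) at_top sequentially"
  shows "filterlim (\<lambda>N. n N (s N + i)) at_top sequentially"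
  unfolding filterlim_at_top
proof
  fix m :: nat
  obtain C where C: "\<And>N j. \<bar>real (n N j) - real N / 2 ^ j\<bar> \<le> C" using n by blast
  have "\<forall>\<^sub>F N in sequentially. (real m + C) * 2 ^ i \<le> real N / 2 ^ s N"
    using s unfolding filterlim_at_top by blast
  then show "\<forall>\<^sub>F N in sequentially. m \<le> n N (s N + i)"
  proof eventually_elim
    case (elim N)
    then have "real m + C \<le> real N / 2 ^ s N / 2 ^ i" by (simp only: pos_le_divide_eq zero_less_power zero_less_numeral)
    then have "real m + C \<le> real N / 2 ^ (s N + i)" by (simp only: power_add divide_divide_eq_left)
    then have "real m \<le> real (n N (s N + i))" using C[of N "s N + i"] by linarith
    then show ?case by simp
  qed
qed

theorem theorem6p1:
  fixes M :: "'a measure"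
    and X Y :: "int \<Rightarrow> 'a \<Rightarrow> real"
    and d \<beta> Cf :: real
    and fstar :: "real \<Rightarrow> real"
    and G :: "real \<Rightarrow> real"
    and q0 K Mv p :: nat
    and g :: "nat \<Rightarrow> int \<Rightarrow> real"
    and w :: "nat \<Rightarrow> real"
    and n :: "nat \<Rightarrow> nat \<Rightarrow> nat"
    and jN :: "nat \<Rightarrow> nat"
  assumes P: "prob_space M"
    and d: "0 < d" "d < 1/2"
    \<comment> \<open>X centered stationary Gaussian with spectral density f = |1-e^{-i lambda}|^{-2d} f*\<close>
    and gauss: "centered_gaussian_process M X"
    and cov: "\<And>s t. (\<integral>\<omega>. X s \<omega> * X t \<omega> \<partial>M) =
        (LBINT x=-pi..pi. cos (of_int (s - t) * x) *
           (norm (1 - cis (- x)) powr (- 2 * d) * fstar x))"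
    and unitvar: "(\<integral>\<omega>. (X 0 \<omega>)\<^sup>2 \<partial>M) = 1"
    \<comment> \<open>f* is a bounded spectral density\<close>
    and fs_meas: "fstar \<in> borel_measurable borel"
    and fs_nonneg: "\<And>x. 0 \<le> fstar x"
    and fs_even: "\<And>x. fstar (- x) = fstar x"
    and fs_int: "set_integrable lborel {-pi..pi} fstar"
    and fs_bdd: "\<exists>B. \<forall>x\<in>{-pi..pi}. fstar x \<le> B"
    \<comment> \<open>Assumption A(i)\<close>
    and fs_cont: "isCont fstar 0"
    and fs_pos: "fstar 0 > 0"
    and beta: "0 < \<beta>" "\<beta> \<le> 2"
    and fs_hoel: "\<And>x. x \<in> {-pi..pi} \<Longrightarrow> \<bar>fstar x - fstar 0\<bar> \<le> Cf * fstar 0 * \<bar>x\<bar> powr \<beta>"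
    \<comment> \<open>G: E G(X_0) = 0, E G(X_0)^2 < infinity, Hermite rank q0\<close>
    and G_meas: "G \<in> borel_measurable borel"
    and G_L2: "integrable lborel (\<lambda>x. (G x)\<^sup>2 * std_normal_density x)"
    and G_mean: "(\<integral>x. G x * std_normal_density x \<partial>lborel) = 0"
    and q0_pos: "1 \<le> q0"
    and q0_rank: "hermite_coeff G q0 \<noteq> 0" "\<And>q. q < q0 \<Longrightarrow> hermite_coeff G q = 0"
    \<comment> \<open>Assumption A(ii)\<close>
    and q0_bound: "real q0 < 1 / (1 - 2 * d)"
    and c_decay: "\<And>l. l > 0 \<Longrightarrow> \<exists>C. \<forall>q. \<bar>hermite_coeff G q\<bar> \<le> C * (fact q) powr d * exp (- l * real q)"
    \<comment> \<open>(Delta^K Y)_t = G(X_t)\<close>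
    and Y_meas: "\<And>t. Y t \<in> borel_measurable M"
    and Y_diff: "\<And>t \<omega>. ((bdiff ^^ K) (\<lambda>s. Y s \<omega>)) t = G (X t \<omega>)"
    \<comment> \<open>(W-1)\<close>
    and W1: "\<exists>A>0. \<forall>j \<tau>. g j \<tau> \<noteq> 0 \<longrightarrow> \<bar>real_of_int \<tau>\<bar> \<le> 2 ^ j * A"
    \<comment> \<open>(W-2), with M = Mv >= K + delta(q0)\<close>
    and Mv_ge: "real Mv \<ge> real K + delta_q d q0" "Mv \<ge> K"
    and W2: "\<exists>C \<alpha>. \<alpha> > 1 \<and> (\<forall>j. \<forall>x\<in>{-pi..pi}.
         norm (dtft (g j) x) \<le> C * 2 powr (real j / 2) * \<bar>2 ^ j * x\<bar> ^ Mv
             * (1 + 2 ^ j * \<bar>x\<bar>) powr (- \<alpha> - real Mv))"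
    \<comment> \<open>(W-3)\<close>
    and W3: "\<exists>(\<Phi> :: nat \<Rightarrow> real \<Rightarrow> real) (ginf :: real \<Rightarrow> complex). (\<exists>x. ginf x \<noteq> 0) \<and>
         (\<forall>S. compact S \<longrightarrow> uniform_limit S
            (\<lambda>j x. complex_of_real (2 powr (- real j / 2)) * dtft (g j) (x / 2 ^ j) * cis (\<Phi> j x))
            ginf sequentially)"
    \<comment> \<open>n_j(N) = N 2^{-j} + O(1)\<close>
    and n_bound: "\<exists>C. \<forall>N j. \<bar>real (n N j) - real N / 2 ^ j\<bar> \<le> C"
    \<comment> \<open>weights\<close>
    and p_pos: "1 \<le> p"
    and w_sum: "(\<Sum>i\<le>p. w i) = 0"
    and w_lin: "(\<Sum>i\<le>p. real i * w i) = 1 / (2 * ln 2)"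
    \<comment> \<open>scale sequence\<close>
    and jN_inf: "filterlim jN at_top sequentially"
    and jN_ratio: "filterlim (\<lambda>N. real N / 2 ^ jN N) at_top sequentially"
  shows "\<forall>\<epsilon>>0. (\<lambda>N. measure M {\<omega>\<in>space M.
            \<bar>(\<Sum>i\<le>p. w i * ln (scalogram g Y (n N (jN N + i)) (jN N + i) \<omega>))
              - (real K + delta_q d q0)\<bar> > \<epsilon>}) \<longlonglongrightarrow> 0"
proof -
  interpret prob_space M by (rule P)
  define \<rho> where "\<rho> x = indicator {-pi<..<pi} x * (norm (1 - cis (- x)) powr (- 2 * d) * fstar x)" for x
  define a where "a = 1 - 2 * d"
  obtain c where c: "c > 0" "integrable lborel \<rho>"
    "\<And>\<epsilon>. \<epsilon> > 0 \<Longrightarrow> \<exists>D\<ge>0. \<forall>x. \<bar>\<rho> x - c * powspec a x\<bar> \<le> \<epsilon> * powspec a x + D * indicator {-pi<..<pi} x"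
    using lrd_density_approx[OF d fs_meas fs_nonneg fs_bdd fs_cont fs_pos] unfolding \<rho>_def a_def by blast
  have acov: "expectation (\<lambda>\<omega>. X s \<omega> * X t \<omega>) = fcoef \<rho> (s - t)" for s t
    unfolding cov \<rho>_def fcoef_interval_integral ..
  have r0: "fcoef \<rho> 0 = 1" using acov[of 0 0] unitvar by (simp add: power2_eq_square)
  obtain u A C \<alpha> winf where sf: "scaled_filters u A C \<alpha> winf"
    and wc: "\<And>(Y :: int \<Rightarrow> 'a \<Rightarrow> real) j k \<omega>. wcoef g Y j k \<omega> = (2 ^ j) powr (real K - 1 / 2) *
       (\<Sum>\<tau>\<in>{- int (A * 2 ^ j)..int (A * 2 ^ j)}. u j \<tau> * (bdiff ^^ K) (\<lambda>s. Y s \<omega>) (2 ^ j * k - \<tau>))"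
    using scaled_filters_of_wavelet[OF W1 Mv_ge(2) W2 W3] by blast
  interpret scaled_filters u A C \<alpha> winf by (rule sf)
  interpret subordinated u A C \<alpha> winf \<rho> a c M X
  proof
    show "0 \<le> \<rho> x" for x using fs_nonneg by (simp add: \<rho>_def)
    show "0 < a" using d by (simp add: a_def)
  qed (fact c gauss acov r0)+
  \<comment> \<open>The rank condition of Assumption A(ii): the leading Hermite term still has long
    memory.\<close>
  have qa: "real q0 * a < 1"
    using q0_bound d by (simp add: a_def field_simps)
  have L2: "integrable std_gauss (\<lambda>x. (G x)\<^sup>2)"
    using G_L2 G_meas by (subst std_gauss_integral(1)) auto
  have hc: "hcoef G q = hermite_coeff G q" for q
    unfolding hcoef_def[OF G_meas L2] hermite_coeff_def
    using G_meas hermite_measurable by (subst std_gauss_integral(2)) auto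
  define Z where "Z n j \<omega> = (1 / real n) * (\<Sum>k<n. (wsum G j k \<omega>)\<^sup>2) / (2 ^ j) powr (2 - real q0 * a)" for n j \<omega>
  obtain L where L: "L > 0"
    and Lim: "\<And>\<epsilon>. \<epsilon> > 0 \<Longrightarrow> \<exists>n0 j0. \<forall>n\<ge>n0. \<forall>j\<ge>j0. expectation (\<lambda>\<omega>. \<bar>Z n j \<omega> - L\<bar>) \<le> \<epsilon>"
    using normalized_scalogram_L1[OF G_meas L2 q0_pos qa] q0_rank unfolding hc Z_def by blast
  let ?D = "real K + delta_q d q0"
  have scal: "scalogram g Y n j \<omega> = (2 ^ j) powr (2 * ?D) * Z n j \<omega>" for n j \<omega>
  proof -
    let ?b = "2 ^ j :: real"
    have w: "wcoef g Y j (int k) \<omega> = ?b powr (real K - 1 / 2) * wsum G j k \<omega>" for k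
      unfolding wc wsum_def Y_diff ..
    \<comment> \<open>Since delta(q0) = (1 - q0 a) / 2, twice d0 is 2 K + 1 - q0 a, which exceeds 2
      - q0 a by 2 K - 1.\<close>
    have "?b powr (real K - 1 / 2) * ?b powr (real K - 1 / 2) = ?b powr (2 * ?D - (2 - real q0 * a))"
      unfolding powr_add[symmetric] by (rule arg_cong[where f = "\<lambda>z. ?b powr z"]) (simp add: delta_q_def a_def field_simps)
    then have "(?b powr (real K - 1 / 2))\<^sup>2 = ?b powr (2 * ?D) / ?b powr (2 - real q0 * a)"
      unfolding powr_diff power2_eq_square .
    then show ?thesis
      unfolding scalogram_def w Z_def power_mult_distrib sum_distrib_left[symmetric] by simp
  qed
  have mZ: "Z n j \<in> borel_measurable M" for n j
    unfolding Z_def[abs_def] using wsum_measurable[OF G_meas] by measurable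
  have iZ: "integrable M (\<lambda>\<omega>. \<bar>Z n j \<omega> - L\<bar>)" for n j
    unfolding Z_def
    by (intro integrable_abs Bochner_Integration.integrable_diff integrable_divide integrable_mult_right
        Bochner_Integration.integrable_sum wsum_L2_bound(1)[OF G_meas L2]) simp
  have lim: "(\<lambda>N. prob {\<omega>\<in>space M. \<bar>Z (n N (jN N + i)) (jN N + i) \<omega> - L\<bar> > \<eta>}) \<longlonglongrightarrow> 0"
    if \<eta>: "\<eta> > 0" for i \<eta>
  proof (rule tendstoI)
    fix e :: real assume e: "e > 0"
    obtain n0 j0 where nj: "\<And>n j. n \<ge> n0 \<Longrightarrow> j \<ge> j0 \<Longrightarrow> expectation (\<lambda>\<omega>. \<bar>Z n j \<omega> - L\<bar>) \<le> \<eta> * (e / 2)"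
      using Lim[of "\<eta> * (e / 2)"] \<eta> e by auto
    have "\<forall>\<^sub>F N in sequentially. n0 \<le> n N (jN N + i)"
      using coefficient_count_at_top[OF n_bound jN_ratio, of i] unfolding filterlim_at_top by blast
    moreover have "\<forall>\<^sub>F N in sequentially. j0 \<le> jN N"
      using jN_inf unfolding filterlim_at_top by blast
    ultimately show "\<forall>\<^sub>F N in sequentially. dist (prob {\<omega>\<in>space M. \<bar>Z (n N (jN N + i)) (jN N + i) \<omega> - L\<bar> > \<eta>}) 0 < e"
    proof eventually_elim
      case (elim N)
      let ?Z = "\<lambda>\<omega>. \<bar>Z (n N (jN N + i)) (jN N + i) \<omega> - L\<bar>"
      have "prob {\<omega>\<in>space M. ?Z \<omega> > \<eta>} \<le> prob {\<omega>\<in>space M. ?Z \<omega> \<ge> \<eta>}"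
        using mZ by (intro finite_measure_mono) (auto intro!: borel_measurable_le)
      also have "\<dots> \<le> expectation ?Z / \<eta>"
        by (rule integral_Markov_inequality_measure[where A = "{}"]) (use iZ \<eta> in auto)
      also have "\<dots> \<le> \<eta> * (e / 2) / \<eta>"
        using \<eta> elim by (intro divide_right_mono nj) auto
      also have "\<dots> < e" using \<eta> e by simp
      finally show ?case by (simp add: dist_real_def)
    qed
  qed
  show ?thesis
    unfolding scal
    by (intro allI impI log_regression_tendsto[where L = L] mZ lim L w_sum w_lin)
qed

end
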